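(* For every nonempty finite subset $K\subset\mathbb Z^d$ and every $a\in K$, $$\lim_{x\to\infty}\|x\|^{d-2}\cdot P(\mathcal S_x\text{ visits }K)=a_d\,\mathrm{BCap}(K),$$ $$\lim_{x\to\infty}P(\mathcal S_x(\tau_K)=a\mid \mathcal S_x\text{ visits }K)=\mathrm{Es}_K(a)/\mathrm{BCap}(K),$$ $$\lim_{x\to\infty}P(\mathcal S_x(\xi_K)=a\mid \mathcal S_x\text{ visits }K)=\mathrm{Esc}_K(a)/\mathrm{BCap}(K).$$
   Context: Setting. $d\ge5$; $\mu$ is a probability distribution on $\mathbb N=\{0,1,2,\dots\}$ with mean $1$ and finite variance $\sigma^2>0$; $\theta$ is a probability distribution on $\mathbb Z^d$ with mean zero, not supported on a strict subgroup of $\mathbb Z^d$, such that for some $C>0$, $\theta(\{x:|x|>r\})<Cr^{-d}$ for all $r\ge1$ ($|\cdot|$ is the Euclidean norm). $Q$ is the covariance matrix of $\theta$, $\|x\|=\sqrt{x\cdot Q^{-1}x}/\sqrt d$, and $a_d=\frac{\Gamma((d-2)/2)}{2d^{(d-2)/2}\pi^{d/2}\sqrt{\det Q}}$. Trees. Trees are rooted ordered (plane) trees, with vertices ordered by depth-first search from the root. The $\mu$-GW tree is the Galton–Watson tree with offspring law $\mu$. Let $\tilde\mu(i)=\sum_{j\ge i+1}\mu(j)$, a probability measure on $\mathbb N$. The adjoint $\mu$-GW tree is the Galton–Watson tree in which the root has offspring law $\tilde\mu$ and all other vertices have offspring law $\mu$. The infinite $\mu$-GW tree: take a semi-infinite line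 of vertices (the spine), rooted at its first vertex, and graft to the left of each spine vertex (identifying roots) an independent adjoint $\mu$-GW tree, called a bush (every spine vertex other than the root is the youngest child of its parent). The invariant $\mu$-GW tree is the same except that the bush grafted to the root is an independent $\mu$-GW tree. Snakes. Given a random tree $T$ and $x\in\mathbb Z^d$, assign, conditionally on $T$, independent $\mathbb Z^d$-valued variables to the edges of $T$ and let $\mathcal S_T(v)-x$ be the sum of the variables on the simple path from the root to $v$. The snake $\mathcal S_x$ (the branching random walk started from one particle at $x$): $T$ is a $\mu$-GW tree and all edge variables have law $\theta$. The reversed infinite snake from $x$: $T$ is an infinite $\mu$-GW tree, spine edges have law $\theta^-$ where $\theta^-(z)=\theta(-z)$, and all other edges have law $\theta$. The invariant snake from $x$: $T$ is an invariant $\mu$-GW tree, spine edges have law $\theta^-$, other edges law $\theta$. A snake visits $K$ if $\mathcal S_T(v)\in K$ for some vertex $v$ of $T$. When $\mathcal S_x$ visits $K$, $\tau_K$ and $\xi_K$ are respectively the first and the last vertex, in depth-first order, of $\{v\in T:\mathcal S_T(v)\in K\}$, and $\mathcal S_x(v)$ means $\mathcal S_T(v)$. Escape probabilities and capacity. $\mathrm{Es}_K(x)$ is the probability that a reversed infinite snake from $x$ does not visit $K$ except possibly by the image of the bush grafted to the root (the bush includes the root). $\mathrm{Esc}_K(x)$ is the probability that an invariant snake from $x$ does not visit $K$ except possibly by the image of the spine. The branching capacity is $\mathrm{BCap}(K)=\sum_{z\in K}\mathrm{Es}_K(z)$ (the paper also writes it as $\sum_{z\in K}\mathrm{Esc}_K(z)$;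 the equality of the two sums is a consequence of this theorem). *)

theory Defs
  imports "HOL-Probability.Probability" "HOL-Library.List_Lexorder"
begin

section \<open>Laws on the lattice\<close>

text \<open>The lattice of dimension \<open>CARD('n)\<close> is the type \<open>int ^ 'n\<close>, embedded in \<open>real ^ 'n\<close> by
  \<open>rvec\<close>.\<close>

definition rvec :: "int ^ 'n \<Rightarrow> real ^ 'n" where
  "rvec x = (\<chi> i. real_of_int (x $ i))"

definition lattice_at_infinity :: "(int ^ 'n) filter" where
  "lattice_at_infinity = filtercomap rvec at_infinity"

definition in_strict_subgroup :: "(int ^ 'n) pmf \<Rightarrow> bool" where
  "in_strict_subgroup \<theta> \<longleftrightarrow>
     (\<exists>H. 0 \<in> H \<and> (\<forall>x\<in>H. \<forall>y\<in>H. x - y \<in> H) \<and> H \<noteq> UNIV \<and> set_pmf \<theta> \<subseteq> H)"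

definition mean_vec :: "(int ^ 'n) pmf \<Rightarrow> real ^ 'n" where
  "mean_vec \<theta> = measure_pmf.expectation \<theta> rvec"

definition covariance :: "(int ^ 'n) pmf \<Rightarrow> real ^ 'n ^ 'n" where
  "covariance \<theta> = (\<chi> i j. measure_pmf.expectation \<theta>
     (\<lambda>x. (rvec x $ i - mean_vec \<theta> $ i) * (rvec x $ j - mean_vec \<theta> $ j)))"

definition cov_norm :: "(int ^ 'n) pmf \<Rightarrow> int ^ 'n \<Rightarrow> real" where
  "cov_norm \<theta> x =
     sqrt (rvec x \<bullet> (matrix_inv (covariance \<theta>) *v rvec x)) / sqrt (real CARD('n))"

definition green_const :: "(int ^ 'n) pmf \<Rightarrow> real" where
  "green_const \<theta> = (let d = real CARD('n) in
     Gamma ((d - 2) / 2) /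
       (2 * d powr ((d - 2) / 2) * pi powr (d / 2) * sqrt (det (covariance \<theta>))))"

definition reversed_pmf :: "(int ^ 'n) pmf \<Rightarrow> (int ^ 'n) pmf" where
  "reversed_pmf \<theta> = map_pmf uminus \<theta>"

definition adjoint_pmf :: "nat pmf \<Rightarrow> nat pmf" where
  "adjoint_pmf \<mu> = embed_pmf (\<lambda>i. measure_pmf.prob \<mu> {i + 1..})"

text \<open>Mean \<open>1\<close> is what makes the weights in \<open>adjoint_pmf\<close> sum to \<open>1\<close>.\<close>

lemma pmf_adjoint_pmf:
  assumes "measure_pmf.expectation \<mu> real = 1"
  shows "pmf (adjoint_pmf \<mu>) i = measure_pmf.prob \<mu> {i + 1..}"
  unfolding adjoint_pmf_def
proof (rule pmf_embed_pmf)
  have int: "integrable (measure_pmf \<mu>) real"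
    using assms not_integrable_integral_eq[of "measure_pmf \<mu>" real] by fastforce
  have "(\<integral>\<^sup>+ i. ennreal (measure_pmf.prob \<mu> {i + 1..}) \<partial>count_space UNIV)
      = (\<Sum>i. emeasure (measure_pmf \<mu>) {j \<in> space (measure_pmf \<mu>). of_nat i < (of_nat j :: ennreal)})"
    by (auto simp: nn_integral_count_space_nat measure_pmf.emeasure_eq_measure
             intro!: suminf_cong arg_cong[where f="measure_pmf.prob \<mu>"])
  also have "\<dots> = (\<integral>\<^sup>+ j. of_nat j \<partial>measure_pmf \<mu>)"
    by (subst nn_integral_nat_function) (auto intro!: suminf_cong arg_cong[where f="emeasure \<mu>"])
  also have "\<dots> = (\<integral>\<^sup>+ j. ennreal (real j) \<partial>measure_pmf \<mu>)"
    by (simp add: ennreal_of_nat_eq_real_of_nat)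
  also have "\<dots> = ennreal 1"
    using int assms by (subst nn_integral_eq_integral) auto
  finally show "(\<integral>\<^sup>+ i. ennreal (measure_pmf.prob \<mu> {i + 1..}) \<partial>count_space UNIV) = 1"
    by simp
qed simp


section \<open>Galton--Watson trees and snakes\<close>

text \<open>Vertices are Ulam--Harris words: \<open>[]\<close> is the root and \<open>u @ [i]\<close> is the \<open>i\<close>-th child of
  \<open>u\<close>. A tree is given by a family \<open>N\<close> of offspring numbers on all words. The depth-first order is
  the lexicographic order on words in which a proper prefix comes first; this is the order \<open>\<le>\<close> on
  \<open>nat list\<close> from \<open>List_Lexorder\<close>.\<close>

type_synonym vertex = "nat list"

definition tree_of :: "(vertex \<Rightarrow> nat) \<Rightarrow> vertex set" where
  "tree_of N = {u. \<forall>k<length u. u ! k < N (take k u)}"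

definition gw_space :: "nat pmf \<Rightarrow> nat pmf \<Rightarrow> (vertex \<Rightarrow> nat) measure" where
  "gw_space \<rho> \<mu> = (\<Pi>\<^sub>M u\<in>UNIV. measure_pmf (if u = [] then \<rho> else \<mu>))"

text \<open>Sample space of a snake on the Galton--Watson tree whose root has offspring law \<open>\<rho>\<close> and whose
  other vertices have law \<open>\<mu>\<close>. The edge variable \<open>\<eta> u\<close>, for \<open>u \<noteq> []\<close>, belongs to the
  edge between \<open>u\<close> and its parent. Variables are attached to all words, independently of the tree,
  so conditionally on the tree those on its edges are i.i.d. with law \<open>\<theta>\<close>.\<close>

type_synonym 'n snake = "(vertex \<Rightarrow> nat) \<times> (vertex \<Rightarrow> int ^ 'n)"

definition snake_space :: "nat pmf \<Rightarrow> nat pmf \<Rightarrow> (int ^ 'n) pmf \<Rightarrow> 'n snake measure" where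
  "snake_space \<rho> \<mu> \<theta> = gw_space \<rho> \<mu> \<Otimes>\<^sub>M (\<Pi>\<^sub>M u\<in>UNIV. measure_pmf \<theta>)"

definition snake_tree :: "'n snake \<Rightarrow> vertex set" where
  "snake_tree \<omega> = tree_of (fst \<omega>)"

definition snake_pos :: "int ^ 'n \<Rightarrow> 'n snake \<Rightarrow> vertex \<Rightarrow> int ^ 'n" where
  "snake_pos x \<omega> u = x + (\<Sum>k<length u. snd \<omega> (take (Suc k) u))"

definition brw :: "nat pmf \<Rightarrow> (int ^ 'n) pmf \<Rightarrow> 'n snake measure" where
  "brw \<mu> \<theta> = snake_space \<mu> \<mu> \<theta>"

definition hits :: "int ^ 'n \<Rightarrow> (int ^ 'n) set \<Rightarrow> 'n snake \<Rightarrow> vertex set" where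
  "hits x K \<omega> = {v \<in> snake_tree \<omega>. snake_pos x \<omega> v \<in> K}"

definition visits :: "int ^ 'n \<Rightarrow> (int ^ 'n) set \<Rightarrow> 'n snake \<Rightarrow> bool" where
  "visits x K \<omega> \<longleftrightarrow> hits x K \<omega> \<noteq> {}"

definition first_hit :: "int ^ 'n \<Rightarrow> (int ^ 'n) set \<Rightarrow> 'n snake \<Rightarrow> vertex" where
  "first_hit x K \<omega> = (LEAST v. v \<in> hits x K \<omega>)"

definition last_hit :: "int ^ 'n \<Rightarrow> (int ^ 'n) set \<Rightarrow> 'n snake \<Rightarrow> vertex" where
  "last_hit x K \<omega> = (GREATEST v. v \<in> hits x K \<omega>)"


section \<open>Snakes on trees with an infinite spine\<close>

text \<open>The spine is indexed by \<open>nat\<close>. A sample consists of one snake on a bush for each spine vertex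
  and of the spine edge variables, the \<open>j\<close>-th one belonging to the edge between the spine vertices
  \<open>j\<close> and \<open>j + 1\<close>. The vertices of the infinite tree are the pairs \<open>(k, w)\<close> with \<open>w\<close> in the \<open>k\<close>-th
  bush, and \<open>(k, [])\<close> is the \<open>k\<close>-th spine vertex. In the plane tree, the children of
  \<open>(k, [])\<close> are, in order, its children \<open>(k, [0])\<close>, \<open>(k, [1])\<close>, \<dots> in the bush and then
  \<open>(k + 1, [])\<close>; the escape events below do not depend on this order.\<close>

type_synonym 'n spine_snake = "(nat \<Rightarrow> 'n snake) \<times> (nat \<Rightarrow> int ^ 'n)"

definition spine_snake_space ::
  "nat pmf \<Rightarrow> nat pmf \<Rightarrow> (int ^ 'n) pmf \<Rightarrow> 'n spine_snake measure" where
  "spine_snake_space \<rho> \<mu> \<theta> =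
     (\<Pi>\<^sub>M k\<in>UNIV. snake_space (if k = 0 then \<rho> else adjoint_pmf \<mu>) \<mu> \<theta>) \<Otimes>\<^sub>M
     (\<Pi>\<^sub>M j\<in>UNIV. measure_pmf (reversed_pmf \<theta>))"

definition reversed_infinite_snake :: "nat pmf \<Rightarrow> (int ^ 'n) pmf \<Rightarrow> 'n spine_snake measure" where
  "reversed_infinite_snake \<mu> \<theta> = spine_snake_space (adjoint_pmf \<mu>) \<mu> \<theta>"

definition invariant_snake :: "nat pmf \<Rightarrow> (int ^ 'n) pmf \<Rightarrow> 'n spine_snake measure" where
  "invariant_snake \<mu> \<theta> = spine_snake_space \<mu> \<mu> \<theta>"

definition spine_snake_tree :: "'n spine_snake \<Rightarrow> (nat \<times> vertex) set" where
  "spine_snake_tree \<omega> = {(k, w). w \<in> snake_tree (fst \<omega> k)}"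

definition spine_snake_pos :: "int ^ 'n \<Rightarrow> 'n spine_snake \<Rightarrow> nat \<times> vertex \<Rightarrow> int ^ 'n" where
  "spine_snake_pos x \<omega> v = snake_pos (x + (\<Sum>j<fst v. snd \<omega> j)) (fst \<omega> (fst v)) (snd v)"

definition root_bush :: "(nat \<times> vertex) set" where
  "root_bush = {v. fst v = 0}"

definition spine :: "(nat \<times> vertex) set" where
  "spine = {v. snd v = []}"

definition avoids_except ::
  "int ^ 'n \<Rightarrow> (int ^ 'n) set \<Rightarrow> (nat \<times> vertex) set \<Rightarrow> 'n spine_snake \<Rightarrow> bool" where
  "avoids_except x K A \<omega> \<longleftrightarrow> (\<forall>v \<in> spine_snake_tree \<omega> - A. spine_snake_pos x \<omega> v \<notin> K)"

definition Es :: "nat pmf \<Rightarrow> (int ^ 'n) pmf \<Rightarrow> (int ^ 'n) set \<Rightarrow> int ^ 'n \<Rightarrow> real" where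
  "Es \<mu> \<theta> K x = \<P>(\<omega> in reversed_infinite_snake \<mu> \<theta>. avoids_except x K root_bush \<omega>)"

definition Esc :: "nat pmf \<Rightarrow> (int ^ 'n) pmf \<Rightarrow> (int ^ 'n) set \<Rightarrow> int ^ 'n \<Rightarrow> real" where
  "Esc \<mu> \<theta> K x = \<P>(\<omega> in invariant_snake \<mu> \<theta>. avoids_except x K spine \<omega>)"

definition BCap :: "nat pmf \<Rightarrow> (int ^ 'n) pmf \<Rightarrow> (int ^ 'n) set \<Rightarrow> real" where
  "BCap \<mu> \<theta> K = (\<Sum>z\<in>K. Es \<mu> \<theta> K z)"

end

theory Submission
  imports Defs
begin

text \<open>
  Cut the tree along the ancestral line of the first visit to \<open>K\<close> in depth-first order. If a vertex of this line sits at
  \<open>x\<close> and its next vertex is child number \<open>i\<close>, then \<open>x\<close> is not in \<open>K\<close>, the subtrees of the \<open>i\<close> older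
  children miss \<open>K\<close>, and the younger ones do not matter. When each child misses with probability \<open>s\<close>, the sum over
  \<open>i\<close> is \<open>\<Sum>i. \<mu>{i<..} * s ^ i\<close>, which is exactly the probability \<open>bush_misses x\<close> that a bush rooted at \<open>x\<close>, an
  adjoint tree, misses \<open>K\<close> below its root. So the probability that the first visit happens in generation \<open>n\<close> and at
  \<open>a\<close> is the weight with which a walk with step law \<open>\<theta>\<close> goes from \<open>x\<close> to \<open>a\<close> in \<open>n\<close> steps when it survives at
  a point \<open>z\<close> with probability \<open>bush_misses z\<close>, and with probability \<open>0\<close> in \<open>K\<close> (\<open>killed_first_at\<close>). For the last
  visit the younger children have to miss \<open>K\<close> instead, which gives the same weights without the condition on the line
  itself, times the probability that the descendants of a vertex at \<open>a\<close> miss \<open>K\<close> (\<open>killed_last_at\<close>).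

  Seen from \<open>a\<close> this walk has the law of the spine of the infinite snakes, and a bush hangs from every vertex that it visits:
  its total mass at time \<open>n\<close> is the probability that the first \<open>n\<close> bushes do their part in the escape event. Hence the
  mass decreases to \<open>Es\<close> for the first visit and, with the factor of the last visit, to \<open>Esc\<close> (\<open>spine_escape\<close>).

  It remains to show that the Green function of the killed walk is asymptotic to the Green function of the free walk times the
  mass that survives for ever (\<open>killed_green_asymptotics\<close>). The asymptotics of the free Green function
  (\<open>green_asymptotics_seq\<close>) come from the local limit theorem by dominated convergence on the diffusive time scale; the
  assumption on the tail of \<open>\<theta>\<close> yields moments of order \<open>d - 1\<close>, and these dominate the small times. For the killed
  walk, stop at a time \<open>M\<close>: what is alive sees the far point \<open>x\<close> as the origin does, and what is killed later contributes
  little, provided the killing rate \<open>k\<close> is square summable. It is, because \<open>k\<close> is at most a multiple of the expected number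
  of visits to \<open>K\<close> (\<open>killing_square_bound\<close>), a finite sum of Green functions, and these decay like the power \<open>2 - d\<close> with
  \<open>d \<ge> 5\<close>.

  The first limit is then the sum over \<open>a\<close> of the asymptotics for the first visit, and the other two are quotients; the
  denominator \<open>BCap\<close> is positive because a square summable killing rate cannot stop the walk everywhere (\<open>some_escape\<close>).
\<close>

section \<open>Linear changes of variables\<close>

lemma measurable_vec_of_fun [measurable]:
  "(\<lambda>f. \<chi> i. f i) \<in> (\<Pi>\<^sub>M i\<in>(UNIV::'n::finite set). lborel) \<rightarrow>\<^sub>M (borel :: (real^'n) measure)"
proof -
  have "(\<lambda>f. \<chi> i. f i) = (\<lambda>f::'n \<Rightarrow> real. \<Sum>i\<in>UNIV. f i *\<^sub>R axis i 1)"
    by (auto simp: vec_eq_iff axis_def if_distrib cong: if_cong)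
  then show ?thesis
    by simp
qed

lemma lborel_vec_eq_PiM:
  "(lborel :: (real^'n) measure) = distr (\<Pi>\<^sub>M i\<in>UNIV. lborel) borel (\<lambda>f. \<chi> i. f i)"
proof (rule lborel_eqI)
  interpret product_sigma_finite "\<lambda>_::'n. lborel :: real measure" ..
  fix l u :: "real^'n" assume le: "\<And>b. b \<in> Basis \<Longrightarrow> l \<bullet> b \<le> u \<bullet> b"
  have le': "l $ i \<le> u $ i" for i
    using le[of "axis i 1"] by (simp add: inner_axis axis_in_Basis_iff)
  have "emeasure (distr (\<Pi>\<^sub>M i\<in>UNIV. lborel) borel (\<lambda>f. \<chi> i. f i)) (box l u)
      = emeasure (\<Pi>\<^sub>M i\<in>UNIV. lborel) (\<Pi>\<^sub>E i\<in>UNIV. {l$i<..<u$i})"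
    by (subst emeasure_distr) (auto simp: space_PiM mem_box_cart PiE_def extensional_def Pi_iff intro!: arg_cong[where f="emeasure _"])
  also have "\<dots> = (\<Prod>i\<in>UNIV. ennreal (u$i - l$i))"
    using le' by (subst emeasure_PiM) auto
  also have "\<dots> = ennreal (\<Prod>i\<in>UNIV. u$i - l$i)"
    using le' by (subst prod_ennreal) auto
  also have "(\<Prod>i\<in>UNIV. u$i - l$i) = prod ((\<bullet>) (u - l)) (range (\<lambda>i. axis i (1::real)))"
    by (subst prod.reindex) (auto simp: inj_on_def axis_eq_axis inner_axis)
  also have "range (\<lambda>i::'n. axis i (1::real)) = Basis"
    by (auto simp: Basis_vec_def)
  finally show "emeasure (distr (\<Pi>\<^sub>M i\<in>UNIV. lborel) borel (\<lambda>f. \<chi> i. f i)) (box l u)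
      = ennreal (prod ((\<bullet>) (u - l)) Basis)" .
qed simp

lemma
  fixes f :: "'n::finite \<Rightarrow> real \<Rightarrow> 'b::{real_normed_field,banach,second_countable_topology}"
  assumes f: "\<And>i. integrable lborel (f i)"
  shows integrable_prod_vec: "integrable lborel (\<lambda>x::real^'n. \<Prod>i\<in>UNIV. f i (x$i))" (is ?A)
    and integral_prod_vec: "integral\<^sup>L lborel (\<lambda>x::real^'n. \<Prod>i\<in>UNIV. f i (x$i)) = (\<Prod>i\<in>UNIV. integral\<^sup>L lborel (f i))" (is ?B)
proof -
  interpret product_sigma_finite "\<lambda>_::'n. lborel :: real measure" ..
  have [measurable]: "f i \<in> borel_measurable borel" for i
    using borel_measurable_integrable[OF f[of i]] by simp
  have [measurable]: "(\<lambda>x::real^'n. \<Prod>i\<in>UNIV. f i (x$i)) \<in> borel_measurable borel"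
    by measurable
  show ?A
    by (subst lborel_vec_eq_PiM, subst integrable_distr_eq) (auto intro!: product_integrable_prod f)
  show ?B
    by (subst lborel_vec_eq_PiM, subst integral_distr) (auto intro!: product_integral_prod f)
qed

lemma borel_measurable_matrix_vector_mult [measurable (raw)]:
  fixes A :: "real^'n^'m"
  assumes "f \<in> borel_measurable M" shows "(\<lambda>x. A *v f x) \<in> borel_measurable M"
  using borel_measurable_continuous_onI[OF linear_continuous_on[OF matrix_vector_mul_bounded_linear[of A], of UNIV]] assms
  by (rule measurable_compose[rotated])

text \<open>For a fixed value of the other coordinates a shear is a translation of the coordinate \<open>m\<close>.\<close>

lemma nn_integral_lborel_shear:
  fixes f :: "real^'n \<Rightarrow> ennreal"
  assumes mn: "m \<noteq> n" and [measurable]: "f \<in> borel_measurable borel"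
  shows "(\<integral>\<^sup>+x. f (\<chi> i. if i = m then x$m + c * x$n else x$i) \<partial>lborel) = (\<integral>\<^sup>+x. f x \<partial>lborel)"
proof -
  interpret product_sigma_finite "\<lambda>_::'n. lborel :: real measure" ..
  define U where "U = UNIV - {m}"
  have U: "UNIV = insert m U" "m \<notin> U" "finite U" by (auto simp: U_def)
  have m1: "(\<lambda>x::real^'n. \<chi> i. if i = m then x$m + c * x$n else x$i) \<in> borel_measurable borel"
  proof -
    have "(\<lambda>x::real^'n. \<chi> i. if i = m then x$m + c * x$n else x$i) = (\<lambda>x. x + (c * x$n) *\<^sub>R axis m 1)"
      by (auto simp: vec_eq_iff axis_def fun_eq_iff)
    then show ?thesis by simp
  qed
  note [measurable] = m1
  have vm: "(\<lambda>x. (\<chi> i. x i)) \<in> (\<Pi>\<^sub>M i\<in>insert m U. lborel) \<rightarrow>\<^sub>M (borel :: (real^'n) measure)"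
    by (subst U(1)[symmetric]) (rule measurable_vec_of_fun)
  \<comment> \<open>The coordinate \<open>m\<close> is integrated first; the others are kept in \<open>y\<close>.\<close>
  have key: "(\<integral>\<^sup>+x. g x \<partial>lborel) = (\<integral>\<^sup>+y. \<integral>\<^sup>+t. g (\<chi> i. (y(m := t)) i) \<partial>lborel \<partial>(\<Pi>\<^sub>M i\<in>U. lborel))"
    if [measurable]: "g \<in> borel_measurable borel" for g :: "real^'n \<Rightarrow> ennreal"
  proof -
    have "(\<integral>\<^sup>+x. g x \<partial>lborel) = (\<integral>\<^sup>+x. g (\<chi> i. x i) \<partial>(\<Pi>\<^sub>M i\<in>insert m U. lborel))"
      by (subst lborel_vec_eq_PiM, subst nn_integral_distr) (auto simp: U(1)[symmetric])
    also have "\<dots> = (\<integral>\<^sup>+y. \<integral>\<^sup>+t. g (\<chi> i. (y(m := t)) i) \<partial>lborel \<partial>(\<Pi>\<^sub>M i\<in>U. lborel))"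
      by (rule product_nn_integral_insert[OF U(3) U(2) measurable_compose[OF vm that]])
    finally show ?thesis .
  qed
  have "(\<integral>\<^sup>+t. f (\<chi> i. if i = m then (y(m := t)) m + c * (y(m := t)) n else (y(m := t)) i) \<partial>lborel)
      = (\<integral>\<^sup>+t. f (\<chi> i. (y(m := t)) i) \<partial>lborel)" for y
  proof -
    have eq: "(\<chi> i. (y(m := t)) i) = (\<chi> i. if i = m then 0 else y i) + t *\<^sub>R axis m (1::real)" for t
      by (auto simp: vec_eq_iff axis_def)
    have fm: "(\<lambda>t. f (\<chi> i. (y(m := t)) i)) \<in> borel_measurable borel"
      unfolding eq by simp
    have "(\<integral>\<^sup>+t. f (\<chi> i. (y(m := t)) i) \<partial>lborel)
       = (\<integral>\<^sup>+t. f (\<chi> i. (y(m := c * y n + t)) i) \<partial>lborel)"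
      using nn_integral_real_affine[OF fm, of 1 "c * y n"] by simp
    also have "\<dots> = (\<integral>\<^sup>+t. f (\<chi> i. if i = m then (y(m := t)) m + c * (y(m := t)) n else (y(m := t)) i) \<partial>lborel)"
      using mn by (intro nn_integral_cong arg_cong[where f=f]) (auto simp: vec_eq_iff)
    finally show ?thesis by simp
  qed
  note h = this
  have "(\<integral>\<^sup>+x. f (\<chi> i. if i = m then x$m + c * x$n else x$i) \<partial>lborel)
    = (\<integral>\<^sup>+y. \<integral>\<^sup>+t. f (\<chi> i. if i = m then (\<chi> i. (y(m := t)) i)$m + c * (\<chi> i. (y(m := t)) i)$n else (\<chi> i. (y(m := t)) i)$i) \<partial>lborel \<partial>(\<Pi>\<^sub>M i\<in>U. lborel))"
    by (rule key) measurable
  also have "\<dots> = (\<integral>\<^sup>+y. \<integral>\<^sup>+t. f (\<chi> i. (y(m := t)) i) \<partial>lborel \<partial>(\<Pi>\<^sub>M i\<in>U. lborel))"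
    using h by (simp only: vec_lambda_beta)
  also have "\<dots> = (\<integral>\<^sup>+x. f x \<partial>lborel)"
    by (rule key[symmetric]) measurable
  finally show ?thesis .
qed

lemma nn_integral_lborel_diagonal:
  fixes A :: "real^'n^'n" and f :: "real^'n \<Rightarrow> ennreal"
  assumes A: "\<And>i j. i \<noteq> j \<Longrightarrow> A$i$j = 0" and nz: "det A \<noteq> 0" and [measurable]: "f \<in> borel_measurable borel"
  shows "ennreal \<bar>det A\<bar> * (\<integral>\<^sup>+x. f (A *v x) \<partial>lborel) = (\<integral>\<^sup>+x. f x \<partial>lborel)"
proof -
  define c where "c j = A $ (axis_index j) $ (axis_index j)" for j :: "real^'n"
  have det: "det A = (\<Prod>i\<in>UNIV. A$i$i)" using A by (rule det_diagonal)
  have detc: "(\<Prod>j\<in>Basis. \<bar>c j\<bar>) = \<bar>det A\<bar>"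
  proof -
    have "(\<Prod>j\<in>Basis. \<bar>c j\<bar>) = prod (\<lambda>j. \<bar>c j\<bar>) (range (\<lambda>i. axis i (1::real)))"
      by (rule prod.cong) (auto simp: Basis_vec_def)
    also have "\<dots> = (\<Prod>i\<in>UNIV. \<bar>A$i$i\<bar>)"
      by (subst prod.reindex) (auto simp: inj_on_def axis_eq_axis c_def)
    finally show ?thesis by (simp add: det abs_prod)
  qed
  have nzc: "c j \<noteq> 0" if "j \<in> Basis" for j
    using nz by (auto simp: c_def det)
  have T: "(\<Sum>j\<in>Basis. (c j * (x \<bullet> j)) *\<^sub>R j) = A *v x" for x
  proof -
    have "(\<Sum>j\<in>Basis. (c j * (x \<bullet> j)) *\<^sub>R j) = sum (\<lambda>j. (c j * (x \<bullet> j)) *\<^sub>R j) (range (\<lambda>i. axis i (1::real)))"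
      by (rule sum.cong) (auto simp: Basis_vec_def)
    also have "\<dots> = (\<Sum>i\<in>UNIV. (A$i$i * x$i) *\<^sub>R axis i 1)"
      by (subst sum.reindex) (auto simp: inj_on_def axis_eq_axis c_def inner_axis)
    also have "\<dots> = A *v x"
    proof -
      have "(A *v x) $ i = A$i$i * x$i" for i
        unfolding matrix_vector_mult_def
        using A by (simp, subst sum.remove[of _ i]) (auto intro!: sum.neutral)
      then show ?thesis
        by (auto simp: vec_eq_iff axis_def if_distrib cong: if_cong)
    qed
    finally show ?thesis .
  qed
  have lb: "lborel = density (distr lborel borel (\<lambda>x. A *v x)) (\<lambda>_. ennreal \<bar>det A\<bar>)"
    using lborel_affine_euclidean[of c 0, OF nzc] by (simp only: T detc add_0)
  have "(\<integral>\<^sup>+x. f x \<partial>lborel) = (\<integral>\<^sup>+x. f x \<partial>density (distr lborel borel (\<lambda>x. A *v x)) (\<lambda>_. ennreal \<bar>det A\<bar>))"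
    by (rule arg_cong[where f="\<lambda>M. nn_integral M f", OF lb])
  also have "\<dots> = (\<integral>\<^sup>+x. ennreal \<bar>det A\<bar> * f x \<partial>distr lborel borel (\<lambda>x. A *v x))"
    by (rule nn_integral_density) auto
  also have "\<dots> = ennreal \<bar>det A\<bar> * (\<integral>\<^sup>+x. f x \<partial>distr lborel borel (\<lambda>x. A *v x))"
    by (rule nn_integral_cmult) auto
  also have "\<dots> = ennreal \<bar>det A\<bar> * (\<integral>\<^sup>+x. f (A *v x) \<partial>lborel)"
    by (intro arg_cong[where f="\<lambda>z. ennreal \<bar>det A\<bar> * z"] nn_integral_distr) auto
  finally show "ennreal \<bar>det A\<bar> * (\<integral>\<^sup>+x. f (A *v x) \<partial>lborel) = (\<integral>\<^sup>+x. f x \<partial>lborel)" ..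
qed

text \<open>Every matrix is a product of diagonal, permutation and shear matrices, and the formula is stable under products.\<close>

lemma nn_integral_lborel_linear:
  fixes A :: "real^'n^'n" and f :: "real^'n \<Rightarrow> ennreal"
  assumes "det A \<noteq> 0" "f \<in> borel_measurable borel"
  shows "ennreal \<bar>det A\<bar> * (\<integral>\<^sup>+x. f (A *v x) \<partial>lborel) = (\<integral>\<^sup>+x. f x \<partial>lborel)"
proof -
  define P where "P A \<longleftrightarrow> det A \<noteq> 0 \<longrightarrow> (\<forall>f\<in>borel_measurable borel. ennreal \<bar>det A\<bar> * (\<integral>\<^sup>+x. f (A *v x) \<partial>lborel) = (\<integral>\<^sup>+x. f x \<partial>lborel))"
    for A :: "real^'n^'n"
  have "P A"
  proof (rule induct_matrix_elementary)
    fix A B :: "real^'n^'n" assume PA: "P A" and PB: "P B"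
    show "P (A ** B)"
      unfolding P_def
    proof (intro impI ballI)
      assume nz: "det (A ** B) \<noteq> 0"
      fix f :: "real^'n \<Rightarrow> ennreal" assume [measurable]: "f \<in> borel_measurable borel"
      have nz: "det A \<noteq> 0" "det B \<noteq> 0" using nz by (auto simp: det_mul)
      have "ennreal \<bar>det (A ** B)\<bar> * (\<integral>\<^sup>+x. f ((A ** B) *v x) \<partial>lborel)
        = ennreal \<bar>det A\<bar> * (ennreal \<bar>det B\<bar> * (\<integral>\<^sup>+x. f (A *v (B *v x)) \<partial>lborel))"
        by (simp add: det_mul abs_mult ennreal_mult mult.assoc matrix_vector_mul_assoc)
      also have "\<dots> = ennreal \<bar>det A\<bar> * (\<integral>\<^sup>+x. f (A *v x) \<partial>lborel)"
        using PB nz by (subst PB[unfolded P_def, rule_format, of "\<lambda>x. f (A *v x)"]) auto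
      also have "\<dots> = (\<integral>\<^sup>+x. f x \<partial>lborel)"
        using PA nz by (auto simp: P_def)
      finally show "ennreal \<bar>det (A ** B)\<bar> * (\<integral>\<^sup>+x. f ((A ** B) *v x) \<partial>lborel) = (\<integral>\<^sup>+x. f x \<partial>lborel)" .
    qed
  next
    fix A :: "real^'n^'n" and i assume "row i A = 0"
    then show "P A" by (simp add: P_def det_zero_row)
  next
    fix A :: "real^'n^'n" assume A: "\<And>i j. i \<noteq> j \<Longrightarrow> A$i$j = 0"
    show "P A" unfolding P_def by (intro impI ballI nn_integral_lborel_diagonal A)
  next
    fix m n :: 'n assume mn: "m \<noteq> n"
    let ?t = "Transposition.transpose m n"
    let ?A = "(\<chi> i j. mat 1 $ i $ ?t j) :: real^'n^'n"
    have Av: "?A *v x = (\<chi> i. x $ ?t i)" for x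
    proof -
      have "(\<Sum>j\<in>UNIV. (if i = ?t j then 1 else 0) * x $ j) = x $ ?t i" for i
      proof -
        have "(\<Sum>j\<in>UNIV. (if i = ?t j then 1 else 0) * x $ j) = (\<Sum>j\<in>UNIV. if j = ?t i then x $ j else 0)"
          by (intro sum.cong) (auto simp: transpose_eq_iff)
        then show ?thesis by simp
      qed
      then show ?thesis
        by (simp add: matrix_vector_mult_def mat_def vec_eq_iff)
    qed
    have det: "\<bar>det ?A\<bar> = 1"
      by (simp add: det_permute_columns permutes_swap_id sign_swap_id abs_mult)
    have lb: "lborel = distr lborel borel (\<lambda>x::real^'n. (\<chi> i. x $ ?t i))"
    proof (rule lborel_eqI)
      have [measurable]: "(\<lambda>x::real^'n. (\<chi> i. x $ ?t i)) \<in> borel_measurable borel"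
      proof -
        have "(\<lambda>x. ?A *v x) \<in> borel_measurable borel" by simp
        then show ?thesis by (simp only: Av)
      qed
      fix l u :: "real^'n" assume le: "\<And>b. b \<in> Basis \<Longrightarrow> l \<bullet> b \<le> u \<bullet> b"
      have le': "l $ i \<le> u $ i" for i
        using le[of "axis i 1"] by (simp add: inner_axis axis_in_Basis_iff)
      have B: "prod ((\<bullet>) w) Basis = (\<Prod>i\<in>UNIV. w $ i)" for w :: "real^'n"
      proof -
        have "prod ((\<bullet>) w) Basis = prod ((\<bullet>) w) (range (\<lambda>i. axis i (1::real)))"
          by (rule prod.cong) (auto simp: Basis_vec_def)
        then show ?thesis by (simp add: prod.reindex inj_on_def axis_eq_axis inner_axis)
      qed
      have "(\<lambda>x::real^'n. (\<chi> i. x $ ?t i)) -` box l u = box (\<chi> i. l $ ?t i) (\<chi> i. u $ ?t i)"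
      proof -
        have "(\<forall>i. l $ i < x $ ?t i \<and> x $ ?t i < u $ i) \<longleftrightarrow> (\<forall>i. l $ ?t i < x $ i \<and> x $ i < u $ ?t i)" for x :: "real^'n"
          by (metis transpose_involutory)
        then show ?thesis by (simp add: mem_box_cart set_eq_iff)
      qed
      then have "emeasure (distr lborel borel (\<lambda>x::real^'n. (\<chi> i. x $ ?t i))) (box l u)
        = emeasure lborel (box (\<chi> i. l $ ?t i) (\<chi> i. u $ ?t i))"
        by (subst emeasure_distr) auto
      also have "\<dots> = ennreal (\<Prod>i\<in>UNIV. (u - l) $ ?t i)"
      proof -
        have pr: "(\<chi> i. l $ ?t i) \<bullet> b \<le> (\<chi> i. u $ ?t i) \<bullet> b" if "b \<in> Basis" for b
          using that le' by (auto simp: Basis_vec_def inner_axis)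
        show ?thesis by (subst emeasure_lborel_box[OF pr]) (auto simp: B)
      qed
      also have "(\<Prod>i\<in>UNIV. (u - l) $ ?t i) = (\<Prod>i\<in>UNIV. (u - l) $ i)"
        using prod.permute[OF permutes_swap_id[of m UNIV n], of "\<lambda>i. (u - l) $ i"] by (simp add: o_def)
      finally show "emeasure (distr lborel borel (\<lambda>x::real^'n. (\<chi> i. x $ ?t i))) (box l u) = ennreal (prod ((\<bullet>) (u - l)) Basis)"
        by (simp add: B)
    qed simp
    show "P ?A"
      unfolding P_def
    proof (intro impI ballI)
      fix f :: "real^'n \<Rightarrow> ennreal" assume [measurable]: "f \<in> borel_measurable borel"
      have [measurable]: "(\<lambda>x::real^'n. (\<chi> i. x $ ?t i)) \<in> borel_measurable borel"
      proof -
        have "(\<lambda>x. ?A *v x) \<in> borel_measurable borel" by simp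
        then show ?thesis by (simp only: Av)
      qed
      show "ennreal \<bar>det ?A\<bar> * (\<integral>\<^sup>+x. f (?A *v x) \<partial>lborel) = (\<integral>\<^sup>+x. f x \<partial>lborel)"
        proof -
        have "(\<integral>\<^sup>+x. f x \<partial>lborel) = (\<integral>\<^sup>+x. f x \<partial>distr lborel borel (\<lambda>x::real^'n. (\<chi> i. x $ ?t i)))"
          by (rule arg_cong[where f="\<lambda>M. nn_integral M f", OF lb])
        also have "\<dots> = (\<integral>\<^sup>+x. f (\<chi> i. x $ ?t i) \<partial>lborel)"
          by (rule nn_integral_distr) auto
        finally show ?thesis unfolding det Av by simp
      qed
    qed
  next
    fix m n :: 'n and c :: real assume mn: "m \<noteq> n"
    let ?A = "(\<chi> i j. if i = m \<and> j = n then c else of_bool (i = j)) :: real^'n^'n"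
    have Av: "?A *v x = (\<chi> i. if i = m then x$m + c * x$n else x$i)" for x
    proof -
      have "(\<Sum>j\<in>UNIV. (if i = m \<and> j = n then c else of_bool (i = j)) * x $ j) = (if i = m then x$m + c * x$n else x$i)" for i
      proof -
        have "(\<Sum>j\<in>UNIV. (if i = m \<and> j = n then c else of_bool (i = j)) * x $ j)
          = (\<Sum>j\<in>UNIV. (if j = n then (if i = m then c * x $ n else 0) else 0) + (if j = i then x $ i else 0))"
          using mn by (intro sum.cong) auto
        then show ?thesis by (simp add: sum.distrib)
      qed
      then show ?thesis
        by (simp add: matrix_vector_mult_def vec_eq_iff)
    qed
    have det: "det ?A = 1"
    proof -
      have "?A = (\<chi> k. if k = m then row m (mat 1) + c *s row n (mat 1) else row k (mat 1))"
        using mn by (auto simp: vec_eq_iff row_def mat_def)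
      then show ?thesis using det_row_operation[OF mn, of "mat 1 :: real^'n^'n" c] by simp
    qed
    show "P ?A"
      unfolding P_def Av det using nn_integral_lborel_shear[OF mn] by simp
  qed
  then show ?thesis using assms by (auto simp: P_def)
qed

section \<open>Gaussian integrals and orthonormal frames\<close>

lemma integral_lborel_linear:
  fixes A :: "real^'n^'n" and f :: "real^'n \<Rightarrow> 'b::{banach,second_countable_topology}"
  assumes A: "det A \<noteq> 0" and [measurable]: "f \<in> borel_measurable borel"
  shows "integral\<^sup>L lborel f = \<bar>det A\<bar> *\<^sub>R (\<integral>x. f (A *v x) \<partial>lborel)"
proof -
  have "lborel = density (distr lborel borel (\<lambda>x. A *v x)) (\<lambda>_. ennreal \<bar>det A\<bar>)"
  proof (rule measure_eqI)
    fix S :: "(real^'n) set" assume "S \<in> sets lborel"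
    then have S[measurable]: "S \<in> sets borel" by simp
    have "emeasure lborel S = ennreal \<bar>det A\<bar> * (\<integral>\<^sup>+x. indicator S (A *v x) \<partial>lborel)"
      using nn_integral_lborel_linear[OF A, of "indicator S"] by simp
    also have "(\<integral>\<^sup>+x. indicator S (A *v x) \<partial>lborel) = emeasure (distr lborel borel (\<lambda>x. A *v x)) S"
      by (subst nn_integral_indicator[symmetric], simp, subst nn_integral_distr) auto
    also have "ennreal \<bar>det A\<bar> * \<dots> = emeasure (density (distr lborel borel (\<lambda>x. A *v x)) (\<lambda>_. ennreal \<bar>det A\<bar>)) S"
      by (subst emeasure_density) (auto simp: nn_integral_cmult_indicator)
    finally show "emeasure lborel S = \<dots>" .
  qed simp
  then have "integral\<^sup>L lborel f = integral\<^sup>L (density (distr lborel borel (\<lambda>x. A *v x)) (\<lambda>_. ennreal \<bar>det A\<bar>)) f"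
    by (rule arg_cong[where f="\<lambda>M. integral\<^sup>L M f"])
  also have "\<dots> = (\<integral>x. \<bar>det A\<bar> *\<^sub>R f x \<partial>distr lborel borel (\<lambda>x. A *v x))"
    by (rule integral_density) auto
  also have "\<dots> = (\<integral>x. \<bar>det A\<bar> *\<^sub>R f (A *v x) \<partial>lborel)"
    by (rule integral_distr) auto
  finally show ?thesis by simp
qed

lemma
  shows integrable_gaussian_char: "integrable lborel (\<lambda>s::real. complex_of_real (exp (- s\<^sup>2 / 2)) * iexp (s * y))"
    and integral_gaussian_char: "(\<integral>s. complex_of_real (exp (- s\<^sup>2 / 2)) * iexp (s * y) \<partial>lborel) = complex_of_real (sqrt (2 * pi) * exp (- y\<^sup>2 / 2))"
proof -
  have eq: "(\<lambda>s. complex_of_real (exp (- s\<^sup>2 / 2)) * iexp (s * y)) = (\<lambda>s. complex_of_real (sqrt (2 * pi)) * (std_normal_density s *\<^sub>R iexp (s * y)))"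
    by (auto simp: std_normal_density_def scaleR_conv_of_real fun_eq_iff)
  have "integrable lborel (\<lambda>s. std_normal_density s *\<^sub>R iexp (s * y))"
    by (rule Bochner_Integration.integrable_bound[where f=std_normal_density])
       (auto intro!: integrable_normal_density)
  then show "integrable lborel (\<lambda>s. complex_of_real (exp (- s\<^sup>2 / 2)) * iexp (s * y))"
    unfolding eq by (intro integrable_mult_right)
  have "(\<integral>s. std_normal_density s *\<^sub>R iexp (s * y) \<partial>lborel) = char std_normal_distribution y"
    unfolding char_def by (subst integral_density) (auto simp: mult.commute)
  also have "\<dots> = complex_of_real (exp (- y\<^sup>2 / 2))"
    by (simp add: char_std_normal_distribution)
  finally have *: "(\<integral>s. std_normal_density s *\<^sub>R iexp (s * y) \<partial>lborel) = complex_of_real (exp (- y\<^sup>2 / 2))" .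
  show "(\<integral>s. complex_of_real (exp (- s\<^sup>2 / 2)) * iexp (s * y) \<partial>lborel) = complex_of_real (sqrt (2 * pi) * exp (- y\<^sup>2 / 2))"
  proof -
    have "(\<integral>s. complex_of_real (exp (- s\<^sup>2 / 2)) * iexp (s * y) \<partial>lborel)
      = complex_of_real (sqrt (2 * pi)) * (\<integral>s. std_normal_density s *\<^sub>R iexp (s * y) \<partial>lborel)"
      unfolding eq by (rule integral_mult_right_zero)
    then show ?thesis unfolding * of_real_mult[of "sqrt (2 * pi)" "exp (- y\<^sup>2 / 2)"] .
  qed
qed

lemma prod_iexp: "finite S \<Longrightarrow> (\<Prod>i\<in>S. iexp (f i)) = iexp (\<Sum>i\<in>S. f i)"
  by (induction S rule: finite_induct) (auto simp: exp_add[symmetric] algebra_simps)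

lemma inner_vec_sum: "(x::real^'n) \<bullet> y = (\<Sum>i\<in>UNIV. x$i * y$i)"
  by (simp add: inner_vec_def)

text \<open>The Gaussian is its own Fourier transform, coordinate by coordinate.\<close>

lemma integral_gaussian_vec:
  fixes y :: "real^'n"
  shows "(\<integral>s. complex_of_real (exp (- (s \<bullet> s) / 2)) * iexp (s \<bullet> y) \<partial>lborel) = complex_of_real (sqrt (2 * pi) ^ CARD('n) * exp (- (y \<bullet> y) / 2))"
proof -
  have exp_eq: "exp (- (s \<bullet> s) / 2) = (\<Prod>i\<in>UNIV. exp (- (s$i)\<^sup>2 / 2))" for s :: "real^'n"
    by (simp add: inner_vec_sum exp_sum[symmetric] sum_divide_distrib sum_negf power2_eq_square)
  have eq: "complex_of_real (exp (- (s \<bullet> s) / 2)) * iexp (s \<bullet> y) = (\<Prod>i\<in>UNIV. complex_of_real (exp (- (s$i)\<^sup>2 / 2)) * iexp (s$i * y$i))" for s :: "real^'n"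
    unfolding prod.distrib prod_iexp[OF finite] inner_vec_sum[symmetric] exp_eq of_real_prod ..
  have "(\<integral>s. complex_of_real (exp (- (s \<bullet> s) / 2)) * iexp (s \<bullet> y) \<partial>lborel) = (\<Prod>i\<in>UNIV. complex_of_real (sqrt (2 * pi) * exp (- (y$i)\<^sup>2 / 2)))"
    unfolding eq by (subst integral_prod_vec, rule integrable_gaussian_char) (simp only: integral_gaussian_char)
  also have "\<dots> = complex_of_real (sqrt (2 * pi) ^ CARD('n) * exp (- (y \<bullet> y) / 2))"
    unfolding exp_eq by (simp add: prod.distrib)
  finally show "(\<integral>s. complex_of_real (exp (- (s \<bullet> s) / 2)) * iexp (s \<bullet> y) \<partial>lborel) = complex_of_real (sqrt (2 * pi) ^ CARD('n) * exp (- (y \<bullet> y) / 2))" .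
qed

text \<open>Gram--Schmidt for the inner product of \<open>Q\<close>: the columns of \<open>B\<close> are an orthonormal basis.\<close>

lemma posdef_orthonormal_matrix:
  fixes Q :: "real^'n^'n"
  assumes sym: "transpose Q = Q" and pos: "\<And>x. x \<noteq> 0 \<Longrightarrow> x \<bullet> (Q *v x) > 0"
  obtains B :: "real^'n^'n" where "transpose B ** Q ** B = mat 1"
proof -
  define b where "b x y = x \<bullet> (Q *v y)" for x y :: "real^'n"
  have badd: "b (x + y) z = b x z + b y z" "b z (x + y) = b z x + b z y" for x y z
    by (auto simp: b_def inner_left_distrib inner_right_distrib matrix_vector_right_distrib)
  have bdiff: "b (x - y) z = b x z - b y z" "b z (x - y) = b z x - b z y" for x y z
    by (auto simp: b_def inner_diff_left inner_diff_right matrix_vector_mult_diff_distrib)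
  have bscale: "b (c *\<^sub>R x) z = c * b x z" "b z (c *\<^sub>R x) = c * b z x" for x z c
    by (auto simp: b_def matrix_vector_mult_scaleR)
  have bsum: "b (\<Sum>x\<in>T. f x) z = (\<Sum>x\<in>T. b (f x) z)" for T z and f :: "real^'n \<Rightarrow> real^'n"
    by (simp add: b_def inner_sum_left)
  have bsym: "b x y = b y x" for x y
    by (metis b_def dot_lmul_matrix inner_commute sym transpose_matrix_vector)
  \<comment> \<open>\<open>ON\<close>: orthonormal with respect to \<open>b\<close>. A set of this kind that does not span is extended by one vector.\<close>
  define ON where "ON S \<longleftrightarrow> finite S \<and> (\<forall>x\<in>S. \<forall>y\<in>S. b x y = (if x = y then 1 else 0))" for S
  have indep: "independent S" if "ON S" for S
  proof (rule independent_if_scalars_zero)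
    show "finite S" using that by (simp add: ON_def)
    fix f x assume 0: "(\<Sum>x\<in>S. f x *\<^sub>R x) = 0" and x: "x \<in> S"
    have "0 = b (\<Sum>x\<in>S. f x *\<^sub>R x) x" by (simp add: 0 b_def)
    also have "\<dots> = (\<Sum>y\<in>S. f y * (if y = x then 1 else 0))"
      unfolding bsum bscale using that x by (intro sum.cong) (auto simp: ON_def)
    also have "\<dots> = f x" using that x by (simp add: ON_def if_distrib cong: if_cong)
    finally show "f x = 0" by simp
  qed
  have card: "card S \<le> CARD('n)" if "ON S" for S
    using independent_bound[OF indep[OF that]] by simp
  have ext: "\<exists>S. ON S \<and> card S = k" if "k \<le> CARD('n)" for k
    using that
  proof (induction k)
    case 0 then show ?case by (intro exI[of _ "{}"]) (auto simp: ON_def)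
  next
    case (Suc k)
    then obtain S where S: "ON S" "card S = k" by auto
    have fin: "finite S" using S by (simp add: ON_def)
    have "span S \<noteq> UNIV"
    proof
      assume "span S = UNIV"
      then have "dim (UNIV :: (real^'n) set) \<le> card S"
        using fin by (intro span_card_ge_dim) auto
      then show False using S Suc.prems by simp
    qed
    then obtain v where v: "v \<notin> span S" by auto
    define w where "w = v - (\<Sum>y\<in>S. b v y *\<^sub>R y)"
    have wn0: "w \<noteq> 0"
    proof
      assume "w = 0"
      then have "v = (\<Sum>y\<in>S. b v y *\<^sub>R y)" by (simp add: w_def)
      also have "(\<Sum>y\<in>S. b v y *\<^sub>R y) \<in> span S"
        by (intro span_sum span_scale span_base)
      finally show False using v by simp
    qed
    have bw: "b w x = 0" if "x \<in> S" for x
    proof -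
      have "b w x = b v x - (\<Sum>y\<in>S. b v y * (if y = x then 1 else 0))"
        unfolding w_def bdiff bsum bscale using S that by (auto simp: ON_def intro!: sum.cong)
      also have "\<dots> = 0" using that fin by (simp add: if_distrib cong: if_cong)
      finally show ?thesis .
    qed
    define u where "u = (1 / sqrt (b w w)) *\<^sub>R w"
    have bww: "b w w > 0" using pos[OF wn0] by (simp add: b_def)
    have buu: "b u u = 1" using bww by (simp add: u_def bscale field_simps)
    have bux: "b u x = 0" "b x u = 0" if "x \<in> S" for x
      using bw[OF that] bsym[of x u] by (auto simp: u_def bscale)
    have "u \<notin> S" using bux buu by force
    then show ?case
      using S fin buu bux by (intro exI[of _ "insert u S"]) (auto simp: ON_def)
  qed
  obtain S where S: "ON S" "card S = CARD('n)" using ext[of "CARD('n)"] by auto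
  then obtain h :: "'n \<Rightarrow> real^'n" where h: "bij_betw h UNIV S"
    by (metis ON_def finite_same_card_bij finite_class.finite_UNIV)
  have bh: "b (h i) (h j) = (if i = j then 1 else 0)" for i j
    using S h by (auto simp: ON_def bij_betw_def inj_on_def)
  define B where "B = (\<chi> i j. h j $ i)"
  have "(transpose B ** Q ** B) $ i $ j = b (h i) (h j)" for i j
    unfolding b_def B_def matrix_mul_assoc[symmetric]
    by (simp add: matrix_matrix_mult_def transpose_def inner_vec_def matrix_vector_mult_def)
  then have "transpose B ** Q ** B = mat 1"
    by (simp add: bh vec_eq_iff mat_def)
  then show ?thesis using that by blast
qed

lemma
  fixes Q B :: "real^'n^'n"
  assumes B: "transpose B ** Q ** B = mat 1"
  shows orthonormal_matrix_det: "(det B)\<^sup>2 * det Q = 1"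
    and orthonormal_matrix_inv: "matrix_inv Q = B ** transpose B"
    and orthonormal_matrix_form: "(B *v s) \<bullet> (Q *v (B *v s)) = s \<bullet> s"
proof -
  have "det (transpose B ** Q ** B) = 1" by (simp add: B)
  then show "(det B)\<^sup>2 * det Q = 1" by (simp add: det_mul power2_eq_square mult_ac)
  have "(transpose B ** Q) ** B = mat 1" using B .
  then have 1: "B ** (transpose B ** Q) = mat 1" by (simp add: matrix_left_right_inverse)
  then have 2: "(B ** transpose B) ** Q = mat 1" by (simp add: matrix_mul_assoc)
  then have 3: "Q ** (B ** transpose B) = mat 1" using matrix_left_right_inverse by blast
  show "matrix_inv Q = B ** transpose B"
  proof -
    have "Q ** matrix_inv Q = mat 1 \<and> matrix_inv Q ** Q = mat 1"
      unfolding matrix_inv_def by (rule someI[where x="B ** transpose B"]) (use 2 3 in auto)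
    then show ?thesis
      using 2 by (metis matrix_mul_assoc matrix_mul_lid matrix_mul_rid)
  qed
  have "(B *v s) \<bullet> (Q *v (B *v s)) = s \<bullet> ((transpose B ** Q ** B) *v s)"
    unfolding matrix_vector_mul_assoc[symmetric]
    by (metis dot_lmul_matrix inner_commute transpose_matrix_vector)
  then show "(B *v s) \<bullet> (Q *v (B *v s)) = s \<bullet> s" by (simp add: B)
qed

section \<open>Random walks and their moments\<close>

primrec walk :: "'a::comm_monoid_add pmf \<Rightarrow> nat \<Rightarrow> 'a pmf" where
  "walk \<theta> 0 = return_pmf 0"
| "walk \<theta> (Suc n) = bind_pmf (walk \<theta> n) (\<lambda>s. map_pmf (\<lambda>x. s + x) \<theta>)"

lemma nn_integral_walk_Suc: "(\<integral>\<^sup>+z. f z \<partial>walk \<theta> (Suc n)) = (\<integral>\<^sup>+s. \<integral>\<^sup>+x. f (s + x) \<partial>\<theta> \<partial>walk \<theta> n)"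
  by simp

lemma nn_integral_walk_add: "(\<integral>\<^sup>+z. f z \<partial>walk \<theta> (m + n)) = (\<integral>\<^sup>+s. \<integral>\<^sup>+x. f (s + x) \<partial>walk \<theta> n \<partial>walk \<theta> m)"
  by (induction n arbitrary: f) (simp_all add: add.assoc)

lemma pmf_walk_add:
  fixes \<theta> :: "'a::ab_group_add pmf"
  shows "ennreal (pmf (walk \<theta> (m + n)) z) = (\<integral>\<^sup>+y. ennreal (pmf (walk \<theta> n) (z - y)) \<partial>walk \<theta> m)"
proof -
  have "ennreal (pmf (walk \<theta> (m + n)) z) = (\<integral>\<^sup>+w. indicator {z} w \<partial>walk \<theta> (m + n))"
    by (simp add: emeasure_pmf_single)
  also have "\<dots> = (\<integral>\<^sup>+y. \<integral>\<^sup>+x. indicator {z} (y + x) \<partial>walk \<theta> n \<partial>walk \<theta> m)"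
    by (rule nn_integral_walk_add)
  also have "\<dots> = (\<integral>\<^sup>+y. \<integral>\<^sup>+x. indicator {z - y} x \<partial>walk \<theta> n \<partial>walk \<theta> m)"
    by (intro nn_integral_cong) (auto simp: indicator_def algebra_simps)
  finally show ?thesis by (simp add: emeasure_pmf_single)
qed

text \<open>A Taylor expansion in which the second order term is kept apart. After integration over a centred \<open>b\<close> the linear term is
  gone; this is the gain that makes moments of walks diffusive.\<close>

lemma abs_add_power_le:
  fixes a b :: real
  assumes p: "p \<ge> 2"
  shows "\<bar>a + b\<bar> ^ p \<le> \<bar>a\<bar> ^ p + real p * sgn a * \<bar>a\<bar> ^ (p - 1) * b + (2 ^ p + real p) * (\<bar>a\<bar> ^ (p - 2) * b\<^sup>2 + \<bar>b\<bar> ^ p)"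
proof (cases "\<bar>b\<bar> \<le> \<bar>a\<bar>")
  \<comment> \<open>If \<open>\<bar>b\<bar> \<le> \<bar>a\<bar>\<close>, then \<open>\<bar>a + b\<bar> = \<bar>a\<bar> + c\<close> and the binomial formula applies; all terms of order at least two are
    bounded by \<open>\<bar>a\<bar> ^ (p - 2) * b\<^sup>2\<close>.\<close>
  case True
  define c where "c = sgn a * b"
  have c: "\<bar>c\<bar> \<le> \<bar>b\<bar>" "c\<^sup>2 \<le> b\<^sup>2" by (auto simp: c_def abs_mult abs_sgn_eq power_mult_distrib sgn_if)
  have "\<bar>a + b\<bar> = \<bar>a\<bar> + c" using True by (auto simp: c_def sgn_if abs_if)
  then have "\<bar>a + b\<bar> ^ p = (\<Sum>k\<le>p. of_nat (p choose k) * c ^ k * \<bar>a\<bar> ^ (p - k))"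
    by (simp add: binomial_ring add.commute)
  also have "{..p} = insert 0 (insert 1 {2..p})" using p by auto
  also have "(\<Sum>k\<in>\<dots>. of_nat (p choose k) * c ^ k * \<bar>a\<bar> ^ (p - k))
    = \<bar>a\<bar> ^ p + real p * sgn a * \<bar>a\<bar> ^ (p - 1) * b + (\<Sum>k=2..p. of_nat (p choose k) * c ^ k * \<bar>a\<bar> ^ (p - k))"
    by (simp add: c_def mult_ac)
  also have "(\<Sum>k=2..p. of_nat (p choose k) * c ^ k * \<bar>a\<bar> ^ (p - k)) \<le> (\<Sum>k=2..p. of_nat (p choose k) * (\<bar>a\<bar> ^ (p - 2) * b\<^sup>2))"
  proof (intro sum_mono)
    fix k assume k: "k \<in> {2..p}"
    have "c ^ k \<le> \<bar>c\<bar> ^ k" by (metis abs_ge_self power_abs)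
    also have "\<dots> = \<bar>c\<bar> ^ (k - 2) * c\<^sup>2" using k by (metis atLeastAtMost_iff le_add_diff_inverse2 power2_abs power_add)
    also have "\<dots> \<le> \<bar>a\<bar> ^ (k - 2) * b\<^sup>2" by (intro mult_mono c(2) power_mono) (use c True in auto)
    finally have "c ^ k * \<bar>a\<bar> ^ (p - k) \<le> (\<bar>a\<bar> ^ (k - 2) * b\<^sup>2) * \<bar>a\<bar> ^ (p - k)"
      by (intro mult_right_mono) auto
    also have "\<dots> = \<bar>a\<bar> ^ (p - 2) * b\<^sup>2"
    proof -
      have "p - 2 = (k - 2) + (p - k)" using k by auto
      then have "\<bar>a\<bar> ^ (p - 2) = \<bar>a\<bar> ^ (k - 2) * \<bar>a\<bar> ^ (p - k)" by (metis power_add)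
      then show ?thesis by simp
    qed
    finally show "of_nat (p choose k) * c ^ k * \<bar>a\<bar> ^ (p - k) \<le> of_nat (p choose k) * (\<bar>a\<bar> ^ (p - 2) * b\<^sup>2)"
      by (metis (no_types, lifting) mult.assoc mult_left_mono of_nat_0_le_iff)
  qed
  also have "\<dots> \<le> 2 ^ p * (\<bar>a\<bar> ^ (p - 2) * b\<^sup>2)"
  proof -
    have "(\<Sum>k=2..p. of_nat (p choose k) :: real) \<le> (\<Sum>k\<le>p. of_nat (p choose k))"
      by (rule sum_mono2) auto
    also have "\<dots> = 2 ^ p"
      by (metis choose_row_sum of_nat_numeral of_nat_power of_nat_sum)
    finally show ?thesis unfolding sum_distrib_right[symmetric] by (intro mult_right_mono) auto
  qed
  also have "\<dots> \<le> (2 ^ p + real p) * (\<bar>a\<bar> ^ (p - 2) * b\<^sup>2 + \<bar>b\<bar> ^ p)"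
    by (intro mult_mono) auto
  finally show ?thesis by simp
next
  case False
  \<comment> \<open>If \<open>b\<close> dominates, the linear term is absorbed by \<open>real p * \<bar>b\<bar> ^ p\<close>.\<close>
  have "\<bar>a + b\<bar> ^ p \<le> (2 * \<bar>b\<bar>) ^ p" using False by (intro power_mono) auto
  also have "\<dots> = 2 ^ p * \<bar>b\<bar> ^ p" by (simp add: power_mult_distrib)
  finally have 1: "\<bar>a + b\<bar> ^ p \<le> 2 ^ p * \<bar>b\<bar> ^ p" .
  have "\<bar>sgn a * \<bar>a\<bar> ^ (p - 1) * b\<bar> \<le> 1 * \<bar>b\<bar> ^ (p - 1) * \<bar>b\<bar>"
    unfolding abs_mult using False by (intro mult_mono) (auto simp: abs_sgn_eq intro!: power_mono)
  also have "\<dots> = \<bar>b\<bar> ^ p" using p by (metis One_nat_def Suc_diff_1 mult_1 not_numeral_le_zero power_Suc2 zero_less_iff_neq_zero)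
  finally have "- (\<bar>b\<bar> ^ p) \<le> sgn a * \<bar>a\<bar> ^ (p - 1) * b" by (simp add: abs_le_iff)
  then have "real p * - (\<bar>b\<bar> ^ p) \<le> real p * (sgn a * \<bar>a\<bar> ^ (p - 1) * b)"
    by (rule mult_left_mono) simp
  then have 2: "0 \<le> real p * sgn a * \<bar>a\<bar> ^ (p - 1) * b + real p * \<bar>b\<bar> ^ p" by (simp add: mult.assoc)
  have 3: "0 \<le> \<bar>a\<bar> ^ p" "0 \<le> (2 ^ p + real p) * (\<bar>a\<bar> ^ (p - 2) * b\<^sup>2)" by auto
  have "(2 ^ p + real p) * (\<bar>a\<bar> ^ (p - 2) * b\<^sup>2 + \<bar>b\<bar> ^ p) = (2 ^ p + real p) * (\<bar>a\<bar> ^ (p - 2) * b\<^sup>2) + 2 ^ p * \<bar>b\<bar> ^ p + real p * \<bar>b\<bar> ^ p"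
    by (simp only: distrib_left distrib_right add.assoc)
  then show ?thesis using 1 2 3 by linarith
qed

text \<open>Sums of centred steps grow diffusively. One step adds to the moment of order \<open>p\<close> at most a multiple of the moment of
  order \<open>p - 2\<close>, so the induction goes from \<open>p - 2\<close> to \<open>p\<close>.\<close>

lemma walk_moment:
  fixes f :: "'a::comm_monoid_add \<Rightarrow> real"
  assumes add: "\<And>x y. f (x + y) = f x + f y"
    and int: "\<And>p. p \<le> q \<Longrightarrow> integrable (measure_pmf \<theta>) (\<lambda>x. \<bar>f x\<bar> ^ p)"
    and mean: "measure_pmf.expectation \<theta> f = 0"
    and p: "p \<le> q" and q: "q \<ge> 2"
  shows "\<exists>C\<ge>0. \<forall>n. (\<integral>\<^sup>+s. ennreal (\<bar>f s\<bar> ^ p) \<partial>walk \<theta> n) \<le> ennreal (C * sqrt (real n) ^ p)"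
  using p
proof (induction p rule: less_induct)
  case (less p)
  have f0: "f 0 = 0" using add[of 0 0] by simp
  have intf: "integrable (measure_pmf \<theta>) f"
    using int[of 1] q by (auto simp: integrable_abs_iff[of f, symmetric])
  have step: "\<exists>C\<ge>0. \<forall>n. (\<integral>\<^sup>+s. ennreal (\<bar>f s\<bar> ^ p) \<partial>walk \<theta> n) \<le> ennreal (C * sqrt (real n) ^ p)"
    if p2: "p \<ge> 2" and pq: "p \<le> q"
      and IH: "\<exists>C\<ge>0. \<forall>n. (\<integral>\<^sup>+s. ennreal (\<bar>f s\<bar> ^ (p - 2)) \<partial>walk \<theta> n) \<le> ennreal (C * sqrt (real n) ^ (p - 2))" for p
  proof -
    obtain C where C: "C \<ge> 0" "\<And>n. (\<integral>\<^sup>+s. ennreal (\<bar>f s\<bar> ^ (p - 2)) \<partial>walk \<theta> n) \<le> ennreal (C * sqrt (real n) ^ (p - 2))"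
      using IH by auto
    define D where "D = 2 ^ p + real p"
    define v where "v = measure_pmf.expectation \<theta> (\<lambda>x. (f x)\<^sup>2)"
    define m where "m = measure_pmf.expectation \<theta> (\<lambda>x. \<bar>f x\<bar> ^ p)"
    have nn: "v \<ge> 0" "m \<ge> 0" "D \<ge> 0" by (auto simp: v_def m_def D_def)
    have int2: "integrable (measure_pmf \<theta>) (\<lambda>x. (f x)\<^sup>2)" using int[of 2] q by simp
    have intp: "integrable (measure_pmf \<theta>) (\<lambda>x. \<bar>f x\<bar> ^ p)" using int pq by auto
    have one: "(\<integral>\<^sup>+x. ennreal (\<bar>f (s + x)\<bar> ^ p) \<partial>\<theta>) \<le> ennreal (\<bar>f s\<bar> ^ p) + ennreal (D * v) * ennreal (\<bar>f s\<bar> ^ (p - 2)) + ennreal (D * m)" for s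
    proof -
      let ?r = "\<lambda>x. \<bar>f s\<bar> ^ p + real p * sgn (f s) * \<bar>f s\<bar> ^ (p - 1) * f x + D * (\<bar>f s\<bar> ^ (p - 2) * (f x)\<^sup>2 + \<bar>f x\<bar> ^ p)"
      have le: "\<bar>f (s + x)\<bar> ^ p \<le> ?r x" for x
        unfolding add D_def using abs_add_power_le[OF p2] .
      have r0: "0 \<le> ?r x" for x by (rule order_trans[OF _ le]) simp
      have ir: "integrable (measure_pmf \<theta>) ?r"
        by (intro Bochner_Integration.integrable_add integrable_mult_right intf int2 intp) auto
      have "(\<integral>\<^sup>+x. ennreal (\<bar>f (s + x)\<bar> ^ p) \<partial>\<theta>) \<le> (\<integral>\<^sup>+x. ennreal (?r x) \<partial>\<theta>)"
        by (intro nn_integral_mono ennreal_leI le)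
      also have "\<dots> = ennreal (measure_pmf.expectation \<theta> ?r)"
        by (intro nn_integral_eq_integral ir AE_I2 r0)
      also have "measure_pmf.expectation \<theta> ?r = \<bar>f s\<bar> ^ p + D * (\<bar>f s\<bar> ^ (p - 2) * v + m)"
        using intf int2 intp mean by (simp add: v_def m_def)
      also have "ennreal \<dots> = ennreal (\<bar>f s\<bar> ^ p) + ennreal (D * v) * ennreal (\<bar>f s\<bar> ^ (p - 2)) + ennreal (D * m)"
        using nn by (simp add: ennreal_plus[symmetric] ennreal_mult[symmetric] algebra_simps del: ennreal_plus)
      finally show ?thesis .
    qed
    define K where "K = D * v * C + D * m"
    have K0: "K \<ge> 0" using nn C by (simp add: K_def)
    have inc: "(\<integral>\<^sup>+s. ennreal (\<bar>f s\<bar> ^ p) \<partial>walk \<theta> (Suc n)) \<le> (\<integral>\<^sup>+s. ennreal (\<bar>f s\<bar> ^ p) \<partial>walk \<theta> n) + ennreal (K * sqrt (real (Suc n)) ^ (p - 2))" for n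
    proof -
      have "(\<integral>\<^sup>+s. ennreal (\<bar>f s\<bar> ^ p) \<partial>walk \<theta> (Suc n)) \<le> (\<integral>\<^sup>+s. ennreal (\<bar>f s\<bar> ^ p) + ennreal (D * v) * ennreal (\<bar>f s\<bar> ^ (p - 2)) + ennreal (D * m) \<partial>walk \<theta> n)"
        unfolding nn_integral_walk_Suc by (intro nn_integral_mono one)
      also have "\<dots> = (\<integral>\<^sup>+s. ennreal (\<bar>f s\<bar> ^ p) \<partial>walk \<theta> n) + (ennreal (D * v) * (\<integral>\<^sup>+s. ennreal (\<bar>f s\<bar> ^ (p - 2)) \<partial>walk \<theta> n) + ennreal (D * m))"
        by (simp add: nn_integral_add nn_integral_cmult add.assoc)
      also have "ennreal (D * v) * (\<integral>\<^sup>+s. ennreal (\<bar>f s\<bar> ^ (p - 2)) \<partial>walk \<theta> n) + ennreal (D * m)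
        \<le> ennreal (D * v) * ennreal (C * sqrt (real n) ^ (p - 2)) + ennreal (D * m)"
        by (intro add_right_mono mult_left_mono C) auto
      also have "\<dots> = ennreal (D * v * (C * sqrt (real n) ^ (p - 2)) + D * m)"
        using nn C by (simp add: ennreal_plus[symmetric] ennreal_mult[symmetric] del: ennreal_plus)
      also have "\<dots> \<le> ennreal (K * sqrt (real (Suc n)) ^ (p - 2))"
      proof (rule ennreal_leI)
        have a: "sqrt (real n) ^ (p - 2) \<le> sqrt (real (Suc n)) ^ (p - 2)" by (intro power_mono) auto
        have b: "1 \<le> sqrt (real (Suc n)) ^ (p - 2)" by (rule one_le_power) simp
        have "D * v * (C * sqrt (real n) ^ (p - 2)) + D * m * 1 \<le> D * v * (C * sqrt (real (Suc n)) ^ (p - 2)) + D * m * sqrt (real (Suc n)) ^ (p - 2)"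
          using nn C a b by (intro add_mono mult_left_mono) auto
        then show "D * v * (C * sqrt (real n) ^ (p - 2)) + D * m \<le> K * sqrt (real (Suc n)) ^ (p - 2)"
          by (simp add: K_def algebra_simps)
      qed
      finally show ?thesis by (simp add: add_left_mono)
    qed
    have "(\<integral>\<^sup>+s. ennreal (\<bar>f s\<bar> ^ p) \<partial>walk \<theta> n) \<le> ennreal (K * sqrt (real n) ^ p)" for n
    proof (induction n)
      case 0 then show ?case using p2 by (simp add: f0 zero_power)
    next
      case (Suc n)
      have e: "sqrt (real k) ^ p = real k * sqrt (real k) ^ (p - 2)" for k
      proof -
        have "p = 2 + (p - 2)" using p2 by simp
        then have "sqrt (real k) ^ p = sqrt (real k) ^ 2 * sqrt (real k) ^ (p - 2)" by (metis power_add)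
        then show ?thesis by simp
      qed
      have "(\<integral>\<^sup>+s. ennreal (\<bar>f s\<bar> ^ p) \<partial>walk \<theta> (Suc n)) \<le> ennreal (K * sqrt (real n) ^ p) + ennreal (K * sqrt (real (Suc n)) ^ (p - 2))"
        using inc[of n] Suc.IH by (meson add_right_mono order_trans)
      also have "\<dots> = ennreal (K * (sqrt (real n) ^ p + sqrt (real (Suc n)) ^ (p - 2)))"
        using K0 by (simp add: ennreal_plus[symmetric] distrib_left del: ennreal_plus)
      also have "\<dots> \<le> ennreal (K * sqrt (real (Suc n)) ^ p)"
      proof (intro ennreal_leI mult_left_mono K0)
        have "real n * sqrt (real n) ^ (p - 2) \<le> real n * sqrt (real (Suc n)) ^ (p - 2)"
          by (intro mult_left_mono power_mono) auto
        then show "sqrt (real n) ^ p + sqrt (real (Suc n)) ^ (p - 2) \<le> sqrt (real (Suc n)) ^ p"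
          unfolding e by (simp add: algebra_simps)
      qed
      finally show ?case .
    qed
    then show ?thesis using K0 by blast
  qed
  consider "p = 0" | "p = 1" | "p \<ge> 2" by linarith
  then show ?case
  proof cases
    case 1 then show ?thesis by (intro exI[of _ 1]) (simp add: measure_pmf.emeasure_space_1[simplified])
  next
    case 3 then show ?thesis using step[of p] less by auto
  next
    case 2
    have "\<exists>C\<ge>0. \<forall>n. (\<integral>\<^sup>+s. ennreal (\<bar>f s\<bar> ^ 2) \<partial>walk \<theta> n) \<le> ennreal (C * sqrt (real n) ^ 2)"
      by (rule step) (use q in \<open>auto intro!: exI[of _ 1] simp: measure_pmf.emeasure_space_1[simplified]\<close>)
    then obtain C where C: "C \<ge> 0" "\<And>n. (\<integral>\<^sup>+s. ennreal (\<bar>f s\<bar> ^ 2) \<partial>walk \<theta> n) \<le> ennreal (C * sqrt (real n) ^ 2)"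
      by auto
    have "(\<integral>\<^sup>+s. ennreal \<bar>f s\<bar> \<partial>walk \<theta> n) \<le> ennreal ((1 + C) * sqrt (real n))" for n
    proof (cases "n = 0")
      case True then show ?thesis by (simp add: f0)
    next
      case False
      define r where "r = sqrt (real n)"
      have r: "r > 0" using False by (simp add: r_def)
      \<comment> \<open>The first moment by interpolation: \<open>r\<close> is the diffusive scale.\<close>
      have le: "\<bar>f s\<bar> \<le> r + 1 / r * (\<bar>f s\<bar> ^ 2)" for s
      proof -
        have "r * \<bar>f s\<bar> \<le> r\<^sup>2 + \<bar>f s\<bar>\<^sup>2"
        proof -
          have "0 \<le> r * \<bar>f s\<bar>" using r by simp
          then show ?thesis using sum_squares_bound[of r "\<bar>f s\<bar>"] by (simp only: mult.assoc)
        qed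
        then have "\<bar>f s\<bar> \<le> (r\<^sup>2 + \<bar>f s\<bar>\<^sup>2) / r" using r by (simp add: field_simps)
        then show ?thesis using r by (simp add: add_divide_distrib power2_eq_square)
      qed
      have "(\<integral>\<^sup>+s. ennreal \<bar>f s\<bar> \<partial>walk \<theta> n) \<le> (\<integral>\<^sup>+s. ennreal r + ennreal (1 / r) * ennreal (\<bar>f s\<bar> ^ 2) \<partial>walk \<theta> n)"
        using r le by (intro nn_integral_mono) (simp add: ennreal_plus[symmetric] ennreal_mult[symmetric] ennreal_leI del: ennreal_plus)
      also have "\<dots> = ennreal r + ennreal (1 / r) * (\<integral>\<^sup>+s. ennreal (\<bar>f s\<bar> ^ 2) \<partial>walk \<theta> n)"
        by (simp add: nn_integral_add nn_integral_cmult)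
      also have "\<dots> \<le> ennreal r + ennreal (1 / r) * ennreal (C * r ^ 2)"
        unfolding r_def by (intro add_left_mono mult_left_mono C) auto
      also have "\<dots> = ennreal ((1 + C) * r)"
        using r C by (simp add: ennreal_plus[symmetric] ennreal_mult[symmetric] power2_eq_square algebra_simps del: ennreal_plus)
      finally show ?thesis by (simp add: r_def)
    qed
    then show ?thesis using 2 C by (intro exI[of _ "1 + C"]) auto
  qed
qed

section \<open>Characteristic functions on the lattice\<close>

lemma expectation_bind_pmf_real:
  fixes f :: "'b \<Rightarrow> real"
  assumes "\<And>x. \<bar>f x\<bar> \<le> B"
  shows "measure_pmf.expectation (bind_pmf M N) f = measure_pmf.expectation M (\<lambda>x. measure_pmf.expectation (N x) f)"
  unfolding measure_pmf_bind
  by (rule integral_bind[where K="count_space UNIV" and B'=1 and B=B])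
     (use assms in \<open>auto simp: measure_pmf_in_subprob_algebra measure_pmf.emeasure_space_1[simplified]\<close>)

lemma integrable_pmf_bounded:
  fixes f :: "'b \<Rightarrow> 'c::{banach,second_countable_topology}"
  assumes "\<And>x. norm (f x) \<le> B" shows "integrable (measure_pmf M) f"
  by (rule measure_pmf.integrable_const_bound[where B=B]) (use assms in auto)

lemma expectation_bind_pmf_complex:
  fixes f :: "'b \<Rightarrow> complex"
  assumes B: "\<And>x. norm (f x) \<le> B"
  shows "measure_pmf.expectation (bind_pmf M N) f = measure_pmf.expectation M (\<lambda>x. measure_pmf.expectation (N x) f)"
proof -
  have i: "integrable (measure_pmf p) f" for p by (rule integrable_pmf_bounded[OF B])
  have "norm (measure_pmf.expectation (N x) f) \<le> B" for x
    by (rule order_trans[OF integral_norm_bound measure_pmf.integral_le_const])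
       (use B integrable_norm[OF i] in auto)
  then have i2: "integrable (measure_pmf M) (\<lambda>x. measure_pmf.expectation (N x) f)"
    by (rule integrable_pmf_bounded)
  have re: "\<bar>Re (f x)\<bar> \<le> B" and im: "\<bar>Im (f x)\<bar> \<le> B" for x
    using B[of x] abs_Re_le_cmod[of "f x"] abs_Im_le_cmod[of "f x"] by linarith+
  show ?thesis
  proof (rule complex_eqI)
    have "Re (measure_pmf.expectation (bind_pmf M N) f) = measure_pmf.expectation (bind_pmf M N) (\<lambda>x. Re (f x))"
      by (rule integral_Re[OF i, symmetric])
    also have "\<dots> = measure_pmf.expectation M (\<lambda>x. measure_pmf.expectation (N x) (\<lambda>y. Re (f y)))"
      by (rule expectation_bind_pmf_real[OF re])
    also have "\<dots> = measure_pmf.expectation M (\<lambda>x. Re (measure_pmf.expectation (N x) f))"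
      by (simp only: integral_Re[OF i])
    also have "\<dots> = Re (measure_pmf.expectation M (\<lambda>x. measure_pmf.expectation (N x) f))"
      by (rule integral_Re[OF i2])
    finally show "Re (measure_pmf.expectation (bind_pmf M N) f) = Re (measure_pmf.expectation M (\<lambda>x. measure_pmf.expectation (N x) f))" .
  next
    have "Im (measure_pmf.expectation (bind_pmf M N) f) = measure_pmf.expectation (bind_pmf M N) (\<lambda>x. Im (f x))"
      by (rule integral_Im[OF i, symmetric])
    also have "\<dots> = measure_pmf.expectation M (\<lambda>x. measure_pmf.expectation (N x) (\<lambda>y. Im (f y)))"
      by (rule expectation_bind_pmf_real[OF im])
    also have "\<dots> = measure_pmf.expectation M (\<lambda>x. Im (measure_pmf.expectation (N x) f))"
      by (simp only: integral_Im[OF i])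
    also have "\<dots> = Im (measure_pmf.expectation M (\<lambda>x. measure_pmf.expectation (N x) f))"
      by (rule integral_Im[OF i2])
    finally show "Im (measure_pmf.expectation (bind_pmf M N) f) = Im (measure_pmf.expectation M (\<lambda>x. measure_pmf.expectation (N x) f))" .
  qed
qed

lemma rvec_add: "rvec (x + y) = rvec x + rvec y"
  and rvec_diff: "rvec (x - y) = rvec x - rvec y"
  and rvec_0 [simp]: "rvec 0 = 0"
  and rvec_nth [simp]: "rvec x $ i = real_of_int (x $ i)"
  by (auto simp: rvec_def vec_eq_iff)

definition cf :: "(int ^ 'n) pmf \<Rightarrow> real ^ 'n \<Rightarrow> complex" where
  "cf \<theta> t = measure_pmf.expectation \<theta> (\<lambda>x. iexp (t \<bullet> rvec x))"

lemma integrable_iexp_pmf: "integrable (measure_pmf \<theta>) (\<lambda>x. iexp (f x))"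
  by (rule integrable_pmf_bounded[where B=1]) simp

lemma norm_cf_le: "norm (cf \<theta> t) \<le> 1"
  unfolding cf_def
  by (rule order_trans[OF integral_norm_bound]) simp

lemma iexp_add: "iexp (x + y) = iexp x * iexp y"
  by (simp add: exp_add[symmetric] algebra_simps)

lemma cf_walk: "cf (walk \<theta> n) t = cf \<theta> t ^ n"
proof (induction n)
  case 0 then show ?case by (simp add: cf_def)
next
  case (Suc n)
  have "cf (walk \<theta> (Suc n)) t = measure_pmf.expectation (walk \<theta> n) (\<lambda>s. measure_pmf.expectation \<theta> (\<lambda>x. iexp (t \<bullet> rvec (s + x))))"
    unfolding cf_def walk.simps
    by (subst expectation_bind_pmf_complex[where B=1]) simp_all
  also have "\<dots> = measure_pmf.expectation (walk \<theta> n) (\<lambda>s. iexp (t \<bullet> rvec s) * cf \<theta> t)"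
    unfolding rvec_add inner_add_right iexp_add cf_def by simp
  also have "\<dots> = cf (walk \<theta> n) t * cf \<theta> t" unfolding cf_def by simp
  finally show ?case using Suc by simp
qed

lemma measurable_pmf_pair_inner [measurable]:
  "(\<lambda>(y, t). t \<bullet> (rvec y - w)) \<in> borel_measurable (measure_pmf P \<Otimes>\<^sub>M lborel)"
proof -
  have [measurable]: "rvec \<in> measurable (measure_pmf P) borel" by simp
  show ?thesis by measurable
qed

lemma continuous_cf:
  fixes \<theta> :: "(int ^ 'n) pmf"
  shows "continuous_on UNIV (cf \<theta>)"
proof (rule continuous_on_sequentiallyI)
  fix u :: "nat \<Rightarrow> real ^ 'n" and a assume u: "u \<longlonglongrightarrow> a"
  show "(\<lambda>n. cf \<theta> (u n)) \<longlonglongrightarrow> cf \<theta> a"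
    unfolding cf_def
    by (rule integral_dominated_convergence[where w="\<lambda>_. 1"]) (auto intro!: tendsto_intros u)
qed

lemma borel_measurable_cf [measurable]: "cf \<theta> \<in> borel_measurable borel"
  by (rule borel_measurable_continuous_onI[OF continuous_cf])

definition torus :: "(real ^ 'n) set" where
  "torus = cbox (\<chi> i. - pi) (\<chi> i. pi)"

lemma mem_torus: "t \<in> torus \<longleftrightarrow> (\<forall>i. t $ i \<in> {-pi..pi})"
  by (auto simp: torus_def mem_box_cart)

lemma torus_sets [measurable]: "torus \<in> sets borel"
  by (simp add: torus_def)

lemma integral_iexp_int:
  fixes k :: int
  shows "integrable lborel (\<lambda>s. indicator {-pi..pi} s *\<^sub>R iexp (s * k))"
    and "(\<integral>s. indicator {-pi..pi} s *\<^sub>R iexp (s * k) \<partial>lborel) = (if k = 0 then 2 * pi else 0)"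
proof -
  have cont: "continuous_on {-pi..pi} (\<lambda>s. iexp (s * k))" by (intro continuous_intros)
  show "integrable lborel (\<lambda>s. indicator {-pi..pi} s *\<^sub>R iexp (s * k))"
    using borel_integrable_compact[OF _ cont] by auto
  show "(\<integral>s. indicator {-pi..pi} s *\<^sub>R iexp (s * k) \<partial>lborel) = (if k = 0 then 2 * pi else 0)"
  proof (cases "k = 0")
    case True
    have "(\<integral>s. indicator {-pi..pi} s *\<^sub>R (1::complex) \<partial>lborel) = 2 * pi"
      by (subst integral_scaleR_left) (auto simp: scaleR_conv_of_real)
    then show ?thesis using True by simp
  next
    case False
    have "(\<integral>s. indicator {-pi..pi} s *\<^sub>R iexp (s * k) \<partial>lborel) = iexp (pi * k) / (\<i> * k) - iexp (- pi * k) / (\<i> * k)"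
    proof (rule integral_FTC_Icc[OF _ _ cont])
      fix x :: real
      define c where "c = \<i> * complex_of_int k"
      have c: "c \<noteq> 0" using False by (simp add: c_def)
      have "((\<lambda>z. exp (c * z) / c) has_field_derivative exp (c * of_real x)) (at (of_real x))"
        using c by (auto intro!: derivative_eq_intros)
      from has_vector_derivative_real_field[OF this]
      have "((\<lambda>s. exp (c * complex_of_real s) / c) has_vector_derivative exp (c * of_real x)) (at x within {-pi..pi})"
        by (simp add: o_def)
      then show "((\<lambda>s. iexp (s * k) / (\<i> * k)) has_vector_derivative iexp (x * k)) (at x within {-pi..pi})"
        by (simp add: c_def mult_ac)
    qed simp
    also have "iexp (pi * k) = iexp (- pi * k)"
    proof -
      have a: "iexp (pi * k) = iexp (- pi * k) * exp (of_int k * (2 * of_real pi * \<i>))"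
        unfolding exp_add[symmetric] by (rule arg_cong[where f=exp]) (simp add: algebra_simps)
      have b: "exp (of_int k * (2 * of_real pi * \<i>)) = (1::complex)"
      proof -
        have "exp (complex_of_real (2 * real_of_int k * pi) * \<i>) = 1" by (rule exp_integer_2pi) simp
        then show ?thesis by (simp only: of_real_mult of_real_of_int_eq of_real_numeral mult_ac)
      qed
      show ?thesis using a unfolding b mult_1_right .
    qed
    finally show ?thesis using False by simp
  qed
qed

text \<open>The torus is a product, and one coordinate with \<open>m $ i \<noteq> 0\<close> makes the product vanish.\<close>

lemma integral_torus_iexp:
  fixes m :: "int ^ 'n"
  shows "(\<integral>t. indicator torus t *\<^sub>R iexp (t \<bullet> rvec m) \<partial>lborel) = (if m = 0 then (2 * pi) ^ CARD('n) else 0)"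
proof -
  have ind: "(indicator torus t :: real) = (\<Prod>i\<in>UNIV. indicator {-pi..pi} (t $ i))" for t :: "real^'n"
    by (auto simp: mem_torus indicator_def prod.neutral)
  have eq: "indicator torus t *\<^sub>R iexp (t \<bullet> rvec m) = (\<Prod>i\<in>UNIV. indicator {-pi..pi} (t $ i) *\<^sub>R iexp (t $ i * (m $ i)))" for t
    unfolding ind scaleR_conv_of_real of_real_prod prod.distrib prod_iexp[OF finite] inner_vec_sum rvec_nth ..
  have "(\<integral>t. indicator torus t *\<^sub>R iexp (t \<bullet> rvec m) \<partial>lborel) = (\<Prod>i\<in>UNIV. if m $ i = 0 then complex_of_real (2 * pi) else 0)"
    unfolding eq by (subst integral_prod_vec, rule integral_iexp_int(1)) (simp only: integral_iexp_int(2) if_distrib of_real_0)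
  also have "\<dots> = (if m = 0 then (2 * pi) ^ CARD('n) else 0)"
  proof (cases "m = 0")
    case False
    then obtain i where "m $ i \<noteq> 0" by (auto simp: vec_eq_iff)
    then have "(\<Prod>i\<in>UNIV. if m $ i = 0 then complex_of_real (2 * pi) else 0) = 0" by (intro prod_zero) auto
    then show ?thesis using False by simp
  qed simp
  finally show "(\<integral>t. indicator torus t *\<^sub>R iexp (t \<bullet> rvec m) \<partial>lborel) = (if m = 0 then (2 * pi) ^ CARD('n) else 0)" .
qed

text \<open>Fubini, and the orthogonality of the characters on the torus.\<close>

lemma fourier_inversion:
  fixes P :: "(int ^ 'n) pmf"
  shows "complex_of_real ((2 * pi) ^ CARD('n) * pmf P x)
    = (\<integral>t. indicator torus t *\<^sub>R (cf P t * iexp (- (t \<bullet> rvec x))) \<partial>lborel)"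
proof -
  interpret pair_sigma_finite "measure_pmf P" "lborel :: (real^'n) measure"
    by unfold_locales
  let ?f = "\<lambda>y t. indicator torus t *\<^sub>R iexp (t \<bullet> (rvec y - rvec x))"
  have meas: "(\<lambda>(y, t). ?f y t) \<in> borel_measurable (measure_pmf P \<Otimes>\<^sub>M lborel)"
  proof -
    define g where "g = (\<lambda>(y, t). t \<bullet> (rvec y - rvec x) :: real)"
    have [measurable]: "g \<in> borel_measurable (measure_pmf P \<Otimes>\<^sub>M lborel)"
      unfolding g_def by (rule measurable_pmf_pair_inner)
    have "(\<lambda>z. indicator torus (snd z) *\<^sub>R iexp (g z)) \<in> borel_measurable (measure_pmf P \<Otimes>\<^sub>M lborel)"
      by measurable
    then show ?thesis by (simp add: g_def case_prod_beta)
  qed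
  have fin: "emeasure lborel (torus :: (real^'n) set) < \<infinity>"
    unfolding torus_def by (rule emeasure_lborel_cbox_finite)
  have int: "integrable (measure_pmf P \<Otimes>\<^sub>M lborel) (\<lambda>(y, t). ?f y t)"
  proof (rule Bochner_Integration.integrable_bound[OF _ meas])
    have "emeasure (measure_pmf P \<Otimes>\<^sub>M lborel) (UNIV \<times> (torus :: (real^'n) set)) < \<infinity>"
      using fin by (subst lborel.emeasure_pair_measure_Times) (auto simp: measure_pmf.emeasure_space_1[simplified])
    then show "integrable (measure_pmf P \<Otimes>\<^sub>M lborel) (indicator (UNIV \<times> (torus :: (real^'n) set)) :: _ \<Rightarrow> real)"
      by (subst integrable_indicator_iff) (auto simp: space_pair_measure)
  qed (auto simp: indicator_def)
  have e: "rvec y - rvec x = rvec (y - x)" for y by (simp add: rvec_diff)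
  have "(\<integral>t. indicator torus t *\<^sub>R (cf P t * iexp (- (t \<bullet> rvec x))) \<partial>lborel) = (\<integral>t. (\<integral>y. ?f y t \<partial>measure_pmf P) \<partial>lborel)"
  proof (intro Bochner_Integration.integral_cong refl)
    fix t :: "real^'n"
    have "(\<integral>y. ?f y t \<partial>measure_pmf P) = (\<integral>y. indicator torus t *\<^sub>R (iexp (t \<bullet> rvec y) * iexp (- (t \<bullet> rvec x))) \<partial>measure_pmf P)"
    proof -
      have h: "t \<bullet> (rvec y - rvec x) = t \<bullet> rvec y + - (t \<bullet> rvec x)" for y by (simp add: inner_diff_right)
      show ?thesis unfolding h iexp_add ..
    qed
    also have "\<dots> = indicator torus t *\<^sub>R (cf P t * iexp (- (t \<bullet> rvec x)))"
      unfolding cf_def integral_scaleR_right integral_mult_left_zero ..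
    finally show "indicator torus t *\<^sub>R (cf P t * iexp (- (t \<bullet> rvec x))) = (\<integral>y. ?f y t \<partial>measure_pmf P)" ..
  qed
  also have "\<dots> = (\<integral>y. (\<integral>t. ?f y t \<partial>lborel) \<partial>measure_pmf P)"
    by (rule Fubini_integral[OF int])
  also have "\<dots> = (\<integral>y. complex_of_real ((2 * pi) ^ CARD('n) * indicator {x} y) \<partial>measure_pmf P)"
    unfolding e integral_torus_iexp by (intro Bochner_Integration.integral_cong refl) auto
  also have "\<dots> = complex_of_real ((2 * pi) ^ CARD('n) * pmf P x)"
    by (simp add: measure_pmf_single)
  finally show ?thesis ..
qed

section \<open>Centred generating walks\<close>

locale centred_walk =
  fixes \<theta> :: "(int ^ 'n) pmf"
  assumes dim: "CARD('n) \<ge> 5"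
    and moments: "\<And>p. p \<le> CARD('n) - 1 \<Longrightarrow> integrable (measure_pmf \<theta>) (\<lambda>x. norm (rvec x) ^ p)"
    and mean0: "mean_vec \<theta> = 0"
    and generating: "\<not> in_strict_subgroup \<theta>"
begin

abbreviation "Q \<equiv> covariance \<theta>"

lemma integrable_inner_power:
  assumes "p \<le> CARD('n) - 1"
  shows "integrable (measure_pmf \<theta>) (\<lambda>x. (t \<bullet> rvec x) ^ p)" "integrable (measure_pmf \<theta>) (\<lambda>x. \<bar>t \<bullet> rvec x\<bar> ^ p)"
proof -
  have i: "integrable (measure_pmf \<theta>) (\<lambda>x. norm t ^ p * norm (rvec x) ^ p)"
    by (intro integrable_mult_right moments assms)
  have "\<bar>t \<bullet> rvec x\<bar> ^ p \<le> norm t ^ p * norm (rvec x) ^ p" for x :: "int^'n"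
    unfolding power_mult_distrib[symmetric] by (intro power_mono Cauchy_Schwarz_ineq2) auto
  then show "integrable (measure_pmf \<theta>) (\<lambda>x. (t \<bullet> rvec x) ^ p)" "integrable (measure_pmf \<theta>) (\<lambda>x. \<bar>t \<bullet> rvec x\<bar> ^ p)"
    by (auto intro!: Bochner_Integration.integrable_bound[OF i] simp: power_abs)
qed

lemma integrable_rvec: "integrable (measure_pmf \<theta>) rvec"
proof -
  have "integrable (measure_pmf \<theta>) (\<lambda>x. norm (rvec x))" using moments[of 1] dim by simp
  then show ?thesis by (rule Bochner_Integration.integrable_bound) auto
qed

lemma mean_inner: "measure_pmf.expectation \<theta> (\<lambda>x. t \<bullet> rvec x) = 0"
proof -
  have "measure_pmf.expectation \<theta> (\<lambda>x. t \<bullet> rvec x) = t \<bullet> mean_vec \<theta>"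
    unfolding mean_vec_def by (rule integral_inner_right) (rule integrable_rvec)
  then show ?thesis unfolding mean0 by simp
qed

lemma quadratic_form: "t \<bullet> (Q *v t) = measure_pmf.expectation \<theta> (\<lambda>x. (t \<bullet> rvec x)\<^sup>2)"
proof -
  have i: "integrable (measure_pmf \<theta>) (\<lambda>x. real_of_int (x $ i) * real_of_int (x $ j))" for i j
  proof (rule Bochner_Integration.integrable_bound)
    show "integrable (measure_pmf \<theta>) (\<lambda>x. norm (rvec x) ^ 2)" using dim by (intro moments) auto
    have "norm (real_of_int (x $ i) * real_of_int (x $ j)) \<le> norm (norm (rvec x) ^ 2)" for x
      using mult_mono[OF component_le_norm_cart[of "rvec x" i] component_le_norm_cart[of "rvec x" j]]
      by (simp add: abs_mult power2_eq_square)
    then show "AE x in measure_pmf \<theta>. norm (real_of_int (x $ i) * real_of_int (x $ j)) \<le> norm (norm (rvec x) ^ 2)" by simp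
  qed simp
  have "(t \<bullet> rvec x)\<^sup>2 = (\<Sum>i\<in>UNIV. \<Sum>j\<in>UNIV. t $ i * t $ j * (real_of_int (x $ i) * real_of_int (x $ j)))" for x
    unfolding inner_vec_sum power2_eq_square sum_product rvec_nth by (simp add: mult_ac)
  then have "measure_pmf.expectation \<theta> (\<lambda>x. (t \<bullet> rvec x)\<^sup>2)
    = (\<Sum>i\<in>UNIV. \<Sum>j\<in>UNIV. t $ i * t $ j * measure_pmf.expectation \<theta> (\<lambda>x. real_of_int (x $ i) * real_of_int (x $ j)))"
    using i by simp
  also have "\<dots> = t \<bullet> (Q *v t)"
    unfolding inner_vec_sum matrix_vector_mult_def covariance_def mean0
    by (simp add: sum_distrib_left mult_ac)
  finally show ?thesis ..
qed

lemma sym_Q: "transpose Q = Q"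
proof -
  have "Q $ i $ j = Q $ j $ i" for i j
    unfolding covariance_def vec_lambda_beta by (rule Bochner_Integration.integral_cong) auto
  then show ?thesis by (simp add: transpose_def vec_eq_iff)
qed

text \<open>The form in which the assumption on subgroups is used: a condition that cuts out a subgroup and holds for the steps holds
  everywhere, in particular at the unit vectors.\<close>

lemma in_subgroup_UNIV:
  assumes "0 \<in> H" "\<And>x y. x \<in> H \<Longrightarrow> y \<in> H \<Longrightarrow> x - y \<in> H" "set_pmf \<theta> \<subseteq> H"
  shows "x \<in> H"
proof (rule ccontr)
  assume "x \<notin> H"
  then have "H \<noteq> UNIV" by auto
  then have "in_strict_subgroup \<theta>"
    unfolding in_strict_subgroup_def by (intro exI[of _ H] conjI ballI assms)
  then show False using generating by simp
qed

text \<open>The kernel of \<open>t\<close> is a subgroup, so \<open>t\<close> cannot vanish on all steps.\<close>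

lemma pos_Q:
  assumes "t \<noteq> 0" shows "t \<bullet> (Q *v t) > 0"
proof (rule ccontr)
  assume "\<not> ?thesis"
  then have "measure_pmf.expectation \<theta> (\<lambda>x. (t \<bullet> rvec x)\<^sup>2) \<le> 0" by (simp add: quadratic_form)
  moreover have "measure_pmf.expectation \<theta> (\<lambda>x. (t \<bullet> rvec x)\<^sup>2) \<ge> 0" by simp
  ultimately have "measure_pmf.expectation \<theta> (\<lambda>x. (t \<bullet> rvec x)\<^sup>2) = 0" by linarith
  then have "AE x in measure_pmf \<theta>. (t \<bullet> rvec x)\<^sup>2 = 0"
    using integrable_inner_power(1)[of 2 t] dim by (subst (asm) integral_nonneg_eq_0_iff_AE) auto
  then have sub: "set_pmf \<theta> \<subseteq> {x. t \<bullet> rvec x = 0}" by (auto simp: AE_measure_pmf_iff)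
  have "t $ i = 0" for i
  proof -
    have "axis i 1 \<in> {x. t \<bullet> rvec x = 0}"
      by (rule in_subgroup_UNIV) (use sub in \<open>auto simp: rvec_diff inner_diff_right\<close>)
    moreover have "rvec (axis i 1) = axis i 1" by (simp add: vec_eq_iff axis_def)
    ultimately show ?thesis by (simp add: inner_axis)
  qed
  then show False using assms by (simp add: vec_eq_iff)
qed

text \<open>Compactness of the sphere and homogeneity.\<close>

lemma form_lower_bound: "\<exists>l>0. \<forall>t. l * (norm t)\<^sup>2 \<le> t \<bullet> (Q *v t)"
proof -
  have "compact (sphere (0::real^'n) 1)" by simp
  moreover have "sphere (0::real^'n) 1 \<noteq> {}" by simp
  moreover have "continuous_on (sphere 0 1) (\<lambda>t. t \<bullet> (Q *v t))"
    by (intro continuous_intros linear_continuous_on_compose[OF continuous_on_id] matrix_vector_mul_linear)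
  ultimately obtain s where s: "s \<in> sphere 0 1" "\<And>t. t \<in> sphere 0 1 \<Longrightarrow> s \<bullet> (Q *v s) \<le> t \<bullet> (Q *v t)"
    by (blast dest: continuous_attains_inf)
  have "(s \<bullet> (Q *v s)) * (norm t)\<^sup>2 \<le> t \<bullet> (Q *v t)" for t
  proof (cases "t = 0")
    case False
    have "s \<bullet> (Q *v s) \<le> ((1 / norm t) *\<^sub>R t) \<bullet> (Q *v ((1 / norm t) *\<^sub>R t))"
      using False by (intro s) simp
    also have "\<dots> = (t \<bullet> (Q *v t)) / (norm t)\<^sup>2"
      by (simp add: matrix_vector_mult_scaleR power2_eq_square)
    finally show ?thesis using False by (simp add: field_simps)
  qed simp
  moreover have "s \<bullet> (Q *v s) > 0" using s by (intro pos_Q) auto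
  ultimately show ?thesis by blast
qed

text \<open>Third moments suffice for the expansion to second order; they exist because \<open>d - 1 \<ge> 3\<close>.\<close>

lemma cf_expansion: "\<exists>M\<ge>0. \<forall>t. norm (cf \<theta> t - complex_of_real (1 - (t \<bullet> (Q *v t)) / 2)) \<le> M * norm t ^ 3"
proof -
  define M where "M = measure_pmf.expectation \<theta> (\<lambda>x. norm (rvec x) ^ 3)"
  have M0: "M \<ge> 0" by (simp add: M_def)
  have "norm (cf \<theta> t - complex_of_real (1 - (t \<bullet> (Q *v t)) / 2)) \<le> M * norm t ^ 3" for t
  proof -
    let ?r = "\<lambda>x. iexp (t \<bullet> rvec x) - (1 + \<i> * complex_of_real (t \<bullet> rvec x) - complex_of_real ((t \<bullet> rvec x)\<^sup>2) / 2)"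
    have i1: "integrable (measure_pmf \<theta>) (\<lambda>x. complex_of_real (t \<bullet> rvec x))"
      using integrable_inner_power(1)[of 1 t] dim by (intro integrable_of_real) auto
    have i2: "integrable (measure_pmf \<theta>) (\<lambda>x. complex_of_real ((t \<bullet> rvec x)\<^sup>2))"
      using integrable_inner_power(1)[of 2 t] dim by (intro integrable_of_real) auto
    have m1: "(\<integral>x. complex_of_real (t \<bullet> rvec x) \<partial>measure_pmf \<theta>) = 0"
      by (subst integral_complex_of_real) (simp add: mean_inner)
    have m2: "(\<integral>x. complex_of_real ((t \<bullet> rvec x)\<^sup>2) \<partial>measure_pmf \<theta>) = complex_of_real (t \<bullet> (Q *v t))"
      by (subst integral_complex_of_real) (simp add: quadratic_form)
    have "cf \<theta> t - complex_of_real (1 - (t \<bullet> (Q *v t)) / 2) = (\<integral>x. ?r x \<partial>measure_pmf \<theta>)"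
      using i1 i2 integrable_iexp_pmf[of \<theta> "\<lambda>x. t \<bullet> rvec x"] m1 m2 by (simp add: cf_def del: of_real_power)
    also have "norm \<dots> \<le> (\<integral>x. norm (?r x) \<partial>measure_pmf \<theta>)" by (rule integral_norm_bound)
    also have "\<dots> \<le> (\<integral>x. norm t ^ 3 * norm (rvec x) ^ 3 \<partial>measure_pmf \<theta>)"
    proof (rule integral_mono)
      show "integrable (measure_pmf \<theta>) (\<lambda>x. norm (?r x))"
        using i1 i2 integrable_iexp_pmf[of \<theta> "\<lambda>x. t \<bullet> rvec x"]
        by (intro integrable_norm Bochner_Integration.integrable_diff Bochner_Integration.integrable_add integrable_mult_right integrable_divide_zero) auto
      show "integrable (measure_pmf \<theta>) (\<lambda>x. norm t ^ 3 * norm (rvec x) ^ 3)"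
        using dim by (intro integrable_mult_right moments) auto
      fix x
      have "norm (?r x) = norm (iexp (t \<bullet> rvec x) - (\<Sum>k\<le>2. (\<i> * complex_of_real (t \<bullet> rvec x)) ^ k / fact k))"
        by (rule arg_cong[where f=norm]) (simp add: numeral_2_eq_2 power_mult_distrib)
      also have "\<dots> \<le> \<bar>t \<bullet> rvec x\<bar> ^ Suc 2 / fact (Suc 2)" by (rule iexp_approx1)
      also have "\<dots> \<le> \<bar>t \<bullet> rvec x\<bar> ^ 3 / 1"
        by (intro frac_le) (auto simp: fact_numeral eval_nat_numeral)
      also have "\<dots> \<le> (norm t * norm (rvec x)) ^ 3"
        by (simp, intro power_mono Cauchy_Schwarz_ineq2)
      finally show "norm (?r x) \<le> norm t ^ 3 * norm (rvec x) ^ 3" by (simp add: power_mult_distrib)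
    qed
    also have "\<dots> = M * norm t ^ 3" by (simp add: M_def)
    finally show ?thesis .
  qed
  then show ?thesis using M0 by blast
qed

lemma Re_cf: "Re (cf \<theta> t) = measure_pmf.expectation \<theta> (\<lambda>x. cos (t \<bullet> rvec x))"
  unfolding cf_def by (subst integral_Re[OF integrable_iexp_pmf, symmetric]) (simp add: Re_exp)

text \<open>The value \<open>1\<close> forces the phase of every step to be a multiple of \<open>2 * pi\<close>. The vectors with such a phase form a subgroup,
  so the unit vectors are among them, and \<open>t = 0\<close> on the torus.\<close>

lemma Re_cf_less_1:
  assumes "t \<in> torus" "t \<noteq> 0" shows "Re (cf \<theta> t) < 1"
proof (rule ccontr)
  assume not: "\<not> ?thesis"
  have int: "integrable (measure_pmf \<theta>) (\<lambda>x. cos (t \<bullet> rvec x))"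
    by (rule integrable_pmf_bounded[where B=1]) simp
  have "measure_pmf.expectation \<theta> (\<lambda>x. 1 - cos (t \<bullet> rvec x)) \<le> 0"
    using not int by (simp add: Re_cf)
  moreover have "measure_pmf.expectation \<theta> (\<lambda>x. 1 - cos (t \<bullet> rvec x)) \<ge> 0" by simp
  ultimately have "measure_pmf.expectation \<theta> (\<lambda>x. 1 - cos (t \<bullet> rvec x)) = 0" by linarith
  then have "AE x in measure_pmf \<theta>. 1 - cos (t \<bullet> rvec x) = 0"
    using int by (subst (asm) integral_nonneg_eq_0_iff_AE) auto
  then have sub: "set_pmf \<theta> \<subseteq> {x. cos (t \<bullet> rvec x) = 1}" by (auto simp: AE_measure_pmf_iff)
  have "t $ i = 0" for i
  proof -
    have "axis i 1 \<in> {x. cos (t \<bullet> rvec x) = 1}"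
    proof (rule in_subgroup_UNIV)
      fix x y assume "x \<in> {x. cos (t \<bullet> rvec x) = 1}" "y \<in> {x. cos (t \<bullet> rvec x) = 1}"
      then have c: "cos (t \<bullet> rvec x) = 1" "cos (t \<bullet> rvec y) = 1" by auto
      then have "sin (t \<bullet> rvec x) = 0"
        by (metis cos_one_sin_zero)
      then show "x - y \<in> {x. cos (t \<bullet> rvec x) = 1}"
        using c by (simp add: rvec_diff inner_diff_right cos_diff)
    qed (use sub in auto)
    moreover have "rvec (axis i 1) = axis i 1" by (simp add: vec_eq_iff axis_def)
    ultimately have "cos (t $ i) = 1" by (simp add: inner_axis)
    then obtain k :: int where k: "t $ i = k * 2 * pi" by (auto simp: cos_one_2pi_int)
    have "\<bar>t $ i\<bar> \<le> pi" using assms(1) by (auto simp: mem_torus abs_le_iff) (smt (verit))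
    then have "\<bar>real_of_int k\<bar> * 2 \<le> 1" unfolding k by (simp add: abs_mult)
    then have "k = 0" by linarith
    then show ?thesis using k by simp
  qed
  then show False using assms by (simp add: vec_eq_iff)
qed

text \<open>Near the origin this is the expansion to second order; elsewhere it is compactness and the strict inequality. Only the real part
  can be bounded: for a periodic walk the modulus is \<open>1\<close> also away from the origin. This is why the lazy walk is used below.\<close>

lemma Re_cf_bound: "\<exists>c>0. \<forall>t\<in>torus. Re (cf \<theta> t) \<le> 1 - c * (norm t)\<^sup>2"
proof -
  obtain l where l: "l > 0" "\<And>t. l * (norm t)\<^sup>2 \<le> t \<bullet> (Q *v t)" using form_lower_bound by auto
  obtain M where M: "M \<ge> 0" "\<And>t. norm (cf \<theta> t - complex_of_real (1 - (t \<bullet> (Q *v t)) / 2)) \<le> M * norm t ^ 3"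
    using cf_expansion by auto
  define K where "K = M + 1"
  have K: "K > 0" "M \<le> K" using M(1) by (auto simp: K_def)
  \<comment> \<open>For \<open>norm t \<le> \<delta>\<close> the cubic error is at most half of the quadratic term.\<close>
  define \<delta> where "\<delta> = l / (4 * K)"
  have \<delta>: "\<delta> > 0" using l K by (simp add: \<delta>_def)
  have near: "Re (cf \<theta> t) \<le> 1 - l / 4 * (norm t)\<^sup>2" if "norm t \<le> \<delta>" for t
  proof -
    have "Re (cf \<theta> t) - (1 - (t \<bullet> (Q *v t)) / 2) = Re (cf \<theta> t - complex_of_real (1 - (t \<bullet> (Q *v t)) / 2))" by simp
    also have "\<dots> \<le> M * norm t ^ 3" using complex_Re_le_cmod M(2) by (rule order_trans)
    finally have "Re (cf \<theta> t) \<le> 1 - (t \<bullet> (Q *v t)) / 2 + M * norm t ^ 3" by simp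
    also have "\<dots> \<le> 1 - l / 2 * (norm t)\<^sup>2 + l / 4 * (norm t)\<^sup>2"
    proof -
      have "M * norm t \<le> K * \<delta>" using that M(1) K by (intro mult_mono) auto
      also have "\<dots> = l / 4" using K by (simp add: \<delta>_def)
      finally have "M * norm t * (norm t)\<^sup>2 \<le> l / 4 * (norm t)\<^sup>2" by (intro mult_right_mono) auto
      then show ?thesis using l(2)[of t] by (simp add: power3_eq_cube power2_eq_square mult_ac)
    qed
    finally show ?thesis by (simp add: field_simps)
  qed
  define S where "S = torus \<inter> {t::real^'n. \<delta> \<le> norm t}"
  have "\<exists>c'>0. \<forall>t\<in>S. Re (cf \<theta> t) \<le> 1 - c' * (norm t)\<^sup>2"
  proof (cases "S = {}")
    case False
    have "compact S"
      unfolding S_def torus_def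
      by (intro compact_Int_closed compact_cbox closed_Collect_le continuous_intros)
    moreover have "continuous_on S (\<lambda>t. Re (cf \<theta> t))"
      by (intro continuous_intros continuous_on_subset[OF continuous_cf]) auto
    ultimately obtain s where s: "s \<in> S" "\<And>t. t \<in> S \<Longrightarrow> Re (cf \<theta> t) \<le> Re (cf \<theta> s)"
      using False by (blast dest: continuous_attains_sup)
    have gap: "1 - Re (cf \<theta> s) > 0" 
    proof -
      have "s \<noteq> 0" "s \<in> torus" using s(1) \<delta> by (auto simp: S_def)
      then show ?thesis using Re_cf_less_1[of s] by simp
    qed
    have "bounded (torus :: (real^'n) set)" by (simp add: torus_def)
    then obtain D where D: "D > 0" "\<And>t::real^'n. t \<in> torus \<Longrightarrow> norm t \<le> D" by (auto simp: bounded_pos)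
    define c' where "c' = (1 - Re (cf \<theta> s)) / D\<^sup>2"
    have "Re (cf \<theta> t) \<le> 1 - c' * (norm t)\<^sup>2" if "t \<in> S" for t
    proof -
      have "c' * (norm t)\<^sup>2 \<le> c' * D\<^sup>2"
        using D gap that by (intro mult_left_mono power_mono) (auto simp: S_def c'_def)
      also have "\<dots> = 1 - Re (cf \<theta> s)" using D by (simp add: c'_def)
      finally show ?thesis using s(2)[OF that] by simp
    qed
    moreover have "c' > 0" using gap D by (simp add: c'_def)
    ultimately show ?thesis by blast
  qed (auto intro: exI[of _ 1])
  then obtain c' where c': "c' > 0" "\<And>t. t \<in> S \<Longrightarrow> Re (cf \<theta> t) \<le> 1 - c' * (norm t)\<^sup>2" by auto
  have "Re (cf \<theta> t) \<le> 1 - min (l / 4) c' * (norm t)\<^sup>2" if "t \<in> torus" for t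
  proof (cases "norm t \<le> \<delta>")
    case True
    have "min (l / 4) c' * (norm t)\<^sup>2 \<le> l / 4 * (norm t)\<^sup>2" by (intro mult_right_mono) auto
    then show ?thesis using near[OF True] by linarith
  next
    case False
    have "min (l / 4) c' * (norm t)\<^sup>2 \<le> c' * (norm t)\<^sup>2" by (intro mult_right_mono) auto
    then show ?thesis using c'(2)[of t] that False by (simp add: S_def)
  qed
  then show ?thesis using l c' by (intro exI[of _ "min (l / 4) c'"]) auto
qed

end

section \<open>The local limit theorem\<close>

lemma integral_lborel_scaleR:
  fixes f :: "real^'n \<Rightarrow> 'b::{banach,second_countable_topology}"
  assumes k: "k > 0" and f: "f \<in> borel_measurable borel"
  shows "integral\<^sup>L lborel f = k ^ CARD('n) *\<^sub>R (\<integral>u. f (k *\<^sub>R u) \<partial>lborel)"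
proof -
  have v: "mat k *v u = k *\<^sub>R u" for u :: "real^'n"
    by (simp add: vec_eq_iff matrix_vector_mult_def mat_def if_distrib[of "\<lambda>x. x * _"] cong: if_cong)
  have d: "det (mat k :: real^'n^'n) = k ^ CARD('n)"
    by (subst det_diagonal) (auto simp: mat_def)
  show ?thesis
    using integral_lborel_linear[of "mat k" f] k f by (simp add: v d)
qed

lemma integrable_exp_square:
  assumes c: "c > 0" shows "integrable lborel (\<lambda>s::real. exp (- c * s\<^sup>2))"
proof -
  have "exp (- c * s\<^sup>2) = sqrt (pi / c) * normal_density 0 (1 / sqrt (2 * c)) s" for s
    using c by (simp add: normal_density_def real_sqrt_divide power_divide)
  then show ?thesis
    using c by (simp only:) (intro integrable_mult_right integrable_normal_density, auto)
qed

lemma power2_norm_vec: "(norm (u::real^'n))\<^sup>2 = (\<Sum>i\<in>UNIV. (u $ i)\<^sup>2)"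
  by (simp add: norm_vec_def L2_set_def sum_nonneg)

lemma integrable_exp_norm_square:
  assumes c: "c > 0" shows "integrable lborel (\<lambda>u::real^'n. exp (- c * (norm u)\<^sup>2))"
proof -
  have "exp (- c * (norm u)\<^sup>2) = (\<Prod>i\<in>UNIV. exp (- c * (u $ i)\<^sup>2))" for u :: "real^'n"
    by (simp add: power2_norm_vec exp_sum[symmetric] sum_distrib_left)
  then show ?thesis
    by (simp only:) (intro integrable_prod_vec integrable_exp_square c)
qed

text \<open>The properties of the characteristic function from which the local limit theorem follows. \<open>R\<close> is the covariance matrix and
  \<open>A\<close> an orthonormal frame for it.\<close>

locale char_decay =
  fixes P :: "(int ^ 'n) pmf" and R A :: "real ^ 'n ^ 'n" and c M :: real
  assumes c: "c > 0"
    and decay: "\<And>t. t \<in> torus \<Longrightarrow> norm (cf P t) \<le> exp (- c * (norm t)\<^sup>2)"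
    and expansion: "\<And>t. norm (cf P t - complex_of_real (1 - (t \<bullet> (R *v t)) / 2)) \<le> M * norm t ^ 3"
    and form_lower: "\<And>t. c * (norm t)\<^sup>2 \<le> (t \<bullet> (R *v t)) / 2"
    and det_A: "det A \<noteq> 0"
    and form_A: "\<And>s. (A *v s) \<bullet> (R *v (A *v s)) = s \<bullet> s"
begin

definition gauss_peak :: real where
  "gauss_peak = \<bar>det A\<bar> / sqrt (2 * pi) ^ CARD('n)"

definition gauss :: "real ^ 'n \<Rightarrow> real" where
  "gauss y = gauss_peak * exp (- (norm (transpose A *v y))\<^sup>2 / 2)"

text \<open>The substitution \<open>u = A *v s\<close> turns the form \<open>R\<close> into the Euclidean one.\<close>

lemma integral_form_exp:
  "(\<integral>u. complex_of_real (exp (- (u \<bullet> (R *v u)) / 2)) * iexp (u \<bullet> y) \<partial>lborel) = (2 * pi) ^ CARD('n) * gauss y"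
proof -
  have m: "(\<lambda>u. complex_of_real (exp (- (u \<bullet> (R *v u)) / 2)) * iexp (u \<bullet> y)) \<in> borel_measurable borel"
    by measurable
  have e: "(A *v s) \<bullet> y = s \<bullet> (transpose A *v y)" for s
    by (simp add: dot_lmul_matrix[symmetric] inner_commute)
  have "(\<integral>u. complex_of_real (exp (- (u \<bullet> (R *v u)) / 2)) * iexp (u \<bullet> y) \<partial>lborel)
     = \<bar>det A\<bar> *\<^sub>R (\<integral>s. complex_of_real (exp (- (s \<bullet> s) / 2)) * iexp (s \<bullet> (transpose A *v y)) \<partial>lborel)"
    by (subst integral_lborel_linear[OF det_A m]) (simp only: form_A e)
  also have "\<dots> = complex_of_real (\<bar>det A\<bar> * (sqrt (2 * pi) ^ CARD('n) * exp (- (norm (transpose A *v y))\<^sup>2 / 2)))"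
    unfolding integral_gaussian_vec power2_norm_eq_inner by (simp add: scaleR_conv_of_real)
  also have "\<bar>det A\<bar> * (sqrt (2 * pi) ^ CARD('n) * exp (- (norm (transpose A *v y))\<^sup>2 / 2)) = (2 * pi) ^ CARD('n) * gauss y"
  proof -
    have "(2 * pi) ^ CARD('n) = sqrt (2 * pi) ^ CARD('n) * sqrt (2 * pi) ^ CARD('n)"
      unfolding power_mult_distrib[symmetric] by simp
    then show ?thesis by (simp add: gauss_def gauss_peak_def)
  qed
  finally show ?thesis .
qed

text \<open>The integrand of the inversion formula for \<open>n\<close> steps on the scale \<open>1 / sqrt n\<close>, without the phase of the end point.\<close>

definition rescaled :: "nat \<Rightarrow> real ^ 'n \<Rightarrow> complex" where
  "rescaled n u = indicator torus ((1 / sqrt n) *\<^sub>R u) *\<^sub>R (cf P ((1 / sqrt n) *\<^sub>R u) ^ n)"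

lemma rescaled_measurable [measurable]: "rescaled n \<in> borel_measurable borel"
proof -
  have "(\<lambda>u. indicator torus ((1 / sqrt n) *\<^sub>R u) *\<^sub>R (cf P ((1 / sqrt n) *\<^sub>R u) ^ n)) \<in> borel_measurable borel"
    by measurable
  then show ?thesis by (simp only: rescaled_def[abs_def])
qed

lemma norm_rescaled: "n > 0 \<Longrightarrow> norm (rescaled n u) \<le> exp (- c * (norm u)\<^sup>2)"
proof -
  assume n: "n > 0"
  show ?thesis
  proof (cases "(1 / sqrt n) *\<^sub>R u \<in> torus")
    case True
    have "norm (rescaled n u) = norm (cf P ((1 / sqrt n) *\<^sub>R u)) ^ n"
      using True by (simp add: rescaled_def norm_power)
    also have "\<dots> \<le> exp (- c * (norm ((1 / sqrt n) *\<^sub>R u))\<^sup>2) ^ n"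
      by (intro power_mono decay True) auto
    also have "\<dots> = exp (- c * (norm u)\<^sup>2)"
      using n by (simp add: exp_of_nat_mult[symmetric] power_mult_distrib power_divide)
    finally show ?thesis .
  qed (simp add: rescaled_def)
qed

lemma pmf_walk_rescaled:
  assumes n: "n > 0"
  shows "complex_of_real ((2 * pi) ^ CARD('n) * (sqrt n ^ CARD('n) * pmf (walk P n) x))
     = (\<integral>u. rescaled n u * iexp (u \<bullet> (- (1 / sqrt n) *\<^sub>R rvec x)) \<partial>lborel)"
proof -
  let ?k = "1 / sqrt n"
  have k: "?k > 0" using n by simp
  have e: "iexp (- ((?k *\<^sub>R u) \<bullet> rvec x)) = iexp (u \<bullet> (- ?k *\<^sub>R rvec x))" for u
    by simp
  have "complex_of_real ((2 * pi) ^ CARD('n) * pmf (walk P n) x)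
      = (\<integral>t. indicator torus t *\<^sub>R (cf P t ^ n * iexp (- (t \<bullet> rvec x))) \<partial>lborel)"
    unfolding fourier_inversion cf_walk ..
  also have "\<dots> = ?k ^ CARD('n) *\<^sub>R (\<integral>u. indicator torus (?k *\<^sub>R u) *\<^sub>R (cf P (?k *\<^sub>R u) ^ n * iexp (- ((?k *\<^sub>R u) \<bullet> rvec x))) \<partial>lborel)"
    by (rule integral_lborel_scaleR[OF k]) measurable
  also have "(\<integral>u. indicator torus (?k *\<^sub>R u) *\<^sub>R (cf P (?k *\<^sub>R u) ^ n * iexp (- ((?k *\<^sub>R u) \<bullet> rvec x))) \<partial>lborel)
     = (\<integral>u. rescaled n u * iexp (u \<bullet> (- ?k *\<^sub>R rvec x)) \<partial>lborel)"
    unfolding e rescaled_def by (simp only: mult_scaleR_left)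
  finally have *: "complex_of_real ((2 * pi) ^ CARD('n) * pmf (walk P n) x)
    = ?k ^ CARD('n) *\<^sub>R (\<integral>u. rescaled n u * iexp (u \<bullet> (- ?k *\<^sub>R rvec x)) \<partial>lborel)" .
  have "complex_of_real ((2 * pi) ^ CARD('n) * (sqrt n ^ CARD('n) * pmf (walk P n) x))
     = (sqrt n ^ CARD('n)) *\<^sub>R complex_of_real ((2 * pi) ^ CARD('n) * pmf (walk P n) x)"
    by (simp add: scaleR_conv_of_real mult_ac)
  also have "\<dots> = (sqrt n ^ CARD('n) * ?k ^ CARD('n)) *\<^sub>R (\<integral>u. rescaled n u * iexp (u \<bullet> (- ?k *\<^sub>R rvec x)) \<partial>lborel)"
    unfolding * by simp
  also have "sqrt n ^ CARD('n) * ?k ^ CARD('n) = 1"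
    unfolding power_mult_distrib[symmetric] using n by simp
  finally show ?thesis by simp
qed

lemma integrable_dominating: "integrable lborel (\<lambda>u::real^'n. exp (- c * (norm u)\<^sup>2))"
  by (rule integrable_exp_norm_square[OF c])

lemma integrable_rescaled: "n > 0 \<Longrightarrow> integrable lborel (\<lambda>u. rescaled n u * iexp (u \<bullet> y))"
  by (rule Bochner_Integration.integrable_bound[OF integrable_dominating]) (use norm_rescaled[of n] in \<open>auto simp: norm_mult\<close>)

lemma integrable_form_exp: "integrable lborel (\<lambda>u. complex_of_real (exp (- (u \<bullet> (R *v u)) / 2)) * iexp (u \<bullet> y))"
  by (rule Bochner_Integration.integrable_bound[OF integrable_dominating])
     (use form_lower in \<open>auto simp: norm_mult\<close>)

lemma pmf_walk_le_powr: "\<exists>C>0. \<forall>n x. pmf (walk P n) x \<le> C * real (Suc n) powr (- real CARD('n) / 2)"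
proof -
  let ?d = "real CARD('n)"
  define I where "I = (\<integral>u. exp (- c * (norm (u::real^'n))\<^sup>2) \<partial>lborel)"
  have I0: "I \<ge> 0" by (simp add: I_def)
  \<comment> \<open>The factor \<open>2 powr (d / 2)\<close> passes from \<open>n\<close> to \<open>Suc n\<close>, and \<open>n = 0\<close> needs \<open>C \<ge> 1\<close>.\<close>
  define C where "C = (I + 1) * 2 powr (?d / 2)"
  have one: "1 \<le> 2 powr (?d / 2)" by (rule ge_one_powr_ge_zero) auto
  have "pmf (walk P n) x \<le> C * real (Suc n) powr (- ?d / 2)" for n x
  proof (cases "n = 0")
    case True
    have "1 * 1 \<le> C" unfolding C_def using one I0 by (intro mult_mono) auto
    moreover have "C * real (Suc n) powr (- ?d / 2) = C" using True by simp
    ultimately show ?thesis using pmf_le_1[of "walk P n" x] by linarith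
  next
    case False
    then have n: "n > 0" by simp
    have "(2 * pi) ^ CARD('n) * (sqrt n ^ CARD('n) * pmf (walk P n) x)
       = norm (complex_of_real ((2 * pi) ^ CARD('n) * (sqrt n ^ CARD('n) * pmf (walk P n) x)))"
      by (simp add: norm_mult norm_power)
    also have "\<dots> \<le> (\<integral>u. norm (rescaled n u * iexp (u \<bullet> (- (1 / sqrt n) *\<^sub>R rvec x))) \<partial>lborel)"
      unfolding pmf_walk_rescaled[OF n] by (rule integral_norm_bound)
    also have "\<dots> \<le> I"
      unfolding I_def
      by (intro integral_mono integrable_norm integrable_rescaled n integrable_dominating)
         (use norm_rescaled[OF n] in \<open>simp add: norm_mult\<close>)
    finally have a: "(2 * pi) ^ CARD('n) * (sqrt n ^ CARD('n) * pmf (walk P n) x) \<le> I" .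
    have pi1: "(1::real) \<le> 2 * pi" using pi_gt3 by linarith
    have "1 * (sqrt n ^ CARD('n) * pmf (walk P n) x) \<le> (2 * pi) ^ CARD('n) * (sqrt n ^ CARD('n) * pmf (walk P n) x)"
      by (intro mult_right_mono one_le_power pi1) auto
    with a have "sqrt n ^ CARD('n) * pmf (walk P n) x \<le> I" by linarith
    moreover have s: "sqrt n ^ CARD('n) = real n powr (?d / 2)"
    proof -
      have "sqrt n ^ CARD('n) = sqrt n powr ?d" using n by (simp add: powr_realpow)
      also have "\<dots> = (real n powr (1 / 2)) powr ?d" by (simp add: powr_half_sqrt)
      finally show ?thesis by (simp add: powr_powr)
    qed
    ultimately have "pmf (walk P n) x \<le> I * real n powr (- ?d / 2)"
      using n by (simp add: powr_minus field_simps)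
    also have "\<dots> \<le> (I + 1) * (2 powr (?d / 2) * real (Suc n) powr (- ?d / 2))"
    proof (intro mult_mono)
      have "(2 * real n) powr (?d / 2) \<ge> real (Suc n) powr (?d / 2)"
        using n by (intro powr_mono2) auto
      then show "real n powr (- ?d / 2) \<le> 2 powr (?d / 2) * real (Suc n) powr (- ?d / 2)"
        using n by (simp add: powr_mult powr_minus field_simps)
    qed (use I0 in auto)
    finally show ?thesis by (simp add: C_def mult_ac)
  qed
  moreover have "C > 0" using I0 by (simp add: C_def)
  ultimately show ?thesis by blast
qed

text \<open>The powers of \<open>cf\<close> are compared with those of its expansion by \<open>\<bar>z ^ n - w ^ n\<bar> \<le> n * \<bar>z - w\<bar>\<close> in the unit disc, and
  the error is \<open>n\<close> times the third power of \<open>1 / sqrt n\<close>.\<close>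

lemma rescaled_tendsto: "(\<lambda>n. rescaled n u) \<longlonglongrightarrow> complex_of_real (exp (- (u \<bullet> (R *v u)) / 2))"
proof -
  define q where "q = u \<bullet> (R *v u)"
  have q0: "q \<ge> 0" using form_lower[of u] c by (simp add: q_def) (smt (verit) mult_nonneg_nonneg zero_le_power2)
  have lim0: "(\<lambda>n. 1 / sqrt (real n)) \<longlonglongrightarrow> 0"
    by (intro tendsto_divide_0[OF tendsto_const] filterlim_at_top_imp_at_infinity filterlim_compose[OF sqrt_at_top] filterlim_real_sequentially)
  have torus: "eventually (\<lambda>n. (1 / sqrt (real n)) *\<^sub>R u \<in> torus) sequentially"
  proof -
    have "(\<lambda>n. (1 / sqrt (real n)) *\<^sub>R u) \<longlonglongrightarrow> 0 *\<^sub>R u" by (intro tendsto_intros lim0)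
    then have "eventually (\<lambda>n. dist ((1 / sqrt (real n)) *\<^sub>R u) (0 *\<^sub>R u) < pi) sequentially"
      by (rule tendstoD) simp
    then show ?thesis
    proof eventually_elim
      case (elim n)
      then have "norm ((1 / sqrt (real n)) *\<^sub>R u) < pi" by simp
      then have "\<bar>((1 / sqrt (real n)) *\<^sub>R u) $ i\<bar> \<le> pi" for i
        by (metis component_le_norm_cart less_eq_real_def order_trans)
      then show ?case unfolding mem_torus by (auto simp: abs_le_iff simp del: vector_scaleR_component) (smt (verit))+
    qed
  qed
  have form: "((1 / sqrt (real n)) *\<^sub>R u) \<bullet> (R *v ((1 / sqrt (real n)) *\<^sub>R u)) = q / real n" for n
    by (simp add: q_def matrix_vector_mult_scaleR)
  have small: "eventually (\<lambda>n. q / 2 / real n \<le> 1) sequentially"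
  proof -
    have "(\<lambda>n. q / 2 / real n) \<longlonglongrightarrow> 0"
      by (intro tendsto_divide_0[OF tendsto_const] filterlim_at_top_imp_at_infinity filterlim_real_sequentially)
    then have "eventually (\<lambda>n. q / 2 / real n < 1) sequentially" by (rule order_tendstoD) simp
    then show ?thesis by eventually_elim simp
  qed
  have diff: "(\<lambda>n. rescaled n u - complex_of_real ((1 + (- q / 2) / real n) ^ n)) \<longlonglongrightarrow> 0"
  proof (rule Lim_null_comparison)
    show "(\<lambda>n. \<bar>M\<bar> * norm u ^ 3 * (1 / sqrt (real n))) \<longlonglongrightarrow> 0"
      using tendsto_mult_right_zero[OF lim0] by simp
    show "eventually (\<lambda>n. norm (rescaled n u - complex_of_real ((1 + (- q / 2) / real n) ^ n)) \<le> \<bar>M\<bar> * norm u ^ 3 * (1 / sqrt (real n))) sequentially"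
      using torus small eventually_gt_at_top[of 0]
    proof eventually_elim
      case (elim n)
      let ?t = "(1 / sqrt (real n)) *\<^sub>R u"
      let ?z = "1 + (- q / 2) / real n"
      have z: "norm (complex_of_real ?z) \<le> 1"
        unfolding norm_of_real using elim q0 by (auto simp: abs_le_iff divide_nonneg_nonneg)
      have "norm (rescaled n u - complex_of_real (?z ^ n)) = norm (cf P ?t ^ n - complex_of_real ?z ^ n)"
        using elim by (simp add: rescaled_def)
      also have "\<dots> \<le> real n * norm (cf P ?t - complex_of_real ?z)"
        by (rule norm_power_diff[OF norm_cf_le z])
      also have "\<dots> \<le> real n * (M * norm ?t ^ 3)"
      proof (rule mult_left_mono)
        have zform: "?z = 1 - (?t \<bullet> (R *v ?t)) / 2" unfolding form by simp
        show "norm (cf P ?t - complex_of_real ?z) \<le> M * norm ?t ^ 3"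
          unfolding zform by (rule expansion)
      qed simp
      also have "\<dots> \<le> real n * (\<bar>M\<bar> * norm ?t ^ 3)"
        by (intro mult_left_mono mult_right_mono) auto
      also have "\<dots> = \<bar>M\<bar> * norm u ^ 3 * (1 / sqrt (real n))"
      proof -
        have "real n * (1 / sqrt (real n)) ^ 3 = 1 / sqrt (real n)"
          using elim by (simp add: power3_eq_cube field_simps)
        moreover have "norm ?t ^ 3 = norm u ^ 3 * (1 / sqrt (real n)) ^ 3" by (simp add: power_divide)
        moreover have "real n * (\<bar>M\<bar> * (norm u ^ 3 * (1 / sqrt (real n)) ^ 3)) = \<bar>M\<bar> * norm u ^ 3 * (real n * (1 / sqrt (real n)) ^ 3)"
          by (simp only: mult_ac)
        ultimately show ?thesis by (simp only:)
      qed
      finally show ?case .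
    qed
  qed
  have "(\<lambda>n. complex_of_real ((1 + (- q / 2) / real n) ^ n)) \<longlonglongrightarrow> complex_of_real (exp (- q / 2))"
    by (intro tendsto_of_real tendsto_exp_limit_sequentially)
  from tendsto_add[OF diff this] show ?thesis unfolding q_def diff_add_cancel add_0 .
qed

text \<open>The end point enters the inversion integral only by a phase, so the error is bounded uniformly in \<open>x\<close> by an \<open>L1\<close> distance,
  and this tends to \<open>0\<close> by dominated convergence.\<close>

theorem local_limit:
  "\<exists>e. e \<longlonglongrightarrow> 0 \<and> (\<forall>n>0. \<forall>x. \<bar>sqrt n ^ CARD('n) * pmf (walk P n) x - gauss ((1 / sqrt n) *\<^sub>R rvec x)\<bar> \<le> e n)"
proof -
  let ?g = "\<lambda>u. complex_of_real (exp (- (u \<bullet> (R *v u)) / 2))"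
  define e where "e n = (\<integral>u. norm (rescaled n u - ?g u) \<partial>lborel)" for n
  have lim: "e \<longlonglongrightarrow> 0"
  proof -
    have "(\<lambda>n. \<integral>u. norm (rescaled (Suc n) u - ?g u) \<partial>lborel) \<longlonglongrightarrow> (\<integral>u. 0 \<partial>(lborel :: (real^'n) measure))"
    proof (rule integral_dominated_convergence[where w="\<lambda>u. 2 * exp (- c * (norm u)\<^sup>2)"])
      show "integrable lborel (\<lambda>u::real^'n. 2 * exp (- c * (norm u)\<^sup>2))" using integrable_dominating by simp
      show "AE u in lborel. (\<lambda>n. norm (rescaled (Suc n) u - ?g u)) \<longlonglongrightarrow> 0"
        by (intro AE_I2 tendsto_norm_zero LIM_zero LIMSEQ_Suc[OF rescaled_tendsto])
      show "AE u in lborel. norm (norm (rescaled (Suc n) u - ?g u)) \<le> 2 * exp (- c * (norm u)\<^sup>2)" for n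
      proof (intro AE_I2)
        fix u
        have "norm (rescaled (Suc n) u - ?g u) \<le> norm (rescaled (Suc n) u) + norm (?g u)" by (rule norm_triangle_ineq4)
        also have "\<dots> \<le> exp (- c * (norm u)\<^sup>2) + exp (- c * (norm u)\<^sup>2)"
          using form_lower[of u] by (intro add_mono norm_rescaled) auto
        finally show "norm (norm (rescaled (Suc n) u - ?g u)) \<le> 2 * exp (- c * (norm u)\<^sup>2)" by simp
      qed
    qed measurable
    then have "(\<lambda>n. e (Suc n)) \<longlonglongrightarrow> 0" by (simp only: e_def Bochner_Integration.integral_zero)
    then show ?thesis by (rule LIMSEQ_imp_Suc)
  qed
  have "\<bar>sqrt n ^ CARD('n) * pmf (walk P n) x - gauss ((1 / sqrt n) *\<^sub>R rvec x)\<bar> \<le> e n" if n: "n > 0" for n x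
  proof -
    let ?y = "- (1 / sqrt n) *\<^sub>R rvec x"
    have gy: "gauss ?y = gauss ((1 / sqrt n) *\<^sub>R rvec x)"
      unfolding gauss_def matrix_vector_mult_scaleR norm_scaleR by simp
    let ?w = "sqrt n ^ CARD('n) * pmf (walk P n) x"
    have eq: "complex_of_real ((2 * pi) ^ CARD('n) * (?w - gauss ?y)) = (\<integral>u. (rescaled n u - ?g u) * iexp (u \<bullet> ?y) \<partial>lborel)"
    proof -
      have "(\<integral>u. (rescaled n u - ?g u) * iexp (u \<bullet> ?y) \<partial>lborel) = (\<integral>u. rescaled n u * iexp (u \<bullet> ?y) \<partial>lborel) - (\<integral>u. ?g u * iexp (u \<bullet> ?y) \<partial>lborel)"
        unfolding left_diff_distrib by (rule Bochner_Integration.integral_diff[OF integrable_rescaled[OF n] integrable_form_exp])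
      then show ?thesis
        unfolding pmf_walk_rescaled[OF n, symmetric] integral_form_exp by (simp only: right_diff_distrib of_real_diff)
    qed
    have "(2 * pi) ^ CARD('n) * \<bar>?w - gauss ?y\<bar> = norm (complex_of_real ((2 * pi) ^ CARD('n) * (?w - gauss ?y)))"
      unfolding norm_of_real abs_mult by simp
    also have "\<dots> \<le> (\<integral>u. norm ((rescaled n u - ?g u) * iexp (u \<bullet> ?y)) \<partial>lborel)"
      unfolding eq by (rule integral_norm_bound)
    also have "\<dots> = e n" by (simp add: e_def norm_mult)
    finally have a: "(2 * pi) ^ CARD('n) * \<bar>?w - gauss ?y\<bar> \<le> e n" .
    have pi1: "(1::real) \<le> 2 * pi" using pi_gt3 by linarith
    have "1 * \<bar>?w - gauss ?y\<bar> \<le> (2 * pi) ^ CARD('n) * \<bar>?w - gauss ?y\<bar>"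
      by (intro mult_right_mono one_le_power pi1) auto
    then show ?thesis using a gy by simp
  qed
  then show ?thesis using lim by blast
qed

end

section \<open>Green functions and the lazy walk\<close>

lemma powr_neg_half: "k > 0 \<Longrightarrow> k powr (- real d / 2) = 1 / sqrt k ^ d"
proof -
  assume k: "k > 0"
  have "sqrt k ^ d = sqrt k powr real d" using k by (simp add: powr_realpow)
  also have "\<dots> = (k powr (1 / 2)) powr real d" using k by (simp add: powr_half_sqrt)
  also have "\<dots> = k powr (real d / 2)" by (simp add: powr_powr)
  finally show ?thesis using k by (simp add: powr_minus_divide)
qed

text \<open>Markov's inequality for a moment of order \<open>q\<close> of the largest coordinate.\<close>

lemma walk_tail:
  fixes P :: "(int ^ 'n) pmf"
  assumes q: "q \<ge> 2"
    and int: "\<And>p i. p \<le> q \<Longrightarrow> integrable (measure_pmf P) (\<lambda>x. \<bar>real_of_int (x $ i)\<bar> ^ p)"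
    and mean: "\<And>i. measure_pmf.expectation P (\<lambda>x. real_of_int (x $ i)) = 0"
  shows "\<exists>C\<ge>0. \<forall>n. \<forall>r>0. emeasure (walk P n) {x. r \<le> norm (rvec x)} \<le> ennreal (C * sqrt n ^ q / r ^ q)"
proof -
  have "\<exists>C\<ge>0. \<forall>n. (\<integral>\<^sup>+s. ennreal (\<bar>real_of_int (s $ i)\<bar> ^ q) \<partial>walk P n) \<le> ennreal (C * sqrt (real n) ^ q)" for i
    by (rule walk_moment[where q=q]) (auto intro: int mean q)
  then obtain C where C: "\<And>i. C i \<ge> 0"
    "\<And>i n. (\<integral>\<^sup>+s. ennreal (\<bar>real_of_int (s $ i)\<bar> ^ q) \<partial>walk P n) \<le> ennreal (C i * sqrt (real n) ^ q)"
    by metis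
  define d where "d = real CARD('n)"
  have d: "d > 0" by (simp add: d_def)
  define D where "D = d ^ q * (\<Sum>i\<in>UNIV. C i)"
  have "emeasure (walk P n) {x. r \<le> norm (rvec x)} \<le> ennreal (D * sqrt n ^ q / r ^ q)" if r: "r > 0" for n r
  proof -
    have pt: "indicator {x. r \<le> norm (rvec x)} x \<le> (\<Sum>i\<in>UNIV. ennreal ((d / r) ^ q) * ennreal (\<bar>real_of_int (x $ i)\<bar> ^ q))" for x :: "int^'n"
    proof (cases "r \<le> norm (rvec x)")
      case True
      have "\<exists>i. r / d \<le> \<bar>real_of_int (x $ i)\<bar>"
      proof (rule ccontr)
        assume "\<not> ?thesis"
        then have "(\<Sum>i\<in>UNIV. \<bar>rvec x $ i\<bar>) < (\<Sum>i\<in>(UNIV::'n set). r / d)"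
          by (intro sum_strict_mono) (auto simp: not_le)
        also have "\<dots> = r" using d by (simp add: d_def)
        finally show False using norm_le_l1_cart[of "rvec x"] True by simp
      qed
      then obtain i where i: "r / d \<le> \<bar>real_of_int (x $ i)\<bar>" by auto
      then have "1 \<le> (d / r) * \<bar>real_of_int (x $ i)\<bar>" using d r by (simp add: field_simps)
      then have "1 \<le> (d / r) ^ q * \<bar>real_of_int (x $ i)\<bar> ^ q"
        unfolding power_mult_distrib[symmetric] by (rule one_le_power)
      then have "1 \<le> ennreal ((d / r) ^ q) * ennreal (\<bar>real_of_int (x $ i)\<bar> ^ q)"
        using d r by (simp add: ennreal_mult[symmetric] ennreal_leI flip: ennreal_1)
      also have "\<dots> \<le> (\<Sum>i\<in>UNIV. ennreal ((d / r) ^ q) * ennreal (\<bar>real_of_int (x $ i)\<bar> ^ q))"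
        by (rule member_le_sum) auto
      finally show ?thesis using True by simp
    qed simp
    have "emeasure (walk P n) {x. r \<le> norm (rvec x)} = (\<integral>\<^sup>+x. indicator {x. r \<le> norm (rvec x)} x \<partial>walk P n)"
      by simp
    also have "\<dots> \<le> (\<integral>\<^sup>+x. (\<Sum>i\<in>UNIV. ennreal ((d / r) ^ q) * ennreal (\<bar>real_of_int (x $ i)\<bar> ^ q)) \<partial>walk P n)"
      by (intro nn_integral_mono pt)
    also have "\<dots> = (\<Sum>i\<in>UNIV. ennreal ((d / r) ^ q) * (\<integral>\<^sup>+x. ennreal (\<bar>real_of_int (x $ i)\<bar> ^ q) \<partial>walk P n))"
      by (simp add: nn_integral_sum nn_integral_cmult)
    also have "\<dots> \<le> (\<Sum>i\<in>UNIV. ennreal ((d / r) ^ q) * ennreal (C i * sqrt (real n) ^ q))"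
      by (intro sum_mono mult_left_mono C) auto
    also have "\<dots> = (\<Sum>i\<in>UNIV. ennreal ((d / r) ^ q * (C i * sqrt (real n) ^ q)))"
      using d r C(1) by (intro sum.cong refl) (simp add: ennreal_mult[symmetric])
    also have "\<dots> = ennreal (\<Sum>i\<in>UNIV. (d / r) ^ q * (C i * sqrt (real n) ^ q))"
      using d r C(1) by (intro sum_ennreal) auto
    also have "(\<Sum>i\<in>UNIV. (d / r) ^ q * (C i * sqrt (real n) ^ q)) = D * sqrt n ^ q / r ^ q"
      by (simp add: D_def power_divide sum_distrib_left sum_distrib_right sum_divide_distrib mult_ac)
    finally show ?thesis .
  qed
  moreover have "D \<ge> 0" using d C(1) by (simp add: D_def sum_nonneg)
  ultimately show ?thesis by blast
qed

text \<open>Staying put half of the time removes periodicity and doubles the Green function.\<close>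

definition lazy :: "'a::comm_monoid_add pmf \<Rightarrow> 'a pmf" where
  "lazy \<theta> = bind_pmf (bernoulli_pmf (1 / 2)) (\<lambda>b. if b then \<theta> else return_pmf 0)"

lemma ennreal_inverse_2: "inverse 2 = ennreal (1 / 2)"
  by simp

lemma enn2real_inverse_2: "enn2real (inverse 2) = 1 / 2"
  unfolding ennreal_inverse_2 by (rule enn2real_ennreal) simp

lemma inverse_2_less_top: "inverse 2 < (\<top> :: ennreal)"
  unfolding ennreal_inverse_2 by (rule ennreal_less_top)

lemma ennreal_inverse_2_mult: "r \<ge> 0 \<Longrightarrow> inverse 2 * ennreal r = ennreal (r / 2)"
proof -
  assume r: "r \<ge> 0"
  have "ennreal (1 / 2) * ennreal r = ennreal (1 / 2 * r)" by (rule ennreal_mult[symmetric]) (use r in auto)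
  then show ?thesis unfolding ennreal_inverse_2 by (simp only: times_divide_eq_left mult_1)
qed

lemma ennreal_2_inverse_2: "2 * inverse 2 = (1 :: ennreal)"
proof -
  have "2 * inverse 2 = ennreal 2 * ennreal (1 / 2)" by (simp only: ennreal_inverse_2 ennreal_numeral)
  also have "\<dots> = ennreal (2 * (1 / 2))" by (rule ennreal_mult[symmetric]) auto
  finally show ?thesis by simp
qed

lemma nn_integral_lazy: "(\<integral>\<^sup>+x. f x \<partial>lazy \<theta>) = inverse 2 * (\<integral>\<^sup>+x. f x \<partial>\<theta>) + inverse 2 * f 0"
  unfolding lazy_def nn_integral_bind_pmf
  by (subst nn_integral_bernoulli_pmf) (auto simp: mult.commute)

lemma integrable_lazy:
  fixes f :: "'a::comm_monoid_add \<Rightarrow> real"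
  assumes "integrable (measure_pmf \<theta>) f" shows "integrable (measure_pmf (lazy \<theta>)) f"
  using assms unfolding integrable_iff_bounded
  by (auto simp: nn_integral_lazy ennreal_mult_less_top inverse_2_less_top)

lemma expectation_lazy:
  fixes f :: "'a::comm_monoid_add \<Rightarrow> real"
  assumes "integrable (measure_pmf \<theta>) f" "f 0 = 0"
  shows "measure_pmf.expectation (lazy \<theta>) f = measure_pmf.expectation \<theta> f / 2"
  unfolding real_lebesgue_integral_def[OF integrable_lazy[OF assms(1)]] real_lebesgue_integral_def[OF assms(1)] nn_integral_lazy
  using assms(2) by (simp add: enn2real_mult enn2real_inverse_2)

lemma cf_lazy: "cf (lazy \<theta>) t = (1 + cf \<theta> t) / 2"
  unfolding cf_def lazy_def
  by (subst expectation_bind_pmf_complex[where B=1], simp)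
     (subst integral_measure_pmf[of UNIV], auto simp: UNIV_bool scaleR_conv_of_real field_simps)

definition green :: "'a::comm_monoid_add pmf \<Rightarrow> 'a \<Rightarrow> ennreal" where
  "green \<theta> x = (\<Sum>n. ennreal (pmf (walk \<theta> n) x))"

lemma walk_1: "walk \<theta> (Suc 0) = \<theta>"
proof -
  have "(\<lambda>x::'a. 0 + x) = (\<lambda>x. x)" by (simp add: fun_eq_iff)
  then show ?thesis by (simp only: walk.simps bind_return_pmf map_pmf_ident)
qed

lemma pmf_walk_Suc:
  fixes \<theta> :: "'a::ab_group_add pmf"
  shows "ennreal (pmf (walk \<theta> (Suc n)) x) = (\<integral>\<^sup>+y. ennreal (pmf (walk \<theta> n) (x - y)) \<partial>\<theta>)"
  using pmf_walk_add[of \<theta> "Suc 0" n x] unfolding walk_1 by simp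

lemma green_first_step:
  fixes \<theta> :: "'a::ab_group_add pmf"
  shows "green \<theta> x = indicator {0} x + (\<integral>\<^sup>+y. green \<theta> (x - y) \<partial>\<theta>)"
proof -
  have "green \<theta> x = ennreal (pmf (walk \<theta> 0) x) + (\<Sum>n. ennreal (pmf (walk \<theta> (Suc n)) x))"
    unfolding green_def by (subst suminf_offset[of _ 1]) (auto simp del: walk.simps(2))
  also have "(\<Sum>n. ennreal (pmf (walk \<theta> (Suc n)) x)) = (\<integral>\<^sup>+y. green \<theta> (x - y) \<partial>\<theta>)"
    unfolding pmf_walk_Suc green_def by (subst nn_integral_suminf) auto
  also have "ennreal (pmf (walk \<theta> 0) x) = indicator {0} x"
    by (auto simp: indicator_def)
  finally show ?thesis .
qed

lemma partial_green_Suc: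
  fixes \<theta> :: "'a::ab_group_add pmf"
  shows "(\<Sum>k<Suc n. ennreal (pmf (walk \<theta> k) x)) = indicator {0} x + (\<integral>\<^sup>+y. (\<Sum>k<n. ennreal (pmf (walk \<theta> k) (x - y))) \<partial>\<theta>)"
proof -
  have "(\<Sum>k<Suc n. ennreal (pmf (walk \<theta> k) x)) = ennreal (pmf (walk \<theta> 0) x) + (\<Sum>k<n. ennreal (pmf (walk \<theta> (Suc k)) x))"
    by (rule sum.lessThan_Suc_shift)
  also have "(\<Sum>k<n. ennreal (pmf (walk \<theta> (Suc k)) x)) = (\<integral>\<^sup>+y. (\<Sum>k<n. ennreal (pmf (walk \<theta> k) (x - y))) \<partial>\<theta>)"
    unfolding pmf_walk_Suc by (simp add: nn_integral_sum del: sum_ennreal)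
  also have "ennreal (pmf (walk \<theta> 0) x) = indicator {0} x"
    by (auto simp: indicator_def)
  finally show ?thesis .
qed

lemma ennreal_half_cancel:
  fixes a b :: ennreal
  assumes a: "a < \<infinity>" shows "a \<le> b + inverse 2 * a \<Longrightarrow> a \<le> 2 * b" and "b + inverse 2 * a \<le> a \<Longrightarrow> 2 * b \<le> a"
proof -
  obtain r where r: "a = ennreal r" "r \<ge> 0" using a by (cases a) auto
  { assume h: "a \<le> b + inverse 2 * a"
    show "a \<le> 2 * b"
    proof (cases b)
      case (real s)
      have "ennreal r \<le> ennreal s + ennreal (r / 2)"
        using h unfolding real r(1) ennreal_inverse_2_mult[OF r(2)] .
      also have "\<dots> = ennreal (s + r / 2)" using real r by (intro ennreal_plus[symmetric]) auto
      finally have "r \<le> 2 * s" using r real by (subst (asm) ennreal_le_iff) auto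
      then have "ennreal r \<le> ennreal (2 * s)" by (rule ennreal_leI)
      also have "\<dots> = 2 * ennreal s" using real by (subst ennreal_mult) auto
      finally show ?thesis unfolding real r(1) .
    qed (simp add: ennreal_mult_top) }
  { assume h: "b + inverse 2 * a \<le> a"
    have "b \<le> b + inverse 2 * a" by simp
    then have "b \<le> a" using h by (rule order_trans)
    then obtain s where s: "b = ennreal s" "s \<ge> 0" using a by (cases b) (auto simp: top_unique)
    have "ennreal (s + r / 2) = ennreal s + ennreal (r / 2)" using s r by (intro ennreal_plus) auto
    also have "\<dots> \<le> ennreal r"
      using h unfolding s(1) r(1) ennreal_inverse_2_mult[OF r(2)] .
    finally have "2 * s \<le> r" using r by (subst (asm) ennreal_le_iff) auto
    then have "ennreal (2 * s) \<le> ennreal r" by (rule ennreal_leI)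
    moreover have "ennreal (2 * s) = 2 * ennreal s" using s by (subst ennreal_mult) auto
    ultimately show "2 * b \<le> a" unfolding s(1) r(1) by simp }
qed

text \<open>Both Green functions solve a first step equation, that of \<open>lazy \<theta>\<close> being
  \<open>G x = indicator {0} x + (G x + P G x) / 2\<close>. Solving for \<open>G\<close> requires cancellation of \<open>G x / 2\<close>, hence the finiteness
  assumption; the two inequalities are proved for partial sums.\<close>

lemma green_lazy:
  fixes \<theta> :: "'a::ab_group_add pmf"
  assumes fin: "\<And>x. green (lazy \<theta>) x < \<infinity>"
  shows "green (lazy \<theta>) x = 2 * green \<theta> x"
proof (rule antisym)
  let ?L = "\<lambda>n x. (\<Sum>k<n. ennreal (pmf (walk (lazy \<theta>) k) x))"
  let ?S = "\<lambda>n x. (\<Sum>k<n. ennreal (pmf (walk \<theta> k) x))"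
  have Lfin: "?L n x < \<infinity>" for n x by (subst sum_ennreal) auto
  have LS: "?L n x \<le> 2 * ?S n x" for n x
  proof (induction n arbitrary: x)
    case (Suc n)
    have "?L (Suc n) x = indicator {0} x + (inverse 2 * (\<integral>\<^sup>+y. ?L n (x - y) \<partial>\<theta>) + inverse 2 * ?L n x)"
      unfolding partial_green_Suc nn_integral_lazy by simp
    also have "\<dots> \<le> indicator {0} x + (inverse 2 * (\<integral>\<^sup>+y. ?L n (x - y) \<partial>\<theta>) + inverse 2 * ?L (Suc n) x)"
      by (intro add_left_mono mult_left_mono) auto
    finally have "?L (Suc n) x \<le> (indicator {0} x + inverse 2 * (\<integral>\<^sup>+y. ?L n (x - y) \<partial>\<theta>)) + inverse 2 * ?L (Suc n) x"
      by (simp only: add.assoc)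
    from ennreal_half_cancel(1)[OF Lfin this]
    have "?L (Suc n) x \<le> 2 * indicator {0} x + (2 * inverse 2) * (\<integral>\<^sup>+y. ?L n (x - y) \<partial>\<theta>)"
      by (simp only: distrib_left mult.assoc)
    also have "\<dots> = 2 * indicator {0} x + 1 * (\<integral>\<^sup>+y. ?L n (x - y) \<partial>\<theta>)"
      unfolding ennreal_2_inverse_2 ..
    also have "\<dots> \<le> 2 * indicator {0} x + 1 * (\<integral>\<^sup>+y. 2 * ?S n (x - y) \<partial>\<theta>)"
      by (intro add_left_mono mult_left_mono nn_integral_mono Suc.IH) auto
    also have "\<dots> = 2 * (indicator {0} x + (\<integral>\<^sup>+y. ?S n (x - y) \<partial>\<theta>))"
      by (simp add: nn_integral_cmult distrib_left)
    also have "\<dots> = 2 * ?S (Suc n) x" unfolding partial_green_Suc ..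
    finally show ?case .
  qed simp
  show "green (lazy \<theta>) x \<le> 2 * green \<theta> x"
    unfolding green_def suminf_eq_SUP
  proof (rule SUP_least)
    fix n :: nat
    have "2 * ?S n x \<le> 2 * (SUP n. ?S n x)" by (intro mult_left_mono SUP_upper) auto
    from LS this show "?L n x \<le> 2 * (SUP n. ?S n x)" by (rule order_trans)
  qed
  have step: "2 * (indicator {0} x + inverse 2 * (\<integral>\<^sup>+y. green (lazy \<theta>) (x - y) \<partial>\<theta>)) \<le> green (lazy \<theta>) x" for x
  proof (rule ennreal_half_cancel(2)[OF fin])
    have "green (lazy \<theta>) x = indicator {0} x + (inverse 2 * (\<integral>\<^sup>+y. green (lazy \<theta>) (x - y) \<partial>\<theta>) + inverse 2 * green (lazy \<theta>) x)"
      by (subst green_first_step) (simp add: nn_integral_lazy)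
    then show "indicator {0} x + inverse 2 * (\<integral>\<^sup>+y. green (lazy \<theta>) (x - y) \<partial>\<theta>) + inverse 2 * green (lazy \<theta>) x \<le> green (lazy \<theta>) x"
      by (simp only: add.assoc order_refl)
  qed
  have SG: "2 * ?S n x \<le> green (lazy \<theta>) x" for n x
  proof (induction n arbitrary: x)
    case (Suc n)
    have "2 * ?S (Suc n) x = 2 * indicator {0} x + (\<integral>\<^sup>+y. 2 * ?S n (x - y) \<partial>\<theta>)"
      unfolding partial_green_Suc by (simp add: nn_integral_cmult distrib_left)
    also have "\<dots> \<le> 2 * indicator {0} x + (2 * inverse 2) * (\<integral>\<^sup>+y. green (lazy \<theta>) (x - y) \<partial>\<theta>)"
      unfolding ennreal_2_inverse_2 mult_1 by (intro add_left_mono nn_integral_mono Suc.IH)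
    also have "\<dots> \<le> green (lazy \<theta>) x" using step[of x] by (simp only: distrib_left mult.assoc)
    finally show ?case .
  qed simp
  have "2 * green \<theta> x = (SUP n. 2 * ?S n x)"
    unfolding green_def suminf_eq_SUP by (rule SUP_mult_left_ennreal)
  also have "\<dots> \<le> green (lazy \<theta>) x" by (rule SUP_least) (rule SG)
  finally show "2 * green \<theta> x \<le> green (lazy \<theta>) x" .
qed

context centred_walk
begin

lemma coordinate_moments:
  assumes "p \<le> CARD('n) - 1" shows "integrable (measure_pmf \<theta>) (\<lambda>x. \<bar>real_of_int (x $ i)\<bar> ^ p)"
  using integrable_inner_power(2)[OF assms, of "axis i 1"] by (simp add: inner_axis')

lemma coordinate_mean: "measure_pmf.expectation \<theta> (\<lambda>x. real_of_int (x $ i)) = 0"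
  using mean_inner[of "axis i 1"] by (simp add: inner_axis')

lemma coordinate_integrable: "integrable (measure_pmf \<theta>) (\<lambda>x. real_of_int (x $ i))"
  using integrable_inner_power(1)[of 1 "axis i 1"] dim by (simp add: inner_axis')

lemma centred_walk_tail: "\<exists>C\<ge>0. \<forall>n. \<forall>r>0. emeasure (walk \<theta> n) {x. r \<le> norm (rvec x)} \<le> ennreal (C * sqrt n ^ (CARD('n) - 1) / r ^ (CARD('n) - 1))"
  by (rule walk_tail) (use dim coordinate_moments coordinate_mean in auto)

lemma lazy_tail: "\<exists>C\<ge>0. \<forall>n. \<forall>r>0. emeasure (walk (lazy \<theta>) n) {x. r \<le> norm (rvec x)} \<le> ennreal (C * sqrt n ^ (CARD('n) - 1) / r ^ (CARD('n) - 1))"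
  by (rule walk_tail)
     (use dim coordinate_moments coordinate_mean coordinate_integrable in \<open>auto intro!: integrable_lazy simp: expectation_lazy\<close>)

end

section \<open>Transition probabilities of the lazy walk\<close>

context centred_walk
begin

text \<open>An orthonormal frame of the covariance form. It makes the Gaussian of the local limit theorem rotationally symmetric, and turns
  the norm of the theorem into \<open>radius\<close>.\<close>

definition frame :: "real ^ 'n ^ 'n" where
  "frame = (SOME B. transpose B ** Q ** B = mat 1)"

lemma frame: "transpose frame ** Q ** frame = mat 1"
proof -
  have "\<exists>B :: real^'n^'n. transpose B ** Q ** B = mat 1"
  proof (rule posdef_orthonormal_matrix[OF sym_Q pos_Q])
    fix B :: "real^'n^'n" assume "transpose B ** Q ** B = mat 1"
    then show ?thesis by (rule exI)
  qed
  then show ?thesis unfolding frame_def by (rule someI_ex)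
qed

definition radius :: "int ^ 'n \<Rightarrow> real" where
  "radius x = norm (transpose frame *v rvec x)"

lemma det_frame: "(det frame)\<^sup>2 * det Q = 1"
  by (rule orthonormal_matrix_det[OF frame])

lemma det_frame_nonzero: "det frame \<noteq> 0"
proof
  assume "det frame = 0"
  then show False using det_frame by simp
qed

lemma radius_form: "radius x = sqrt (rvec x \<bullet> (matrix_inv Q *v rvec x))"
  unfolding radius_def orthonormal_matrix_inv[OF frame] norm_eq_sqrt_inner matrix_vector_mul_assoc[symmetric]
  by (simp only: transpose_matrix_vector dot_lmul_matrix)

lemma mat_mult_vec: "mat k *v u = k *\<^sub>R (u :: real^'n)"
  by (simp add: vec_eq_iff matrix_vector_mult_def mat_def if_distrib[of "\<lambda>x. x * _"] cong: if_cong)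

lemma det_mat: "det (mat k :: real^'n^'n) = k ^ CARD('n)"
  by (subst det_diagonal) (auto simp: mat_def)

text \<open>Laziness halves the covariance form, so the frame has to be scaled by \<open>sqrt 2\<close>. The modulus of \<open>(1 + z) / 2\<close> is
  controlled by the real part of \<open>z\<close>.\<close>

lemma lazy_char_decay: "\<exists>c M. char_decay (lazy \<theta>) ((1/2) *\<^sub>R Q) (mat (sqrt 2) ** frame) c M"
proof -
  obtain c0 where c0: "c0 > 0" "\<And>t. t \<in> torus \<Longrightarrow> Re (cf \<theta> t) \<le> 1 - c0 * (norm t)\<^sup>2" using Re_cf_bound by auto
  obtain l where l: "l > 0" "\<And>t. l * (norm t)\<^sup>2 \<le> t \<bullet> (Q *v t)" using form_lower_bound by auto
  obtain M where M: "M \<ge> 0" "\<And>t. norm (cf \<theta> t - complex_of_real (1 - (t \<bullet> (Q *v t)) / 2)) \<le> M * norm t ^ 3"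
    using cf_expansion by auto
  have halfQ: "((1/2) *\<^sub>R Q) *v t = (1/2) *\<^sub>R (Q *v t)" for t
    by (simp add: scaleR_matrix_vector_assoc)
  define c where "c = min (c0 / 4) (l / 4)"
  have cle: "c \<le> c0 / 4" "c \<le> l / 4" "c > 0" using c0 l by (auto simp: c_def)
  have "char_decay (lazy \<theta>) ((1/2) *\<^sub>R Q) (mat (sqrt 2) ** frame) c (M / 2)"
  proof
    show "c > 0" by fact
    show "norm (cf (lazy \<theta>) t) \<le> exp (- c * (norm t)\<^sup>2)" if t: "t \<in> torus" for t
    proof -
      let ?z = "cf \<theta> t"
      have z1: "(norm ?z)\<^sup>2 \<le> 1" using norm_cf_le[of \<theta> t] by (simp add: power_le_one)
      have "(norm (cf (lazy \<theta>) t))\<^sup>2 = ((1 + Re ?z)\<^sup>2 + (Im ?z)\<^sup>2) / 4"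
        unfolding cf_lazy norm_divide power_divide by (simp add: cmod_power2)
      also have "\<dots> = (1 + 2 * Re ?z + (norm ?z)\<^sup>2) / 4" by (simp add: cmod_power2 power2_sum)
      also have "\<dots> \<le> 1 - c0 / 2 * (norm t)\<^sup>2" using z1 c0(2)[OF t] by simp
      also have "\<dots> \<le> exp (- (c0 / 2 * (norm t)\<^sup>2))" using exp_ge_add_one_self[of "- (c0 / 2 * (norm t)\<^sup>2)"] by simp
      also have "\<dots> \<le> exp (- (2 * c * (norm t)\<^sup>2))"
      proof -
        have "2 * c * (norm t)\<^sup>2 \<le> c0 / 2 * (norm t)\<^sup>2" using cle by (intro mult_right_mono) auto
        then show ?thesis by simp
      qed
      also have "\<dots> = (exp (- c * (norm t)\<^sup>2))\<^sup>2" by (simp add: exp_double[symmetric])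
      finally show ?thesis by (rule power2_le_imp_le) simp
    qed
    show "norm (cf (lazy \<theta>) t - complex_of_real (1 - (t \<bullet> (((1/2) *\<^sub>R Q) *v t)) / 2)) \<le> M / 2 * norm t ^ 3" for t
    proof -
      have eq: "cf (lazy \<theta>) t - complex_of_real (1 - (t \<bullet> (((1/2) *\<^sub>R Q) *v t)) / 2) = (cf \<theta> t - complex_of_real (1 - (t \<bullet> (Q *v t)) / 2)) / 2"
        unfolding cf_lazy halfQ by (simp add: field_simps)
      show ?thesis unfolding eq norm_divide using M(2)[of t] by simp
    qed
    show "c * (norm t)\<^sup>2 \<le> (t \<bullet> (((1/2) *\<^sub>R Q) *v t)) / 2" for t
    proof -
      have "c * (norm t)\<^sup>2 \<le> l / 4 * (norm t)\<^sup>2" using cle by (intro mult_right_mono) auto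
      then show ?thesis unfolding halfQ using l(2)[of t] by simp
    qed
    show "det (mat (sqrt 2) ** frame) \<noteq> 0" by (simp add: det_mul det_mat det_frame_nonzero)
    show "((mat (sqrt 2) ** frame) *v s) \<bullet> (((1/2) *\<^sub>R Q) *v ((mat (sqrt 2) ** frame) *v s)) = s \<bullet> s" for s
      unfolding halfQ matrix_vector_mul_assoc[symmetric] mat_mult_vec
      by (simp add: matrix_vector_mult_scaleR orthonormal_matrix_form[OF frame])
  qed
  then show ?thesis by blast
qed

text \<open>The density at \<open>0\<close> of the Gaussian law with covariance \<open>Q / 2\<close>.\<close>

definition kappa :: real where "kappa = \<bar>det frame\<bar> / sqrt pi ^ CARD('n)"

abbreviation p :: "nat \<Rightarrow> int ^ 'n \<Rightarrow> real" where "p n x \<equiv> pmf (walk (lazy \<theta>) n) x"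

lemma lazy_local_limit:
  "\<exists>e. e \<longlonglongrightarrow> 0 \<and> (\<forall>n>0. \<forall>x. \<bar>sqrt n ^ CARD('n) * p n x - kappa * exp (- ((radius x)\<^sup>2 / n))\<bar> \<le> e n)"
proof -
  obtain c M where "char_decay (lazy \<theta>) ((1/2) *\<^sub>R Q) (mat (sqrt 2) ** frame) c M" using lazy_char_decay by blast
  then interpret char_decay "lazy \<theta>" "(1/2) *\<^sub>R Q" "mat (sqrt 2) ** frame" c M .
  have d0: "gauss_peak = kappa"
    by (simp add: gauss_peak_def kappa_def det_mul det_mat abs_mult real_sqrt_mult power_mult_distrib)
  have tr: "transpose (mat (sqrt 2) ** frame) *v y = sqrt 2 *\<^sub>R (transpose frame *v y)" for y
    by (simp add: matrix_transpose_mul transpose_mat matrix_vector_mul_assoc[symmetric] mat_mult_vec matrix_vector_mult_scaleR del: transpose_matrix_vector)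
  have "gauss ((1 / sqrt n) *\<^sub>R rvec x) = kappa * exp (- ((radius x)\<^sup>2 / n))" for n :: nat and x
    unfolding gauss_def d0 tr radius_def matrix_vector_mult_scaleR norm_scaleR
    by (simp add: power_mult_distrib power_divide)
  then show ?thesis using local_limit by simp
qed

lemma lazy_sup_bound: "\<exists>C>0. \<forall>n x. p n x \<le> C / sqrt (Suc n) ^ CARD('n)"
proof -
  obtain c M where "char_decay (lazy \<theta>) ((1/2) *\<^sub>R Q) (mat (sqrt 2) ** frame) c M" using lazy_char_decay by blast
  then interpret char_decay "lazy \<theta>" "(1/2) *\<^sub>R Q" "mat (sqrt 2) ** frame" c M .
  have h: "real (Suc n) powr (- real CARD('n) / 2) = 1 / sqrt (Suc n) ^ CARD('n)" for n
    by (rule powr_neg_half) simp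
  show ?thesis using pmf_walk_le_powr unfolding h by (simp only: times_divide_eq_right mult_1_right)
qed

text \<open>Splitting at half time: one of the halves covers half of the distance, at a price given by the moments of order \<open>d - 1\<close>, and
  the other half costs a factor \<open>n\<close> to the power \<open>- d / 2\<close>. The bound makes small times negligible in the Green function.\<close>

lemma lazy_small_time_bound:
  "\<exists>C\<ge>0. \<forall>n>0. \<forall>x. x \<noteq> 0 \<longrightarrow> p n x \<le> C / (sqrt n * norm (rvec x) ^ (CARD('n) - 1))"
proof -
  let ?q = "CARD('n) - 1"
  obtain C1 where C1: "C1 > 0" "\<And>n x. p n x \<le> C1 / sqrt (Suc n) ^ CARD('n)" using lazy_sup_bound by auto
  obtain C2 where C2: "C2 \<ge> 0"
    "\<And>n r. r > 0 \<Longrightarrow> emeasure (walk (lazy \<theta>) n) {x. r \<le> norm (rvec x)} \<le> ennreal (C2 * sqrt n ^ ?q / r ^ ?q)"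
    using lazy_tail by blast
  define C where "C = 2 * C1 * sqrt 2 ^ CARD('n) * C2 * 2 ^ ?q"
  have "p n x \<le> C / (sqrt n * norm (rvec x) ^ ?q)" if n: "n > 0" and x: "x \<noteq> 0" for n x
  proof -
    \<comment> \<open>Both halves have at least half of the time, up to a step, and at most all of it.\<close>
    define m where "m = n div 2"
    define l where "l = n - m"
    have nml: "n = m + l" and ml: "real n / 2 \<le> real (Suc m)" "real n / 2 \<le> real (Suc l)" "m \<le> n" "l \<le> n"
      by (auto simp: m_def l_def)
    have rx: "norm (rvec x) > 0" using x by (auto simp: vec_eq_iff)
    define r where "r = norm (rvec x) / 2"
    have r: "r > 0" using rx by (simp add: r_def)
    define U where "U = C1 * sqrt 2 ^ CARD('n) / sqrt n ^ CARD('n)"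
    define T where "T = C2 * sqrt n ^ ?q / r ^ ?q"
    have U0: "U \<ge> 0" and T0: "T \<ge> 0" using C1 C2 r by (auto simp: U_def T_def)
    have sup: "p k y \<le> U" if "real n / 2 \<le> real (Suc k)" for k y
    proof -
      have "p k y \<le> C1 / sqrt (Suc k) ^ CARD('n)" by (rule C1)
      also have "\<dots> \<le> C1 / sqrt (real n / 2) ^ CARD('n)"
        using that n C1(1) by (intro divide_left_mono power_mono mult_pos_pos zero_less_power) auto
      also have "\<dots> = U" by (simp add: U_def real_sqrt_divide power_divide)
      finally show ?thesis .
    qed
    have tail: "emeasure (walk (lazy \<theta>) k) {x. r \<le> norm (rvec x)} \<le> ennreal T" if "k \<le> n" for k
    proof (rule order_trans[OF C2(2)[OF r] ennreal_leI])
      show "C2 * sqrt (real k) ^ ?q / r ^ ?q \<le> T"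
        unfolding T_def using that C2(1) r by (intro divide_right_mono mult_left_mono power_mono) auto
    qed
    let ?B = "{x. r \<le> norm (rvec x)} :: (int^'n) set"
    have split: "ennreal (p l (x - y)) \<le> ennreal U * indicator ?B y + ennreal (p l (x - y)) * indicator ?B (x - y)" for y
    proof (cases "r \<le> norm (rvec y)")
      case True
      then have "ennreal (p l (x - y)) \<le> ennreal U * indicator ?B y" using sup[OF ml(2), of "x - y"] by (simp add: ennreal_leI)
      then show ?thesis by (simp add: add_increasing2)
    next
      case False
      have "norm (rvec x) \<le> norm (rvec y) + norm (rvec (x - y))"
        using norm_triangle_ineq[of "rvec y" "rvec (x - y)"] by (simp add: rvec_diff)
      then show ?thesis using False by (simp add: r_def indicator_def)
    qed
    \<comment> \<open>When the second half covers the distance, the first half provides the uniform bound.\<close>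
    have second: "(\<integral>\<^sup>+y. ennreal (p l (x - y)) * indicator ?B (x - y) \<partial>walk (lazy \<theta>) m) \<le> ennreal U * ennreal T"
    proof -
      have "(\<integral>\<^sup>+y. ennreal (p l (x - y)) * indicator ?B (x - y) \<partial>walk (lazy \<theta>) m)
          = (\<integral>\<^sup>+y. ennreal (p m y) * (ennreal (p l (x - y)) * indicator ?B (x - y)) \<partial>count_space UNIV)"
        by (rule nn_integral_measure_pmf)
      also have "\<dots> \<le> (\<integral>\<^sup>+y. ennreal U * (ennreal (p l (x - y)) * indicator ?B (x - y)) \<partial>count_space UNIV)"
        by (intro nn_integral_mono mult_right_mono ennreal_leI sup ml) auto
      also have "\<dots> = ennreal U * (\<integral>\<^sup>+y. ennreal (p l (x - y)) * indicator ?B (x - y) \<partial>count_space UNIV)"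
        by (rule nn_integral_cmult) simp
      also have "(\<integral>\<^sup>+y. ennreal (p l (x - y)) * indicator ?B (x - y) \<partial>count_space UNIV) = (\<integral>\<^sup>+z. ennreal (p l z) * indicator ?B z \<partial>count_space UNIV)"
        by (rule nn_integral_bij_count_space[where g="\<lambda>y. x - y"]) (rule bij_betwI[where g="\<lambda>y. x - y"], auto)
      also have "\<dots> = emeasure (walk (lazy \<theta>) l) ?B"
        by (simp add: nn_integral_measure_pmf[symmetric])
      also have "ennreal U * \<dots> \<le> ennreal U * ennreal T" by (intro mult_left_mono tail ml) auto
      finally show ?thesis .
    qed
    have "ennreal (p n x) = (\<integral>\<^sup>+y. ennreal (p l (x - y)) \<partial>walk (lazy \<theta>) m)"
      unfolding nml by (rule pmf_walk_add)
    also have "\<dots> \<le> (\<integral>\<^sup>+y. ennreal U * indicator ?B y + ennreal (p l (x - y)) * indicator ?B (x - y) \<partial>walk (lazy \<theta>) m)"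
      by (intro nn_integral_mono split)
    also have "\<dots> = ennreal U * emeasure (walk (lazy \<theta>) m) ?B + (\<integral>\<^sup>+y. ennreal (p l (x - y)) * indicator ?B (x - y) \<partial>walk (lazy \<theta>) m)"
      by (simp add: nn_integral_add nn_integral_cmult_indicator)
    also have "\<dots> \<le> ennreal U * ennreal T + ennreal U * ennreal T"
      by (intro add_mono mult_left_mono tail ml second) auto
    also have "\<dots> = ennreal (2 * (U * T))"
      using U0 T0 by (simp add: ennreal_mult[symmetric] ennreal_plus[symmetric] del: ennreal_plus)
    finally have "p n x \<le> 2 * (U * T)" using U0 T0 by (simp add: ennreal_le_iff)
    also have "\<dots> = C / (sqrt n * norm (rvec x) ^ ?q)"
    proof -
      have "sqrt n ^ CARD('n) = sqrt n * sqrt n ^ ?q" using dim by (simp flip: power_Suc)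
      then show ?thesis using n rx by (simp add: U_def T_def C_def r_def power_divide field_simps)
    qed
    finally show ?thesis .
  qed
  moreover have "C \<ge> 0" using C1 C2 by (simp add: C_def)
  ultimately show ?thesis by blast
qed

lemma summable_decay: "summable (\<lambda>n. real (Suc n) powr (- real CARD('n) / 4))"
proof -
  have "summable (\<lambda>n. real n powr (- real CARD('n) / 4))"
    using dim by (subst summable_real_powr_iff) auto
  then show ?thesis by (subst summable_Suc_iff)
qed

lemma green_lazy_finite: "\<exists>B. \<forall>x. green (lazy \<theta>) x \<le> ennreal B"
proof -
  obtain C where C: "C > 0" "\<And>n x. p n x \<le> C / sqrt (Suc n) ^ CARD('n)" using lazy_sup_bound by auto
  have le: "p n x \<le> C * real (Suc n) powr (- real CARD('n) / 4)" for n x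
  proof -
    have "p n x \<le> C * real (Suc n) powr (- real CARD('n) / 2)"
    proof -
      have h: "real (Suc n) powr (- real CARD('n) / 2) = 1 / sqrt (Suc n) ^ CARD('n)" by (rule powr_neg_half) simp
      show ?thesis unfolding h using C(2)[of n x] by (simp only: times_divide_eq_right mult_1_right)
    qed
    also have "\<dots> \<le> C * real (Suc n) powr (- real CARD('n) / 4)"
      using C(1) by (intro mult_left_mono powr_mono) auto
    finally show ?thesis .
  qed
  have s: "summable (\<lambda>n. C * real (Suc n) powr (- real CARD('n) / 4))" by (intro summable_mult summable_decay)
  have "green (lazy \<theta>) x \<le> ennreal (\<Sum>n. C * real (Suc n) powr (- real CARD('n) / 4))" for x
  proof -
    have "green (lazy \<theta>) x \<le> (\<Sum>n. ennreal (C * real (Suc n) powr (- real CARD('n) / 4)))"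
      unfolding green_def by (intro suminf_le ennreal_leI le) auto
    also have "\<dots> = ennreal (\<Sum>n. C * real (Suc n) powr (- real CARD('n) / 4))"
      using C(1) by (intro suminf_ennreal2 s) auto
    finally show ?thesis .
  qed
  then show ?thesis by blast
qed

lemma green_eq: "green (lazy \<theta>) x = 2 * green \<theta> x"
proof (rule green_lazy)
  fix x show "green (lazy \<theta>) x < \<infinity>"
    using green_lazy_finite ennreal_less_top le_less_trans by (metis infinity_ennreal_def)
qed

lemma green_finite: "green \<theta> x < \<infinity>"
proof -
  have "green (lazy \<theta>) x < \<infinity>"
    using green_lazy_finite ennreal_less_top le_less_trans by (metis infinity_ennreal_def)
  then show ?thesis unfolding green_eq by (auto simp: ennreal_mult_less_top)
qed

text \<open>Transition probabilities at times \<open>m \<le> n\<close> have inner product at most \<open>sup (p n)\<close>, of order \<open>n\<close> to the power \<open>- d / 2\<close>. This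
  is at most the product of the powers \<open>- d / 4\<close> of \<open>m\<close> and \<open>n\<close>, and they are summable for \<open>d \<ge> 5\<close>.\<close>

lemma green_square_summable: "(\<integral>\<^sup>+z. green \<theta> z * green \<theta> z \<partial>count_space UNIV) < \<infinity>"
proof -
  obtain C where C: "C > 0" "\<And>n x. p n x \<le> C / sqrt (Suc n) ^ CARD('n)" using lazy_sup_bound by auto
  let ?w = "\<lambda>n::nat. real (Suc n) powr (- real CARD('n) / 4)"
  have sup: "p n x \<le> C * (?w n * ?w n)" for n x
    using C(2)[of n x] powr_neg_half[of "real (Suc n)" "CARD('n)"]
    by (simp add: powr_add[symmetric])
  have w_mono: "?w n \<le> ?w m" if "m \<le> n" for m n using that by (intro powr_mono2') auto
  have cross0: "(\<integral>\<^sup>+z. ennreal (p m z) * ennreal (p n z) \<partial>count_space UNIV) \<le> ennreal (C * ?w m * ?w n)" if "m \<le> n" for m n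
  proof -
    have "(\<integral>\<^sup>+z. ennreal (p m z) * ennreal (p n z) \<partial>count_space UNIV) \<le> (\<integral>\<^sup>+z. ennreal (p m z) * ennreal (C * ?w m * ?w n) \<partial>count_space UNIV)"
    proof (intro nn_integral_mono mult_left_mono ennreal_leI)
      fix z
      have "C * (?w n * ?w n) \<le> C * (?w m * ?w n)"
        using C(1) w_mono[OF that] by (intro mult_left_mono mult_right_mono) auto
      then show "p n z \<le> C * ?w m * ?w n" using sup[of n z] by (simp add: mult.assoc)
    qed simp
    also have "\<dots> = ennreal (C * ?w m * ?w n)"
      by (simp add: nn_integral_multc nn_integral_pmf measure_pmf.emeasure_space_1[simplified])
    finally show ?thesis .
  qed
  have cross: "(\<integral>\<^sup>+z. ennreal (p m z) * ennreal (p n z) \<partial>count_space UNIV) \<le> ennreal (C * ?w m * ?w n)" for m n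
  proof (cases "m \<le> n")
    case False
    then show ?thesis using cross0[of n m] by (simp add: mult_ac)
  qed (rule cross0)
  have "(\<integral>\<^sup>+z. green (lazy \<theta>) z * green (lazy \<theta>) z \<partial>count_space UNIV)
      = (\<Sum>m. \<Sum>n. \<integral>\<^sup>+z. ennreal (p m z) * ennreal (p n z) \<partial>count_space UNIV)"
  proof -
    have "green (lazy \<theta>) z * green (lazy \<theta>) z = (\<Sum>m. \<Sum>n. ennreal (p m z) * ennreal (p n z))" for z
    proof -
      have "green (lazy \<theta>) z * green (lazy \<theta>) z = (\<Sum>m. ennreal (p m z) * green (lazy \<theta>) z)"
        unfolding green_def by (rule ennreal_suminf_multc[symmetric])
      also have "\<dots> = (\<Sum>m. \<Sum>n. ennreal (p m z) * ennreal (p n z))"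
        unfolding green_def by (intro suminf_cong ennreal_suminf_cmult[symmetric])
      finally show ?thesis .
    qed
    then have "(\<integral>\<^sup>+z. green (lazy \<theta>) z * green (lazy \<theta>) z \<partial>count_space UNIV)
      = (\<integral>\<^sup>+z. (\<Sum>m. \<Sum>n. ennreal (p m z) * ennreal (p n z)) \<partial>count_space UNIV)" by simp
    also have "\<dots> = (\<Sum>m. \<integral>\<^sup>+z. (\<Sum>n. ennreal (p m z) * ennreal (p n z)) \<partial>count_space UNIV)"
      by (rule nn_integral_suminf) simp
    also have "\<dots> = (\<Sum>m. \<Sum>n. \<integral>\<^sup>+z. ennreal (p m z) * ennreal (p n z) \<partial>count_space UNIV)"
      by (intro suminf_cong nn_integral_suminf) simp
    finally show ?thesis .
  qed
  also have "\<dots> \<le> (\<Sum>m. \<Sum>n. ennreal (C * ?w m * ?w n))"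
    by (intro suminf_le cross) auto
  also have "\<dots> = (\<Sum>m. ennreal (C * ?w m * (\<Sum>n. ?w n)))"
  proof (intro suminf_cong)
    fix m
    have "(\<Sum>n. ennreal (C * ?w m * ?w n)) = ennreal (\<Sum>n. C * ?w m * ?w n)"
      using C(1) by (intro suminf_ennreal2 summable_mult summable_decay) auto
    also have "(\<Sum>n. C * ?w m * ?w n) = C * ?w m * (\<Sum>n. ?w n)" by (rule suminf_mult[OF summable_decay])
    finally show "(\<Sum>n. ennreal (C * ?w m * ?w n)) = ennreal (C * ?w m * (\<Sum>n. ?w n))" .
  qed
  also have "\<dots> = ennreal (\<Sum>m. C * ?w m * (\<Sum>n. ?w n))"
    using C(1) by (intro suminf_ennreal2 summable_mult2 summable_mult summable_decay mult_nonneg_nonneg suminf_nonneg) auto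
  also have "\<dots> < \<infinity>" by simp
  finally have "(\<integral>\<^sup>+z. green (lazy \<theta>) z * green (lazy \<theta>) z \<partial>count_space UNIV) < \<infinity>" .
  moreover have "green \<theta> z * green \<theta> z \<le> green (lazy \<theta>) z * green (lazy \<theta>) z" for z
    unfolding green_eq by (intro mult_mono) (auto simp: mult_2)
  then have "(\<integral>\<^sup>+z. green \<theta> z * green \<theta> z \<partial>count_space UNIV) \<le> (\<integral>\<^sup>+z. green (lazy \<theta>) z * green (lazy \<theta>) z \<partial>count_space UNIV)"
    by (rule nn_integral_mono)
  ultimately show ?thesis by (rule le_less_trans[rotated])
qed

end

section \<open>Asymptotics of the Green function\<close>

lemma eventually_lattice_at_infinity:
  "eventually P lattice_at_infinity \<longleftrightarrow> (\<exists>r. \<forall>x. r \<le> norm (rvec x) \<longrightarrow> P x)"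
proof
  assume "eventually P lattice_at_infinity"
  then obtain Q where "eventually Q at_infinity" "\<And>x. Q (rvec x) \<Longrightarrow> P x"
    unfolding lattice_at_infinity_def eventually_filtercomap by blast
  then show "\<exists>r. \<forall>x. r \<le> norm (rvec x) \<longrightarrow> P x"
    unfolding eventually_at_infinity by blast
next
  assume "\<exists>r. \<forall>x. r \<le> norm (rvec x) \<longrightarrow> P x"
  then obtain r where "\<And>x. r \<le> norm (rvec x) \<Longrightarrow> P x" by blast
  then show "eventually P lattice_at_infinity"
    unfolding lattice_at_infinity_def eventually_filtercomap eventually_at_infinity
    by (intro exI[of _ "\<lambda>y. r \<le> norm y"]) auto
qed

text \<open>Dominated convergence is a statement about sequences; this reduces limits on the lattice to them.\<close>

lemma tendsto_lattice_at_infinityI: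
  fixes f :: "int ^ 'n \<Rightarrow> 'b::topological_space"
  assumes "\<And>X. filterlim (\<lambda>i. norm (rvec (X i))) at_top sequentially \<Longrightarrow> (\<lambda>i. f (X i)) \<longlonglongrightarrow> l"
  shows "(f \<longlongrightarrow> l) lattice_at_infinity"
proof (rule topological_tendstoI, rule ccontr)
  fix S assume S: "open S" "l \<in> S" and "\<not> eventually (\<lambda>x. f x \<in> S) lattice_at_infinity"
  then have "\<forall>i::nat. \<exists>x. real i \<le> norm (rvec x) \<and> f x \<notin> S"
    unfolding eventually_lattice_at_infinity by blast
  then obtain X where X: "\<And>i::nat. real i \<le> norm (rvec (X i))" "\<And>i. f (X i) \<notin> S" by metis
  have "filterlim (\<lambda>i. norm (rvec (X i))) at_top sequentially"
    by (rule filterlim_at_top_mono[OF filterlim_real_sequentially]) (use X in auto)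
  from topological_tendstoD[OF assms[OF this] S] X(2) show False by simp
qed

lemma suminf_eq_nn_integral_floor:
  fixes f :: "nat \<Rightarrow> ennreal"
  shows "(\<Sum>n. f n) = (\<integral>\<^sup>+s. f (nat \<lfloor>s\<rfloor>) * indicator {0..} s \<partial>(lborel :: real measure))"
proof -
  have pt: "(\<Sum>n. f n * indicator {real n..<real n + 1} s) = f (nat \<lfloor>s\<rfloor>) * indicator {0..} s" for s :: real
  proof (cases "s \<ge> 0")
    case True
    have "(\<Sum>n. f n * indicator {real n..<real n + 1} s) = (\<Sum>n\<in>{nat \<lfloor>s\<rfloor>}. f n * indicator {real n..<real n + 1} s)"
    proof (rule suminf_finite)
      fix n assume "n \<notin> {nat \<lfloor>s\<rfloor>}"
      then have "s \<notin> {real n..<real n + 1}" using True by (auto simp: nat_eq_iff floor_eq_iff) (smt (verit) floor_eq_iff nat_int of_int_of_nat_eq)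
      then show "f n * indicator {real n..<real n + 1} s = 0" by simp
    qed simp
    also have "\<dots> = f (nat \<lfloor>s\<rfloor>)" using True by (auto simp: indicator_def)
    finally show ?thesis using True by simp
  next
    case False
    then have "f n * indicator {real n..<real n + 1} s = 0" for n by (auto simp: indicator_def)
    then show ?thesis using False by simp
  qed
  have "(\<integral>\<^sup>+s. f (nat \<lfloor>s\<rfloor>) * indicator {0..} s \<partial>(lborel :: real measure)) = (\<integral>\<^sup>+s. (\<Sum>n. f n * indicator {real n..<real n + 1} s) \<partial>lborel)"
    by (simp only: pt)
  also have "\<dots> = (\<Sum>n. \<integral>\<^sup>+s. f n * indicator {real n..<real n + 1} s \<partial>lborel)"
    by (rule nn_integral_suminf) simp
  also have "\<dots> = (\<Sum>n. f n)"
    by (intro suminf_cong) (simp add: nn_integral_cmult_indicator)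
  finally show ?thesis ..
qed

text \<open>The substitution \<open>t = 1 / v\<close> in the integral for the Gamma function.\<close>

lemma inverse_gamma_integral:
  fixes d :: nat assumes d: "d \<ge> 3"
  shows "(\<integral>\<^sup>+v. ennreal (sqrt (1 / v) ^ d * exp (- 1 / v)) * indicator {0<..} v \<partial>lborel) = ennreal (Gamma (real d / 2 - 1))"
proof -
  let ?f = "\<lambda>v::real. sqrt (1 / v) ^ d * exp (- 1 / v)"
  let ?S = "{0<..} :: real set"
  have "((\<lambda>t. t powr (real d / 2 - 1 - 1) / exp t) has_integral Gamma (real d / 2 - 1)) {0..}"
    by (rule Gamma_integral_real) (use d in auto)
  then have "((\<lambda>t. t powr (real d / 2 - 1 - 1) / exp t) has_integral Gamma (real d / 2 - 1)) ?S"
    by (subst has_integral_spike_set_eq[where T="{0..}"]) (auto intro!: negligible_subset[OF negligible_sing[of "0::real"]])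
  moreover have "t powr (real d / 2 - 1 - 1) / exp t = \<bar>- 1 / t\<^sup>2\<bar> * ?f (1 / t)" if "t \<in> ?S" for t
  proof -
    have "sqrt t ^ d = sqrt t powr real d" using that by (simp add: powr_realpow)
    also have "\<dots> = (t powr (1 / 2)) powr real d" using that by (simp add: powr_half_sqrt)
    also have "\<dots> = t powr (real d / 2)" by (simp add: powr_powr)
    finally have s: "sqrt t ^ d = t powr (real d / 2)" .
    have "t powr (real d / 2 - 1 - 1) = t powr (real d / 2) / t powr 2"
      by (simp add: powr_diff[symmetric])
    also have "t powr 2 = t\<^sup>2" using that by simp
    finally show ?thesis using that by (simp add: s exp_minus field_simps)
  qed
  ultimately have h: "((\<lambda>t. \<bar>- 1 / t\<^sup>2\<bar> * ?f (1 / t)) has_integral Gamma (real d / 2 - 1)) ?S"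
    by (rule has_integral_eq[rotated])
  then have a: "(\<lambda>t. \<bar>- 1 / t\<^sup>2\<bar> * ?f (1 / t)) absolutely_integrable_on ?S"
    by (intro nonnegative_absolutely_integrable_1) (auto simp: has_integral_integrable)
  have img: "(\<lambda>t. 1 / t) ` ?S = ?S"
    by (rule bij_betw_imp_surj_on[OF bij_betwI[where g="\<lambda>t. 1 / t"]]) auto
  have "(\<lambda>t. \<bar>- 1 / t\<^sup>2\<bar> * ?f (1 / t)) absolutely_integrable_on ?S \<and>
      integral ?S (\<lambda>t. \<bar>- 1 / t\<^sup>2\<bar> * ?f (1 / t)) = Gamma (real d / 2 - 1)
     \<longleftrightarrow> ?f absolutely_integrable_on ((\<lambda>t. 1 / t) ` ?S) \<and> integral ((\<lambda>t. 1 / t) ` ?S) ?f = Gamma (real d / 2 - 1)"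
    by (rule has_absolute_integral_change_of_variables_1')
       (auto intro!: derivative_eq_intros inj_onI simp: power2_eq_square)
  then have f: "?f absolutely_integrable_on ?S \<and> integral ?S ?f = Gamma (real d / 2 - 1)"
    unfolding img using a integral_unique[OF h] by blast
  have "(?f has_integral integral ?S ?f) ?S"
    using f set_lebesgue_integral_eq_integral(1) integrable_integral by blast
  with f have "(?f has_integral Gamma (real d / 2 - 1)) ?S" by simp
  then show ?thesis
    by (intro nn_integral_has_integral_lebesgue') auto
qed

text \<open>The integrable majorant for the rescaled transition probabilities: the square root comes from \<open>lazy_small_time_bound\<close>, and the
  power \<open>- b\<close> with \<open>b = d / 2\<close> from the uniform bound.\<close>

definition envelope :: "real \<Rightarrow> real \<Rightarrow> real" where
  "envelope b v = (if v \<le> 0 then 0 else if v \<le> 1 then v powr (- 1 / 2) else v powr (- b))"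

lemma envelope_measurable [measurable]: "envelope b \<in> borel_measurable borel"
  unfolding envelope_def[abs_def] by measurable

lemma nn_integral_envelope:
  assumes "b > 1" shows "(\<integral>\<^sup>+v. ennreal (envelope b v) \<partial>lborel) < \<infinity>"
proof -
  have 1: "(\<integral>\<^sup>+v. ennreal (v powr (- 1 / 2)) * indicator {0..1} v \<partial>lborel) = ennreal (1 powr (- 1 / 2 + 1) / (- 1 / 2 + 1))"
    by (intro nn_integral_has_integral_lebesgue' has_integral_powr_from_0) auto
  have 2: "(\<integral>\<^sup>+v. ennreal (v powr (- b)) * indicator {1..} v \<partial>lborel) = ennreal (- (1 powr (- b + 1)) / (- b + 1))"
    by (intro nn_integral_has_integral_lebesgue' has_integral_powr_to_inf) (use assms in auto)
  have "(\<integral>\<^sup>+v. ennreal (envelope b v) \<partial>lborel) \<le> (\<integral>\<^sup>+v. ennreal (v powr (- 1 / 2)) * indicator {0..1} v + ennreal (v powr (- b)) * indicator {1..} v \<partial>lborel)"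
    by (intro nn_integral_mono) (auto simp: envelope_def indicator_def)
  also have "\<dots> = (\<integral>\<^sup>+v. ennreal (v powr (- 1 / 2)) * indicator {0..1} v \<partial>lborel) + (\<integral>\<^sup>+v. ennreal (v powr (- b)) * indicator {1..} v \<partial>lborel)"
    by (rule nn_integral_add) auto
  also have "\<dots> < \<infinity>" unfolding 1 2 by simp
  finally show ?thesis .
qed

context centred_walk
begin

lemma radius_bounds: "\<exists>a>0. \<exists>b>0. \<forall>x. a * norm (rvec x) \<le> radius x \<and> radius x \<le> b * norm (rvec x)"
proof -
  have lin: "linear ((*v) (transpose frame))" by simp
  have inj: "inj ((*v) (transpose frame))"
    using det_frame_nonzero by (intro inj_matrix_vector_mult) (simp add: invertible_det_nz)
  obtain a where a: "a > 0" "\<And>y. a * norm y \<le> norm (transpose frame *v y)"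
    using linear_inj_bounded_below_pos[OF lin inj] by blast
  obtain b where b: "b > 0" "\<And>y. norm (transpose frame *v y) \<le> b * norm y"
    using bounded_linear.pos_bounded[OF matrix_vector_mul_bounded_linear[of "transpose frame"]] by (auto simp: mult.commute)
  show ?thesis unfolding radius_def using a b by blast
qed

text \<open>The sum over times is an integral, written in units of \<open>(radius x)\<^sup>2\<close>, the time that the walk needs to reach \<open>x\<close>.\<close>

lemma green_lazy_integral:
  assumes R: "radius x > 0"
  shows "ennreal (radius x ^ (CARD('n) - 2)) * green (lazy \<theta>) x
     = (\<integral>\<^sup>+v. ennreal (radius x ^ CARD('n) * p (nat \<lfloor>(radius x)\<^sup>2 * v\<rfloor>) x) * indicator {0..} v \<partial>lborel)"
proof -
  let ?R = "radius x"
  have m: "(\<lambda>s::real. ennreal (p (nat \<lfloor>s\<rfloor>) x) * indicator {0..} s) \<in> borel_measurable borel" by measurable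
  have R2: "?R\<^sup>2 > 0" using R by simp
  have "green (lazy \<theta>) x = (\<integral>\<^sup>+s. ennreal (p (nat \<lfloor>s\<rfloor>) x) * indicator {0..} s \<partial>(lborel :: real measure))"
    unfolding green_def by (rule suminf_eq_nn_integral_floor[of "\<lambda>n. ennreal (p n x)"])
  also have "\<dots> = ennreal \<bar>?R\<^sup>2\<bar> * (\<integral>\<^sup>+v. ennreal (p (nat \<lfloor>0 + ?R\<^sup>2 * v\<rfloor>) x) * indicator {0..} (0 + ?R\<^sup>2 * v) \<partial>lborel)"
    by (rule nn_integral_real_affine[OF m]) (use R in auto)
  also have "\<dots> = ennreal (?R\<^sup>2) * (\<integral>\<^sup>+v. ennreal (p (nat \<lfloor>?R\<^sup>2 * v\<rfloor>) x) * indicator {0..} v \<partial>lborel)"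
  proof -
    have "indicator {0..} (0 + ?R\<^sup>2 * v) = (indicator {0..} v :: ennreal)" for v
      using R2 by (auto simp: indicator_def zero_le_mult_iff)
    then show ?thesis by (simp only: add_0 abs_power2)
  qed
  finally have g: "green (lazy \<theta>) x = ennreal (?R\<^sup>2) * (\<integral>\<^sup>+v. ennreal (p (nat \<lfloor>?R\<^sup>2 * v\<rfloor>) x) * indicator {0..} v \<partial>lborel)" .
  have "CARD('n) = (CARD('n) - 2) + 2" using dim by simp
  then have "?R ^ CARD('n) = ?R ^ (CARD('n) - 2) * ?R\<^sup>2" by (metis power_add)
  then have "ennreal (?R ^ (CARD('n) - 2)) * green (lazy \<theta>) x
     = ennreal (?R ^ CARD('n)) * (\<integral>\<^sup>+v. ennreal (p (nat \<lfloor>?R\<^sup>2 * v\<rfloor>) x) * indicator {0..} v \<partial>lborel)"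
    unfolding g using R by (simp only: ennreal_mult zero_le_power less_imp_le zero_le_power2 mult.assoc)
  also have "\<dots> = (\<integral>\<^sup>+v. ennreal (?R ^ CARD('n)) * (ennreal (p (nat \<lfloor>?R\<^sup>2 * v\<rfloor>) x) * indicator {0..} v) \<partial>lborel)"
    by (rule nn_integral_cmult[symmetric]) measurable
  also have "\<dots> = (\<integral>\<^sup>+v. ennreal (?R ^ CARD('n) * p (nat \<lfloor>?R\<^sup>2 * v\<rfloor>) x) * indicator {0..} v \<partial>lborel)"
    using R by (intro nn_integral_cong) (simp add: ennreal_mult mult.assoc)
  finally show ?thesis .
qed

text \<open>In the units of \<open>green_lazy_integral\<close> the integrand is dominated uniformly in \<open>x\<close>.\<close>

lemma rescaled_transition_bound:
  "\<exists>K\<ge>0. \<forall>x v. x \<noteq> 0 \<longrightarrow> v > 0 \<longrightarrow> radius x ^ CARD('n) * p (nat \<lfloor>(radius x)\<^sup>2 * v\<rfloor>) x \<le> K * envelope (real CARD('n) / 2) v"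
proof -
  let ?d = "CARD('n)"
  obtain a b where ab: "a > 0" "b > 0" "\<And>x. a * norm (rvec x) \<le> radius x" "\<And>x. radius x \<le> b * norm (rvec x)"
    using radius_bounds by blast
  obtain C1 where C1: "C1 > 0" "\<And>n x. p n x \<le> C1 / sqrt (Suc n) ^ ?d" using lazy_sup_bound by auto
  obtain C2 where C2: "C2 \<ge> 0" "\<And>n x. n > 0 \<Longrightarrow> x \<noteq> 0 \<Longrightarrow> p n x \<le> C2 / (sqrt n * norm (rvec x) ^ (?d - 1))"
    using lazy_small_time_bound by blast
  define K where "K = C1 + C2 * sqrt 2 * b ^ (?d - 1)"
  have K: "K \<ge> 0" "C1 \<le> K" "C2 * sqrt 2 * b ^ (?d - 1) \<le> K" using C1 C2 ab by (auto simp: K_def)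
  have "radius x ^ ?d * p (nat \<lfloor>(radius x)\<^sup>2 * v\<rfloor>) x \<le> K * envelope (real ?d / 2) v" if x: "x \<noteq> 0" and v: "v > 0" for x v
  proof -
    define R where "R = radius x"
    define n where "n = nat \<lfloor>R\<^sup>2 * v\<rfloor>"
    have nx: "norm (rvec x) > 0" using x by (auto simp: vec_eq_iff)
    have R: "R > 0" using ab(1) ab(3)[of x] nx unfolding R_def by (smt (verit) mult_pos_pos)
    have R2v: "R\<^sup>2 * v > 0" using R v by simp
    have n_le: "R\<^sup>2 * v \<le> real (Suc n)" unfolding n_def using R2v by linarith
    \<comment> \<open>The uniform bound, good for all times; for \<open>v \<le> 1\<close> it is not integrable.\<close>
    have large: "R ^ ?d * p n x \<le> C1 * v powr (- (real ?d / 2))"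
    proof -
      have s: "sqrt (R\<^sup>2 * v) = R * sqrt v" using R by (simp add: real_sqrt_mult)
      have "p n x \<le> C1 / sqrt (Suc n) ^ ?d" by (rule C1)
      also have "\<dots> \<le> C1 / sqrt (R\<^sup>2 * v) ^ ?d"
        using n_le R2v C1(1) by (intro divide_left_mono power_mono mult_pos_pos zero_less_power) auto
      finally have "R ^ ?d * p n x \<le> R ^ ?d * (C1 / (R * sqrt v) ^ ?d)"
        unfolding s using R by (intro mult_left_mono) auto
      also have "\<dots> = C1 * (1 / sqrt v ^ ?d)" using R by (simp add: power_mult_distrib)
      also have "1 / sqrt v ^ ?d = v powr (- (real ?d / 2))" using powr_neg_half[OF v, of ?d] by simp
      finally show ?thesis .
    qed
    show ?thesis
    proof (cases "v \<le> 1")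
      case False
      then have "envelope (real ?d / 2) v = v powr (- (real ?d / 2))" using v by (simp add: envelope_def)
      moreover have "C1 * v powr (- (real ?d / 2)) \<le> K * v powr (- (real ?d / 2))" using K by (intro mult_right_mono) auto
      ultimately show ?thesis using large by (simp add: R_def n_def)
    next
      case True
      have dom: "envelope (real ?d / 2) v = 1 / sqrt v" using v True by (simp add: envelope_def powr_minus powr_half_sqrt inverse_eq_divide)
      show ?thesis
      proof (cases "n = 0")
        \<comment> \<open>The walk has not moved yet.\<close>
        case n0: True
        then have "p n x = 0" using x by simp
        then show ?thesis using K v dom by (simp add: R_def[symmetric] n_def[symmetric])
      next
        case False
        then have n1: "n > 0" by simp
        have half: "R\<^sup>2 * v / 2 \<le> real n" using n_le n1 by simp
        have s: "sqrt (R\<^sup>2 * v / 2) = R * sqrt v / sqrt 2" using R by (simp add: real_sqrt_mult real_sqrt_divide)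
        have sn: "R * sqrt v / sqrt 2 \<le> sqrt n" unfolding s[symmetric] using half by (rule real_sqrt_le_mono)
        have rb: "R ^ (?d - 1) \<le> b ^ (?d - 1) * norm (rvec x) ^ (?d - 1)"
          unfolding power_mult_distrib[symmetric] R_def using ab R R_def by (intro power_mono) auto
        have Rd: "R ^ ?d = R * R ^ (?d - 1)" using dim by (simp flip: power_Suc)
        have "R ^ ?d * p n x \<le> R ^ ?d * (C2 / (sqrt n * norm (rvec x) ^ (?d - 1)))"
          using R by (intro mult_left_mono C2 n1 x) auto
        also have "\<dots> = (R / sqrt n) * (R ^ (?d - 1) / norm (rvec x) ^ (?d - 1)) * C2"
          unfolding Rd by simp
        also have "\<dots> \<le> (sqrt 2 / sqrt v) * b ^ (?d - 1) * C2"
        proof (intro mult_right_mono mult_mono)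
          show "R / sqrt n \<le> sqrt 2 / sqrt v" using sn n1 v by (simp add: field_simps)
          show "R ^ (?d - 1) / norm (rvec x) ^ (?d - 1) \<le> b ^ (?d - 1)" using rb nx by (simp add: field_simps)
        qed (use R nx v C2 in auto)
        also have "\<dots> = (C2 * sqrt 2 * b ^ (?d - 1)) * (1 / sqrt v)" by simp
        also have "\<dots> \<le> K * (1 / sqrt v)" using K v by (intro mult_right_mono) auto
        finally show ?thesis by (simp add: dom R_def n_def)
      qed
    qed
  qed
  then show ?thesis using K by blast
qed

text \<open>At a time of order \<open>(radius x)\<^sup>2\<close> the local limit theorem gives the limit.\<close>

lemma rescaled_transition_limit:
  assumes R: "filterlim (\<lambda>i. radius (X i)) at_top sequentially" and v: "v > 0"
  shows "(\<lambda>i. radius (X i) ^ CARD('n) * p (nat \<lfloor>(radius (X i))\<^sup>2 * v\<rfloor>) (X i)) \<longlonglongrightarrow> kappa * (sqrt (1 / v) ^ CARD('n) * exp (- 1 / v))"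
proof -
  define R where "R i = radius (X i)" for i
  define n where "n i = nat \<lfloor>(R i)\<^sup>2 * v\<rfloor>" for i
  obtain e where e: "e \<longlonglongrightarrow> 0"
    "\<And>n x. n > 0 \<Longrightarrow> \<bar>sqrt n ^ CARD('n) * p n x - kappa * exp (- ((radius x)\<^sup>2 / n))\<bar> \<le> e n"
    using lazy_local_limit by blast
  have Rlim: "filterlim R at_top sequentially" using R by (simp add: R_def[abs_def])
  have R2: "filterlim (\<lambda>i. (R i)\<^sup>2) at_top sequentially"
    by (rule filterlim_pow_at_top[OF _ Rlim]) simp
  have nn: "(R i)\<^sup>2 * v - 1 \<le> real (n i)" "real (n i) \<le> (R i)\<^sup>2 * v" for i
  proof -
    have "(R i)\<^sup>2 * v \<ge> 0" using v by simp
    then show "(R i)\<^sup>2 * v - 1 \<le> real (n i)" "real (n i) \<le> (R i)\<^sup>2 * v" unfolding n_def by linarith+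
  qed
  have "filterlim (\<lambda>i. - 1 + (R i)\<^sup>2 * v) at_top sequentially"
    by (rule filterlim_tendsto_add_at_top[OF tendsto_const])
       (rule filterlim_at_top_mult_tendsto_pos[OF tendsto_const v R2])
  then have rn: "filterlim (\<lambda>i. real (n i)) at_top sequentially"
    by (rule filterlim_at_top_mono) (use nn in auto)
  then have nlim: "filterlim n at_top sequentially"
    by (simp add: filterlim_sequentially_iff_filterlim_real)
  have en: "(\<lambda>i. e (n i)) \<longlonglongrightarrow> 0" by (rule filterlim_compose[OF e(1) nlim])
  have npos: "eventually (\<lambda>i. n i > 0) sequentially"
    by (rule nlim[unfolded filterlim_iff, rule_format, OF eventually_gt_at_top])
  have Rpos: "eventually (\<lambda>i. R i > 0) sequentially"
    using Rlim by (auto simp: filterlim_at_top_dense)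
  have ratio: "(\<lambda>i. real (n i) / (R i)\<^sup>2) \<longlonglongrightarrow> v"
  proof (rule tendsto_sandwich)
    show "(\<lambda>i. v - 1 / (R i)\<^sup>2) \<longlonglongrightarrow> v"
      using tendsto_diff[OF tendsto_const[of v] tendsto_divide_0[OF tendsto_const[of 1] filterlim_at_top_imp_at_infinity[OF R2]]] by simp
    show "eventually (\<lambda>i. v - 1 / (R i)\<^sup>2 \<le> real (n i) / (R i)\<^sup>2) sequentially"
      using Rpos
    proof eventually_elim
      case (elim i)
      have "v - 1 / (R i)\<^sup>2 = ((R i)\<^sup>2 * v - 1) / (R i)\<^sup>2" using elim by (simp add: diff_divide_distrib)
      also have "\<dots> \<le> real (n i) / (R i)\<^sup>2" by (intro divide_right_mono nn) auto
      finally show ?case .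
    qed
    show "eventually (\<lambda>i. real (n i) / (R i)\<^sup>2 \<le> v) sequentially"
      using Rpos
    proof eventually_elim
      case (elim i)
      have "real (n i) / (R i)\<^sup>2 \<le> ((R i)\<^sup>2 * v) / (R i)\<^sup>2" by (intro divide_right_mono nn) auto
      then show ?case using elim by simp
    qed
  qed (rule tendsto_const)
  have ratio': "(\<lambda>i. (R i)\<^sup>2 / real (n i)) \<longlonglongrightarrow> 1 / v"
    using tendsto_inverse[OF ratio] v by (simp add: field_simps)
  have main: "(\<lambda>i. sqrt (n i) ^ CARD('n) * p (n i) (X i)) \<longlonglongrightarrow> kappa * exp (- (1 / v))"
  proof -
    have "(\<lambda>i. sqrt (n i) ^ CARD('n) * p (n i) (X i) - kappa * exp (- ((R i)\<^sup>2 / n i))) \<longlonglongrightarrow> 0"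
    proof (rule Lim_null_comparison[OF _ en])
      show "eventually (\<lambda>i. norm (sqrt (n i) ^ CARD('n) * p (n i) (X i) - kappa * exp (- ((R i)\<^sup>2 / n i))) \<le> e (n i)) sequentially"
        using npos by eventually_elim (auto simp: R_def intro!: e(2))
    qed
    moreover have "(\<lambda>i. kappa * exp (- ((R i)\<^sup>2 / n i))) \<longlonglongrightarrow> kappa * exp (- (1 / v))"
      by (intro tendsto_intros ratio')
    ultimately show ?thesis using tendsto_add by fastforce
  qed
  have "(\<lambda>i. sqrt ((R i)\<^sup>2 / n i) ^ CARD('n) * (sqrt (n i) ^ CARD('n) * p (n i) (X i))) \<longlonglongrightarrow> sqrt (1 / v) ^ CARD('n) * (kappa * exp (- (1 / v)))"
    by (intro tendsto_intros ratio' main)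
  moreover have "eventually (\<lambda>i. sqrt ((R i)\<^sup>2 / n i) ^ CARD('n) * (sqrt (n i) ^ CARD('n) * p (n i) (X i)) = R i ^ CARD('n) * p (n i) (X i)) sequentially"
    using npos Rpos
  proof eventually_elim
    case (elim i)
    then have "sqrt ((R i)\<^sup>2 / n i) * sqrt (n i) = R i" by (simp add: real_sqrt_divide)
    then show ?case by (simp add: mult.assoc[symmetric] power_mult_distrib[symmetric])
  qed
  ultimately have "(\<lambda>i. R i ^ CARD('n) * p (n i) (X i)) \<longlonglongrightarrow> sqrt (1 / v) ^ CARD('n) * (kappa * exp (- (1 / v)))"
    by (rule Lim_transform_eventually)
  then show ?thesis by (simp add: R_def n_def mult_ac)
qed

lemma radius_at_top:
  assumes "filterlim (\<lambda>i. norm (rvec (X i))) at_top sequentially"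
  shows "filterlim (\<lambda>i. radius (X i)) at_top sequentially"
proof -
  obtain a b where ab: "a > 0" "\<And>x. a * norm (rvec x) \<le> radius x" using radius_bounds by blast
  have "filterlim (\<lambda>i. a * norm (rvec (X i))) at_top sequentially"
    by (rule filterlim_tendsto_pos_mult_at_top[OF tendsto_const ab(1) assms])
  then show ?thesis by (rule filterlim_at_top_mono) (use ab in auto)
qed

text \<open>With \<open>d = CARD('n)\<close>, the constant of the theorem up to the factor between \<open>radius\<close> and \<open>cov_norm\<close>; the factor \<open>1 / 2\<close> undoes
  the laziness.\<close>

definition green_limit :: real where
  "green_limit = kappa * Gamma (real CARD('n) / 2 - 1) / 2"

lemma kappa_pos: "kappa > 0"
  using det_frame_nonzero by (simp add: kappa_def)

lemma green_limit_pos: "green_limit > 0"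
  unfolding green_limit_def using kappa_pos dim by (intro divide_pos_pos mult_pos_pos Gamma_real_pos) auto

theorem green_asymptotics_seq:
  assumes X: "filterlim (\<lambda>i. norm (rvec (X i))) at_top sequentially"
  shows "(\<lambda>i. radius (X i) ^ (CARD('n) - 2) * enn2real (green \<theta> (X i))) \<longlonglongrightarrow> green_limit"
proof -
  let ?d = "CARD('n)"
  note R = radius_at_top[OF X]
  \<comment> \<open>The bounds hold for nonzero points only, so finitely many terms are dropped.\<close>
  obtain N where N: "\<And>i. i \<ge> N \<Longrightarrow> radius (X i) > 0"
    using R by (auto simp: filterlim_at_top_dense eventually_sequentially)
  define Y where "Y i = X (i + N)" for i
  have RY: "filterlim (\<lambda>i. radius (Y i)) at_top sequentially"
    unfolding Y_def using R by (rule filterlim_compose) (rule filterlim_add_const_nat_at_top)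
  have Ypos: "radius (Y i) > 0" for i using N by (simp add: Y_def)
  have Y0: "Y i \<noteq> 0" for i using Ypos[of i] by (auto simp: radius_def)
  obtain K where K: "K \<ge> 0" "\<And>x v. x \<noteq> 0 \<Longrightarrow> v > 0 \<Longrightarrow> radius x ^ ?d * p (nat \<lfloor>(radius x)\<^sup>2 * v\<rfloor>) x \<le> K * envelope (real ?d / 2) v"
    using rescaled_transition_bound by blast
  let ?u = "\<lambda>i v. ennreal (radius (Y i) ^ ?d * p (nat \<lfloor>(radius (Y i))\<^sup>2 * v\<rfloor>) (Y i)) * indicator {0..} v"
  let ?g = "\<lambda>v. ennreal (kappa * (sqrt (1 / v) ^ ?d * exp (- 1 / v))) * indicator {0<..} v"
  have ne0: "AE v in lborel. v \<noteq> (0::real)" by (rule AE_lborel_singleton)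
  have "(\<lambda>i. \<integral>\<^sup>+v. ?u i v \<partial>lborel) \<longlonglongrightarrow> (\<integral>\<^sup>+v. ?g v \<partial>lborel)"
  proof (rule nn_integral_dominated_convergence[where w="\<lambda>v. ennreal (K * envelope (real ?d / 2) v)"])
    show "AE v in lborel. ?u i v \<le> ennreal (K * envelope (real ?d / 2) v)" for i
      using ne0
    proof eventually_elim
      case (elim v)
      show ?case
      proof (cases "v > 0")
        case True
        then show ?thesis using K(2)[OF Y0 True, of i] by (simp add: ennreal_leI)
      qed (use elim in \<open>auto simp: indicator_def\<close>)
    qed
    have "(\<integral>\<^sup>+v. ennreal (K * envelope (real ?d / 2) v) \<partial>lborel) = ennreal K * (\<integral>\<^sup>+v. ennreal (envelope (real ?d / 2) v) \<partial>lborel)"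
      using K(1) by (subst nn_integral_cmult[symmetric]) (auto simp: ennreal_mult' intro!: nn_integral_cong)
    also have "\<dots> < \<infinity>" using nn_integral_envelope[of "real ?d / 2"] dim by (simp add: ennreal_mult_less_top)
    finally show "(\<integral>\<^sup>+v. ennreal (K * envelope (real ?d / 2) v) \<partial>lborel) < \<infinity>" .
    show "AE v in lborel. (\<lambda>i. ?u i v) \<longlonglongrightarrow> ?g v"
      using ne0
    proof eventually_elim
      case (elim v)
      show ?case
      proof (cases "v > 0")
        case True
        then show ?thesis using tendsto_ennrealI[OF rescaled_transition_limit[OF RY True]] by simp
      qed (use elim in \<open>auto simp: indicator_def\<close>)
    qed
  qed measurable
  moreover have "(\<integral>\<^sup>+v. ?u i v \<partial>lborel) = ennreal (radius (Y i) ^ (?d - 2)) * green (lazy \<theta>) (Y i)" for i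
    using green_lazy_integral[OF Ypos] by simp
  moreover have "(\<integral>\<^sup>+v. ?g v \<partial>lborel) = ennreal (kappa * Gamma (real ?d / 2 - 1))"
  proof -
    have "(\<integral>\<^sup>+v. ?g v \<partial>lborel) = (\<integral>\<^sup>+v. ennreal kappa * (ennreal (sqrt (1 / v) ^ ?d * exp (- 1 / v)) * indicator {0<..} v) \<partial>lborel)"
    proof (intro nn_integral_cong)
      fix v :: real
      show "?g v = ennreal kappa * (ennreal (sqrt (1 / v) ^ ?d * exp (- 1 / v)) * indicator {0<..} v)"
        using kappa_pos by (cases "v > 0") (auto simp: ennreal_mult mult.assoc)
    qed
    also have "\<dots> = ennreal kappa * ennreal (Gamma (real ?d / 2 - 1))"
      using inverse_gamma_integral[of ?d] dim by (subst nn_integral_cmult) auto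
    finally show ?thesis using kappa_pos by (simp add: ennreal_mult')
  qed
  ultimately have "(\<lambda>i. ennreal (radius (Y i) ^ (?d - 2)) * green (lazy \<theta>) (Y i)) \<longlonglongrightarrow> ennreal (kappa * Gamma (real ?d / 2 - 1))"
    by simp
  then have "(\<lambda>i. enn2real (ennreal (radius (Y i) ^ (?d - 2)) * green (lazy \<theta>) (Y i))) \<longlonglongrightarrow> kappa * Gamma (real ?d / 2 - 1)"
    using kappa_pos dim by (intro tendsto_enn2real) (auto intro!: mult_nonneg_nonneg less_imp_le[OF Gamma_real_pos])
  moreover have "enn2real (ennreal (radius (Y i) ^ (?d - 2)) * green (lazy \<theta>) (Y i)) = 2 * (radius (Y i) ^ (?d - 2) * enn2real (green \<theta> (Y i)))" for i
    unfolding green_eq using Ypos[of i] by (simp add: enn2real_mult)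
  ultimately have "(\<lambda>i. 2 * (radius (Y i) ^ (?d - 2) * enn2real (green \<theta> (Y i))) / 2) \<longlonglongrightarrow> kappa * Gamma (real ?d / 2 - 1) / 2"
    by (intro tendsto_divide) auto
  then have "(\<lambda>i. radius (X (i + N)) ^ (?d - 2) * enn2real (green \<theta> (X (i + N)))) \<longlonglongrightarrow> green_limit"
    by (simp add: Y_def green_limit_def)
  then show ?thesis by (rule LIMSEQ_offset)
qed

end

section \<open>Walks with killing\<close>

lemma nn_integral_count_space_swap:
  "(\<integral>\<^sup>+x. (\<integral>\<^sup>+y. f x y \<partial>count_space UNIV) \<partial>count_space UNIV) = (\<integral>\<^sup>+y. (\<integral>\<^sup>+x. f x y \<partial>count_space UNIV) \<partial>count_space UNIV)"
  using nn_integral_fst_count_space[of "\<lambda>(x, y). f x y"] nn_integral_snd_count_space[of "\<lambda>(x, y). f x y"] by simp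

lemma nn_integral_count_space_pmf_swap:
  "(\<integral>\<^sup>+x. (\<integral>\<^sup>+y. f x y \<partial>measure_pmf \<theta>) \<partial>count_space UNIV) = (\<integral>\<^sup>+y. (\<integral>\<^sup>+x. f x y \<partial>count_space UNIV) \<partial>measure_pmf \<theta>)"
  unfolding nn_integral_measure_pmf
  by (subst nn_integral_count_space_swap) (simp add: nn_integral_cmult)

lemma nn_integral_count_space_shift:
  fixes f :: "'a::ab_group_add \<Rightarrow> ennreal"
  shows "(\<integral>\<^sup>+x. f (x + y) \<partial>count_space UNIV) = (\<integral>\<^sup>+x. f x \<partial>count_space UNIV)"
    and "(\<integral>\<^sup>+x. f (y + x) \<partial>count_space UNIV) = (\<integral>\<^sup>+x. f x \<partial>count_space UNIV)"
    and "(\<integral>\<^sup>+x. f (y - x) \<partial>count_space UNIV) = (\<integral>\<^sup>+x. f x \<partial>count_space UNIV)"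
proof -
  have "bij (\<lambda>x. x + y)" by (rule bij_betwI[where g="\<lambda>x. x - y"]) auto
  then show "(\<integral>\<^sup>+x. f (x + y) \<partial>count_space UNIV) = (\<integral>\<^sup>+x. f x \<partial>count_space UNIV)"
    by (rule nn_integral_bij_count_space)
  then show "(\<integral>\<^sup>+x. f (y + x) \<partial>count_space UNIV) = (\<integral>\<^sup>+x. f x \<partial>count_space UNIV)"
    by (simp only: add.commute)
  have "bij (\<lambda>x. y - x)" by (rule bij_betwI[where g="\<lambda>x. y - x"]) auto
  then show "(\<integral>\<^sup>+x. f (y - x) \<partial>count_space UNIV) = (\<integral>\<^sup>+x. f x \<partial>count_space UNIV)"
    by (rule nn_integral_bij_count_space)
qed

definition step :: "'a::ab_group_add pmf \<Rightarrow> ('a \<Rightarrow> ennreal) \<Rightarrow> 'a \<Rightarrow> ennreal" where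
  "step \<theta> f x = (\<integral>\<^sup>+y. f (x + y) \<partial>\<theta>)"

lemma step_mono: "(\<And>x. f x \<le> g x) \<Longrightarrow> step \<theta> f x \<le> step \<theta> g x"
  unfolding step_def by (intro nn_integral_mono)

lemma step_add: "step \<theta> (\<lambda>x. f x + g x) x = step \<theta> f x + step \<theta> g x"
  unfolding step_def by (rule nn_integral_add) auto

lemma step_cmult: "step \<theta> (\<lambda>x. c * f x) x = c * step \<theta> f x"
  unfolding step_def by (rule nn_integral_cmult) auto

lemma nn_integral_step: "(\<integral>\<^sup>+x. step \<theta> f x \<partial>count_space UNIV) = (\<integral>\<^sup>+x. f x \<partial>count_space UNIV)"
  unfolding step_def nn_integral_count_space_pmf_swap nn_integral_count_space_shift by simp

lemma step_pow: "(step \<theta> ^^ n) f x = (\<integral>\<^sup>+y. f (x + y) \<partial>walk \<theta> n)"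
proof (induction n arbitrary: x)
  case (Suc n)
  have "(step \<theta> ^^ Suc n) f x = (\<integral>\<^sup>+y. (\<integral>\<^sup>+z. f (x + (y + z)) \<partial>walk \<theta> n) \<partial>walk \<theta> (Suc 0))"
    unfolding walk_1 by (simp add: step_def Suc.IH add.assoc)
  also have "\<dots> = (\<integral>\<^sup>+y. f (x + y) \<partial>walk \<theta> (Suc 0 + n))" by (rule nn_integral_walk_add[symmetric])
  finally show ?case by simp
qed simp

lemma step_pmf_walk: "step \<theta> (\<lambda>x. ennreal (pmf (walk \<theta> n) (a - x))) x = ennreal (pmf (walk \<theta> (Suc n)) (a - x))"
  unfolding step_def pmf_walk_Suc by (simp add: algebra_simps)

text \<open>Summation over all times turns iterated steps into convolution with the Green function.\<close>

lemma green_operator: "(\<Sum>n. (step \<theta> ^^ n) f x) = (\<integral>\<^sup>+z. green \<theta> (z - x) * f z \<partial>count_space UNIV)"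
proof -
  have "(step \<theta> ^^ n) f x = (\<integral>\<^sup>+z. ennreal (pmf (walk \<theta> n) (z - x)) * f z \<partial>count_space UNIV)" for n
  proof -
    have "(step \<theta> ^^ n) f x = (\<integral>\<^sup>+y. ennreal (pmf (walk \<theta> n) (x + y - x)) * f (x + y) \<partial>count_space UNIV)"
      unfolding step_pow nn_integral_measure_pmf by simp
    also have "\<dots> = (\<integral>\<^sup>+z. ennreal (pmf (walk \<theta> n) (z - x)) * f z \<partial>count_space UNIV)"
      by (rule nn_integral_count_space_shift(2)[of "\<lambda>z. ennreal (pmf (walk \<theta> n) (z - x)) * f z"])
    finally show ?thesis .
  qed
  then have "(\<Sum>n. (step \<theta> ^^ n) f x) = (\<Sum>n. \<integral>\<^sup>+z. ennreal (pmf (walk \<theta> n) (z - x)) * f z \<partial>count_space UNIV)"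
    by simp
  also have "\<dots> = (\<integral>\<^sup>+z. (\<Sum>n. ennreal (pmf (walk \<theta> n) (z - x)) * f z) \<partial>count_space UNIV)"
    by (rule nn_integral_suminf[symmetric]) simp
  also have "\<dots> = (\<integral>\<^sup>+z. green \<theta> (z - x) * f z \<partial>count_space UNIV)"
    unfolding green_def by (simp add: ennreal_suminf_multc)
  finally show ?thesis .
qed

text \<open>The walk survives at \<open>x\<close> with probability \<open>q x\<close> and is killed there with probability \<open>k x\<close>.\<close>

locale killing =
  fixes \<theta> :: "'a::ab_group_add pmf" and q k :: "'a \<Rightarrow> ennreal"
  assumes q_plus_k: "\<And>x. q x + k x = 1"
begin

lemma q_le_1: "q x \<le> 1"
  using q_plus_k[of x] by (metis le_iff_add)

definition kstep :: "('a \<Rightarrow> ennreal) \<Rightarrow> 'a \<Rightarrow> ennreal" where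
  "kstep f x = q x * step \<theta> f x"

lemma kstep_le: "kstep f x \<le> step \<theta> f x"
  unfolding kstep_def using mult_right_mono[OF q_le_1] by fastforce

lemma step_split: "step \<theta> f x = kstep f x + k x * step \<theta> f x"
  unfolding kstep_def using q_plus_k[of x] by (simp add: distrib_right[symmetric])

lemma kstep_mono: "(\<And>x. f x \<le> g x) \<Longrightarrow> kstep f x \<le> kstep g x"
  unfolding kstep_def by (intro mult_left_mono step_mono) auto

lemma kstep_add: "kstep (\<lambda>x. f x + g x) x = kstep f x + kstep g x"
  unfolding kstep_def step_add by (simp add: distrib_left)

text \<open>As a function of \<open>x\<close>, the weight of the walks that go from \<open>x\<close> to \<open>a\<close> in \<open>n\<close> steps and survive at all points but the last. Seen
  from \<open>a\<close>, it is the distribution at time \<open>n\<close> of a walk with the opposite steps that is killed where it lands.\<close>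

definition killed_walk :: "'a \<Rightarrow> nat \<Rightarrow> 'a \<Rightarrow> ennreal" where
  "killed_walk a n = (kstep ^^ n) (indicator {a})"

lemma killed_walk_0 [simp]: "killed_walk a 0 = indicator {a}" and killed_walk_Suc: "killed_walk a (Suc n) = kstep (killed_walk a n)"
  by (simp_all add: killed_walk_def)

lemma killed_walk_add: "killed_walk a (m + n) = (kstep ^^ n) (killed_walk a m)"
  by (simp add: killed_walk_def funpow_add[symmetric, unfolded o_def] add.commute[of m n] fun_eq_iff)
     (metis comp_apply funpow_add)

lemma killed_walk_le: "killed_walk a n x \<le> ennreal (pmf (walk \<theta> n) (a - x))"
proof (induction n arbitrary: x)
  case 0 then show ?case by (auto simp: indicator_def)
next
  case (Suc n)
  have "killed_walk a (Suc n) x \<le> step \<theta> (killed_walk a n) x" unfolding killed_walk_Suc by (rule kstep_le)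
  also have "\<dots> \<le> step \<theta> (\<lambda>x. ennreal (pmf (walk \<theta> n) (a - x))) x" by (intro step_mono Suc.IH)
  finally show ?case unfolding step_pmf_walk .
qed

definition mass :: "'a \<Rightarrow> nat \<Rightarrow> ennreal" where
  "mass a n = (\<integral>\<^sup>+x. killed_walk a n x \<partial>count_space UNIV)"

lemma mass_0 [simp]: "mass a 0 = 1"
  by (simp add: mass_def)

lemma mass_Suc_le: "mass a (Suc n) \<le> mass a n"
  unfolding mass_def killed_walk_Suc nn_integral_step[of \<theta> "killed_walk a n", symmetric]
  by (intro nn_integral_mono kstep_le)

lemma mass_antimono: "m \<le> n \<Longrightarrow> mass a n \<le> mass a m"
  by (rule lift_Suc_antimono_le[of "mass a"]) (auto intro: mass_Suc_le)

lemma mass_le_1: "mass a n \<le> 1"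
  using mass_antimono[of 0 n a] by simp

text \<open>The visits of the free walk after time \<open>M\<close>; they bound what the killed walk can still do.\<close>

definition late :: "'a \<Rightarrow> nat \<Rightarrow> 'a \<Rightarrow> ennreal" where
  "late a M z = (\<Sum>i. ennreal (pmf (walk \<theta> (M + i)) (a - z)))"

definition late_killing :: "'a \<Rightarrow> nat \<Rightarrow> ennreal" where
  "late_killing a M = (\<integral>\<^sup>+z. k z * late a M z \<partial>count_space UNIV)"

lemma late_le: "late a M z \<le> green \<theta> (a - z)"
proof -
  have "green \<theta> (a - z) = (\<Sum>i. ennreal (pmf (walk \<theta> (i + M)) (a - z))) + (\<Sum>i<M. ennreal (pmf (walk \<theta> i) (a - z)))"
    unfolding green_def by (subst suminf_offset[of _ M]) (auto simp: add.commute)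
  then show ?thesis by (simp add: late_def add.commute)
qed

lemma mass_split: "mass a n \<le> mass a (Suc n) + (\<integral>\<^sup>+z. k z * ennreal (pmf (walk \<theta> (Suc n)) (a - z)) \<partial>count_space UNIV)"
proof -
  have "mass a n = (\<integral>\<^sup>+x. killed_walk a (Suc n) x + k x * step \<theta> (killed_walk a n) x \<partial>count_space UNIV)"
    unfolding mass_def nn_integral_step[of \<theta> "killed_walk a n", symmetric] killed_walk_Suc
    by (intro nn_integral_cong) (rule step_split)
  also have "\<dots> = mass a (Suc n) + (\<integral>\<^sup>+x. k x * step \<theta> (killed_walk a n) x \<partial>count_space UNIV)"
    unfolding mass_def by (rule nn_integral_add) auto
  also have "(\<integral>\<^sup>+x. k x * step \<theta> (killed_walk a n) x \<partial>count_space UNIV) \<le> (\<integral>\<^sup>+z. k z * ennreal (pmf (walk \<theta> (Suc n)) (a - z)) \<partial>count_space UNIV)"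
    unfolding step_pmf_walk[symmetric] by (intro nn_integral_mono mult_left_mono step_mono killed_walk_le) auto
  finally show ?thesis by (simp add: add_left_mono)
qed

text \<open>What has disappeared was killed at a visit of the free walk.\<close>

lemma mass_lower: "1 \<le> mass a n + late_killing a 0"
proof -
  have "1 \<le> mass a n + (\<Sum>i<n. \<integral>\<^sup>+z. k z * ennreal (pmf (walk \<theta> (Suc i)) (a - z)) \<partial>count_space UNIV)"
  proof (induction n)
    case (Suc n)
    have "1 \<le> mass a n + (\<Sum>i<n. \<integral>\<^sup>+z. k z * ennreal (pmf (walk \<theta> (Suc i)) (a - z)) \<partial>count_space UNIV)" by (rule Suc)
    also have "\<dots> \<le> (mass a (Suc n) + (\<integral>\<^sup>+z. k z * ennreal (pmf (walk \<theta> (Suc n)) (a - z)) \<partial>count_space UNIV)) + (\<Sum>i<n. \<integral>\<^sup>+z. k z * ennreal (pmf (walk \<theta> (Suc i)) (a - z)) \<partial>count_space UNIV)"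
      by (intro add_right_mono mass_split)
    finally show ?case by (simp only: sum.lessThan_Suc add_ac)
  qed simp
  also have "(\<Sum>i<n. \<integral>\<^sup>+z. k z * ennreal (pmf (walk \<theta> (Suc i)) (a - z)) \<partial>count_space UNIV) = (\<integral>\<^sup>+z. k z * (\<Sum>i<n. ennreal (pmf (walk \<theta> (Suc i)) (a - z))) \<partial>count_space UNIV)"
    by (simp add: nn_integral_sum[symmetric] sum_distrib_left del: sum_ennreal walk.simps)
  also have "\<dots> \<le> late_killing a 0"
    unfolding late_killing_def
  proof (intro nn_integral_mono mult_left_mono)
    fix z
    have "(\<Sum>i<n. ennreal (pmf (walk \<theta> (Suc i)) (a - z))) = (\<Sum>i\<in>{1..<Suc n}. ennreal (pmf (walk \<theta> i) (a - z)))"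
      by (rule sum.reindex_bij_witness[where i="\<lambda>i. i - 1" and j=Suc]) (auto simp del: walk.simps)
    also have "\<dots> \<le> (\<Sum>i. ennreal (pmf (walk \<theta> i) (a - z)))"
      by (rule sum_le_suminf) auto
    finally show "(\<Sum>i<n. ennreal (pmf (walk \<theta> (Suc i)) (a - z))) \<le> late a 0 z" by (simp add: late_def)
  qed simp
  finally show ?thesis by (simp add: add_left_mono)
qed

text \<open>Both Green operators solve a first step equation. The difference of the two is again a Green function of the free walk, applied to
  what is killed. The proof compares partial sums, as the equations cannot be subtracted for infinite values.\<close>

lemma green_operator_comparison:
  "(\<Sum>n. (step \<theta> ^^ n) f x) \<le> (\<Sum>n. (kstep ^^ n) f x) + (\<Sum>n. (step \<theta> ^^ n) (\<lambda>z. k z * (\<Sum>n. (step \<theta> ^^ n) f z)) x)"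
proof -
  define U where "U n x = (\<Sum>m<n. (step \<theta> ^^ m) f x)" for n x
  define V where "V n x = (\<Sum>m<n. (kstep ^^ m) f x)" for n x
  define g where "g z = k z * (\<Sum>n. (step \<theta> ^^ n) f z)" for z
  define H where "H n x = (\<Sum>m<n. (step \<theta> ^^ m) g x)" for n x
  have step_sum: "step \<theta> (\<lambda>x. \<Sum>m<n. F m x) x = (\<Sum>m<n. step \<theta> (F m) x)" for F :: "nat \<Rightarrow> 'a \<Rightarrow> ennreal" and n x
    unfolding step_def by (rule nn_integral_sum) auto
  have kstep_sum: "kstep (\<lambda>x. \<Sum>m<n. F m x) x = (\<Sum>m<n. kstep (F m) x)" for F :: "nat \<Rightarrow> 'a \<Rightarrow> ennreal" and n x
    unfolding kstep_def step_sum by (simp add: sum_distrib_left)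
  have US: "U (Suc n) x = f x + step \<theta> (U n) x" for n x
    unfolding U_def sum.lessThan_Suc_shift step_sum by simp
  have VS: "V (Suc n) x = f x + kstep (V n) x" for n x
    unfolding V_def sum.lessThan_Suc_shift kstep_sum by simp
  have HS: "H (Suc n) x = g x + step \<theta> (H n) x" for n x
    unfolding H_def sum.lessThan_Suc_shift step_sum by simp
  \<comment> \<open>Bounding the partial sum by the full Green function in the killed part keeps the recursion for \<open>H\<close> closed.\<close>
  have UU: "step \<theta> (U n) x \<le> (\<Sum>n. (step \<theta> ^^ n) f x)" for n x
  proof -
    have "step \<theta> (U n) x \<le> U (Suc n) x" unfolding US by simp
    also have "\<dots> \<le> (\<Sum>n. (step \<theta> ^^ n) f x)" unfolding U_def by (rule sum_le_suminf) auto
    finally show ?thesis .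
  qed
  have main: "U n x \<le> V n x + H n x" for n x
  proof (induction n arbitrary: x)
    case 0 then show ?case by (simp add: U_def)
  next
    case (Suc n)
    have "U (Suc n) x = f x + (kstep (U n) x + k x * step \<theta> (U n) x)"
      unfolding US using step_split by simp
    also have "\<dots> \<le> f x + (kstep (\<lambda>x. V n x + H n x) x + g x)"
      unfolding g_def by (intro add_left_mono add_mono kstep_mono Suc.IH mult_left_mono UU) auto
    also have "\<dots> \<le> f x + (kstep (V n) x + step \<theta> (H n) x + g x)"
      unfolding kstep_add by (intro add_left_mono add_right_mono kstep_le)
    also have "\<dots> = V (Suc n) x + H (Suc n) x" unfolding VS HS by (simp only: add_ac)
    finally show ?case .
  qed
  have "U n x \<le> (\<Sum>n. (kstep ^^ n) f x) + (\<Sum>n. (step \<theta> ^^ n) g x)" for n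
  proof -
    have "V n x \<le> (\<Sum>n. (kstep ^^ n) f x)" "H n x \<le> (\<Sum>n. (step \<theta> ^^ n) g x)"
      unfolding V_def H_def by (auto intro!: sum_le_suminf)
    then show ?thesis using main[of n x] by (meson add_mono order_trans)
  qed
  then show ?thesis unfolding g_def[symmetric] U_def by (subst suminf_eq_SUP) (auto intro!: SUP_least)
qed

lemma step_pow_pmf: "(step \<theta> ^^ i) (\<lambda>z. ennreal (pmf (walk \<theta> M) (a - z))) x = ennreal (pmf (walk \<theta> (M + i)) (a - x))"
proof (induction i arbitrary: x)
  case (Suc i)
  have "(step \<theta> ^^ Suc i) (\<lambda>z. ennreal (pmf (walk \<theta> M) (a - z))) x = step \<theta> (\<lambda>x. ennreal (pmf (walk \<theta> (M + i)) (a - x))) x"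
    by (simp add: Suc.IH[abs_def] del: walk.simps)
  then show ?case unfolding step_pmf_walk by simp
qed simp

lemma step_pow_mono: "(\<And>x. f x \<le> g x) \<Longrightarrow> (step \<theta> ^^ n) f x \<le> (step \<theta> ^^ n) g x"
  unfolding step_pow by (intro nn_integral_mono)

lemma kstep_pow_le: "(kstep ^^ n) f x \<le> (step \<theta> ^^ n) f x"
proof (induction n arbitrary: x)
  case (Suc n)
  have "(kstep ^^ Suc n) f x \<le> step \<theta> ((kstep ^^ n) f) x" by (simp add: kstep_le)
  also have "\<dots> \<le> step \<theta> ((step \<theta> ^^ n) f) x" by (intro step_mono Suc.IH)
  finally show ?case by simp
qed simp

lemma late_eq: "(\<Sum>i. (step \<theta> ^^ i) (\<lambda>z. ennreal (pmf (walk \<theta> M) (a - z))) x) = late a M x"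
  unfolding step_pow_pmf late_def ..

lemma killed_green_upper: "(\<Sum>n. killed_walk a (M + n) x) \<le> (\<integral>\<^sup>+z. green \<theta> (z - x) * killed_walk a M z \<partial>count_space UNIV)"
  unfolding killed_walk_add green_operator[symmetric] by (intro suminf_le kstep_pow_le) auto

lemma killed_green_lower:
  "(\<integral>\<^sup>+z. green \<theta> (z - x) * killed_walk a M z \<partial>count_space UNIV)
    \<le> (\<Sum>n. killed_walk a (M + n) x) + (\<integral>\<^sup>+z. green \<theta> (z - x) * (k z * late a M z) \<partial>count_space UNIV)"
proof -
  have "(\<Sum>n. (step \<theta> ^^ n) (killed_walk a M) z) \<le> late a M z" for z
    unfolding late_eq[symmetric] by (intro suminf_le step_pow_mono killed_walk_le) auto
  then have "(\<Sum>n. (step \<theta> ^^ n) (\<lambda>z. k z * (\<Sum>n. (step \<theta> ^^ n) (killed_walk a M) z)) x) \<le> (\<Sum>n. (step \<theta> ^^ n) (\<lambda>z. k z * late a M z) x)"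
    by (intro suminf_le step_pow_mono mult_left_mono) auto
  then show ?thesis
    using green_operator_comparison[of "killed_walk a M" x] unfolding killed_walk_add green_operator[symmetric]
    by (meson add_left_mono order_trans)
qed

text \<open>The probability that the walk with the opposite steps survives for \<open>n\<close> steps, by the position \<open>x\<close> of its start; it is not exposed
  to killing at \<open>x\<close> itself.\<close>

primrec survival :: "nat \<Rightarrow> 'a \<Rightarrow> ennreal" where
  "survival 0 x = 1"
| "survival (Suc n) x = (\<integral>\<^sup>+y. q (x - y) * survival n (x - y) \<partial>\<theta>)"

text \<open>Transposing one step of the killed walk.\<close>

lemma kstep_dual:
  "(\<integral>\<^sup>+x. \<phi> x * kstep f x \<partial>count_space UNIV) = (\<integral>\<^sup>+z. f z * (\<integral>\<^sup>+y. q (z - y) * \<phi> (z - y) \<partial>\<theta>) \<partial>count_space UNIV)"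
proof -
  have "(\<integral>\<^sup>+x. \<phi> x * kstep f x \<partial>count_space UNIV) = (\<integral>\<^sup>+x. (\<integral>\<^sup>+y. \<phi> x * q x * f (x + y) \<partial>\<theta>) \<partial>count_space UNIV)"
    unfolding kstep_def step_def by (simp add: nn_integral_cmult mult.assoc)
  also have "\<dots> = (\<integral>\<^sup>+y. (\<integral>\<^sup>+x. \<phi> x * q x * f (x + y) \<partial>count_space UNIV) \<partial>\<theta>)"
    by (rule nn_integral_count_space_pmf_swap)
  also have "\<dots> = (\<integral>\<^sup>+y. (\<integral>\<^sup>+z. f z * (q (z - y) * \<phi> (z - y)) \<partial>count_space UNIV) \<partial>\<theta>)"
    using nn_integral_count_space_shift(1)[of "\<lambda>z. f z * (q (z - y) * \<phi> (z - y))" y for y]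
    by (simp add: mult_ac)
  also have "\<dots> = (\<integral>\<^sup>+z. (\<integral>\<^sup>+y. f z * (q (z - y) * \<phi> (z - y)) \<partial>\<theta>) \<partial>count_space UNIV)"
    by (rule nn_integral_count_space_pmf_swap[symmetric])
  finally show ?thesis by (simp add: nn_integral_cmult)
qed

lemma nn_integral_kstep_pow: "(\<integral>\<^sup>+x. (kstep ^^ n) f x \<partial>count_space UNIV) = (\<integral>\<^sup>+z. f z * survival n z \<partial>count_space UNIV)"
proof (induction n arbitrary: f)
  case (Suc n)
  have "(\<integral>\<^sup>+x. (kstep ^^ Suc n) f x \<partial>count_space UNIV) = (\<integral>\<^sup>+z. kstep f z * survival n z \<partial>count_space UNIV)"
    unfolding funpow_Suc_right o_def by (rule Suc.IH)
  then show ?case using kstep_dual[of "survival n" f] by (simp add: mult.commute)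
qed simp

lemma mass_eq_survival: "mass a n = survival n a"
  unfolding mass_def killed_walk_def nn_integral_kstep_pow by (simp add: mult.commute[of "indicator {a} _"] one_ennreal_def[symmetric] nn_integral_count_space_indicator[symmetric])

lemma survival_antimono: "m \<le> n \<Longrightarrow> survival n x \<le> survival m x"
  using mass_antimono unfolding mass_eq_survival .

definition escape :: "'a \<Rightarrow> ennreal" where
  "escape a = (INF n. mass a n)"

lemma mass_tendsto: "mass a \<longlonglongrightarrow> escape a"
  unfolding escape_def by (rule LIMSEQ_INF) (auto simp: antimono_def intro: mass_antimono)

lemma escape_step_le: "ennreal (pmf \<theta> y) * (q (x - y) * escape (x - y)) \<le> escape x"
  unfolding escape_def[of x]
proof (rule INF_greatest)
  fix n
  have "ennreal (pmf \<theta> y) * (q (x - y) * escape (x - y)) \<le> ennreal (pmf \<theta> y) * (q (x - y) * survival n (x - y))"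
    unfolding escape_def mass_eq_survival by (intro mult_left_mono INF_lower) auto
  also have "\<dots> = (\<integral>\<^sup>+z. ennreal (pmf \<theta> z) * (q (x - z) * survival n (x - z)) * indicator {y} z \<partial>count_space UNIV)"
    by (subst nn_integral_count_space_indicator[symmetric]) (auto simp: nn_integral_count_space_finite)
  also have "\<dots> \<le> (\<integral>\<^sup>+z. ennreal (pmf \<theta> z) * (q (x - z) * survival n (x - z)) \<partial>count_space UNIV)"
    by (intro nn_integral_mono) (auto simp: indicator_def)
  also have "\<dots> = survival (Suc n) x" by (simp add: nn_integral_measure_pmf)
  also have "\<dots> \<le> mass x n" unfolding mass_eq_survival by (rule survival_antimono) simp
  finally show "ennreal (pmf \<theta> y) * (q (x - y) * escape (x - y)) \<le> mass x n" .
qed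

text \<open>If no escape were possible from \<open>K\<close>, none would be possible from any point that the walk can reach, because the walk survives
  outside of \<open>K\<close> with positive probability. From each of these points the expected killing would then be at least \<open>1\<close>; but on average over
  the position at time \<open>M\<close> it is \<open>late_killing a M\<close>.\<close>

lemma escape_positive:
  assumes pos: "\<And>x. x \<notin> K \<Longrightarrow> q x > 0" and a: "a \<in> K"
    and lim: "late_killing a M < 1"
  shows "\<exists>b\<in>K. escape b > 0"
proof (rule ccontr)
  assume "\<not> ?thesis"
  then have K0: "escape b = 0" if "b \<in> K" for b using that by (auto simp: not_less)
  have reach: "pmf (walk \<theta> n) (a - z) > 0 \<Longrightarrow> escape z = 0" for n z
  proof (induction n arbitrary: z)
    case 0
    then show ?case using K0[OF a] by (auto simp: indicator_def split: if_splits)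
  next
    case (Suc n)
    have "step \<theta> (\<lambda>x. ennreal (pmf (walk \<theta> n) (a - x))) z \<noteq> 0"
      using Suc.prems unfolding step_pmf_walk by (simp del: walk.simps)
    then have "\<not> (AE y in \<theta>. ennreal (pmf (walk \<theta> n) (a - (z + y))) = 0)"
      unfolding step_def by (subst (asm) nn_integral_0_iff_AE) auto
    then obtain y where y: "y \<in> set_pmf \<theta>" "pmf (walk \<theta> n) (a - (z + y)) > 0"
      by (auto simp: AE_measure_pmf_iff ennreal_eq_0_iff not_le)
    have "escape (z + y) = 0" by (rule Suc.IH[OF y(2)])
    then have "ennreal (pmf \<theta> y) * (q z * escape z) = 0"
      using escape_step_le[of y "z + y"] by simp
    then have "q z = 0 \<or> escape z = 0" using y(1) by (auto simp: set_pmf_iff)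
    then show ?case using K0 pos[of z] by (cases "z \<in> K") auto
  qed
  have one: "1 \<le> escape z + late_killing z 0" for z
  proof -
    have "(\<lambda>n. mass z n + late_killing z 0) \<longlonglongrightarrow> escape z + late_killing z 0"
      by (intro tendsto_intros mass_tendsto)
    then show ?thesis by (rule LIMSEQ_le_const) (auto intro: mass_lower)
  qed
  have "1 = (\<integral>\<^sup>+z. ennreal (pmf (walk \<theta> M) (a - z)) \<partial>count_space UNIV)"
    using nn_integral_count_space_shift(3)[of "\<lambda>z. ennreal (pmf (walk \<theta> M) z)" a]
    by (simp add: nn_integral_pmf measure_pmf.emeasure_space_1[simplified])
  also have "\<dots> \<le> (\<integral>\<^sup>+z. ennreal (pmf (walk \<theta> M) (a - z)) * late_killing z 0 \<partial>count_space UNIV)"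
  proof (intro nn_integral_mono)
    fix z show "ennreal (pmf (walk \<theta> M) (a - z)) \<le> ennreal (pmf (walk \<theta> M) (a - z)) * late_killing z 0"
    proof (cases "pmf (walk \<theta> M) (a - z) > 0")
      case True
      then have "1 \<le> late_killing z 0" using one[of z] reach by simp
      from mult_left_mono[OF this, of "ennreal (pmf (walk \<theta> M) (a - z))"] show ?thesis by simp
    next
      case False
      then have "pmf (walk \<theta> M) (a - z) = 0" using pmf_nonneg[of "walk \<theta> M" "a - z"] by linarith
      then show ?thesis by simp
    qed
  qed
  also have "\<dots> = (\<integral>\<^sup>+z. (\<integral>\<^sup>+y. ennreal (pmf (walk \<theta> M) (a - z)) * (k y * late z 0 y) \<partial>count_space UNIV) \<partial>count_space UNIV)"
    unfolding late_killing_def by (simp add: nn_integral_cmult)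
  also have "\<dots> = (\<integral>\<^sup>+y. (\<integral>\<^sup>+z. ennreal (pmf (walk \<theta> M) (a - z)) * (k y * late z 0 y) \<partial>count_space UNIV) \<partial>count_space UNIV)"
    by (rule nn_integral_count_space_swap)
  also have "\<dots> = (\<integral>\<^sup>+y. k y * late a M y \<partial>count_space UNIV)"
  proof (intro nn_integral_cong)
    fix y
    have conv: "(\<integral>\<^sup>+z. ennreal (pmf (walk \<theta> M) (a - z)) * ennreal (pmf (walk \<theta> i) (z - y)) \<partial>count_space UNIV) = ennreal (pmf (walk \<theta> (M + i)) (a - y))" for i
    proof -
      have "(\<integral>\<^sup>+z. ennreal (pmf (walk \<theta> M) (a - z)) * ennreal (pmf (walk \<theta> i) (z - y)) \<partial>count_space UNIV)
        = (\<integral>\<^sup>+w. ennreal (pmf (walk \<theta> M) (a - (a - w))) * ennreal (pmf (walk \<theta> i) ((a - w) - y)) \<partial>count_space UNIV)"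
        by (rule nn_integral_count_space_shift(3)[symmetric, of "\<lambda>z. ennreal (pmf (walk \<theta> M) (a - z)) * ennreal (pmf (walk \<theta> i) (z - y))" a])
      also have "\<dots> = (\<integral>\<^sup>+w. ennreal (pmf (walk \<theta> i) ((a - y) - w)) \<partial>walk \<theta> M)"
        unfolding nn_integral_measure_pmf by (simp add: algebra_simps)
      finally show ?thesis unfolding pmf_walk_add .
    qed
    have "(\<integral>\<^sup>+z. ennreal (pmf (walk \<theta> M) (a - z)) * (k y * late z 0 y) \<partial>count_space UNIV)
       = (\<integral>\<^sup>+z. k y * (\<Sum>i. ennreal (pmf (walk \<theta> M) (a - z)) * ennreal (pmf (walk \<theta> i) (z - y))) \<partial>count_space UNIV)"
      unfolding late_def ennreal_suminf_cmult by (simp add: mult_ac)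
    also have "\<dots> = k y * (\<integral>\<^sup>+z. (\<Sum>i. ennreal (pmf (walk \<theta> M) (a - z)) * ennreal (pmf (walk \<theta> i) (z - y))) \<partial>count_space UNIV)"
      by (rule nn_integral_cmult) simp
    also have "(\<integral>\<^sup>+z. (\<Sum>i. ennreal (pmf (walk \<theta> M) (a - z)) * ennreal (pmf (walk \<theta> i) (z - y))) \<partial>count_space UNIV)
      = (\<Sum>i. \<integral>\<^sup>+z. ennreal (pmf (walk \<theta> M) (a - z)) * ennreal (pmf (walk \<theta> i) (z - y)) \<partial>count_space UNIV)"
      by (rule nn_integral_suminf) simp
    also have "\<dots> = (\<Sum>i. ennreal (pmf (walk \<theta> (M + i)) (a - y)))" unfolding conv ..
    finally show "(\<integral>\<^sup>+z. ennreal (pmf (walk \<theta> M) (a - z)) * (k y * late z 0 y) \<partial>count_space UNIV) = k y * late a M y"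
      by (simp add: late_def)
  qed
  also have "\<dots> < 1" using lim by (simp add: late_killing_def)
  finally show False by simp
qed

end

section \<open>Asymptotics of the killed Green function\<close>

context centred_walk
begin

lemma filterlim_norm_shift:
  assumes X: "filterlim (\<lambda>i. norm (rvec (X i))) at_top sequentially"
  shows "filterlim (\<lambda>i. norm (rvec (z - X i))) at_top sequentially"
proof -
  have f: "filterlim (\<lambda>i. - norm (rvec z) + norm (rvec (X i))) at_top sequentially"
    by (rule filterlim_tendsto_add_at_top[OF tendsto_const X])
  have le: "- norm (rvec z) + norm (rvec (X i)) \<le> norm (rvec (z - X i))" for i
    using norm_triangle_ineq3[of "rvec (X i)" "rvec z"] by (simp add: rvec_diff norm_minus_commute abs_le_iff)
  show ?thesis by (rule filterlim_at_top_mono[OF f always_eventually]) (intro allI le)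
qed

text \<open>The asymptotics bound the Green function far away; on the remaining ball it is bounded.\<close>

lemma green_uniform_bound:
  "\<exists>C\<ge>0. \<forall>y. y \<noteq> 0 \<longrightarrow> norm (rvec y) ^ (CARD('n) - 2) * enn2real (green \<theta> y) \<le> C"
proof -
  let ?q = "CARD('n) - 2"
  obtain a where a: "a > 0" "\<And>x. a * norm (rvec x) \<le> radius x" using radius_bounds by blast
  obtain B where B: "\<And>x. green (lazy \<theta>) x \<le> ennreal B" using green_lazy_finite by blast
  have "((\<lambda>x. radius x ^ ?q * enn2real (green \<theta> x)) \<longlongrightarrow> green_limit) lattice_at_infinity"
    by (rule tendsto_lattice_at_infinityI) (rule green_asymptotics_seq)
  then have "eventually (\<lambda>x. radius x ^ ?q * enn2real (green \<theta> x) < green_limit + 1) lattice_at_infinity"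
    by (rule order_tendstoD) simp
  then obtain r where r: "\<And>x. r \<le> norm (rvec x) \<Longrightarrow> radius x ^ ?q * enn2real (green \<theta> x) < green_limit + 1"
    unfolding eventually_lattice_at_infinity by blast
  have gB: "enn2real (green \<theta> y) \<le> max B 0" for y
  proof -
    have "green \<theta> y \<le> green (lazy \<theta>) y" unfolding green_eq by (simp add: mult_2)
    also have "\<dots> \<le> ennreal B" by (rule B)
    also have "\<dots> \<le> ennreal (max B 0)" by (intro ennreal_leI) simp
    finally show ?thesis by (rule enn2real_leI[rotated]) simp
  qed
  define C where "C = (green_limit + 1) / a ^ ?q + (max r 0) ^ ?q * max B 0"
  have "norm (rvec y) ^ ?q * enn2real (green \<theta> y) \<le> C" for y
  proof (cases "r \<le> norm (rvec y)")
    case True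
    have "(a * norm (rvec y)) ^ ?q * enn2real (green \<theta> y) \<le> radius y ^ ?q * enn2real (green \<theta> y)"
      using a by (intro mult_right_mono power_mono) auto
    also have "\<dots> \<le> green_limit + 1" using r[OF True] by simp
    finally have "norm (rvec y) ^ ?q * enn2real (green \<theta> y) \<le> (green_limit + 1) / a ^ ?q"
      using a(1) by (simp add: power_mult_distrib field_simps)
    then show ?thesis unfolding C_def by (rule order_trans) simp
  next
    case False
    have "norm (rvec y) ^ ?q * enn2real (green \<theta> y) \<le> (max r 0) ^ ?q * max B 0"
      using False gB by (intro mult_mono power_mono) auto
    moreover have "0 \<le> (green_limit + 1) / a ^ ?q" using green_limit_pos a(1) by simp
    ultimately show ?thesis unfolding C_def by linarith
  qed
  moreover have "C \<ge> 0" using green_limit_pos a(1) by (simp add: C_def)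
  ultimately show ?thesis by blast
qed

lemma radius_nonneg: "0 \<le> radius x"
  unfolding radius_def by (rule norm_ge_zero)

lemma radius_triangle: "radius (x + y) \<le> radius x + radius y"
  unfolding radius_def rvec_add matrix_vector_right_distrib by (rule norm_triangle_ineq)

lemma radius_minus: "radius (x - y) = radius (y - x)"
  unfolding radius_def rvec_diff matrix_vector_mult_diff_distrib by (rule norm_minus_commute)

text \<open>A bounded shift does not change the norm of a far point asymptotically.\<close>

lemma green_asymptotics_shift:
  assumes X: "filterlim (\<lambda>i. norm (rvec (X i))) at_top sequentially"
  shows "(\<lambda>i. radius (X i) ^ (CARD('n) - 2) * enn2real (green \<theta> (z - X i))) \<longlonglongrightarrow> green_limit"
proof -
  let ?q = "CARD('n) - 2"
  define Y where "Y i = z - X i" for i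
  have Y: "filterlim (\<lambda>i. norm (rvec (Y i))) at_top sequentially"
    unfolding Y_def by (rule filterlim_norm_shift[OF X])
  note RY = radius_at_top[OF Y]
  have diff: "\<bar>radius (X i) - radius (Y i)\<bar> \<le> radius z" for i
  proof -
    have "radius (X i) \<le> radius (X i - z) + radius z" using radius_triangle[of "X i - z" z] by simp
    moreover have "radius (z - X i) \<le> radius z + radius (X i - 0) " using radius_triangle[of z "- X i"] radius_minus[of 0 "X i"] by simp
    ultimately show ?thesis using radius_minus[of "X i" z] by (simp add: Y_def abs_le_iff)
  qed
  have Ypos: "eventually (\<lambda>i. radius (Y i) > 0) sequentially"
    using RY by (auto simp: filterlim_at_top_dense)
  have "(\<lambda>i. (radius (X i) - radius (Y i)) / radius (Y i)) \<longlonglongrightarrow> 0"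
  proof (rule Lim_null_comparison)
    show "(\<lambda>i. radius z / radius (Y i)) \<longlonglongrightarrow> 0"
      by (rule tendsto_divide_0[OF tendsto_const filterlim_at_top_imp_at_infinity[OF RY]])
    show "eventually (\<lambda>i. norm ((radius (X i) - radius (Y i)) / radius (Y i)) \<le> radius z / radius (Y i)) sequentially"
      using Ypos by eventually_elim (auto simp: abs_divide intro!: divide_right_mono diff)
  qed
  then have "(\<lambda>i. 1 + (radius (X i) - radius (Y i)) / radius (Y i)) \<longlonglongrightarrow> 1 + 0" by (intro tendsto_intros)
  moreover have "eventually (\<lambda>i. 1 + (radius (X i) - radius (Y i)) / radius (Y i) = radius (X i) / radius (Y i)) sequentially"
    using Ypos by eventually_elim (simp add: field_simps)
  ultimately have ratio: "(\<lambda>i. radius (X i) / radius (Y i)) \<longlonglongrightarrow> 1"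
    using Lim_transform_eventually by fastforce
  have "(\<lambda>i. (radius (X i) / radius (Y i)) ^ ?q * (radius (Y i) ^ ?q * enn2real (green \<theta> (Y i)))) \<longlonglongrightarrow> 1 ^ ?q * green_limit"
    by (intro tendsto_intros ratio green_asymptotics_seq Y)
  moreover have "eventually (\<lambda>i. (radius (X i) / radius (Y i)) ^ ?q * (radius (Y i) ^ ?q * enn2real (green \<theta> (Y i))) = radius (X i) ^ ?q * enn2real (green \<theta> (z - X i))) sequentially"
    using Ypos by eventually_elim (simp add: power_divide Y_def)
  ultimately show ?thesis using Lim_transform_eventually by fastforce
qed

text \<open>The tail bound of order \<open>d - 1\<close> beats the power \<open>d - 2\<close>.\<close>

lemma fixed_time_negligible:
  assumes X: "filterlim (\<lambda>i. norm (rvec (X i))) at_top sequentially"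
  shows "(\<lambda>i. radius (X i) ^ (CARD('n) - 2) * pmf (walk \<theta> n) (a - X i)) \<longlonglongrightarrow> 0"
proof -
  let ?q = "CARD('n) - 2"
  obtain b where b: "b > 0" "\<And>x. radius x \<le> b * norm (rvec x)" using radius_bounds by blast
  obtain C where C: "C \<ge> 0" "\<And>n r. r > 0 \<Longrightarrow> emeasure (walk \<theta> n) {x. r \<le> norm (rvec x)} \<le> ennreal (C * sqrt n ^ (CARD('n) - 1) / r ^ (CARD('n) - 1))"
    using centred_walk_tail by blast
  define D where "D = (2 * b) ^ ?q * (C * sqrt n ^ (CARD('n) - 1))"
  have q1: "CARD('n) - 1 = Suc ?q" using dim by simp
  note Y = filterlim_norm_shift[OF X, of a]
  show ?thesis
  proof (rule Lim_null_comparison)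
    show "(\<lambda>i. D / norm (rvec (a - X i))) \<longlonglongrightarrow> 0"
      by (rule tendsto_divide_0[OF tendsto_const filterlim_at_top_imp_at_infinity[OF Y]])
    have "eventually (\<lambda>i. norm (rvec (a - X i)) > norm (rvec a)) sequentially"
      using Y by (auto simp: filterlim_at_top_dense)
    then show "eventually (\<lambda>i. norm (radius (X i) ^ ?q * pmf (walk \<theta> n) (a - X i)) \<le> D / norm (rvec (a - X i))) sequentially"
    proof eventually_elim
      case (elim i)
      define r where "r = norm (rvec (a - X i))"
      have r: "r > 0" using elim unfolding r_def by (smt (verit) norm_ge_zero)
      have "ennreal (pmf (walk \<theta> n) (a - X i)) = emeasure (walk \<theta> n) {a - X i}" by (simp add: emeasure_pmf_single)
      also have "\<dots> \<le> emeasure (walk \<theta> n) {x. r \<le> norm (rvec x)}" by (intro emeasure_mono) (auto simp: r_def)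
      also have "\<dots> \<le> ennreal (C * sqrt n ^ (CARD('n) - 1) / r ^ (CARD('n) - 1))" by (rule C(2)[OF r])
      finally have pm: "pmf (walk \<theta> n) (a - X i) \<le> C * sqrt n ^ (CARD('n) - 1) / r ^ (CARD('n) - 1)"
        using C(1) r by (subst (asm) ennreal_le_iff) auto
      have "norm (rvec (X i)) \<le> norm (rvec a) + r"
        using norm_triangle_ineq4[of "rvec a" "rvec (a - X i)"] by (simp add: r_def rvec_diff)
      then have "norm (rvec (X i)) \<le> 2 * r" using elim by (simp add: r_def)
      then have "b * norm (rvec (X i)) \<le> b * (2 * r)" using b(1) by (intro mult_left_mono) auto
      then have "radius (X i) \<le> 2 * b * r" using b(2)[of "X i"] by (simp add: mult_ac)
      then have "radius (X i) ^ ?q \<le> (2 * b * r) ^ ?q" by (rule power_mono[OF _ radius_nonneg])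
      then have "radius (X i) ^ ?q * pmf (walk \<theta> n) (a - X i) \<le> (2 * b * r) ^ ?q * (C * sqrt n ^ (CARD('n) - 1) / r ^ (CARD('n) - 1))"
        using pm b r by (intro mult_mono) auto
      also have "\<dots> = D / r" unfolding q1 D_def using r by (simp add: power_mult_distrib)
      finally show ?case by (simp add: r_def radius_def)
    qed
  qed
qed

lemma green_shift_square: "(\<integral>\<^sup>+z. (green \<theta> (a - z))\<^sup>2 \<partial>count_space UNIV) < \<infinity>" "(\<integral>\<^sup>+z. (green \<theta> (z - a))\<^sup>2 \<partial>count_space UNIV) < \<infinity>"
proof -
  have s: "(\<integral>\<^sup>+z. (green \<theta> z)\<^sup>2 \<partial>count_space UNIV) < \<infinity>"
    using green_square_summable by (simp add: power2_eq_square)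
  show "(\<integral>\<^sup>+z. (green \<theta> (a - z))\<^sup>2 \<partial>count_space UNIV) < \<infinity>"
    using s nn_integral_count_space_shift(3)[of "\<lambda>z. (green \<theta> z)\<^sup>2" a] by simp
  show "(\<integral>\<^sup>+z. (green \<theta> (z - a))\<^sup>2 \<partial>count_space UNIV) < \<infinity>"
    using s nn_integral_count_space_shift(1)[of "\<lambda>z. (green \<theta> z)\<^sup>2" "- a"] by simp
qed

end

text \<open>Square summability is the quantitative assumption on the killing: together with that of the Green function it bounds the expected
  killing by the Cauchy--Schwarz inequality.\<close>

locale killed_centred_walk = centred_walk \<theta> + killing \<theta> q k
  for \<theta> :: "(int ^ 'n) pmf" and q k :: "int ^ 'n \<Rightarrow> ennreal" +
  assumes killing_square: "(\<integral>\<^sup>+z. (k z)\<^sup>2 \<partial>count_space UNIV) < \<infinity>"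
begin

lemma late_tendsto_0: "(\<lambda>M. late a M z) \<longlonglongrightarrow> 0"
proof -
  have fin: "(\<Sum>i. ennreal (pmf (walk \<theta> i) (a - z))) \<noteq> \<top>" using green_finite[of "a - z"] by (simp add: green_def)
  have s: "summable (\<lambda>i. pmf (walk \<theta> i) (a - z))" by (rule summable_suminf_not_top[OF _ fin]) simp
  have "late a M z = ennreal (\<Sum>i. pmf (walk \<theta> (i + M)) (a - z))" for M
    unfolding late_def using summable_ignore_initial_segment[OF s, of M]
    by (subst suminf_ennreal2[symmetric]) (auto simp: add.commute)
  then show ?thesis using tendsto_ennrealI[OF suminf_exist_split2[OF s]] by simp
qed

lemma killing_green_finite: "(\<integral>\<^sup>+z. k z * green \<theta> (a - z) \<partial>count_space UNIV) < \<infinity>"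
proof -
  have "(\<integral>\<^sup>+z. k z * green \<theta> (a - z) \<partial>count_space UNIV)\<^sup>2 \<le> (\<integral>\<^sup>+z. (k z)\<^sup>2 \<partial>count_space UNIV) * (\<integral>\<^sup>+z. (green \<theta> (a - z))\<^sup>2 \<partial>count_space UNIV)"
    by (rule Cauchy_Schwarz_nn_integral) auto
  also have "\<dots> < \<infinity>" using killing_square green_shift_square(1) by (simp add: ennreal_mult_less_top)
  finally show ?thesis by (simp add: power_less_top_ennreal)
qed

lemma late_killing_tendsto_0: "late_killing a \<longlonglongrightarrow> 0"
proof -
  have "(\<lambda>M. \<integral>\<^sup>+z. k z * late a M z \<partial>count_space UNIV) \<longlonglongrightarrow> (\<integral>\<^sup>+z. 0 \<partial>count_space (UNIV :: (int^'n) set))"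
  proof (rule nn_integral_dominated_convergence[OF _ _ _ _ killing_green_finite])
    show "AE z in count_space UNIV. k z * late a M z \<le> k z * green \<theta> (a - z)" for M
      by (intro AE_I2 mult_left_mono late_le) auto
    show "AE z in count_space UNIV. (\<lambda>M. k z * late a M z) \<longlonglongrightarrow> 0"
    proof (intro AE_I2)
      fix z
      have "k z < \<top>" using q_plus_k[of z] by (metis ennreal_one_less_top le_iff_add add.commute le_less_trans)
      then show "(\<lambda>M. k z * late a M z) \<longlonglongrightarrow> 0"
        using ennreal_tendsto_cmult[OF _ late_tendsto_0, of "k z" a z] by simp
    qed
  qed auto
  then show ?thesis by (simp add: late_killing_def[abs_def])
qed

context
  fixes X :: "nat \<Rightarrow> int ^ 'n"
  assumes X: "filterlim (\<lambda>i. norm (rvec (X i))) at_top sequentially"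
begin

abbreviation "h i \<equiv> radius (X i) ^ (CARD('n) - 2)"

lemma h_nonneg: "h i \<ge> 0" by (simp add: radius_def)

text \<open>The far point \<open>X i\<close> sees every fixed point that the killed walk can occupy at time \<open>M\<close> like the origin, so the Green functions
  converge pointwise. That no mass is lost in the limit follows from Scheffe's lemma, applied to the free walk: its Green function after time \<open>M\<close> is
  at most the full one, whose asymptotics are known. The weights of the killed walk are smaller than those of the free walk.\<close>

lemma green_of_killed_mass:
  "(\<lambda>i. h i * enn2real (\<integral>\<^sup>+z. green \<theta> (z - X i) * killed_walk a M z \<partial>count_space UNIV)) \<longlonglongrightarrow> green_limit * enn2real (mass a M)"
proof -
  let ?C = "count_space (UNIV :: (int^'n) set)"
  let ?g = "\<lambda>i z. enn2real (green \<theta> (z - X i))"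
  define \<pi> where "\<pi> z = pmf (walk \<theta> M) (a - z)" for z
  define r where "r z = enn2real (killed_walk a M z)" for z
  have killed_walk_fin: "killed_walk a M z < \<top>" for z using killed_walk_le[of a M z] by (rule le_less_trans) simp
  have r: "0 \<le> r z" "r z \<le> \<pi> z" "ennreal (r z) = killed_walk a M z" for z
  proof -
    show "ennreal (r z) = killed_walk a M z" unfolding r_def using killed_walk_fin[of z] by simp
    show "r z \<le> \<pi> z" unfolding r_def \<pi>_def using killed_walk_le[of a M z] by (intro enn2real_leI) auto
  qed (simp add: r_def)
  have g: "ennreal (?g i z) = green \<theta> (z - X i)" for i z using green_finite[of "z - X i"] by simp
  have \<pi>1: "(\<integral>\<^sup>+z. ennreal (\<pi> z) \<partial>?C) = 1"
    using nn_integral_count_space_shift(3)[of "\<lambda>z. ennreal (pmf (walk \<theta> M) z)" a]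
    by (simp add: \<pi>_def nn_integral_pmf measure_pmf.emeasure_space_1[simplified])
  have F\<pi>: "(\<integral>\<^sup>+z. ennreal (norm (h i * ?g i z * \<pi> z)) \<partial>?C) \<le> ennreal (h i * ?g i a)" for i
  proof -
    have "(\<integral>\<^sup>+z. ennreal (norm (h i * ?g i z * \<pi> z)) \<partial>?C) = (\<integral>\<^sup>+z. ennreal (h i) * (green \<theta> (z - X i) * ennreal (\<pi> z)) \<partial>?C)"
    proof (intro nn_integral_cong)
      fix z
      have "norm (h i * ?g i z * \<pi> z) = h i * (?g i z * \<pi> z)" using h_nonneg[of i] by (simp add: abs_mult \<pi>_def)
      then show "ennreal (norm (h i * ?g i z * \<pi> z)) = ennreal (h i) * (green \<theta> (z - X i) * ennreal (\<pi> z))"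
        using h_nonneg[of i] by (simp only: ennreal_mult mult_nonneg_nonneg enn2real_nonneg pmf_nonneg \<pi>_def g)
    qed
    also have "\<dots> = ennreal (h i) * (\<integral>\<^sup>+z. green \<theta> (z - X i) * ennreal (\<pi> z) \<partial>?C)" by (rule nn_integral_cmult) simp
    also have "(\<integral>\<^sup>+z. green \<theta> (z - X i) * ennreal (\<pi> z) \<partial>?C) = late a M (X i)"
      unfolding late_eq[symmetric] green_operator \<pi>_def ..
    also have "ennreal (h i) * late a M (X i) \<le> ennreal (h i) * green \<theta> (a - X i)"
      by (intro mult_left_mono late_le) auto
    also have "\<dots> = ennreal (h i * ?g i a)" using h_nonneg by (simp add: ennreal_mult g)
    finally show ?thesis .
  qed
  have intF: "integrable ?C (\<lambda>z. h i * ?g i z * \<pi> z)" for i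
    unfolding integrable_iff_bounded using F\<pi>[of i] by (auto intro: le_less_trans)
  have int\<pi>: "integrable ?C (\<lambda>z. green_limit * \<pi> z)"
    using \<pi>1 by (intro integrable_mult_right) (auto simp: integrable_iff_bounded \<pi>_def)
  have n\<pi>: "(\<integral>\<^sup>+z. ennreal (norm (green_limit * \<pi> z)) \<partial>?C) = ennreal green_limit"
  proof -
    have "(\<integral>\<^sup>+z. ennreal (norm (green_limit * \<pi> z)) \<partial>?C) = (\<integral>\<^sup>+z. ennreal green_limit * ennreal (\<pi> z) \<partial>?C)"
      using green_limit_pos by (intro nn_integral_cong) (simp add: abs_mult ennreal_mult' \<pi>_def)
    also have "\<dots> = ennreal green_limit" by (subst nn_integral_cmult) (auto simp: \<pi>1)
    finally show ?thesis .
  qed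
  have lim\<pi>: "(\<lambda>i. \<integral>\<^sup>+z. norm (h i * ?g i z * \<pi> z - green_limit * \<pi> z) \<partial>?C) \<longlonglongrightarrow> 0"
  proof (rule Scheffe_lemma1[OF intF int\<pi>])
    show "AE z in ?C. (\<lambda>i. h i * ?g i z * \<pi> z) \<longlonglongrightarrow> green_limit * \<pi> z"
      by (intro AE_I2 tendsto_intros green_asymptotics_shift X)
    have "limsup (\<lambda>i. \<integral>\<^sup>+z. norm (h i * ?g i z * \<pi> z) \<partial>?C) \<le> limsup (\<lambda>i. ennreal (h i * ?g i a))"
      by (intro Limsup_mono always_eventually allI F\<pi>)
    also have "\<dots> = ennreal green_limit"
      by (intro lim_imp_Limsup tendsto_ennrealI green_asymptotics_shift X) simp
    finally show "limsup (\<lambda>i. \<integral>\<^sup>+z. norm (h i * ?g i z * \<pi> z) \<partial>?C) \<le> (\<integral>\<^sup>+z. norm (green_limit * \<pi> z) \<partial>?C)"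
      unfolding n\<pi> .
  qed
  have le: "\<bar>c * r z\<bar> \<le> \<bar>c * \<pi> z\<bar>" for c z
    using r[of z] by (simp add: abs_mult mult_left_mono)
  have intFr: "integrable ?C (\<lambda>z. h i * ?g i z * r z)" for i
    by (rule Bochner_Integration.integrable_bound[OF intF[of i]]) (auto simp: le simp del: abs_mult)
  have intr: "integrable ?C (\<lambda>z. green_limit * r z)"
    by (rule Bochner_Integration.integrable_bound[OF int\<pi>]) (auto simp: le simp del: abs_mult)
  have lim: "(\<lambda>i. \<integral>z. h i * ?g i z * r z \<partial>?C) \<longlonglongrightarrow> (\<integral>z. green_limit * r z \<partial>?C)"
  proof (rule tendsto_L1_int[OF intFr intr])
    show "(\<lambda>i. \<integral>\<^sup>+z. norm (h i * ?g i z * r z - green_limit * r z) \<partial>?C) \<longlonglongrightarrow> 0"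
    proof (rule tendsto_sandwich[OF _ _ tendsto_const lim\<pi>])
      have "norm (h i * ?g i z * r z - green_limit * r z) \<le> norm (h i * ?g i z * \<pi> z - green_limit * \<pi> z)" for i z
        using le[of "h i * ?g i z - green_limit" z] by (simp add: left_diff_distrib)
      then show "eventually (\<lambda>i. (\<integral>\<^sup>+z. norm (h i * ?g i z * r z - green_limit * r z) \<partial>?C) \<le> (\<integral>\<^sup>+z. norm (h i * ?g i z * \<pi> z - green_limit * \<pi> z) \<partial>?C)) sequentially"
        by (intro always_eventually allI nn_integral_mono ennreal_leI)
    qed simp
  qed
  have e1: "(\<integral>z. h i * ?g i z * r z \<partial>?C) = h i * enn2real (\<integral>\<^sup>+z. green \<theta> (z - X i) * killed_walk a M z \<partial>?C)" for i
  proof -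
    have "(\<integral>z. h i * ?g i z * r z \<partial>?C) = h i * (\<integral>z. ?g i z * r z \<partial>?C)"
      by (simp add: mult.assoc)
    also have "(\<integral>z. ?g i z * r z \<partial>?C) = enn2real (\<integral>\<^sup>+z. ennreal (?g i z * r z) \<partial>?C)"
      by (rule integral_eq_nn_integral) (auto simp: r)
    also have "(\<integral>\<^sup>+z. ennreal (?g i z * r z) \<partial>?C) = (\<integral>\<^sup>+z. green \<theta> (z - X i) * killed_walk a M z \<partial>?C)"
      by (intro nn_integral_cong) (simp only: ennreal_mult enn2real_nonneg r g)
    finally show ?thesis .
  qed
  have e2: "(\<integral>z. green_limit * r z \<partial>?C) = green_limit * enn2real (mass a M)"
  proof -
    have "(\<integral>z. r z \<partial>?C) = enn2real (\<integral>\<^sup>+z. ennreal (r z) \<partial>?C)" by (rule integral_eq_nn_integral) (auto simp: r)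
    then show ?thesis by (simp add: r mass_def)
  qed
  show ?thesis using lim unfolding e1 e2 .
qed

text \<open>The points \<open>z\<close> where the walk is killed are split according to their distance from \<open>X i\<close>. Far from \<open>X i\<close> the Green function
  has the order of its value at \<open>X i\<close>, and the killing after time \<open>M\<close> counts. Near \<open>X i\<close> the visits \<open>late a M z\<close> have this order
  instead; there \<open>k\<close> is the square summable tail of a fixed function, and the Cauchy--Schwarz inequality makes the sum vanish in the limit.\<close>

lemma late_killing_contribution:
  "\<exists>C\<ge>0. \<exists>\<delta>. \<delta> \<longlonglongrightarrow> 0 \<and> (\<forall>M. eventually (\<lambda>i. h i * enn2real (\<integral>\<^sup>+z. green \<theta> (z - X i) * (k z * late a M z) \<partial>count_space UNIV)
     \<le> C * enn2real (late_killing a M) + \<delta> i) sequentially)"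
proof -
  let ?q = "CARD('n) - 2"
  let ?C = "count_space (UNIV :: (int^'n) set)"
  obtain b where b: "b > 0" "\<And>x. radius x \<le> b * norm (rvec x)" using radius_bounds by blast
  obtain C0 where C0: "C0 \<ge> 0" "\<And>y. y \<noteq> 0 \<Longrightarrow> norm (rvec y) ^ ?q * enn2real (green \<theta> y) \<le> C0" using green_uniform_bound by blast
  define C where "C = (4 * b) ^ ?q * C0"
  have C: "C \<ge> 0" using b C0 by (simp add: C_def)
  \<comment> \<open>At distance at least a quarter of the norm of \<open>X i\<close>, the Green function is at most of the order of its value at \<open>X i\<close>.\<close>
  have far: "h i * enn2real (green \<theta> y) \<le> C" if y: "norm (rvec (X i)) \<le> 4 * norm (rvec y)" and x: "norm (rvec (X i)) > 0" for i y
  proof -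
    have y0: "y \<noteq> 0" using y x by auto
    have "b * norm (rvec (X i)) \<le> b * (4 * norm (rvec y))" using y b(1) by (intro mult_left_mono) auto
    then have "radius (X i) \<le> 4 * b * norm (rvec y)" using b(2)[of "X i"] by (simp add: mult_ac)
    then have "h i \<le> (4 * b * norm (rvec y)) ^ ?q" by (rule power_mono[OF _ radius_nonneg])
    then have "h i * enn2real (green \<theta> y) \<le> (4 * b * norm (rvec y)) ^ ?q * enn2real (green \<theta> y)"
      by (intro mult_right_mono) auto
    also have "\<dots> = (4 * b) ^ ?q * (norm (rvec y) ^ ?q * enn2real (green \<theta> y))" by (simp add: power_mult_distrib)
    also have "\<dots> \<le> C" unfolding C_def using b by (intro mult_left_mono C0 y0) auto
    finally show ?thesis .
  qed
  \<comment> \<open>\<open>A i\<close> contains the points near \<open>X i\<close>; \<open>N i\<close> is their contribution with the visits to \<open>z\<close> factored out.\<close>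
  define A where "A i = {z :: int ^ 'n. norm (rvec (X i)) \<le> 2 * norm (rvec z)}" for i
  define N where "N i = (\<integral>\<^sup>+z. green \<theta> (z - X i) * (k z * indicator (A i) z) \<partial>?C)" for i
  have N0: "(\<lambda>i. enn2real (N i)) \<longlonglongrightarrow> 0"
  proof -
    define S where "S = (\<integral>\<^sup>+z. (green \<theta> z)\<^sup>2 \<partial>?C)"
    have S: "S < \<infinity>" using green_shift_square(2)[of 0] by (simp add: S_def)
    define K where "K i = (\<integral>\<^sup>+z. (k z * indicator (A i) z)\<^sup>2 \<partial>?C)" for i
    have "K \<longlonglongrightarrow> (\<integral>\<^sup>+z. 0 \<partial>?C)"
      unfolding K_def[abs_def]
    proof (rule nn_integral_dominated_convergence[OF _ _ _ _ killing_square])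
      show "AE z in ?C. (k z * indicator (A i) z)\<^sup>2 \<le> (k z)\<^sup>2" for i
        by (intro AE_I2) (auto simp: indicator_def)
      show "AE z in ?C. (\<lambda>i. (k z * indicator (A i) z)\<^sup>2) \<longlonglongrightarrow> 0"
      proof (intro AE_I2)
        fix z :: "int ^ 'n"
        have "eventually (\<lambda>i. norm (rvec (X i)) > 2 * norm (rvec z)) sequentially"
          using X by (auto simp: filterlim_at_top_dense)
        then have "eventually (\<lambda>i. (k z * indicator (A i) z)\<^sup>2 = 0) sequentially"
          by eventually_elim (auto simp: A_def)
        then show "(\<lambda>i. (k z * indicator (A i) z)\<^sup>2) \<longlonglongrightarrow> 0" by (rule tendsto_eventually)
      qed
    qed auto
    then have K0: "K \<longlonglongrightarrow> 0" by simp
    have CS: "(N i)\<^sup>2 \<le> S * K i" for i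
    proof -
      have "(N i)\<^sup>2 \<le> (\<integral>\<^sup>+z. (green \<theta> (z - X i))\<^sup>2 \<partial>?C) * K i"
        unfolding N_def K_def by (rule Cauchy_Schwarz_nn_integral) auto
      also have "(\<integral>\<^sup>+z. (green \<theta> (z - X i))\<^sup>2 \<partial>?C) = S"
        unfolding S_def using nn_integral_count_space_shift(1)[of "\<lambda>z. (green \<theta> z)\<^sup>2" "- X i"] by simp
      finally show ?thesis .
    qed
    have "(\<lambda>i. S * K i) \<longlonglongrightarrow> S * 0" using ennreal_tendsto_cmult[OF _ K0, of S] S by simp
    then have "(\<lambda>i. (N i)\<^sup>2) \<longlonglongrightarrow> 0"
      using tendsto_sandwich[of "\<lambda>_. 0" "\<lambda>i. (N i)\<^sup>2" sequentially "\<lambda>i. S * K i" 0] CS by simp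
    then have "(\<lambda>i. enn2real ((N i)\<^sup>2)) \<longlonglongrightarrow> 0" by (intro tendsto_enn2real) auto
    then have "(\<lambda>i. (enn2real (N i))\<^sup>2) \<longlonglongrightarrow> 0" by (simp add: power2_eq_square enn2real_mult)
    from tendsto_real_sqrt[OF this] show ?thesis by simp
  qed
  have Nfin: "N i < \<infinity>" for i
  proof -
    have "(N i)\<^sup>2 \<le> (\<integral>\<^sup>+z. (green \<theta> (z - X i))\<^sup>2 \<partial>?C) * (\<integral>\<^sup>+z. (k z * indicator (A i) z)\<^sup>2 \<partial>?C)"
      unfolding N_def by (rule Cauchy_Schwarz_nn_integral) auto
    also have "\<dots> \<le> (\<integral>\<^sup>+z. (green \<theta> (z - X i))\<^sup>2 \<partial>?C) * (\<integral>\<^sup>+z. (k z)\<^sup>2 \<partial>?C)"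
      by (intro mult_left_mono nn_integral_mono) (auto simp: indicator_def)
    also have "\<dots> < \<infinity>" using killing_square green_shift_square(2) by (simp add: ennreal_mult_less_top)
    finally show ?thesis by (simp add: power_less_top_ennreal)
  qed
  have "eventually (\<lambda>i. h i * enn2real (\<integral>\<^sup>+z. green \<theta> (z - X i) * (k z * late a M z) \<partial>?C) \<le> C * enn2real (late_killing a M) + C * enn2real (N i)) sequentially" for M
  proof -
    have lk: "late_killing a M < \<infinity>"
    proof -
      have "late_killing a M \<le> (\<integral>\<^sup>+z. k z * green \<theta> (a - z) \<partial>?C)"
        unfolding late_killing_def by (intro nn_integral_mono mult_left_mono late_le) auto
      then show ?thesis using killing_green_finite[of a] by (rule le_less_trans)
    qed
    have "eventually (\<lambda>i. norm (rvec (X i)) > 4 * norm (rvec a)) sequentially"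
      using X by (auto simp: filterlim_at_top_dense)
    then show ?thesis
    proof eventually_elim
      case (elim i)
      have x: "norm (rvec (X i)) > 0" using elim by (smt (verit) norm_ge_zero)
      have pt: "ennreal (h i) * (green \<theta> (z - X i) * (k z * late a M z)) \<le> ennreal C * (k z * late a M z) + ennreal C * (green \<theta> (z - X i) * (k z * indicator (A i) z))" for z
      proof (cases "norm (rvec (X i)) \<le> 2 * norm (rvec (z - X i))")
        case True
        have "ennreal (h i) * green \<theta> (z - X i) = ennreal (h i * enn2real (green \<theta> (z - X i)))"
          using h_nonneg green_finite[of "z - X i"] by (simp add: ennreal_mult)
        also have "\<dots> \<le> ennreal C" using far[of i "z - X i"] True x by (intro ennreal_leI) auto
        finally have "ennreal (h i) * green \<theta> (z - X i) * (k z * late a M z) \<le> ennreal C * (k z * late a M z)"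
          by (rule mult_right_mono) simp
        then show ?thesis by (simp add: mult.assoc add_increasing2)
      next
        case False
        have "norm (rvec (X i)) \<le> norm (rvec (z - X i)) + norm (rvec z)"
          using norm_triangle_ineq4[of "rvec z" "rvec (z - X i)"] by (simp add: rvec_diff)
        then have zA: "z \<in> A i" and z2: "norm (rvec (X i)) \<le> 2 * norm (rvec z)" using False by (auto simp: A_def)
        have "norm (rvec z) \<le> norm (rvec (a - z)) + norm (rvec a)"
          using norm_triangle_ineq4[of "rvec a" "rvec (a - z)"] by (simp add: rvec_diff)
        then have "norm (rvec (X i)) \<le> 4 * norm (rvec (a - z))" using z2 elim by linarith
        then have f: "h i * enn2real (green \<theta> (a - z)) \<le> C" using x by (rule far)
        have "ennreal (h i) * late a M z \<le> ennreal (h i) * green \<theta> (a - z)" by (intro mult_left_mono late_le) auto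
        also have "\<dots> = ennreal (h i * enn2real (green \<theta> (a - z)))"
          using h_nonneg green_finite[of "a - z"] by (simp add: ennreal_mult)
        also have "\<dots> \<le> ennreal C" using f by (rule ennreal_leI)
        finally have "ennreal (h i) * late a M z * (green \<theta> (z - X i) * k z) \<le> ennreal C * (green \<theta> (z - X i) * k z)"
          by (rule mult_right_mono) simp
        then show ?thesis using zA by (simp add: mult_ac add_increasing)
      qed
      have "ennreal (h i) * (\<integral>\<^sup>+z. green \<theta> (z - X i) * (k z * late a M z) \<partial>?C) = (\<integral>\<^sup>+z. ennreal (h i) * (green \<theta> (z - X i) * (k z * late a M z)) \<partial>?C)"
        by (rule nn_integral_cmult[symmetric]) simp
      also have "\<dots> \<le> (\<integral>\<^sup>+z. ennreal C * (k z * late a M z) + ennreal C * (green \<theta> (z - X i) * (k z * indicator (A i) z)) \<partial>?C)"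
        by (intro nn_integral_mono pt)
      also have "\<dots> = ennreal C * late_killing a M + ennreal C * N i"
        unfolding late_killing_def N_def by (simp add: nn_integral_add nn_integral_cmult)
      also have "\<dots> = ennreal (C * enn2real (late_killing a M) + C * enn2real (N i))"
        using lk Nfin[of i] C by (simp add: ennreal_plus ennreal_mult)
      finally have "enn2real (ennreal (h i) * (\<integral>\<^sup>+z. green \<theta> (z - X i) * (k z * late a M z) \<partial>?C)) \<le> C * enn2real (late_killing a M) + C * enn2real (N i)"
        using C by (intro enn2real_leI) auto
      then show ?case using h_nonneg[of i] by (simp add: enn2real_mult)
    qed
  qed
  moreover have "(\<lambda>i. C * enn2real (N i)) \<longlonglongrightarrow> 0" using tendsto_mult_right_zero[OF N0] by simp
  ultimately show ?thesis using C by (intro exI[of _ C] conjI exI[of _ "\<lambda>i. C * enn2real (N i)"]) auto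
qed

text \<open>For every \<open>M\<close>, the killed Green function lies between that of the free walk started from the mass at time \<open>M\<close>, and the same minus
  the effect of killing after \<open>M\<close>, up to the first \<open>M\<close> terms, which are negligible. Let first \<open>i\<close> and then \<open>M\<close> tend to infinity.\<close>

theorem killed_green_asymptotics_seq:
  "(\<lambda>i. h i * enn2real (\<Sum>n. killed_walk a n (X i))) \<longlonglongrightarrow> green_limit * enn2real (escape a)"
proof -
  define W where "W i = enn2real (\<Sum>n. killed_walk a n (X i))" for i
  define B where "B M i = enn2real (\<integral>\<^sup>+z. green \<theta> (z - X i) * killed_walk a M z \<partial>count_space UNIV)" for M i
  define L where "L M i = enn2real (\<integral>\<^sup>+z. green \<theta> (z - X i) * (k z * late a M z) \<partial>count_space UNIV)" for M i
  define E where "E M i = (\<Sum>n<M. pmf (walk \<theta> n) (a - X i))" for M i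
  have Lle: "(\<integral>\<^sup>+z. green \<theta> (z - x) * (k z * late a M z) \<partial>count_space UNIV) < \<infinity>" for M x
  proof -
    obtain D where D: "\<And>y. green (lazy \<theta>) y \<le> ennreal D" using green_lazy_finite by blast
    have gD: "green \<theta> y \<le> ennreal D" for y using D[of y] unfolding green_eq by (simp add: mult_2) (meson le_iff_add order_trans)
    have "(\<integral>\<^sup>+z. green \<theta> (z - x) * (k z * late a M z) \<partial>count_space UNIV) \<le> (\<integral>\<^sup>+z. ennreal D * (k z * green \<theta> (a - z)) \<partial>count_space UNIV)"
      by (intro nn_integral_mono mult_mono gD late_le) auto
    also have "\<dots> < \<infinity>" using killing_green_finite[of a] by (simp add: nn_integral_cmult ennreal_mult_less_top)
    finally show ?thesis .
  qed
  have Wfin: "(\<Sum>n. killed_walk a (M + n) x) < \<infinity>" for M x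
  proof -
    have "(\<Sum>n. killed_walk a (M + n) x) \<le> late a M x" unfolding late_def by (intro suminf_le killed_walk_le) auto
    also have "\<dots> \<le> green \<theta> (a - x)" by (rule late_le)
    finally show ?thesis using green_finite[of "a - x"] by (rule le_less_trans)
  qed
  have split: "(\<Sum>n. killed_walk a n x) = (\<Sum>n. killed_walk a (M + n) x) + (\<Sum>n<M. killed_walk a n x)" for M x
    by (subst suminf_offset[of _ M]) (auto simp: add.commute)
  have Blate: "(\<integral>\<^sup>+z. green \<theta> (z - x) * killed_walk a M z \<partial>count_space UNIV) < \<infinity>" for M x
    using killed_green_lower[of x a M] Wfin[of M x] Lle[of x M] by (auto intro: le_less_trans)
  have upper: "W i \<le> B M i + E M i" for M i
  proof -
    have "(\<Sum>n. killed_walk a n (X i)) \<le> (\<integral>\<^sup>+z. green \<theta> (z - X i) * killed_walk a M z \<partial>count_space UNIV) + (\<Sum>n<M. ennreal (pmf (walk \<theta> n) (a - X i)))"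
      unfolding split[of "X i" M] by (intro add_mono killed_green_upper sum_mono killed_walk_le)
    also have "\<dots> = ennreal (B M i + E M i)"
      unfolding B_def E_def using Blate[where M=M and x="X i"] by (simp add: ennreal_plus sum_nonneg)
    finally show ?thesis unfolding W_def by (intro enn2real_leI) (auto simp: B_def E_def sum_nonneg)
  qed
  have lower: "B M i \<le> W i + L M i" for M i
  proof -
    have "(\<integral>\<^sup>+z. green \<theta> (z - X i) * killed_walk a M z \<partial>count_space UNIV) \<le> (\<Sum>n. killed_walk a n (X i)) + (\<integral>\<^sup>+z. green \<theta> (z - X i) * (k z * late a M z) \<partial>count_space UNIV)"
      using killed_green_lower[of "X i" a M] unfolding split[of "X i" M]
      by (rule order_trans) (simp add: add_right_mono add_increasing2)
    also have "\<dots> = ennreal (W i + L M i)"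
      unfolding W_def L_def using Wfin[where M=0 and x="X i"] Lle[where M=M and x="X i"] by (simp add: ennreal_plus)
    finally show ?thesis unfolding B_def by (intro enn2real_leI) (auto simp: W_def L_def)
  qed
  have E0: "(\<lambda>i. h i * E M i) \<longlonglongrightarrow> 0" for M
  proof -
    have "(\<lambda>i. \<Sum>n<M. h i * pmf (walk \<theta> n) (a - X i)) \<longlonglongrightarrow> (\<Sum>n<M. 0)"
      by (intro tendsto_sum fixed_time_negligible X)
    then show ?thesis by (simp add: E_def sum_distrib_left)
  qed
  have Blim: "(\<lambda>i. h i * B M i) \<longlonglongrightarrow> green_limit * enn2real (mass a M)" for M
    unfolding B_def by (rule green_of_killed_mass)
  obtain C \<delta> where C: "C \<ge> 0" "\<delta> \<longlonglongrightarrow> 0"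
    "\<And>M. eventually (\<lambda>i. h i * L M i \<le> C * enn2real (late_killing a M) + \<delta> i) sequentially"
    unfolding L_def using late_killing_contribution[of a] by blast
  have escfin: "escape a \<le> 1" unfolding escape_def by (rule INF_lower2[of 0]) auto
  have ef: "escape a < \<top>" using escfin ennreal_one_less_top by (rule le_less_trans)
  have masslim: "(\<lambda>M. enn2real (mass a M)) \<longlonglongrightarrow> enn2real (escape a)"
    by (rule tendsto_enn2real) (use mass_tendsto[of a] ef in auto)
  have latelim: "(\<lambda>M. enn2real (late_killing a M)) \<longlonglongrightarrow> 0"
    by (rule tendsto_enn2real) (use late_killing_tendsto_0[of a] in auto)
  show ?thesis
    unfolding W_def[symmetric]
  proof (rule LIMSEQ_I)
    fix r :: real assume r: "r > 0"
    \<comment> \<open>The limits in \<open>M\<close> fix \<open>M\<close> first; the five errors below are those of \<open>mass\<close>, \<open>B\<close>, \<open>E\<close>, \<open>late_killing\<close> and the near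
      killing \<open>\<delta>\<close>.\<close>
    define \<epsilon> where "\<epsilon> = r / 5"
    have \<epsilon>: "\<epsilon> > 0" using r by (simp add: \<epsilon>_def)
    have m1: "(\<lambda>M. green_limit * enn2real (mass a M)) \<longlonglongrightarrow> green_limit * enn2real (escape a)"
      by (intro tendsto_intros masslim)
    have m2: "(\<lambda>M. C * enn2real (late_killing a M)) \<longlonglongrightarrow> 0" using tendsto_mult_right_zero[OF latelim] by simp
    have "eventually (\<lambda>M. \<bar>green_limit * enn2real (mass a M) - green_limit * enn2real (escape a)\<bar> < \<epsilon> \<and> C * enn2real (late_killing a M) < \<epsilon>) sequentially"
      using tendstoD[OF m1 \<epsilon>] order_tendstoD(2)[OF m2 \<epsilon>] by eventually_elim (auto simp: dist_real_def)
    then obtain M where M: "\<bar>green_limit * enn2real (mass a M) - green_limit * enn2real (escape a)\<bar> < \<epsilon>" "C * enn2real (late_killing a M) < \<epsilon>"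
      by (auto simp: eventually_sequentially)
    have "eventually (\<lambda>i. norm (h i * W i - green_limit * enn2real (escape a)) < r) sequentially"
      using tendstoD[OF Blim[of M] \<epsilon>] order_tendstoD(2)[OF E0[of M] \<epsilon>] order_tendstoD(2)[OF C(2) \<epsilon>] C(3)[of M]
    proof eventually_elim
      case (elim i)
      have "h i * W i \<le> h i * B M i + h i * E M i"
        using mult_left_mono[OF upper[where M=M and i=i] h_nonneg[of i]] by (simp add: distrib_left)
      moreover have "h i * B M i \<le> h i * W i + h i * L M i"
        using mult_left_mono[OF lower[where M=M and i=i] h_nonneg[of i]] by (simp add: distrib_left)
      ultimately show ?case using elim M unfolding \<epsilon>_def dist_real_def real_norm_def by linarith
    qed
    then show "\<exists>no. \<forall>n\<ge>no. norm (h n * W n - green_limit * enn2real (escape a)) < r"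
      by (simp add: eventually_sequentially)
  qed
qed

end

theorem killed_green_asymptotics:
  "((\<lambda>x. radius x ^ (CARD('n) - 2) * enn2real (\<Sum>n. killed_walk a n x)) \<longlongrightarrow> green_limit * enn2real (escape a)) lattice_at_infinity"
  by (rule tendsto_lattice_at_infinityI) (rule killed_green_asymptotics_seq)

lemma some_escape:
  assumes "\<And>x. x \<notin> K \<Longrightarrow> q x > 0" "a \<in> K"
  shows "\<exists>b\<in>K. escape b > 0"
proof -
  have "eventually (\<lambda>M. late_killing a M < 1) sequentially"
    by (rule order_tendstoD(2)[OF late_killing_tendsto_0]) simp
  then obtain M where "late_killing a M < 1" by (auto simp: eventually_sequentially)
  with assms show ?thesis by (rule escape_positive)
qed

end

section \<open>The branching property\<close>

lemma prob_space_gw: "prob_space (gw_space \<rho> \<mu>)"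
  unfolding gw_space_def by (intro prob_space_PiM) (auto intro: prob_space_measure_pmf)

lemma prob_space_snake: "prob_space (snake_space \<rho> \<mu> \<theta>)"
  unfolding snake_space_def
  by (intro prob_space_pair prob_space_gw prob_space_PiM) (auto intro: prob_space_measure_pmf)

lemma space_gw [simp]: "space (gw_space \<rho> \<mu>) = UNIV"
  by (simp add: gw_space_def space_PiM)

lemma space_snake [simp]: "space (snake_space \<rho> \<mu> \<theta>) = UNIV"
  by (simp add: snake_space_def space_pair_measure space_PiM)

lemma sets_snake: "sets (snake_space \<rho> \<mu> \<theta>) = sets (snake_space \<mu> \<mu> \<theta>)"
  unfolding snake_space_def gw_space_def
  by (intro sets_pair_measure_cong sets_PiM_cong) auto

lemma measurable_offspring [measurable]:
  "(\<lambda>\<omega>. fst \<omega> w) \<in> measurable (snake_space \<rho> \<mu> \<theta>) (count_space UNIV)"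
proof -
  have "(\<lambda>N. N w) \<in> measurable (gw_space \<rho> \<mu>) (measure_pmf (if w = [] then \<rho> else \<mu>))"
    unfolding gw_space_def by (rule measurable_component_singleton) simp
  then have "(\<lambda>N. N w) \<in> measurable (gw_space \<rho> \<mu>) (count_space UNIV)" by (simp cong: measurable_cong_sets)
  then show ?thesis unfolding snake_space_def by measurable
qed

lemma measurable_edge [measurable]:
  "(\<lambda>\<omega>. snd \<omega> w) \<in> measurable (snake_space \<rho> \<mu> \<theta>) (count_space UNIV)"
proof -
  have "(\<lambda>N. N w) \<in> measurable (\<Pi>\<^sub>M u\<in>UNIV. measure_pmf \<theta>) (measure_pmf \<theta>)"
    by (rule measurable_component_singleton) simp
  then have "(\<lambda>N. N w) \<in> measurable (\<Pi>\<^sub>M u\<in>(UNIV::vertex set). measure_pmf \<theta>) (count_space UNIV)"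
    by (simp cong: measurable_cong_sets)
  then show ?thesis unfolding snake_space_def by measurable
qed

lemma measurable_into_snake:
  assumes "\<And>w. (\<lambda>x. fst (f x) w) \<in> measurable M (count_space UNIV)"
    and "\<And>w. (\<lambda>x. snd (f x) w) \<in> measurable M (count_space UNIV)"
  shows "f \<in> measurable M (snake_space \<rho> \<mu> \<theta>)"
proof -
  have "(\<lambda>x. (fst (f x), snd (f x))) \<in> measurable M (snake_space \<rho> \<mu> \<theta>)"
    unfolding snake_space_def gw_space_def
    by (intro measurable_Pair measurable_PiM_single')
       (use assms in \<open>auto simp: space_PiM cong: measurable_cong_sets\<close>)
  then show ?thesis by simp
qed

text \<open>The snake on the subtree of child \<open>i\<close> of the root. Its variable at the word \<open>[]\<close> belongs to the edge above that child: the
  displacement of the child is therefore read off from \<open>snd (subsnake i \<omega>) []\<close>, a variable that no position inside the subtree depends on.\<close>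

definition subsnake :: "nat \<Rightarrow> 'n snake \<Rightarrow> 'n snake" where
  "subsnake i \<omega> = (\<lambda>w. fst \<omega> (i # w), \<lambda>w. snd \<omega> (i # w))"

lemma measurable_subsnake [measurable]:
  "subsnake i \<in> measurable (snake_space \<rho> \<mu> \<theta>) (snake_space \<mu> \<mu> \<theta>)"
  by (rule measurable_into_snake) (auto simp: subsnake_def)

lemma distr_subsnake: "distr (snake_space \<rho> \<mu> \<theta>) (snake_space \<mu> \<mu> \<theta>) (subsnake i) = snake_space \<mu> \<mu> \<theta>"
proof -
  let ?G = "gw_space \<rho> \<mu>" let ?H = "\<Pi>\<^sub>M u\<in>(UNIV::vertex set). measure_pmf \<theta>"
  have G: "distr ?G (gw_space \<mu> \<mu>) (\<lambda>N w. N (i # w)) = gw_space \<mu> \<mu>"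
    using distr_PiM_reindex[of UNIV "\<lambda>u. measure_pmf (if u = [] then \<rho> else \<mu>)" "(#) i" UNIV]
    by (simp add: gw_space_def prob_space_measure_pmf restrict_def)
  have H: "distr ?H ?H (\<lambda>N w. N (i # w)) = ?H"
    using distr_PiM_reindex[of UNIV "\<lambda>u. measure_pmf \<theta>" "(#) i" UNIV]
    by (simp add: prob_space_measure_pmf restrict_def)
  have mG: "(\<lambda>N w. N (i # w)) \<in> measurable ?G (gw_space \<mu> \<mu>)"
  proof -
    have "(\<lambda>N. N (i # w)) \<in> measurable ?G (measure_pmf (if i # w = [] then \<rho> else \<mu>))" for w
      unfolding gw_space_def by (rule measurable_component_singleton) simp
    then show ?thesis unfolding gw_space_def[of \<mu> \<mu>] by (intro measurable_PiM_single') (auto simp: space_PiM)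
  qed
  have mH: "(\<lambda>N w. N (i # w)) \<in> measurable ?H ?H"
    by (rule measurable_PiM_single') (auto simp: space_PiM)
  have ps: "prob_space ?H" by (intro prob_space_PiM) (rule prob_space_measure_pmf)
  have "distr ?G (gw_space \<mu> \<mu>) (\<lambda>N w. N (i # w)) \<Otimes>\<^sub>M distr ?H ?H (\<lambda>N w. N (i # w))
      = distr (?G \<Otimes>\<^sub>M ?H) (gw_space \<mu> \<mu> \<Otimes>\<^sub>M ?H) (\<lambda>(x, y). (\<lambda>w. x (i # w), \<lambda>w. y (i # w)))"
    by (rule pair_measure_distr[OF mG mH]) (use ps in \<open>simp add: H prob_space_imp_sigma_finite\<close>)
  then show ?thesis unfolding G H by (simp add: snake_space_def subsnake_def[abs_def] case_prod_beta')
qed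

lemma emeasure_snake_rectangle:
  assumes "finite I" "finite J"
  shows "emeasure (snake_space \<rho> \<mu> \<theta>) {\<omega>. (\<forall>u\<in>I. fst \<omega> u \<in> A u) \<and> (\<forall>u\<in>J. snd \<omega> u \<in> B u)}
       = (\<Prod>u\<in>I. emeasure (measure_pmf (if u = [] then \<rho> else \<mu>)) (A u)) * (\<Prod>u\<in>J. emeasure (measure_pmf \<theta>) (B u))"
proof -
  let ?H = "\<Pi>\<^sub>M u\<in>(UNIV::vertex set). measure_pmf \<theta>"
  have 1: "emeasure (gw_space \<rho> \<mu>) {N. \<forall>u\<in>I. N u \<in> A u} = (\<Prod>u\<in>I. emeasure (measure_pmf (if u = [] then \<rho> else \<mu>)) (A u))"
  proof -
    interpret product_prob_space "\<lambda>u. measure_pmf (if u = [] then \<rho> else \<mu>)" UNIV ..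
    show ?thesis using emeasure_PiM_Collect[of I A] assms by (simp add: gw_space_def space_PiM)
  qed
  have 2: "emeasure ?H {N. \<forall>u\<in>J. N u \<in> B u} = (\<Prod>u\<in>J. emeasure (measure_pmf \<theta>) (B u))"
  proof -
    interpret product_prob_space "\<lambda>u::vertex. measure_pmf \<theta>" UNIV ..
    show ?thesis using emeasure_PiM_Collect[of J B] assms by (simp add: space_PiM)
  qed
  have m1: "{N. \<forall>u\<in>I. N u \<in> A u} \<in> sets (gw_space \<rho> \<mu>)"
  proof -
    have "{N\<in>space (gw_space \<rho> \<mu>). \<forall>u\<in>I. N u \<in> A u} \<in> sets (gw_space \<rho> \<mu>)"
      unfolding gw_space_def by (rule sets.sets_Collect_finite_All) (use assms in auto)
    then show ?thesis by simp
  qed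
  have m2: "{N. \<forall>u\<in>J. N u \<in> B u} \<in> sets ?H"
  proof -
    have "{N\<in>space ?H. \<forall>u\<in>J. N u \<in> B u} \<in> sets ?H"
      by (rule sets.sets_Collect_finite_All) (use assms in auto)
    then show ?thesis by (simp add: space_PiM)
  qed
  interpret H: prob_space ?H by (intro prob_space_PiM) (rule prob_space_measure_pmf)
  have "{\<omega>. (\<forall>u\<in>I. fst \<omega> u \<in> A u) \<and> (\<forall>u\<in>J. snd \<omega> u \<in> B u)} = {N. \<forall>u\<in>I. N u \<in> A u} \<times> {N. \<forall>u\<in>J. N u \<in> B u}"
    by auto
  then show ?thesis unfolding snake_space_def using H.emeasure_pair_measure_Times[OF m1 m2] 1 2 by simp
qed

text \<open>Offspring numbers and edge variables as a single family with values in one type, the unused component being \<open>0\<close>; this puts the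
  independence of all of them into one statement.\<close>

definition coordinate :: "bool \<times> vertex \<Rightarrow> 'n snake \<Rightarrow> nat \<times> (int ^ 'n)" where
  "coordinate j \<omega> = (if fst j then (0, snd \<omega> (snd j)) else (fst \<omega> (snd j), 0))"

text \<open>Independence is checked on finite rectangles, where both product measures factorize.\<close>

lemma indep_coordinates:
  "prob_space.indep_vars (snake_space \<rho> \<mu> \<theta>) (\<lambda>_. count_space UNIV) coordinate UNIV"
proof -
  let ?M = "snake_space \<rho> \<mu> \<theta>"
  interpret prob_space ?M by (rule prob_space_snake)
  have rv: "random_variable (count_space UNIV) (coordinate j)" for j
    unfolding coordinate_def by measurable
  have rect: "emeasure ?M {\<omega>. \<forall>j\<in>J. coordinate j \<omega> \<in> B j} = (\<Prod>j\<in>J.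
      (if fst j then emeasure (measure_pmf \<theta>) {y. (0, y) \<in> B j} else emeasure (measure_pmf (if snd j = [] then \<rho> else \<mu>)) {n. (n, 0) \<in> B j}))"
    if J: "finite J" for J B
  proof -
    define I0 I1 where "I0 = {u. (False, u) \<in> J}" and "I1 = {u. (True, u) \<in> J}"
    have fin: "finite I0" "finite I1"
      using finite_vimageI[OF J, of "Pair False"] finite_vimageI[OF J, of "Pair True"] by (auto simp: I0_def I1_def inj_on_def vimage_def)
    have Jeq: "J = Pair False ` I0 \<union> Pair True ` I1"
    proof (safe, goal_cases)
      case (1 b u) then show ?case by (cases b) (auto simp: I0_def I1_def)
    qed (auto simp: I0_def I1_def)
    have "{\<omega>. \<forall>j\<in>J. coordinate j \<omega> \<in> B j} = {\<omega>. (\<forall>u\<in>I0. fst \<omega> u \<in> {n. (n, 0) \<in> B (False, u)}) \<and> (\<forall>u\<in>I1. snd \<omega> u \<in> {y. (0, y) \<in> B (True, u)})}"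
      unfolding Jeq by (simp add: ball_Un coordinate_def)
    then have "emeasure ?M {\<omega>. \<forall>j\<in>J. coordinate j \<omega> \<in> B j} = (\<Prod>u\<in>I0. emeasure (measure_pmf (if u = [] then \<rho> else \<mu>)) {n. (n, 0) \<in> B (False, u)}) * (\<Prod>u\<in>I1. emeasure (measure_pmf \<theta>) {y. (0, y) \<in> B (True, u)})"
      using emeasure_snake_rectangle[OF fin, of \<rho> \<mu> \<theta> "\<lambda>u. {n. (n, 0) \<in> B (False, u)}" "\<lambda>u. {y. (0, y) \<in> B (True, u)}"] by simp
    also have "\<dots> = (\<Prod>j\<in>J. (if fst j then emeasure (measure_pmf \<theta>) {y. (0, y) \<in> B j} else emeasure (measure_pmf (if snd j = [] then \<rho> else \<mu>)) {n. (n, 0) \<in> B j}))"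
      unfolding Jeq using fin by (subst prod.union_disjoint) (auto simp: prod.reindex inj_on_def)
    finally show ?thesis .
  qed
  have one: "emeasure ?M {\<omega>. coordinate j \<omega> \<in> B} = (if fst j then emeasure (measure_pmf \<theta>) {y. (0, y) \<in> B} else emeasure (measure_pmf (if snd j = [] then \<rho> else \<mu>)) {n. (n, 0) \<in> B})" for j B
    using rect[of "{j}" "\<lambda>_. B"] by simp
  have "indep_sets (\<lambda>j. {coordinate j -` A \<inter> space ?M |A. A \<in> sets (count_space UNIV)}) UNIV"
  proof (rule indep_setsI)
    fix j show "{coordinate j -` A \<inter> space ?M |A. A \<in> sets (count_space UNIV)} \<subseteq> events"
      using measurable_sets[OF rv[of j]] by auto
  next
    fix A J assume J: "finite J" and "\<forall>j\<in>J. A j \<in> {coordinate j -` A \<inter> space ?M |A. A \<in> sets (count_space UNIV)}"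
    then obtain B where B: "\<And>j. j \<in> J \<Longrightarrow> A j = {\<omega>. coordinate j \<omega> \<in> B j}"
      unfolding vimage_def by (simp add: Collect_conj_eq) metis
    have "(\<Inter>j\<in>J. A j) = {\<omega>. \<forall>j\<in>J. coordinate j \<omega> \<in> B j}" using B by auto
    then have "emeasure ?M (\<Inter>j\<in>J. A j) = (\<Prod>j\<in>J. emeasure ?M (A j))"
      using rect[OF J, of B] by (simp add: B one)
    then show "prob (\<Inter>j\<in>J. A j) = (\<Prod>j\<in>J. prob (A j))"
      by (simp add: emeasure_eq_measure prod_ennreal prod_nonneg)
  qed
  then show ?thesis unfolding indep_vars_def2 using rv by auto
qed

text \<open>The number of children of the root and the coordinates of the subtrees of its children are disjoint blocks of coordinates, so the
  subsnakes of the children are independent of each other and of that number. They are defined for all words, so there is no need to condition on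
  the number of children.\<close>

lemma branching:
  assumes J: "finite J" and B: "\<And>j. j \<in> J \<Longrightarrow> B j \<in> sets (snake_space \<mu> \<mu> \<theta>)"
  shows "emeasure (snake_space \<rho> \<mu> \<theta>) {\<omega>. fst \<omega> [] \<in> S \<and> (\<forall>j\<in>J. subsnake j \<omega> \<in> B j)}
       = emeasure (measure_pmf \<rho>) S * (\<Prod>j\<in>J. emeasure (snake_space \<mu> \<mu> \<theta>) (B j))"
proof -
  let ?M = "snake_space \<rho> \<mu> \<theta>" let ?N = "snake_space \<mu> \<mu> \<theta>"
  interpret prob_space ?M by (rule prob_space_snake)
  \<comment> \<open>\<open>None\<close> stands for the offspring number of the root, \<open>Some i\<close> for the subtree of child \<open>i\<close>.\<close>
  define block where "block c = (case c of None \<Rightarrow> {(False, [])} | Some i \<Rightarrow> {(b, i # w) |b w. True})" for c :: "nat option"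
  define f where "f c X = (case c of None \<Rightarrow> (\<lambda>w. fst (X (False, [])), \<lambda>w. 0)
      | Some i \<Rightarrow> (\<lambda>w. fst (X (False, i # w)), \<lambda>w. snd (X (True, i # w))))" for c :: "nat option" and X :: "bool \<times> vertex \<Rightarrow> nat \<times> (int ^ 'a)"
  have *: "indep_vars (\<lambda>c. PiM (block c) (\<lambda>_. count_space UNIV)) (\<lambda>c \<omega>. restrict (\<lambda>j. coordinate j \<omega>) (block c)) UNIV"
    by (rule indep_vars_restrict[OF indep_coordinates]) (auto simp: block_def disjoint_family_on_def split: option.splits)
  have comp: "(\<lambda>X. g (X j)) \<in> measurable (PiM I (\<lambda>_. count_space UNIV)) (count_space UNIV)"
    if "j \<in> I" for j and g :: "nat \<times> (int ^ 'a) \<Rightarrow> 'b" and I :: "(bool \<times> vertex) set"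
    by (rule measurable_compose[OF measurable_component_singleton[OF that]]) simp
  have "f c \<in> measurable (PiM (block c) (\<lambda>_. count_space UNIV)) ?N" for c
    by (rule measurable_into_snake)
       (auto simp: f_def block_def split: option.splits
         intro!: comp[of _ _ fst] comp[of _ _ snd])
  then have "indep_vars (\<lambda>_. ?N) (\<lambda>c \<omega>. f c (restrict (\<lambda>j. coordinate j \<omega>) (block c))) UNIV"
    by (rule indep_vars_compose2[OF *])
  moreover have "(\<lambda>c \<omega>. f c (restrict (\<lambda>j. coordinate j \<omega>) (block c)))
      = (\<lambda>c \<omega>. case c of None \<Rightarrow> (\<lambda>_. fst \<omega> [], \<lambda>_. 0) | Some i \<Rightarrow> subsnake i \<omega>)"
  proof (intro ext)
    fix c :: "nat option" and \<omega> :: "'a snake"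
    have "\<exists>b. b" "\<exists>b. \<not> b" by auto
    then show "f c (restrict (\<lambda>j. coordinate j \<omega>) (block c)) = (case c of None \<Rightarrow> (\<lambda>_. fst \<omega> [], \<lambda>_. 0) | Some i \<Rightarrow> subsnake i \<omega>)"
      by (cases c) (simp_all add: f_def block_def subsnake_def coordinate_def)
  qed
  ultimately have ind: "indep_vars (\<lambda>_. ?N) (\<lambda>c \<omega>. case c of None \<Rightarrow> (\<lambda>_. fst \<omega> [], \<lambda>_. 0) | Some i \<Rightarrow> subsnake i \<omega>) UNIV"
    by simp
  define A where "A c = (case c of None \<Rightarrow> {\<omega>. fst \<omega> [] \<in> S} | Some i \<Rightarrow> B i)" for c
  have "prob (\<Inter>c\<in>insert None (Some ` J). (\<lambda>\<omega>. case c of None \<Rightarrow> (\<lambda>_. fst \<omega> [], \<lambda>_. 0) | Some i \<Rightarrow> subsnake i \<omega>) -` A c \<inter> space ?M)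
      = (\<Prod>c\<in>insert None (Some ` J). prob ((\<lambda>\<omega>. case c of None \<Rightarrow> (\<lambda>_. fst \<omega> [], \<lambda>_. 0) | Some i \<Rightarrow> subsnake i \<omega>) -` A c \<inter> space ?M))"
  proof (rule indep_varsD[OF ind])
    fix c assume "c \<in> insert None (Some ` J)"
    moreover have "{\<omega> \<in> space ?N. fst \<omega> [] \<in> S} \<in> sets ?N" by measurable
    ultimately show "A c \<in> sets ?N" using B by (auto simp: A_def)
  qed (use J in auto)
  also have "(\<Inter>c\<in>insert None (Some ` J). (\<lambda>\<omega>. case c of None \<Rightarrow> (\<lambda>_. fst \<omega> [], \<lambda>_. 0) | Some i \<Rightarrow> subsnake i \<omega>) -` A c \<inter> space ?M)
      = {\<omega>. fst \<omega> [] \<in> S \<and> (\<forall>j\<in>J. subsnake j \<omega> \<in> B j)}"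
    by (auto simp: A_def)
  also have "(\<Prod>c\<in>insert None (Some ` J). prob ((\<lambda>\<omega>. case c of None \<Rightarrow> (\<lambda>_. fst \<omega> [], \<lambda>_. 0) | Some i \<Rightarrow> subsnake i \<omega>) -` A c \<inter> space ?M))
      = prob {\<omega>. fst \<omega> [] \<in> S} * (\<Prod>j\<in>J. prob (subsnake j -` B j))"
    using J by (simp add: prod.reindex A_def vimage_def)
  finally have main: "emeasure ?M {\<omega>. fst \<omega> [] \<in> S \<and> (\<forall>j\<in>J. subsnake j \<omega> \<in> B j)}
      = emeasure ?M {\<omega>. fst \<omega> [] \<in> S} * (\<Prod>j\<in>J. emeasure ?M (subsnake j -` B j))"
    by (simp add: emeasure_eq_measure prod_ennreal ennreal_mult prod_nonneg)
  have "emeasure ?M (subsnake j -` B j) = emeasure ?N (B j)" if "j \<in> J" for j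
  proof -
    have "emeasure ?N (B j) = emeasure (distr ?M ?N (subsnake j)) (B j)" by (simp add: distr_subsnake)
    also have "\<dots> = emeasure ?M (subsnake j -` B j \<inter> space ?M)" by (rule emeasure_distr) (use B[OF that] in auto)
    finally show ?thesis by simp
  qed
  moreover have "emeasure ?M {\<omega>. fst \<omega> [] \<in> S} = emeasure (measure_pmf \<rho>) S"
    using emeasure_snake_rectangle[of "{[]}" "{}" \<rho> \<mu> \<theta> "\<lambda>_. S"] by simp
  ultimately show ?thesis using main by simp
qed

section \<open>Events of the first generation\<close>

lemma emeasure_snake_UNIV: "emeasure (snake_space \<rho> \<mu> \<theta>) UNIV = 1"
  using prob_space.emeasure_space_1[OF prob_space_snake] by simp

lemma sets_snake_Compl: "A \<in> sets (snake_space \<rho> \<mu> \<theta>) \<Longrightarrow> - A \<in> sets (snake_space \<rho> \<mu> \<theta>)"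
  using sets.compl_sets[of A "snake_space \<rho> \<mu> \<theta>"] by (simp add: Compl_eq_Diff_UNIV)

lemma snake_vimage: "A \<in> sets (snake_space \<mu> \<mu> \<theta>) \<Longrightarrow> {\<omega>. subsnake i \<omega> \<in> A} \<in> sets (snake_space \<rho> \<mu> \<theta>)"
  using measurable_sets[OF measurable_subsnake, of A \<mu> \<theta> i \<rho>] by (simp add: vimage_def)

lemma first_generation_sets:
  assumes "finite J" "\<And>j. j \<in> J \<Longrightarrow> B j \<in> sets (snake_space \<mu> \<mu> \<theta>)"
  shows "{\<omega>. fst \<omega> [] \<in> S \<and> (\<forall>j\<in>J. subsnake j \<omega> \<in> B j)} \<in> sets (snake_space \<rho> \<mu> \<theta>)"
proof -
  have "{\<omega> \<in> space (snake_space \<rho> \<mu> \<theta>). fst \<omega> [] \<in> S} \<in> sets (snake_space \<rho> \<mu> \<theta>)" by measurable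
  moreover have "{\<omega> \<in> space (snake_space \<rho> \<mu> \<theta>). \<forall>j\<in>J. subsnake j \<omega> \<in> B j} \<in> sets (snake_space \<rho> \<mu> \<theta>)"
    by (rule sets.sets_Collect_finite_All) (use snake_vimage[OF assms(2)] assms(1) in auto)
  ultimately have "{\<omega>. fst \<omega> [] \<in> S} \<inter> {\<omega>. \<forall>j\<in>J. subsnake j \<omega> \<in> B j} \<in> sets (snake_space \<rho> \<mu> \<theta>)" by (intro sets.Int) auto
  then show ?thesis by (simp add: Collect_conj_eq)
qed

lemma nn_integral_pmf_nat: "(\<integral>\<^sup>+m. f m \<partial>measure_pmf \<rho>) = (\<Sum>m. ennreal (pmf \<rho> m) * f (m::nat))"
  by (simp add: nn_integral_measure_pmf nn_integral_count_space_nat)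

text \<open>Conditioning on the number \<open>m\<close> of children.\<close>

lemma no_child_in:
  assumes V: "V \<in> sets (snake_space \<mu> \<mu> \<theta>)"
  shows "emeasure (snake_space \<rho> \<mu> \<theta>) {\<omega>. \<forall>i<fst \<omega> []. subsnake i \<omega> \<notin> V}
       = (\<integral>\<^sup>+m. emeasure (snake_space \<mu> \<mu> \<theta>) (- V) ^ m \<partial>\<rho>)"
    and "{\<omega>. \<forall>i<fst \<omega> []. subsnake i \<omega> \<notin> V} \<in> sets (snake_space \<rho> \<mu> \<theta>)"
proof -
  let ?M = "snake_space \<rho> \<mu> \<theta>" let ?N = "snake_space \<mu> \<mu> \<theta>"
  define D where "D m = {\<omega>. fst \<omega> [] \<in> {m} \<and> (\<forall>j\<in>{..<m}. subsnake j \<omega> \<in> - V)}" for m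
  have eq: "{\<omega>. \<forall>i<fst \<omega> []. subsnake i \<omega> \<notin> V} = (\<Union>m. D m)" by (auto simp: D_def)
  have sets: "D m \<in> sets ?M" for m
    unfolding D_def by (rule first_generation_sets) (use sets_snake_Compl[OF V] in auto)
  have "emeasure ?M (D m) = ennreal (pmf \<rho> m) * emeasure ?N (- V) ^ m" for m
    unfolding D_def
    by (subst branching) (use sets_snake_Compl[OF V] in \<open>auto simp: emeasure_pmf_single\<close>)
  moreover have "disjoint_family D" by (auto simp: disjoint_family_on_def D_def)
  ultimately show "emeasure ?M {\<omega>. \<forall>i<fst \<omega> []. subsnake i \<omega> \<notin> V} = (\<integral>\<^sup>+m. emeasure ?N (- V) ^ m \<partial>\<rho>)"
    unfolding eq nn_integral_pmf_nat using suminf_emeasure[of D ?M] sets by (simp add: image_subset_iff)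
  show "{\<omega>. \<forall>i<fst \<omega> []. subsnake i \<omega> \<notin> V} \<in> sets ?M" unfolding eq using sets by auto
qed

text \<open>The events for the different numbers of children \<open>m\<close> and selected children \<open>i\<close> are disjoint, because of two candidates one would
  have to be in the set that is required to miss \<open>V\<close>. With \<open>Q m i\<close> the older, or the younger, siblings of \<open>i\<close> this is one step along the
  ancestral line of the first, or last, visit.\<close>

lemma selected_child:
  assumes A: "A \<in> sets (snake_space \<mu> \<mu> \<theta>)" and V: "V \<in> sets (snake_space \<mu> \<mu> \<theta>)" and AV: "A \<subseteq> V"
    and fin: "\<And>m i. finite (Q m i)" and notin: "\<And>m i. i \<notin> Q m i"
    and sep: "\<And>m i j. i < m \<Longrightarrow> j < m \<Longrightarrow> i \<noteq> j \<Longrightarrow> i \<in> Q m j \<or> j \<in> Q m i"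
  shows "emeasure (snake_space \<rho> \<mu> \<theta>) {\<omega>. \<exists>i<fst \<omega> []. subsnake i \<omega> \<in> A \<and> (\<forall>j\<in>Q (fst \<omega> []) i. subsnake j \<omega> \<notin> V)}
       = (\<integral>\<^sup>+m. (\<Sum>i<m. emeasure (snake_space \<mu> \<mu> \<theta>) (- V) ^ card (Q m i)) \<partial>\<rho>) * emeasure (snake_space \<mu> \<mu> \<theta>) A"
proof -
  let ?M = "snake_space \<rho> \<mu> \<theta>" let ?N = "snake_space \<mu> \<mu> \<theta>"
  define D where "D m i = {\<omega>. fst \<omega> [] \<in> {m} \<and> (\<forall>j\<in>insert i (Q m i). subsnake j \<omega> \<in> (if j = i then A else - V))}" for m i
  define E where "E m = (\<Union>i<m. D m i)" for m
  have D_alt: "\<omega> \<in> D m i \<longleftrightarrow> fst \<omega> [] = m \<and> subsnake i \<omega> \<in> A \<and> (\<forall>j\<in>Q m i. subsnake j \<omega> \<notin> V)" for m i \<omega>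
    using notin[of i m] by (auto simp: D_def split: if_splits)
  have eq: "{\<omega>. \<exists>i<fst \<omega> []. subsnake i \<omega> \<in> A \<and> (\<forall>j\<in>Q (fst \<omega> []) i. subsnake j \<omega> \<notin> V)} = (\<Union>m. E m)"
    unfolding E_def by (auto simp: D_alt)
  have sets: "D m i \<in> sets ?M" for m i
    unfolding D_def by (rule first_generation_sets) (use sets_snake_Compl[OF V] A fin in auto)
  have "emeasure ?M (D m i) = ennreal (pmf \<rho> m) * (emeasure ?N A * emeasure ?N (- V) ^ card (Q m i))" for m i
  proof -
    have "(\<Prod>j\<in>Q m i. emeasure ?N (if j = i then A else - V)) = (\<Prod>j\<in>Q m i. emeasure ?N (- V))"
      using notin[of i m] by (intro prod.cong) auto
    then show ?thesis
      unfolding D_def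
      by (subst branching) (use sets_snake_Compl[OF V] A fin notin in \<open>auto simp: emeasure_pmf_single\<close>)
  qed
  moreover have "emeasure ?M (E m) = (\<Sum>i<m. emeasure ?M (D m i))" for m
  proof -
    have "disjoint_family_on (D m) {..<m}"
    proof (unfold disjoint_family_on_def, intro ballI impI)
      fix i j assume ij: "i \<in> {..<m}" "j \<in> {..<m}" "i \<noteq> j"
      show "D m i \<inter> D m j = {}" using sep[of i m j] ij AV by (auto simp: D_alt)
    qed
    then show ?thesis unfolding E_def using sum_emeasure[of "D m" "{..<m}" ?M] sets by (simp add: image_subset_iff)
  qed
  ultimately have "emeasure ?M (E m) = ennreal (pmf \<rho> m) * (\<Sum>i<m. emeasure ?N (- V) ^ card (Q m i)) * emeasure ?N A" for m
    by (simp add: sum_distrib_left sum_distrib_right mult_ac)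
  moreover have "(\<Sum>m. emeasure ?M (E m)) = emeasure ?M (\<Union>m. E m)"
    by (rule suminf_emeasure) (use sets in \<open>auto simp: E_def disjoint_family_on_def D_alt\<close>)
  ultimately show ?thesis
    unfolding eq nn_integral_pmf_nat by (simp add: ennreal_suminf_multc)
qed

lemma some_child_in_le:
  assumes A: "A \<in> sets (snake_space \<mu> \<mu> \<theta>)"
  shows "emeasure (snake_space \<rho> \<mu> \<theta>) {\<omega>. \<exists>i<fst \<omega> []. subsnake i \<omega> \<in> A}
       \<le> (\<Sum>i. emeasure (measure_pmf \<rho>) {i<..}) * emeasure (snake_space \<mu> \<mu> \<theta>) A"
proof -
  let ?M = "snake_space \<rho> \<mu> \<theta>" let ?N = "snake_space \<mu> \<mu> \<theta>"
  define D where "D i = {\<omega>. fst \<omega> [] \<in> {i<..} \<and> (\<forall>j\<in>{i}. subsnake j \<omega> \<in> A)}" for i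
  have eq: "{\<omega>. \<exists>i<fst \<omega> []. subsnake i \<omega> \<in> A} = (\<Union>i. D i)" by (auto simp: D_def)
  have sets: "D i \<in> sets ?M" for i unfolding D_def by (rule first_generation_sets) (use A in auto)
  have "emeasure ?M (D i) = emeasure (measure_pmf \<rho>) {i<..} * emeasure ?N A" for i
    unfolding D_def by (subst branching) (use A in auto)
  moreover have "emeasure ?M (\<Union>i. D i) \<le> (\<Sum>i. emeasure ?M (D i))"
    by (rule emeasure_subadditive_countably) (use sets in auto)
  ultimately show ?thesis unfolding eq by (simp add: ennreal_suminf_multc)
qed

text \<open>Events that concern positions inside the tree do not depend on the variable of the edge above the root.\<close>

definition ignores_root_edge :: "'n snake set \<Rightarrow> bool" where
  "ignores_root_edge A \<longleftrightarrow> (\<forall>\<omega> y. (fst \<omega>, (snd \<omega>)([] := y)) \<in> A \<longleftrightarrow> \<omega> \<in> A)"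

text \<open>The root edge variable and all other coordinates are two disjoint blocks; replacing the variable by \<open>0\<close> expresses the event by the
  second block.\<close>

lemma root_edge_indep:
  assumes A: "A \<in> sets (snake_space \<mu> \<mu> \<theta>)" and ign: "ignores_root_edge A"
  shows "emeasure (snake_space \<mu> \<mu> \<theta>) {\<omega>. snd \<omega> [] = y \<and> \<omega> \<in> A} = ennreal (pmf \<theta> y) * emeasure (snake_space \<mu> \<mu> \<theta>) A"
proof -
  let ?M = "snake_space \<mu> \<mu> \<theta>"
  interpret prob_space ?M by (rule prob_space_snake)
  define block where "block c = (if c then {(True, [])} else - {(True, [] :: vertex)})" for c
  define f where "f c X = (if c then (\<lambda>w. 0, \<lambda>w. snd (X (True, [])))
      else (\<lambda>w. fst (X (False, w)), \<lambda>w. if w = [] then 0 else snd (X (True, w))))" for c :: bool and X :: "bool \<times> vertex \<Rightarrow> nat \<times> (int ^ 'a)"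
  have *: "indep_vars (\<lambda>c. PiM (block c) (\<lambda>_. count_space UNIV)) (\<lambda>c \<omega>. restrict (\<lambda>j. coordinate j \<omega>) (block c)) UNIV"
    by (rule indep_vars_restrict[OF indep_coordinates]) (auto simp: block_def disjoint_family_on_def split: if_splits)
  have comp: "(\<lambda>X. g (X j)) \<in> measurable (PiM I (\<lambda>_. count_space UNIV)) (count_space UNIV)"
    if "j \<in> I" for j and g :: "nat \<times> (int ^ 'a) \<Rightarrow> 'b" and I :: "(bool \<times> vertex) set"
    by (rule measurable_compose[OF measurable_component_singleton[OF that]]) simp
  have fm: "f c \<in> measurable (PiM (block c) (\<lambda>_. count_space UNIV)) ?M" for c
  proof (rule measurable_into_snake)
    fix w
    show "(\<lambda>X. fst (f c X) w) \<in> measurable (PiM (block c) (\<lambda>_. count_space UNIV)) (count_space UNIV)"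
      by (cases c) (auto simp: f_def block_def intro!: comp[of _ _ fst])
    show "(\<lambda>X. snd (f c X) w) \<in> measurable (PiM (block c) (\<lambda>_. count_space UNIV)) (count_space UNIV)"
      by (cases c; cases "w = []") (auto simp: f_def block_def intro!: comp[of _ _ snd])
  qed
  have "indep_vars (\<lambda>_. ?M) (\<lambda>c \<omega>. f c (restrict (\<lambda>j. coordinate j \<omega>) (block c))) UNIV"
    by (rule indep_vars_compose2[OF * fm])
  moreover have "(\<lambda>c \<omega>. f c (restrict (\<lambda>j. coordinate j \<omega>) (block c)))
      = (\<lambda>c \<omega>. if c then (\<lambda>_. 0, \<lambda>_. snd \<omega> []) else (fst \<omega>, (snd \<omega>)([] := 0)))"
    by (intro ext) (simp add: f_def block_def coordinate_def fun_eq_iff)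
  ultimately have ind: "indep_vars (\<lambda>_. ?M) (\<lambda>c \<omega>. if c then (\<lambda>_. 0, \<lambda>_. snd \<omega> []) else (fst \<omega>, (snd \<omega>)([] := 0))) UNIV"
    by simp
  have "prob (\<Inter>c\<in>UNIV. (\<lambda>\<omega>. if c then (\<lambda>_. 0, \<lambda>_. snd \<omega> []) else (fst \<omega>, (snd \<omega>)([] := 0))) -` (if c then {\<omega>. snd \<omega> [] = y} else A) \<inter> space ?M)
      = (\<Prod>c\<in>UNIV. prob ((\<lambda>\<omega>. if c then (\<lambda>_. 0, \<lambda>_. snd \<omega> []) else (fst \<omega>, (snd \<omega>)([] := 0))) -` (if c then {\<omega>. snd \<omega> [] = y} else A) \<inter> space ?M))"
  proof (rule indep_varsD[OF ind])
    fix c :: bool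
    have "{\<omega> \<in> space ?M. snd \<omega> [] = y} \<in> sets ?M" by measurable
    then show "(if c then {\<omega>. snd \<omega> [] = y} else A) \<in> sets ?M" using A by auto
  qed auto
  also have "(\<Inter>c\<in>UNIV. (\<lambda>\<omega>. if c then (\<lambda>_. 0, \<lambda>_. snd \<omega> []) else (fst \<omega>, (snd \<omega>)([] := 0))) -` (if c then {\<omega>. snd \<omega> [] = y} else A) \<inter> space ?M)
      = {\<omega>. snd \<omega> [] = y \<and> \<omega> \<in> A}"
    using ign by (auto simp: UNIV_bool ignores_root_edge_def)
  also have "(\<Prod>c\<in>UNIV. prob ((\<lambda>\<omega>. if c then (\<lambda>_. 0, \<lambda>_. snd \<omega> []) else (fst \<omega>, (snd \<omega>)([] := 0))) -` (if c then {\<omega>. snd \<omega> [] = y} else A) \<inter> space ?M))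
      = prob {\<omega>. snd \<omega> [] = y} * prob A"
    using ign by (auto simp: UNIV_bool ignores_root_edge_def vimage_def)
  finally have "emeasure ?M {\<omega>. snd \<omega> [] = y \<and> \<omega> \<in> A} = emeasure ?M {\<omega>. snd \<omega> [] = y} * emeasure ?M A"
    by (simp add: emeasure_eq_measure ennreal_mult)
  moreover have "emeasure ?M {\<omega>. snd \<omega> [] = y} = ennreal (pmf \<theta> y)"
    using emeasure_snake_rectangle[of "{}" "{[]}" \<mu> \<mu> \<theta> "\<lambda>_. UNIV" "\<lambda>_. {y}"] by (simp add: emeasure_pmf_single)
  ultimately show ?thesis by simp
qed

text \<open>The event for the snake that starts one step away from \<open>x\<close>, the step being the root edge variable. Applied to a subsnake, it is the event
  for the subtree of a child of a vertex at \<open>x\<close>.\<close>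

definition moved :: "(int ^ 'n \<Rightarrow> 'n snake set) \<Rightarrow> int ^ 'n \<Rightarrow> 'n snake set" where
  "moved A x = {\<omega>. \<omega> \<in> A (x + snd \<omega> [])}"

lemma
  fixes A :: "int ^ 'n \<Rightarrow> 'n snake set"
  assumes A: "\<And>x. A x \<in> sets (snake_space \<mu> \<mu> \<theta>)"
  shows moved_sets: "moved A x \<in> sets (snake_space \<mu> \<mu> \<theta>)"
    and emeasure_moved: "(\<And>x. ignores_root_edge (A x)) \<Longrightarrow>
      emeasure (snake_space \<mu> \<mu> \<theta>) (moved A x) = step \<theta> (\<lambda>x. emeasure (snake_space \<mu> \<mu> \<theta>) (A x)) x"
proof -
  let ?M = "snake_space \<mu> \<mu> \<theta>"
  define D where "D y = {\<omega>. snd \<omega> [] = y \<and> \<omega> \<in> A (x + y)}" for y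
  have eq: "moved A x = (\<Union>y. D y)" by (auto simp: moved_def D_def)
  have sets: "D y \<in> sets ?M" for y
  proof -
    have "{\<omega> \<in> space ?M. snd \<omega> [] = y} \<in> sets ?M" by measurable
    then have "{\<omega>. snd \<omega> [] = y} \<inter> A (x + y) \<in> sets ?M" using A by auto
    also have "{\<omega>. snd \<omega> [] = y} \<inter> A (x + y) = D y" by (auto simp: D_def)
    finally show ?thesis .
  qed
  have cnt: "countable (UNIV :: (int ^ 'n) set)" by (rule countableI_type)
  show "moved A x \<in> sets ?M" unfolding eq by (rule sets.countable_UN'') (use sets cnt in auto)
  assume ign: "\<And>x. ignores_root_edge (A x)"
  have "emeasure ?M (\<Union>y. D y) = (\<integral>\<^sup>+y. emeasure ?M (D y) \<partial>count_space UNIV)"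
    by (rule emeasure_UN_countable) (use sets cnt in \<open>auto simp: disjoint_family_on_def D_def\<close>)
  also have "\<dots> = (\<integral>\<^sup>+y. ennreal (pmf \<theta> y) * emeasure ?M (A (x + y)) \<partial>count_space UNIV)"
    unfolding D_def using root_edge_indep[OF A ign] by simp
  finally show "emeasure ?M (moved A x) = step \<theta> (\<lambda>x. emeasure ?M (A x)) x"
    unfolding eq step_def nn_integral_measure_pmf .
qed

section \<open>Hitting a set, generation by generation\<close>

lemma snake_pos_Nil [simp]: "snake_pos x \<omega> [] = x"
  by (simp add: snake_pos_def)

lemma snake_pos_Cons: "snake_pos x \<omega> (i # w) = snake_pos (x + snd (subsnake i \<omega>) []) (subsnake i \<omega>) w"
  unfolding snake_pos_def length_Cons sum.lessThan_Suc_shift by (simp add: subsnake_def add.assoc)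

lemma Nil_in_hits [simp]: "[] \<in> hits x K \<omega> \<longleftrightarrow> x \<in> K"
  by (simp add: hits_def snake_tree_def tree_of_def)

lemma Cons_in_hits: "i # w \<in> hits x K \<omega> \<longleftrightarrow> i < fst \<omega> [] \<and> w \<in> hits (x + snd (subsnake i \<omega>) []) K (subsnake i \<omega>)"
proof -
  have "(\<forall>k<Suc (length w). (i # w) ! k < fst \<omega> (take k (i # w))) \<longleftrightarrow> i < fst \<omega> [] \<and> (\<forall>k<length w. w ! k < fst \<omega> (i # take k w))"
    by (subst All_less_Suc2) simp
  then show ?thesis
    unfolding hits_def snake_tree_def tree_of_def by (simp add: snake_pos_Cons) (simp add: subsnake_def)
qed

lemma snake_pos_root_edge: "snake_pos x (fst \<omega>, (snd \<omega>)([] := y)) v = snake_pos x \<omega> v"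
  unfolding snake_pos_def by (intro arg_cong2[where f="(+)"] sum.cong) auto

lemma hits_root_edge: "hits x K (fst \<omega>, (snd \<omega>)([] := y)) = hits x K \<omega>"
  unfolding hits_def snake_pos_root_edge by (simp add: snake_tree_def)

lemma measurable_snake_pos [measurable]:
  "(\<lambda>\<omega>. snake_pos x \<omega> v) \<in> measurable (snake_space \<rho> \<mu> \<theta>) (count_space UNIV)"
proof -
  have "(\<lambda>\<omega>. \<Sum>k<n. snd \<omega> (take (Suc k) v)) \<in> measurable (snake_space \<rho> \<mu> \<theta>) (count_space UNIV)" for n
  proof (induction n)
    case (Suc n)
    have "(\<lambda>\<omega>. (\<Sum>k<n. snd \<omega> (take (Suc k) v), snd \<omega> (take (Suc n) v)))
        \<in> measurable (snake_space \<rho> \<mu> \<theta>) (count_space UNIV \<Otimes>\<^sub>M count_space UNIV)"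
      using Suc by (intro measurable_Pair measurable_edge)
    then have "(\<lambda>\<omega>. (\<Sum>k<n. snd \<omega> (take (Suc k) v), snd \<omega> (take (Suc n) v)))
        \<in> measurable (snake_space \<rho> \<mu> \<theta>) (count_space UNIV)"
      by (simp add: pair_measure_countable)
    from measurable_compose[OF this, of "\<lambda>(a, b). a + b" "count_space UNIV"] show ?case by simp
  qed simp
  from measurable_compose[OF this, of "\<lambda>a. x + a" "count_space UNIV"] show ?thesis unfolding snake_pos_def by simp
qed

lemma measurable_hits [measurable]: "Measurable.pred (snake_space \<rho> \<mu> \<theta>) (\<lambda>\<omega>. v \<in> hits x K \<omega>)"
proof -
  have [measurable]: "Measurable.pred (snake_space \<rho> \<mu> \<theta>) (\<lambda>\<omega>. snake_pos x \<omega> v \<in> K)"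
    using measurable_compose[OF measurable_snake_pos, of "\<lambda>y. y \<in> K" "count_space UNIV"] by simp
  have [measurable]: "Measurable.pred (snake_space \<rho> \<mu> \<theta>) (\<lambda>\<omega>. k < fst \<omega> u)" for k u
    using measurable_compose[OF measurable_offspring, of "\<lambda>n. k < n" "count_space UNIV"] by simp
  show ?thesis unfolding hits_def snake_tree_def tree_of_def mem_Collect_eq by measurable
qed

definition visit :: "(int ^ 'n) set \<Rightarrow> int ^ 'n \<Rightarrow> 'n snake set" where
  "visit K x = {\<omega>. visits x K \<omega>}"

text \<open>The events below quantify over all vertices, so that they are measurable as countable unions and intersections.\<close>

definition visit_at :: "(int ^ 'n) set \<Rightarrow> nat \<Rightarrow> int ^ 'n \<Rightarrow> 'n snake set" where
  "visit_at K n x = {\<omega>. \<exists>v. v \<in> hits x K \<omega> \<and> length v = n}"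

definition first_at :: "(int ^ 'n) set \<Rightarrow> int ^ 'n \<Rightarrow> nat \<Rightarrow> int ^ 'n \<Rightarrow> 'n snake set" where
  "first_at K a n x = {\<omega>. \<exists>v. v \<in> hits x K \<omega> \<and> length v = n \<and> snake_pos x \<omega> v = a \<and> (\<forall>u. u \<in> hits x K \<omega> \<longrightarrow> v \<le> u)}"

definition last_at :: "(int ^ 'n) set \<Rightarrow> int ^ 'n \<Rightarrow> nat \<Rightarrow> int ^ 'n \<Rightarrow> 'n snake set" where
  "last_at K a n x = {\<omega>. \<exists>v. v \<in> hits x K \<omega> \<and> length v = n \<and> snake_pos x \<omega> v = a \<and> (\<forall>u. u \<in> hits x K \<omega> \<longrightarrow> u \<le> v)}"

lemma sets_visit: "visit K x \<in> sets (snake_space \<rho> \<mu> \<theta>)"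
proof -
  have "{\<omega> \<in> space (snake_space \<rho> \<mu> \<theta>). \<exists>v. v \<in> hits x K \<omega>} \<in> sets (snake_space \<rho> \<mu> \<theta>)" by measurable
  also have "{\<omega> \<in> space (snake_space \<rho> \<mu> \<theta>). \<exists>v. v \<in> hits x K \<omega>} = visit K x" by (auto simp: visit_def visits_def)
  finally show ?thesis .
qed

lemma sets_visit_at: "visit_at K n x \<in> sets (snake_space \<rho> \<mu> \<theta>)"
proof -
  have "{\<omega> \<in> space (snake_space \<rho> \<mu> \<theta>). \<exists>v. v \<in> hits x K \<omega> \<and> length v = n} \<in> sets (snake_space \<rho> \<mu> \<theta>)" by measurable
  then show ?thesis by (simp add: visit_at_def)
qed

lemma sets_first_at: "first_at K a n x \<in> sets (snake_space \<rho> \<mu> \<theta>)"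
proof -
  have "{\<omega> \<in> space (snake_space \<rho> \<mu> \<theta>). \<exists>v. v \<in> hits x K \<omega> \<and> length v = n \<and> snake_pos x \<omega> v = a \<and> (\<forall>u. u \<in> hits x K \<omega> \<longrightarrow> v \<le> u)} \<in> sets (snake_space \<rho> \<mu> \<theta>)" by measurable
  then show ?thesis by (simp add: first_at_def)
qed

lemma sets_last_at: "last_at K a n x \<in> sets (snake_space \<rho> \<mu> \<theta>)"
proof -
  have "{\<omega> \<in> space (snake_space \<rho> \<mu> \<theta>). \<exists>v. v \<in> hits x K \<omega> \<and> length v = n \<and> snake_pos x \<omega> v = a \<and> (\<forall>u. u \<in> hits x K \<omega> \<longrightarrow> u \<le> v)} \<in> sets (snake_space \<rho> \<mu> \<theta>)" by measurable
  then show ?thesis by (simp add: last_at_def)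
qed

lemma ignores_root_edge_hits:
  "ignores_root_edge (visit K x)" "ignores_root_edge (visit_at K n x)"
  "ignores_root_edge (first_at K a n x)" "ignores_root_edge (last_at K a n x)"
  by (simp_all add: ignores_root_edge_def visit_def visits_def visit_at_def first_at_def last_at_def hits_root_edge snake_pos_root_edge)

lemma hits_empty_iff: "hits x K \<omega> = {} \<longleftrightarrow> x \<notin> K \<and> (\<forall>i<fst \<omega> []. subsnake i \<omega> \<notin> moved (visit K) x)"
proof -
  have "hits x K \<omega> = {} \<longleftrightarrow> [] \<notin> hits x K \<omega> \<and> (\<forall>i w. i # w \<notin> hits x K \<omega>)"
    by (metis all_not_in_conv neq_Nil_conv)
  then show ?thesis by (auto simp: Cons_in_hits moved_def visit_def visits_def)
qed

lemma visit_at_0: "visit_at K 0 x = {\<omega>. x \<in> K}"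
  by (auto simp: visit_at_def)

lemma ex_vertex_Suc: "(\<exists>v. P v \<and> length v = Suc n \<and> Q v) \<longleftrightarrow> (\<exists>i w. P (i # w) \<and> length w = n \<and> Q (i # w :: vertex))"
  by (auto simp: length_Suc_conv)

lemma visit_at_Suc: "visit_at K (Suc n) x = {\<omega>. \<exists>i<fst \<omega> []. subsnake i \<omega> \<in> moved (visit_at K n) x}"
  using ex_vertex_Suc[of _ n "\<lambda>_. True"] by (simp add: visit_at_def moved_def Cons_in_hits)

lemma first_at_0: "a \<in> K \<Longrightarrow> first_at K a 0 x = {\<omega>. x = a}"
  by (auto simp: first_at_def)

lemma last_at_0:
  assumes "a \<in> K"
  shows "last_at K a 0 x = {\<omega>. x = a \<and> (\<forall>i<fst \<omega> []. subsnake i \<omega> \<notin> moved (visit K) x)}"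
proof -
  have "(\<forall>u. u \<in> hits x K \<omega> \<longrightarrow> u \<le> []) \<longleftrightarrow> (\<forall>i w. i # w \<notin> hits x K \<omega>)" for \<omega> :: "'a snake"
    by (metis le_Nil list.distinct(1) neq_Nil_conv)
  then show ?thesis using assms by (auto simp: last_at_def Cons_in_hits moved_def visit_def visits_def)
qed

lemma all_vertices_iff: "(\<forall>u. P u) \<longleftrightarrow> P [] \<and> (\<forall>i w. P (i # w :: vertex))"
  by (metis neq_Nil_conv)

lemma first_branch_iff:
  assumes "i < (N :: nat)"
  shows "(\<forall>j u. j < N \<and> u \<in> h j \<longrightarrow> i < j \<or> i = j \<and> w \<le> u) \<longleftrightarrow> (\<forall>j\<in>{..<i}. h j = {}) \<and> (\<forall>u. u \<in> h i \<longrightarrow> w \<le> u)"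
proof (intro iffI conjI ballI allI impI)
  fix j assume a: "\<forall>j u. j < N \<and> u \<in> h j \<longrightarrow> i < j \<or> i = j \<and> w \<le> u" and "j \<in> {..<i}"
  then have "j < N" "\<not> i < j" "i \<noteq> j" using assms by auto
  then show "h j = {}" using a by blast
next
  fix u assume "\<forall>j u. j < N \<and> u \<in> h j \<longrightarrow> i < j \<or> i = j \<and> w \<le> u" "u \<in> h i"
  then show "w \<le> u" using assms by blast
next
  fix j u assume "(\<forall>j\<in>{..<i}. h j = {}) \<and> (\<forall>u. u \<in> h i \<longrightarrow> w \<le> u)" "j < N \<and> u \<in> h j"
  then show "i < j \<or> i = j \<and> w \<le> u" by (cases j i rule: linorder_cases) auto
qed

lemma last_branch_iff:
  assumes "i < (N :: nat)"
  shows "(\<forall>j u. j < N \<and> u \<in> h j \<longrightarrow> j < i \<or> j = i \<and> u \<le> w) \<longleftrightarrow> (\<forall>j\<in>{i<..<N}. h j = {}) \<and> (\<forall>u. u \<in> h i \<longrightarrow> u \<le> w)"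
proof (intro iffI conjI ballI allI impI)
  fix j assume a: "\<forall>j u. j < N \<and> u \<in> h j \<longrightarrow> j < i \<or> j = i \<and> u \<le> w" and "j \<in> {i<..<N}"
  then have "j < N" "\<not> j < i" "j \<noteq> i" by auto
  then show "h j = {}" using a by blast
next
  fix u assume "\<forall>j u. j < N \<and> u \<in> h j \<longrightarrow> j < i \<or> j = i \<and> u \<le> w" "u \<in> h i"
  then show "u \<le> w" using assms by blast
next
  fix j u assume "(\<forall>j\<in>{i<..<N}. h j = {}) \<and> (\<forall>u. u \<in> h i \<longrightarrow> u \<le> w)" "j < N \<and> u \<in> h j"
  then show "j < i \<or> j = i \<and> u \<le> w" by (cases j i rule: linorder_cases) auto
qed

text \<open>The first visit is in the subtree of child \<open>i\<close> if it is the first visit there, all older children miss \<open>K\<close>, and the root is not in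
  \<open>K\<close>: the depth-first order compares the first letters of the words.\<close>

lemma first_at_Suc:
  "first_at K a (Suc n) x = {\<omega>. x \<notin> K \<and> (\<exists>i<fst \<omega> []. subsnake i \<omega> \<in> moved (first_at K a n) x \<and>
     (\<forall>j\<in>{..<i}. subsnake j \<omega> \<notin> moved (visit K) x))}"
proof (intro set_eqI)
  fix \<omega> :: "'a snake"
  define h where "h j = hits (x + snd (subsnake j \<omega>) []) K (subsnake j \<omega>)" for j
  have V: "subsnake j \<omega> \<in> moved (visit K) x \<longleftrightarrow> h j \<noteq> {}" for j by (auto simp: moved_def visit_def visits_def h_def)
  have F: "subsnake j \<omega> \<in> moved (first_at K a n) x \<longleftrightarrow> (\<exists>w. w \<in> h j \<and> length w = n
      \<and> snake_pos (x + snd (subsnake j \<omega>) []) (subsnake j \<omega>) w = a \<and> (\<forall>u. u \<in> h j \<longrightarrow> w \<le> u))" for j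
    by (simp add: moved_def first_at_def h_def)
  have all: "(\<forall>u. u \<in> hits x K \<omega> \<longrightarrow> i # w \<le> u) \<longleftrightarrow> x \<notin> K \<and> (\<forall>j u. j < fst \<omega> [] \<and> u \<in> h j \<longrightarrow> i < j \<or> i = j \<and> w \<le> u)" for i w
    by (subst all_vertices_iff) (simp add: Cons_in_hits h_def)
  have "\<omega> \<in> first_at K a (Suc n) x \<longleftrightarrow> (\<exists>i w. i < fst \<omega> [] \<and> w \<in> h i \<and> length w = n
      \<and> snake_pos (x + snd (subsnake i \<omega>) []) (subsnake i \<omega>) w = a \<and> x \<notin> K
      \<and> (\<forall>j u. j < fst \<omega> [] \<and> u \<in> h j \<longrightarrow> i < j \<or> i = j \<and> w \<le> u))"
    unfolding first_at_def mem_Collect_eq ex_vertex_Suc all Cons_in_hits h_def[symmetric] snake_pos_Cons by blast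
  also have "\<dots> \<longleftrightarrow> x \<notin> K \<and> (\<exists>i<fst \<omega> []. (\<exists>w. w \<in> h i \<and> length w = n
      \<and> snake_pos (x + snd (subsnake i \<omega>) []) (subsnake i \<omega>) w = a \<and> (\<forall>u. u \<in> h i \<longrightarrow> w \<le> u)) \<and> (\<forall>j\<in>{..<i}. h j = {}))"
    using first_branch_iff[where N="fst \<omega> []" and h=h] by blast
  finally show "\<omega> \<in> first_at K a (Suc n) x \<longleftrightarrow> \<omega> \<in> {\<omega>. x \<notin> K \<and> (\<exists>i<fst \<omega> []. subsnake i \<omega> \<in> moved (first_at K a n) x \<and>
     (\<forall>j\<in>{..<i}. subsnake j \<omega> \<notin> moved (visit K) x))}"
    unfolding mem_Collect_eq V F by simp
qed

text \<open>Here the root may be in \<open>K\<close>, as it comes before all its descendants.\<close>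

lemma last_at_Suc:
  "last_at K a (Suc n) x = {\<omega>. \<exists>i<fst \<omega> []. subsnake i \<omega> \<in> moved (last_at K a n) x \<and>
     (\<forall>j\<in>{i<..<fst \<omega> []}. subsnake j \<omega> \<notin> moved (visit K) x)}"
proof (intro set_eqI)
  fix \<omega> :: "'a snake"
  define h where "h j = hits (x + snd (subsnake j \<omega>) []) K (subsnake j \<omega>)" for j
  have V: "subsnake j \<omega> \<in> moved (visit K) x \<longleftrightarrow> h j \<noteq> {}" for j by (auto simp: moved_def visit_def visits_def h_def)
  have F: "subsnake j \<omega> \<in> moved (last_at K a n) x \<longleftrightarrow> (\<exists>w. w \<in> h j \<and> length w = n
      \<and> snake_pos (x + snd (subsnake j \<omega>) []) (subsnake j \<omega>) w = a \<and> (\<forall>u. u \<in> h j \<longrightarrow> u \<le> w))" for j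
    by (simp add: moved_def last_at_def h_def)
  have all: "(\<forall>u. u \<in> hits x K \<omega> \<longrightarrow> u \<le> i # w) \<longleftrightarrow> (\<forall>j u. j < fst \<omega> [] \<and> u \<in> h j \<longrightarrow> j < i \<or> j = i \<and> u \<le> w)" for i w
    by (subst all_vertices_iff) (simp add: Cons_in_hits h_def)
  have "\<omega> \<in> last_at K a (Suc n) x \<longleftrightarrow> (\<exists>i w. i < fst \<omega> [] \<and> w \<in> h i \<and> length w = n
      \<and> snake_pos (x + snd (subsnake i \<omega>) []) (subsnake i \<omega>) w = a
      \<and> (\<forall>j u. j < fst \<omega> [] \<and> u \<in> h j \<longrightarrow> j < i \<or> j = i \<and> u \<le> w))"
    unfolding last_at_def mem_Collect_eq ex_vertex_Suc all Cons_in_hits h_def[symmetric] snake_pos_Cons by blast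
  also have "\<dots> \<longleftrightarrow> (\<exists>i<fst \<omega> []. (\<exists>w. w \<in> h i \<and> length w = n
      \<and> snake_pos (x + snd (subsnake i \<omega>) []) (subsnake i \<omega>) w = a \<and> (\<forall>u. u \<in> h i \<longrightarrow> u \<le> w)) \<and> (\<forall>j\<in>{i<..<fst \<omega> []}. h j = {}))"
    using last_branch_iff[where N="fst \<omega> []" and h=h] by blast
  finally show "\<omega> \<in> last_at K a (Suc n) x \<longleftrightarrow> \<omega> \<in> {\<omega>. \<exists>i<fst \<omega> []. subsnake i \<omega> \<in> moved (last_at K a n) x \<and>
     (\<forall>j\<in>{i<..<fst \<omega> []}. subsnake j \<omega> \<notin> moved (visit K) x)}"
    unfolding mem_Collect_eq V F by simp
qed

section \<open>Recursions for the hitting probabilities\<close>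

context
  fixes \<mu> :: "nat pmf" and \<theta> :: "(int ^ 'n) pmf" and K :: "(int ^ 'n) set"
begin

abbreviation snake_prob :: "'n snake set \<Rightarrow> ennreal" where
  "snake_prob \<equiv> emeasure (snake_space \<mu> \<mu> \<theta>)"

definition child_misses :: "int ^ 'n \<Rightarrow> ennreal" where
  "child_misses x = snake_prob (- moved (visit K) x)"

text \<open>The generating function of the adjoint law at \<open>child_misses x\<close>: the probability that a bush with root at \<open>x\<close> misses \<open>K\<close> below its
  root.\<close>

definition bush_misses :: "int ^ 'n \<Rightarrow> ennreal" where
  "bush_misses x = (\<Sum>l. emeasure (measure_pmf \<mu>) {l<..} * child_misses x ^ l)"

definition tree_misses :: "int ^ 'n \<Rightarrow> ennreal" where
  "tree_misses x = (\<integral>\<^sup>+m. child_misses x ^ m \<partial>\<mu>)"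

lemma child_misses_plus: "child_misses x + step \<theta> (\<lambda>x. snake_prob (visit K x)) x = 1"
proof -
  have "child_misses x + snake_prob (moved (visit K) x) = snake_prob (- moved (visit K) x \<union> moved (visit K) x)"
    unfolding child_misses_def
    by (rule plus_emeasure) (auto intro: sets_snake_Compl moved_sets sets_visit)
  then show ?thesis using emeasure_moved[of "visit K" \<mu> \<theta> x] by (simp add: sets_visit ignores_root_edge_hits emeasure_snake_UNIV)
qed

lemma child_misses_le_1: "child_misses x \<le> 1"
  using child_misses_plus[of x] by (metis le_iff_add)

text \<open>The position of a selected child among its siblings, averaged over the offspring number, has the adjoint law as weights.\<close>

lemma sum_child_misses: "(\<integral>\<^sup>+m. (\<Sum>i<m. child_misses x ^ i) \<partial>\<mu>) = bush_misses x"
proof -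
  have "(\<Sum>i<m. child_misses x ^ i) = (\<Sum>i. indicator {i<..} m * child_misses x ^ i)" for m
  proof -
    have "(\<Sum>i. indicator {i<..} m * child_misses x ^ i) = (\<Sum>i<m. indicator {i<..} m * child_misses x ^ i)"
      by (rule suminf_finite) auto
    then show ?thesis by simp
  qed
  then have "(\<integral>\<^sup>+m. (\<Sum>i<m. child_misses x ^ i) \<partial>\<mu>) = (\<integral>\<^sup>+m. (\<Sum>i. indicator {i<..} m * child_misses x ^ i) \<partial>\<mu>)" by simp
  also have "\<dots> = (\<Sum>i. \<integral>\<^sup>+m. indicator {i<..} m * child_misses x ^ i \<partial>\<mu>)" by (rule nn_integral_suminf) simp
  also have "\<dots> = bush_misses x" unfolding bush_misses_def by (simp add: nn_integral_multc)
  finally show ?thesis .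
qed

lemma first_at_Suc_prob:
  "snake_prob (first_at K a (Suc n) x) = indicator (- K) x * bush_misses x * step \<theta> (\<lambda>x. snake_prob (first_at K a n x)) x"
proof (cases "x \<in> K")
  case True then show ?thesis by (simp add: first_at_Suc)
next
  case False
  have sub: "moved (first_at K a n) x \<subseteq> moved (visit K) x"
    by (auto simp: moved_def first_at_def visit_def visits_def)
  have "snake_prob (first_at K a (Suc n) x) = (\<integral>\<^sup>+m. (\<Sum>i<m. child_misses x ^ card {..<i}) \<partial>\<mu>) * snake_prob (moved (first_at K a n) x)"
    unfolding first_at_Suc child_misses_def using False
    by (simp, subst selected_child[where Q="\<lambda>m i. {..<i}"])
       (use sub in \<open>auto intro: moved_sets sets_visit sets_first_at\<close>)
  then show ?thesis using False
    by (simp add: sum_child_misses emeasure_moved sets_first_at ignores_root_edge_hits)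
qed

lemma last_at_Suc_prob:
  "snake_prob (last_at K a (Suc n) x) = bush_misses x * step \<theta> (\<lambda>x. snake_prob (last_at K a n x)) x"
proof -
  have sub: "moved (last_at K a n) x \<subseteq> moved (visit K) x"
    by (auto simp: moved_def last_at_def visit_def visits_def)
  have "snake_prob (last_at K a (Suc n) x) = (\<integral>\<^sup>+m. (\<Sum>i<m. child_misses x ^ card {i<..<m}) \<partial>\<mu>) * snake_prob (moved (last_at K a n) x)"
    unfolding last_at_Suc child_misses_def
    by (subst selected_child[where Q="\<lambda>m i. {i<..<m}"])
       (use sub in \<open>auto intro: moved_sets sets_visit sets_last_at\<close>)
  also have "(\<lambda>m. \<Sum>i<m. child_misses x ^ card {i<..<m}) = (\<lambda>m. \<Sum>i<m. child_misses x ^ i)"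
    by (rule ext) (simp add: sum.nat_diff_reindex[symmetric, of "\<lambda>i. child_misses x ^ i"])
  finally show ?thesis
    by (simp add: sum_child_misses emeasure_moved sets_last_at ignores_root_edge_hits)
qed

lemma first_at_0_prob: "a \<in> K \<Longrightarrow> snake_prob (first_at K a 0 x) = indicator {a} x"
  by (auto simp: first_at_0 emeasure_snake_UNIV indicator_def)

lemma last_at_0_prob: "a \<in> K \<Longrightarrow> snake_prob (last_at K a 0 x) = tree_misses a * indicator {a} x"
proof (cases "x = a")
  case True
  assume "a \<in> K"
  then show ?thesis using True no_child_in(1)[of "moved (visit K) a" \<mu> \<theta> \<mu>]
    by (simp add: last_at_0 tree_misses_def child_misses_def moved_sets sets_visit)
qed (simp add: last_at_0)

lemma visit_at_0_prob: "snake_prob (visit_at K 0 x) = indicator K x"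
  by (auto simp: visit_at_0 emeasure_snake_UNIV indicator_def)

text \<open>Both sides satisfy the same recursion in \<open>n\<close>.\<close>

lemma killed_first_at:
  assumes "killing q k" and q: "\<And>x. q x = indicator (- K) x * bush_misses x" and a: "a \<in> K"
  shows "snake_prob (first_at K a n x) = killing.killed_walk \<theta> q a n x"
proof -
  interpret killing \<theta> q k by fact
  show ?thesis
  proof (induction n arbitrary: x)
    case (Suc n) then show ?case by (simp add: first_at_Suc_prob killed_walk_Suc kstep_def q[symmetric])
  qed (simp add: first_at_0_prob[OF a])
qed

lemma killed_last_at:
  assumes "killing bush_misses k" and a: "a \<in> K"
  shows "snake_prob (last_at K a n x) = tree_misses a * killing.killed_walk \<theta> bush_misses a n x"
proof -
  interpret killing \<theta> bush_misses k by fact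
  show ?thesis
  proof (induction n arbitrary: x)
    case (Suc n) then show ?case by (simp add: last_at_Suc_prob killed_walk_Suc kstep_def step_cmult mult_ac)
  qed (simp add: last_at_0_prob[OF a])
qed

context
  assumes mean1: "(\<Sum>i. emeasure (measure_pmf \<mu>) {i<..}) = 1"
begin

text \<open>A union bound over the children, with one child on average; so the expected number of visits is bounded by that of a single walk.\<close>

lemma visit_at_le:
  assumes K: "finite K"
  shows "snake_prob (visit_at K n x) \<le> (\<Sum>b\<in>K. ennreal (pmf (walk \<theta> n) (b - x)))"
proof (induction n arbitrary: x)
  case 0
  have "(indicator K x :: ennreal) \<le> (\<Sum>b\<in>K. ennreal (pmf (walk \<theta> 0) (b - x)))"
  proof (cases "x \<in> K")
    case True
    have "ennreal (pmf (walk \<theta> 0) (x - x)) \<le> (\<Sum>b\<in>K. ennreal (pmf (walk \<theta> 0) (b - x)))"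
      by (rule member_le_sum[OF True]) (use K in auto)
    then show ?thesis using True by simp
  qed simp
  then show ?case by (simp add: visit_at_0_prob)
next
  case (Suc n)
  have "snake_prob (visit_at K (Suc n) x) \<le> snake_prob (moved (visit_at K n) x)"
    unfolding visit_at_Suc using some_child_in_le[of "moved (visit_at K n) x" \<mu> \<theta> \<mu>]
    by (simp add: mean1 moved_sets sets_visit_at)
  also have "\<dots> = step \<theta> (\<lambda>x. snake_prob (visit_at K n x)) x"
    by (simp add: emeasure_moved sets_visit_at ignores_root_edge_hits)
  also have "\<dots> \<le> step \<theta> (\<lambda>x. \<Sum>b\<in>K. ennreal (pmf (walk \<theta> n) (b - x))) x"
    by (intro step_mono Suc.IH)
  also have "\<dots> = (\<Sum>b\<in>K. step \<theta> (\<lambda>x. ennreal (pmf (walk \<theta> n) (b - x))) x)"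
    unfolding step_def by (rule nn_integral_sum) simp
  finally show ?case unfolding step_pmf_walk .
qed

lemma visit_eq_visit_at: "visit K x = (\<Union>n. visit_at K n x)"
  by (auto simp: visit_def visits_def visit_at_def)

lemma suminf_visit_at_le: "finite K \<Longrightarrow> (\<Sum>n. snake_prob (visit_at K n x)) \<le> (\<Sum>b\<in>K. green \<theta> (b - x))"
proof -
  assume K: "finite K"
  have "(\<Sum>n. snake_prob (visit_at K n x)) \<le> (\<Sum>n. \<Sum>b\<in>K. ennreal (pmf (walk \<theta> n) (b - x)))"
    by (intro suminf_le visit_at_le K) auto
  also have "\<dots> = (\<Sum>b\<in>K. green \<theta> (b - x))" unfolding green_def by (rule suminf_sum) simp
  finally show ?thesis .
qed

lemma visit_prob_le: "finite K \<Longrightarrow> snake_prob (visit K x) \<le> (\<Sum>b\<in>K. green \<theta> (b - x))"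
proof -
  assume K: "finite K"
  have "snake_prob (visit K x) \<le> (\<Sum>n. snake_prob (visit_at K n x))"
    unfolding visit_eq_visit_at by (rule emeasure_subadditive_countably) (auto simp: sets_visit_at)
  then show ?thesis using suminf_visit_at_le[OF K] by (rule order_trans)
qed

lemma child_hit_le: "finite K \<Longrightarrow> step \<theta> (\<lambda>x. snake_prob (visit K x)) x \<le> (\<Sum>b\<in>K. green \<theta> (b - x))"
proof -
  assume K: "finite K"
  have "step \<theta> (\<lambda>x. snake_prob (visit K x)) x \<le> step \<theta> (\<lambda>x. \<Sum>b\<in>K. green \<theta> (b - x)) x"
    by (intro step_mono visit_prob_le K)
  also have "\<dots> = (\<Sum>b\<in>K. step \<theta> (\<lambda>x. green \<theta> (b - x)) x)"
    unfolding step_def by (rule nn_integral_sum) simp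
  also have "\<dots> \<le> (\<Sum>b\<in>K. green \<theta> (b - x))"
  proof (rule sum_mono)
    fix b
    have "step \<theta> (\<lambda>x. green \<theta> (b - x)) x = (\<integral>\<^sup>+y. green \<theta> (b - x - y) \<partial>\<theta>)" unfolding step_def by (simp add: algebra_simps)
    also have "\<dots> \<le> green \<theta> (b - x)" using green_first_step[of \<theta> "b - x"] by (metis le_iff_add add.commute)
    finally show "step \<theta> (\<lambda>x. green \<theta> (b - x)) x \<le> green \<theta> (b - x)" .
  qed
  finally show ?thesis .
qed

lemma power_plus_ge_1:
  fixes s r :: ennreal
  assumes "s + r = 1"
  shows "1 \<le> s ^ l + of_nat l * r"
proof (induction l)
  case (Suc l)
  have s: "s \<le> 1" using assms by (metis le_iff_add)
  have "1 = s + r" using assms by simp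
  also have "\<dots> \<le> s * (s ^ l + of_nat l * r) + r" using mult_left_mono[OF Suc, of s] by (simp add: add_right_mono)
  also have "\<dots> = s ^ Suc l + (s * (of_nat l * r) + r)" by (simp add: distrib_left add.assoc)
  also have "\<dots> \<le> s ^ Suc l + (1 * (of_nat l * r) + r)" by (intro add_mono mult_right_mono order_refl s) auto
  also have "\<dots> = s ^ Suc l + of_nat (Suc l) * r" by (simp add: distrib_right add.commute)
  finally show ?case .
qed simp

text \<open>Bernoulli's inequality \<open>1 - s ^ l \<le> l * (1 - s)\<close>, averaged over the adjoint law, in a form without subtraction.\<close>

lemma bush_misses_plus: "1 \<le> bush_misses x + (\<Sum>l. emeasure (measure_pmf \<mu>) {l<..} * of_nat l) * step \<theta> (\<lambda>x. snake_prob (visit K x)) x"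
proof -
  have "1 = (\<Sum>l. emeasure (measure_pmf \<mu>) {l<..} * 1)" using mean1 by simp
  also have "\<dots> \<le> (\<Sum>l. emeasure (measure_pmf \<mu>) {l<..} * (child_misses x ^ l + of_nat l * step \<theta> (\<lambda>x. snake_prob (visit K x)) x))"
    by (intro suminf_le mult_left_mono power_plus_ge_1 child_misses_plus) auto
  also have "\<dots> = bush_misses x + (\<Sum>l. emeasure (measure_pmf \<mu>) {l<..} * of_nat l) * step \<theta> (\<lambda>x. snake_prob (visit K x)) x"
    unfolding bush_misses_def distrib_left by (subst suminf_add[symmetric]) (auto simp: mult.assoc[symmetric])
  finally show ?thesis .
qed

lemma bush_misses_le_1: "bush_misses x \<le> 1"
proof -
  have "bush_misses x \<le> (\<Sum>l. emeasure (measure_pmf \<mu>) {l<..} * 1)"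
    unfolding bush_misses_def by (intro suminf_le mult_left_mono power_le_one child_misses_le_1) auto
  then show ?thesis using mean1 by simp
qed

text \<open>A bush is reduced to its root with positive probability, as the offspring number is not almost surely \<open>0\<close>.\<close>

lemma bush_misses_pos: "bush_misses x > 0"
proof -
  have "emeasure (measure_pmf \<mu>) {0<..} > 0"
  proof (rule ccontr)
    assume "\<not> emeasure (measure_pmf \<mu>) {0<..} > 0"
    then have "emeasure (measure_pmf \<mu>) {i<..} = 0" for i
      using emeasure_mono[of "{i<..}" "{0<..}" "measure_pmf \<mu>"] by auto
    then show False using mean1 by simp
  qed
  also have "emeasure (measure_pmf \<mu>) {0<..} = (\<Sum>l\<in>{0}. emeasure (measure_pmf \<mu>) {l<..} * child_misses x ^ l)" by simp
  also have "\<dots> \<le> bush_misses x" unfolding bush_misses_def by (rule sum_le_suminf) auto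
  finally show ?thesis .
qed

end

end

section \<open>The first and the last visit\<close>

lemma finite_generation: "finite {v \<in> tree_of N. length v = n}"
proof (induction n)
  case (Suc n)
  have "{v \<in> tree_of N. length v = Suc n} \<subseteq> (\<Union>u\<in>{v \<in> tree_of N. length v = n}. (\<lambda>i. u @ [i]) ` {..<N u})"
  proof
    fix v assume v: "v \<in> {v \<in> tree_of N. length v = Suc n}"
    define u where "u = take n v"
    have v_eq: "v = u @ [v ! n]" using v take_Suc_conv_app_nth[of n v] by (simp add: u_def)
    have "\<forall>k<Suc n. v ! k < N (take k v)" using v by (simp add: tree_of_def)
    then have "u \<in> tree_of N" "length u = n" "v ! n < N u" using v by (auto simp: u_def tree_of_def min_def)
    then show "v \<in> (\<Union>u\<in>{v \<in> tree_of N. length v = n}. (\<lambda>i. u @ [i]) ` {..<N u})" using v_eq by blast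
  qed
  then show ?case using Suc by (elim finite_subset) auto
qed simp

lemma first_at_unique: "\<omega> \<in> first_at K a n x \<Longrightarrow> \<omega> \<in> first_at K a m x \<Longrightarrow> n = m"
proof -
  assume "\<omega> \<in> first_at K a n x" "\<omega> \<in> first_at K a m x"
  then obtain v w where "v \<in> hits x K \<omega>" "length v = n" "\<And>u. u \<in> hits x K \<omega> \<Longrightarrow> v \<le> u"
    and "w \<in> hits x K \<omega>" "length w = m" "\<And>u. u \<in> hits x K \<omega> \<Longrightarrow> w \<le> u"
    unfolding first_at_def by blast
  then show "n = m" using order_antisym[of v w] by blast
qed

lemma last_at_unique: "\<omega> \<in> last_at K a n x \<Longrightarrow> \<omega> \<in> last_at K a m x \<Longrightarrow> n = m"
proof -
  assume "\<omega> \<in> last_at K a n x" "\<omega> \<in> last_at K a m x"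
  then obtain v w where "v \<in> hits x K \<omega>" "length v = n" "\<And>u. u \<in> hits x K \<omega> \<Longrightarrow> u \<le> v"
    and "w \<in> hits x K \<omega>" "length w = m" "\<And>u. u \<in> hits x K \<omega> \<Longrightarrow> u \<le> w"
    unfolding last_at_def by blast
  then show "n = m" using order_antisym[of v w] by blast
qed

lemma first_hit_eq: "v \<in> hits x K \<omega> \<Longrightarrow> (\<And>u. u \<in> hits x K \<omega> \<Longrightarrow> v \<le> u) \<Longrightarrow> first_hit x K \<omega> = v"
  unfolding first_hit_def by (rule Least_equality)

lemma last_hit_eq: "v \<in> hits x K \<omega> \<Longrightarrow> (\<And>u. u \<in> hits x K \<omega> \<Longrightarrow> u \<le> v) \<Longrightarrow> last_hit x K \<omega> = v"
  unfolding last_hit_def by (rule Greatest_equality)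

text \<open>An infinite set of visits may have no first element in depth-first order. Then \<open>first_hit\<close> is a fixed arbitrary word, and this keeps
  the event \<open>first_event\<close> measurable.\<close>

lemma first_hit_default: "\<not> (\<exists>v. v \<in> hits x K \<omega> \<and> (\<forall>u. u \<in> hits x K \<omega> \<longrightarrow> v \<le> u)) \<Longrightarrow> first_hit x K \<omega> = (THE v. False)"
  unfolding first_hit_def Least_def by (rule arg_cong[where f=The]) (rule ext, blast)

lemma last_hit_default: "\<not> (\<exists>v. v \<in> hits x K \<omega> \<and> (\<forall>u. u \<in> hits x K \<omega> \<longrightarrow> u \<le> v)) \<Longrightarrow> last_hit x K \<omega> = (THE v. False)"
  unfolding last_hit_def Greatest_def by (rule arg_cong[where f=The]) (rule ext, blast)

definition some_first :: "(int ^ 'n) set \<Rightarrow> int ^ 'n \<Rightarrow> 'n snake set" where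
  "some_first K x = {\<omega>. \<exists>v. v \<in> hits x K \<omega> \<and> (\<forall>u. u \<in> hits x K \<omega> \<longrightarrow> v \<le> u)}"

definition some_last :: "(int ^ 'n) set \<Rightarrow> int ^ 'n \<Rightarrow> 'n snake set" where
  "some_last K x = {\<omega>. \<exists>v. v \<in> hits x K \<omega> \<and> (\<forall>u. u \<in> hits x K \<omega> \<longrightarrow> u \<le> v)}"

definition first_event :: "(int ^ 'n) set \<Rightarrow> int ^ 'n \<Rightarrow> int ^ 'n \<Rightarrow> 'n snake set" where
  "first_event K a x = {\<omega>. snake_pos x \<omega> (first_hit x K \<omega>) = a \<and> visits x K \<omega>}"

definition last_event :: "(int ^ 'n) set \<Rightarrow> int ^ 'n \<Rightarrow> int ^ 'n \<Rightarrow> 'n snake set" where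
  "last_event K a x = {\<omega>. snake_pos x \<omega> (last_hit x K \<omega>) = a \<and> visits x K \<omega>}"

lemma sets_some_first: "some_first K x \<in> sets (snake_space \<rho> \<mu> \<theta>)"
proof -
  have "{\<omega> \<in> space (snake_space \<rho> \<mu> \<theta>). \<exists>v. v \<in> hits x K \<omega> \<and> (\<forall>u. u \<in> hits x K \<omega> \<longrightarrow> v \<le> u)} \<in> sets (snake_space \<rho> \<mu> \<theta>)" by measurable
  then show ?thesis by (simp add: some_first_def)
qed

lemma sets_some_last: "some_last K x \<in> sets (snake_space \<rho> \<mu> \<theta>)"
proof -
  have "{\<omega> \<in> space (snake_space \<rho> \<mu> \<theta>). \<exists>v. v \<in> hits x K \<omega> \<and> (\<forall>u. u \<in> hits x K \<omega> \<longrightarrow> u \<le> v)} \<in> sets (snake_space \<rho> \<mu> \<theta>)" by measurable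
  then show ?thesis by (simp add: some_last_def)
qed

lemma sets_pos_eq: "{\<omega>. snake_pos x \<omega> v = a} \<in> sets (snake_space \<rho> \<mu> \<theta>)"
proof -
  have "{\<omega> \<in> space (snake_space \<rho> \<mu> \<theta>). snake_pos x \<omega> v = a} \<in> sets (snake_space \<rho> \<mu> \<theta>)" by measurable
  then show ?thesis by simp
qed

lemma first_event_on_some_first: "\<omega> \<in> some_first K x \<Longrightarrow> \<omega> \<in> first_event K a x \<longleftrightarrow> \<omega> \<in> (\<Union>n. first_at K a n x)"
proof -
  assume "\<omega> \<in> some_first K x"
  then obtain v where v: "v \<in> hits x K \<omega>" "\<And>u. u \<in> hits x K \<omega> \<Longrightarrow> v \<le> u" by (auto simp: some_first_def)
  have "\<omega> \<in> first_at K a n x \<longleftrightarrow> length v = n \<and> snake_pos x \<omega> v = a" for n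
    unfolding first_at_def using v by (auto intro: order_antisym) (metis order_antisym)+
  then show ?thesis using first_hit_eq[OF v] v(1) by (auto simp: first_event_def visits_def)
qed

lemma last_event_on_some_last: "\<omega> \<in> some_last K x \<Longrightarrow> \<omega> \<in> last_event K a x \<longleftrightarrow> \<omega> \<in> (\<Union>n. last_at K a n x)"
proof -
  assume "\<omega> \<in> some_last K x"
  then obtain v where v: "v \<in> hits x K \<omega>" "\<And>u. u \<in> hits x K \<omega> \<Longrightarrow> u \<le> v" by (auto simp: some_last_def)
  have "\<omega> \<in> last_at K a n x \<longleftrightarrow> length v = n \<and> snake_pos x \<omega> v = a" for n
    unfolding last_at_def using v by (auto intro: order_antisym) (metis order_antisym)+
  then show ?thesis using last_hit_eq[OF v] v(1) by (auto simp: last_event_def visits_def)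
qed

lemma sets_first_event: "first_event K a x \<in> sets (snake_space \<rho> \<mu> \<theta>)"
proof -
  have "first_event K a x = some_first K x \<inter> (\<Union>n. first_at K a n x) \<union> (visit K x - some_first K x) \<inter> {\<omega>. snake_pos x \<omega> (THE v. False) = a}"
  proof (intro set_eqI)
    fix \<omega> :: "'a snake"
    show "\<omega> \<in> first_event K a x \<longleftrightarrow> \<omega> \<in> some_first K x \<inter> (\<Union>n. first_at K a n x) \<union> (visit K x - some_first K x) \<inter> {\<omega>. snake_pos x \<omega> (THE v. False) = a}"
    proof (cases "\<omega> \<in> some_first K x")
      case True then show ?thesis using first_event_on_some_first by blast
    next
      case False
      then have "first_hit x K \<omega> = (THE v. False)" unfolding some_first_def mem_Collect_eq by (rule first_hit_default)
      then show ?thesis using False by (auto simp: first_event_def visit_def)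
    qed
  qed
  then show ?thesis
    by (simp, intro sets.Un sets.Int sets.Diff sets_some_first sets_visit sets_pos_eq sets.countable_UN) (auto simp: sets_first_at)
qed

lemma sets_last_event: "last_event K a x \<in> sets (snake_space \<rho> \<mu> \<theta>)"
proof -
  have "last_event K a x = some_last K x \<inter> (\<Union>n. last_at K a n x) \<union> (visit K x - some_last K x) \<inter> {\<omega>. snake_pos x \<omega> (THE v. False) = a}"
  proof (intro set_eqI)
    fix \<omega> :: "'a snake"
    show "\<omega> \<in> last_event K a x \<longleftrightarrow> \<omega> \<in> some_last K x \<inter> (\<Union>n. last_at K a n x) \<union> (visit K x - some_last K x) \<inter> {\<omega>. snake_pos x \<omega> (THE v. False) = a}"
    proof (cases "\<omega> \<in> some_last K x")
      case True then show ?thesis using last_event_on_some_last by blast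
    next
      case False
      then have "last_hit x K \<omega> = (THE v. False)" unfolding some_last_def mem_Collect_eq by (rule last_hit_default)
      then show ?thesis using False by (auto simp: last_event_def visit_def)
    qed
  qed
  then show ?thesis
    by (simp, intro sets.Un sets.Int sets.Diff sets_some_last sets_visit sets_pos_eq sets.countable_UN) (auto simp: sets_last_at)
qed

lemma finite_hits_some_first: "finite (hits x K \<omega>) \<Longrightarrow> visits x K \<omega> \<Longrightarrow> \<omega> \<in> some_first K x \<inter> some_last K x"
  unfolding some_first_def some_last_def visits_def
  using Min_in[of "hits x K \<omega>"] Min_le[of "hits x K \<omega>"] Max_in[of "hits x K \<omega>"] Max_ge[of "hits x K \<omega>"]
  by (intro IntI CollectI exI[of _ "Min (hits x K \<omega>)"] exI[of _ "Max (hits x K \<omega>)"] conjI allI impI) auto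

context
  fixes \<mu> :: "nat pmf" and \<theta> :: "(int ^ 'n) pmf" and K :: "(int ^ 'n) set" and x :: "int ^ 'n"
  assumes mean1: "(\<Sum>i. emeasure (measure_pmf \<mu>) {i<..}) = 1" and K: "finite K"
    and transient: "\<And>y. green \<theta> y < \<infinity>"
begin

text \<open>The expected numbers of visits by generation have a finite sum, so by Borel--Cantelli only finitely many generations visit \<open>K\<close>; and
  generations are finite.\<close>

lemma AE_finite_hits: "AE \<omega> in snake_space \<mu> \<mu> \<theta>. finite (hits x K \<omega>)"
proof -
  interpret prob_space "snake_space \<mu> \<mu> \<theta>" by (rule prob_space_snake)
  have "(\<Sum>n. snake_prob \<mu> \<theta> (visit_at K n x)) < \<infinity>"
    by (rule le_less_trans[OF suminf_visit_at_le[OF mean1 K]]) (use K transient in auto)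
  then have "(\<Sum>n. ennreal (measure (snake_space \<mu> \<mu> \<theta>) (visit_at K n x))) \<noteq> \<infinity>"
    by (simp add: emeasure_eq_measure less_top[symmetric])
  then have "summable (\<lambda>n. measure (snake_space \<mu> \<mu> \<theta>) (visit_at K n x))"
    by (intro summable_suminf_not_top) auto
  then have "AE \<omega> in snake_space \<mu> \<mu> \<theta>. eventually (\<lambda>n. \<omega> \<in> space (snake_space \<mu> \<mu> \<theta>) - visit_at K n x) sequentially"
    by (intro borel_cantelli_AE1) (auto simp: sets_visit_at emeasure_eq_measure)
  then show ?thesis
  proof eventually_elim
    fix \<omega> assume "eventually (\<lambda>n. \<omega> \<in> space (snake_space \<mu> \<mu> \<theta>) - visit_at K n x) sequentially"
    then obtain m where "\<And>n. n \<ge> m \<Longrightarrow> \<omega> \<notin> visit_at K n x" by (auto simp: eventually_sequentially)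
    then have "hits x K \<omega> \<subseteq> (\<Union>n<m. {v \<in> tree_of (fst \<omega>). length v = n})"
      by (force simp: visit_at_def hits_def snake_tree_def not_le[symmetric])
    then show "finite (hits x K \<omega>)" by (rule finite_subset) (simp add: finite_generation)
  qed
qed

text \<open>A finite set of visits has a first element, which lies in exactly one generation.\<close>

lemma first_event_prob: "snake_prob \<mu> \<theta> (first_event K a x) = (\<Sum>n. snake_prob \<mu> \<theta> (first_at K a n x))"
proof -
  have "snake_prob \<mu> \<theta> (first_event K a x) = snake_prob \<mu> \<theta> (\<Union>n. first_at K a n x)"
  proof (rule emeasure_eq_AE)
    show "AE \<omega> in snake_space \<mu> \<mu> \<theta>. \<omega> \<in> first_event K a x \<longleftrightarrow> \<omega> \<in> (\<Union>n. first_at K a n x)"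
      using AE_finite_hits
    proof eventually_elim
      case (elim \<omega>)
      show ?case
      proof (cases "visits x K \<omega>")
        case True
        then show ?thesis using finite_hits_some_first[OF elim] first_event_on_some_first by blast
      qed (auto simp: first_event_def first_at_def visits_def)
    qed
  qed (auto simp: sets_first_event sets_first_at)
  also have "\<dots> = (\<Sum>n. snake_prob \<mu> \<theta> (first_at K a n x))"
  proof (rule suminf_emeasure[symmetric])
    show "disjoint_family (\<lambda>n. first_at K a n x)"
      unfolding disjoint_family_on_def using first_at_unique by blast
  qed (auto simp: sets_first_at)
  finally show ?thesis .
qed

lemma last_event_prob: "snake_prob \<mu> \<theta> (last_event K a x) = (\<Sum>n. snake_prob \<mu> \<theta> (last_at K a n x))"
proof -
  have "snake_prob \<mu> \<theta> (last_event K a x) = snake_prob \<mu> \<theta> (\<Union>n. last_at K a n x)"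
  proof (rule emeasure_eq_AE)
    show "AE \<omega> in snake_space \<mu> \<mu> \<theta>. \<omega> \<in> last_event K a x \<longleftrightarrow> \<omega> \<in> (\<Union>n. last_at K a n x)"
      using AE_finite_hits
    proof eventually_elim
      case (elim \<omega>)
      show ?case
      proof (cases "visits x K \<omega>")
        case True
        then show ?thesis using finite_hits_some_first[OF elim] last_event_on_some_last by blast
      qed (auto simp: last_event_def last_at_def visits_def)
    qed
  qed (auto simp: sets_last_event sets_last_at)
  also have "\<dots> = (\<Sum>n. snake_prob \<mu> \<theta> (last_at K a n x))"
  proof (rule suminf_emeasure[symmetric])
    show "disjoint_family (\<lambda>n. last_at K a n x)"
      unfolding disjoint_family_on_def using last_at_unique by blast
  qed (auto simp: sets_last_at)
  finally show ?thesis .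
qed

lemma visit_prob: "snake_prob \<mu> \<theta> (visit K x) = (\<Sum>a\<in>K. snake_prob \<mu> \<theta> (first_event K a x))"
proof -
  have "snake_prob \<mu> \<theta> (visit K x) = snake_prob \<mu> \<theta> (\<Union>a\<in>K. first_event K a x)"
  proof (rule emeasure_eq_AE)
    show "AE \<omega> in snake_space \<mu> \<mu> \<theta>. \<omega> \<in> visit K x \<longleftrightarrow> \<omega> \<in> (\<Union>a\<in>K. first_event K a x)"
      using AE_finite_hits
    proof eventually_elim
      case (elim \<omega>)
      show ?case
      proof (cases "visits x K \<omega>")
        case True
        then obtain v where v: "v \<in> hits x K \<omega>" "\<And>u. u \<in> hits x K \<omega> \<Longrightarrow> v \<le> u"
          using finite_hits_some_first[OF elim] by (auto simp: some_first_def)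
        then have "snake_pos x \<omega> (first_hit x K \<omega>) \<in> K" using first_hit_eq[OF v] by (simp add: hits_def)
        then show ?thesis using True by (auto simp: first_event_def visit_def)
      qed (auto simp: first_event_def visit_def)
    qed
  qed (use K in \<open>auto simp: sets_first_event sets_visit\<close>)
  also have "\<dots> = (\<Sum>a\<in>K. snake_prob \<mu> \<theta> (first_event K a x))"
    by (rule sum_emeasure[symmetric]) (use K in \<open>auto simp: disjoint_family_on_def image_subset_iff sets_first_event, auto simp: first_event_def\<close>)
  finally show ?thesis .
qed

end

section \<open>Snakes with an infinite spine\<close>

lemma measurable_partial_sum: "(\<lambda>w. (\<Sum>j<k. w j :: int ^ 'n)) \<in> measurable (\<Pi>\<^sub>M j\<in>(UNIV :: nat set). measure_pmf \<nu>) (count_space UNIV)"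
proof -
  let ?W = "\<Pi>\<^sub>M j\<in>(UNIV :: nat set). measure_pmf \<nu>"
  have coord: "(\<lambda>w. w j) \<in> measurable ?W (count_space UNIV)" for j
  proof -
    have "(\<lambda>w. w j) \<in> measurable ?W (measure_pmf \<nu>)" by (rule measurable_component_singleton) simp
    then show ?thesis by (simp cong: measurable_cong_sets)
  qed
  show "(\<lambda>w. (\<Sum>j<k. w j :: int ^ 'n)) \<in> measurable ?W (count_space UNIV)"
  proof (induction k)
    case (Suc n)
    have "(\<lambda>w. (\<Sum>j<n. w j, w n)) \<in> measurable ?W (count_space UNIV \<Otimes>\<^sub>M count_space UNIV)"
      using Suc coord by (intro measurable_Pair)
    then have "(\<lambda>w. (\<Sum>j<n. w j, w n)) \<in> measurable ?W (count_space UNIV)" by (simp add: pair_measure_countable)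
    from measurable_compose[OF this, of "\<lambda>(a, b). a + b" "count_space UNIV"] show ?case by simp
  qed simp
qed

lemma nn_integral_reversed: "(\<integral>\<^sup>+y. f y \<partial>reversed_pmf \<theta>) = (\<integral>\<^sup>+y. f (- y) \<partial>\<theta>)"
  unfolding reversed_pmf_def by (simp add: nn_integral_map_pmf)

context
  fixes \<theta> :: "(int ^ 'n) pmf" and q k :: "int ^ 'n \<Rightarrow> ennreal"
  assumes killing: "killing q k"
begin

interpretation killing \<theta> q k by (rule killing)

text \<open>Induction by the first spine edge: the remaining edge variables form the same product space. The spine steps have law
  \<open>reversed_pmf \<theta>\<close>, which accounts for the sign in \<open>survival\<close>.\<close>

lemma spine_product:
  "(\<integral>\<^sup>+w. (\<Prod>i<n. q (x + (\<Sum>j<Suc i. w j))) \<partial>(\<Pi>\<^sub>M j\<in>UNIV. measure_pmf (reversed_pmf \<theta>))) = survival n x"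
proof (induction n arbitrary: x)
  case 0
  interpret prob_space "\<Pi>\<^sub>M j\<in>(UNIV :: nat set). measure_pmf (reversed_pmf \<theta>)"
    by (intro prob_space_PiM) (rule prob_space_measure_pmf)
  show ?case using emeasure_space_1 by simp
next
  case (Suc n)
  interpret sequence_space "measure_pmf (reversed_pmf \<theta>)" ..
  have S: "sigma_finite_measure S" by (intro prob_space_imp_sigma_finite prob_space_PiM) (rule prob_space_measure_pmf)
  let ?f = "\<lambda>n x w. \<Prod>i<n. q (x + (\<Sum>j<Suc i. w j))"
  have meas: "?f n x \<in> borel_measurable S" for n x
  proof (rule borel_measurable_prod_ennreal)
    fix i
    show "(\<lambda>w. q (x + (\<Sum>j<Suc i. w j))) \<in> borel_measurable S"
      using measurable_compose[OF measurable_partial_sum[of "Suc i"], of "\<lambda>z. q (x + z)" borel "reversed_pmf \<theta>"] by simp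
  qed
  have mc: "(\<lambda>(s, w). case_nat s w) \<in> measurable (measure_pmf (reversed_pmf \<theta>) \<Otimes>\<^sub>M S) S"
    by measurable
  have "(\<integral>\<^sup>+w. ?f (Suc n) x w \<partial>S) = (\<integral>\<^sup>+w. ?f (Suc n) x w \<partial>distr (measure_pmf (reversed_pmf \<theta>) \<Otimes>\<^sub>M S) S (\<lambda>(s, w). case_nat s w))"
    by (simp only: PiM_iter)
  also have "\<dots> = (\<integral>\<^sup>+p. ?f (Suc n) x ((\<lambda>(s, w). case_nat s w) p) \<partial>(measure_pmf (reversed_pmf \<theta>) \<Otimes>\<^sub>M S))"
    using meas[of x "Suc n"] by (intro nn_integral_distr[OF mc]) (simp only: measurable_distr_eq1)
  also have "\<dots> = (\<integral>\<^sup>+y. \<integral>\<^sup>+w. ?f (Suc n) x (case_nat y w) \<partial>S \<partial>reversed_pmf \<theta>)"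
    using sigma_finite_measure.nn_integral_fst[OF S, OF measurable_compose[OF mc meas[of x "Suc n"]]] by simp
  also have "\<dots> = (\<integral>\<^sup>+y. q (x + y) * survival n (x + y) \<partial>reversed_pmf \<theta>)"
  proof (rule nn_integral_cong)
    fix y
    have "?f (Suc n) x (case_nat y w) = q (x + y) * ?f n (x + y) w" for w
      unfolding prod.lessThan_Suc_shift sum.lessThan_Suc_shift by (simp add: add.assoc)
    then have "(\<integral>\<^sup>+w. ?f (Suc n) x (case_nat y w) \<partial>S) = (\<integral>\<^sup>+w. q (x + y) * ?f n (x + y) w \<partial>S)" by (simp only:)
    also have "\<dots> = q (x + y) * survival n (x + y)" by (simp only: nn_integral_cmult[OF meas] Suc.IH)
    finally show "(\<integral>\<^sup>+w. ?f (Suc n) x (case_nat y w) \<partial>S) = q (x + y) * survival n (x + y)" .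
  qed
  also have "\<dots> = survival (Suc n) x" by (simp add: nn_integral_reversed)
  finally show ?case .
qed

text \<open>Given the spine, the bushes are independent, and the probability that the first \<open>n\<close> of them behave is the product of \<open>q\<close> along
  the spine; its expectation is \<open>survival n x\<close>. The bush at the root has its own law \<open>\<rho>\<close> and its own event \<open>Root\<close>.\<close>

lemma spine_escape:
  fixes \<rho> \<mu> :: "nat pmf" and Good :: "int ^ 'n \<Rightarrow> 'n snake set"
  assumes Good: "\<And>x. Good x \<in> sets (snake_space \<mu> \<mu> \<theta>)"
    and q: "\<And>x. emeasure (snake_space (adjoint_pmf \<mu>) \<mu> \<theta>) (Good x) = q x"
    and Root: "Root \<in> sets (snake_space \<mu> \<mu> \<theta>)"
  shows "emeasure (spine_snake_space \<rho> \<mu> \<theta>) {\<omega> \<in> space (spine_snake_space \<rho> \<mu> \<theta>).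
      fst \<omega> 0 \<in> Root \<and> (\<forall>i. fst \<omega> (Suc i) \<in> Good (x + (\<Sum>j<Suc i. snd \<omega> j)))}
    = emeasure (snake_space \<rho> \<mu> \<theta>) Root * escape x"
proof -
  let ?N = "\<lambda>k :: nat. snake_space (if k = 0 then \<rho> else adjoint_pmf \<mu>) \<mu> \<theta>"
  let ?B = "\<Pi>\<^sub>M k\<in>UNIV. ?N k"
  let ?W = "\<Pi>\<^sub>M j\<in>(UNIV :: nat set). measure_pmf (reversed_pmf \<theta>)"
  let ?M = "spine_snake_space \<rho> \<mu> \<theta>"
  interpret B: product_prob_space ?N UNIV
    by (rule product_prob_spaceI) (rule prob_space_snake)
  interpret W: prob_space ?W by (intro prob_space_PiM) (rule prob_space_measure_pmf)
  interpret BW: pair_prob_space ?B ?W ..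
  have M: "?M = ?B \<Otimes>\<^sub>M ?W" by (simp add: spine_snake_space_def)
  have spB: "space ?B = UNIV" and spW: "space ?W = UNIV" and spM: "space ?M = UNIV"
    by (simp_all add: M space_PiM space_pair_measure)
  have setsN: "A \<in> sets (?N k)" if "A \<in> sets (snake_space \<mu> \<mu> \<theta>)" for A k
    using that sets_snake by blast
  have bush: "{\<omega>. fst \<omega> k \<in> A} \<in> sets ?M" if "A \<in> sets (snake_space \<mu> \<mu> \<theta>)" for A k
  proof -
    have "(\<lambda>\<omega>. fst \<omega> k) \<in> measurable (?B \<Otimes>\<^sub>M ?W) (?N k)"
      by (rule measurable_compose[OF measurable_fst measurable_component_singleton]) simp
    from measurable_sets[OF this setsN[OF that]] show ?thesis using spM unfolding M by (simp add: vimage_def)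
  qed
  have spine: "{\<omega>. (\<Sum>j<k. snd \<omega> j) = y} \<in> sets ?M" for k y
  proof -
    have "(\<lambda>\<omega>. (\<Sum>j<k. snd \<omega> j)) \<in> measurable (?B \<Otimes>\<^sub>M ?W) (count_space UNIV)"
      by (rule measurable_compose[OF measurable_snd measurable_partial_sum])
    from measurable_sets[OF this, of "{y}"]
    show ?thesis using spM unfolding M by (simp add: vimage_def)
  qed
  define G where "G i = {\<omega>. fst \<omega> (Suc i) \<in> Good (x + (\<Sum>j<Suc i. snd \<omega> j))}" for i
  have G: "G i \<in> sets ?M" for i
  proof -
    have "G i = (\<Union>y. {\<omega>. (\<Sum>j<Suc i. snd \<omega> j) = y} \<inter> {\<omega>. fst \<omega> (Suc i) \<in> Good (x + y)})" by (auto simp: G_def)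
    also have "\<dots> \<in> sets ?M"
      by (rule sets.countable_UN'') (use countableI_type spine bush[OF Good] in blast)+
    finally show ?thesis .
  qed
  define E where "E n = {\<omega>. fst \<omega> 0 \<in> Root} \<inter> (\<Inter>i\<in>{..<n}. G i)" for n
  have E: "E n \<in> sets ?M" for n
  proof (cases "n = 0")
    case False
    then show ?thesis unfolding E_def by (intro sets.Int bush[OF Root] sets.finite_INT G) auto
  qed (simp add: E_def bush[OF Root])
  have prob: "emeasure ?M (E n) = emeasure (snake_space \<rho> \<mu> \<theta>) Root * survival n x" for n
  proof -
    have "emeasure ?M (E n) = (\<integral>\<^sup>+w. emeasure ?B ((\<lambda>b. (b, w)) -` E n) \<partial>?W)"
      unfolding M by (rule BW.emeasure_pair_measure_alt2) (use E M in simp)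
    also have "\<dots> = (\<integral>\<^sup>+w. emeasure (snake_space \<rho> \<mu> \<theta>) Root * (\<Prod>i<n. q (x + (\<Sum>j<Suc i. w j))) \<partial>?W)"
    proof (rule nn_integral_cong)
      fix w :: "nat \<Rightarrow> int ^ 'n"
      let ?X = "\<lambda>k. if k = 0 then Root else Good (x + (\<Sum>j<k. w j))"
      have "(\<lambda>b. (b, w)) -` E n = {b \<in> space ?B. \<forall>k\<in>{..<Suc n}. b k \<in> ?X k}"
        unfolding E_def G_def spB by (auto simp: less_Suc_eq_0_disj simp del: sum.lessThan_Suc)
      then have "emeasure ?B ((\<lambda>b. (b, w)) -` E n) = (\<Prod>k\<in>{..<Suc n}. emeasure (?N k) (?X k))"
        using B.emeasure_PiM_Collect[of "{..<Suc n}" ?X] Root Good setsN by (simp only: finite_lessThan subset_UNIV) auto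
      also have "\<dots> = emeasure (snake_space \<rho> \<mu> \<theta>) Root * (\<Prod>i<n. q (x + (\<Sum>j<Suc i. w j)))"
        unfolding prod.lessThan_Suc_shift by (simp del: sum.lessThan_Suc add: q)
      finally show "emeasure ?B ((\<lambda>b. (b, w)) -` E n) = emeasure (snake_space \<rho> \<mu> \<theta>) Root * (\<Prod>i<n. q (x + (\<Sum>j<Suc i. w j)))" .
    qed
    also have "\<dots> = emeasure (snake_space \<rho> \<mu> \<theta>) Root * (\<integral>\<^sup>+w. (\<Prod>i<n. q (x + (\<Sum>j<Suc i. w j))) \<partial>?W)"
    proof (rule nn_integral_cmult, rule borel_measurable_prod_ennreal)
      fix i
      show "(\<lambda>w. q (x + (\<Sum>j<Suc i. w j))) \<in> borel_measurable ?W"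
        using measurable_compose[OF measurable_partial_sum[of "Suc i"], of "\<lambda>z. q (x + z)" borel "reversed_pmf \<theta>"] by simp
    qed
    finally show ?thesis unfolding spine_product .
  qed
  interpret M: prob_space ?M unfolding M by (rule BW.P.prob_space_axioms)
  have lim: "(\<lambda>n. emeasure ?M (E n)) \<longlonglongrightarrow> emeasure ?M (\<Inter>n. E n)"
    by (rule Lim_emeasure_decseq) (use E in \<open>auto simp: decseq_def E_def M.emeasure_eq_measure\<close>)
  have lim': "(\<lambda>n. emeasure ?M (E n)) \<longlonglongrightarrow> emeasure (snake_space \<rho> \<mu> \<theta>) Root * escape x"
  proof -
    interpret R: prob_space "snake_space \<rho> \<mu> \<theta>" by (rule prob_space_snake)
    show ?thesis unfolding prob mass_eq_survival[symmetric]
      by (intro ennreal_tendsto_cmult mass_tendsto) (simp add: R.emeasure_eq_measure)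
  qed
  have "(\<Inter>n. E n) = {\<omega> \<in> space ?M. fst \<omega> 0 \<in> Root \<and> (\<forall>i. fst \<omega> (Suc i) \<in> Good (x + (\<Sum>j<Suc i. snd \<omega> j)))}"
    unfolding E_def G_def spM by (auto simp del: sum.lessThan_Suc)
  from LIMSEQ_unique[OF lim lim', unfolded this] show ?thesis .
qed

end

section \<open>Escape probabilities and moment assumptions\<close>

text \<open>No vertex but possibly the root visits \<open>K\<close>.\<close>

definition miss_below :: "(int ^ 'n) set \<Rightarrow> int ^ 'n \<Rightarrow> 'n snake set" where
  "miss_below K x = {\<omega>. \<forall>i<fst \<omega> []. subsnake i \<omega> \<notin> moved (visit K) x}"

lemma sets_miss_below: "miss_below K x \<in> sets (snake_space \<rho> \<mu> \<theta>)"
  unfolding miss_below_def by (rule no_child_in(2)[OF moved_sets[OF sets_visit]])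

lemma miss_below_prob: "emeasure (snake_space \<rho> \<mu> \<theta>) (miss_below K x) = (\<integral>\<^sup>+m. child_misses \<mu> \<theta> K x ^ m \<partial>\<rho>)"
  unfolding miss_below_def child_misses_def by (rule no_child_in(1)[OF moved_sets[OF sets_visit]])

lemma miss_below_prob_adjoint:
  assumes "measure_pmf.expectation \<mu> real = 1"
  shows "emeasure (snake_space (adjoint_pmf \<mu>) \<mu> \<theta>) (miss_below K x) = bush_misses \<mu> \<theta> K x"
proof -
  have "{m + 1..} = {m<..}" for m :: nat by auto
  then show ?thesis
    by (simp add: miss_below_prob bush_misses_def nn_integral_pmf_nat pmf_adjoint_pmf[OF assms] measure_pmf.emeasure_eq_measure)
qed

lemma not_visit_eq: "- visit K x = (if x \<in> K then {} else miss_below K x)"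
  using hits_empty_iff[of x K] by (auto simp: visit_def visits_def miss_below_def)

lemma miss_below_iff: "\<omega> \<in> miss_below K x \<longleftrightarrow> (\<forall>w. w \<noteq> [] \<longrightarrow> w \<notin> hits x K \<omega>)"
proof -
  have "(\<forall>w. w \<noteq> [] \<longrightarrow> w \<notin> hits x K \<omega>) \<longleftrightarrow> (\<forall>i w. i # w \<notin> hits x K \<omega>)"
    by (metis list.distinct(1) neq_Nil_conv)
  then show ?thesis by (auto simp: miss_below_def Cons_in_hits moved_def visit_def visits_def)
qed

lemma avoids_except_iff:
  "avoids_except x K A \<omega> \<longleftrightarrow> (\<forall>k w. (k, w) \<notin> A \<longrightarrow> w \<notin> hits (x + (\<Sum>j<k. snd \<omega> j)) K (fst \<omega> k))"
  unfolding avoids_except_def spine_snake_tree_def spine_snake_pos_def hits_def by (auto simp: Ball_def)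

lemma avoids_except_root_bush:
  "avoids_except x K root_bush \<omega> \<longleftrightarrow> (\<forall>i. fst \<omega> (Suc i) \<in> - visit K (x + (\<Sum>j<Suc i. snd \<omega> j)))"
  unfolding avoids_except_iff root_bush_def visit_def visits_def
  by (auto simp del: sum.lessThan_Suc simp: gr0_conv_Suc)

lemma avoids_except_spine:
  "avoids_except x K spine \<omega> \<longleftrightarrow> fst \<omega> 0 \<in> miss_below K x \<and> (\<forall>i. fst \<omega> (Suc i) \<in> miss_below K (x + (\<Sum>j<Suc i. snd \<omega> j)))"
proof -
  have "(\<forall>k w. (k, w) \<notin> spine \<longrightarrow> w \<notin> hits (x + (\<Sum>j<k. snd \<omega> j)) K (fst \<omega> k)) \<longleftrightarrow> (\<forall>k. fst \<omega> k \<in> miss_below K (x + (\<Sum>j<k. snd \<omega> j)))"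
    by (simp add: spine_def miss_below_iff)
  also have "\<dots> \<longleftrightarrow> fst \<omega> 0 \<in> miss_below K (x + (\<Sum>j<0. snd \<omega> j)) \<and> (\<forall>i. fst \<omega> (Suc i) \<in> miss_below K (x + (\<Sum>j<Suc i. snd \<omega> j)))"
    by (metis not0_implies_Suc)
  finally show ?thesis unfolding avoids_except_iff by simp
qed

text \<open>All bushes but the first have to miss \<open>K\<close> entirely, including their roots on the spine.\<close>

lemma Es_eq_escape:
  assumes "killing q k" and q: "\<And>x. q x = indicator (- K) x * bush_misses \<mu> \<theta> K x"
    and mean: "measure_pmf.expectation \<mu> real = 1"
  shows "Es \<mu> \<theta> K a = enn2real (killing.escape \<theta> q a)"
proof -
  have prob: "emeasure (snake_space (adjoint_pmf \<mu>) \<mu> \<theta>) (- visit K x) = q x" for x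
    by (simp add: not_visit_eq q miss_below_prob_adjoint[OF mean])
  have root: "UNIV \<in> sets (snake_space \<mu> \<mu> \<theta>)" using sets.top[of "snake_space \<mu> \<mu> \<theta>"] by simp
  have "emeasure (reversed_infinite_snake \<mu> \<theta>) {\<omega> \<in> space (reversed_infinite_snake \<mu> \<theta>). avoids_except a K root_bush \<omega>} = killing.escape \<theta> q a"
    unfolding reversed_infinite_snake_def avoids_except_root_bush
    using spine_escape[OF assms(1) sets_snake_Compl[OF sets_visit] prob root, where \<rho>="adjoint_pmf \<mu>" and x=a]
    by (simp only: UNIV_I simp_thms emeasure_snake_UNIV mult_1)
  then show ?thesis unfolding Es_def measure_def by simp
qed

text \<open>All bushes have to miss \<open>K\<close> outside of the spine. The first one is an ordinary tree, which contributes the factor \<open>tree_misses\<close>.\<close>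

lemma Esc_eq_escape:
  assumes "killing (bush_misses \<mu> \<theta> K) k" and mean: "measure_pmf.expectation \<mu> real = 1"
  shows "Esc \<mu> \<theta> K a = enn2real (tree_misses \<mu> \<theta> K a) * enn2real (killing.escape \<theta> (bush_misses \<mu> \<theta> K) a)"
proof -
  have "emeasure (invariant_snake \<mu> \<theta>) {\<omega> \<in> space (invariant_snake \<mu> \<theta>). avoids_except a K spine \<omega>}
      = tree_misses \<mu> \<theta> K a * killing.escape \<theta> (bush_misses \<mu> \<theta> K) a"
    unfolding invariant_snake_def avoids_except_spine
    using spine_escape[OF assms(1) sets_miss_below miss_below_prob_adjoint[OF mean] sets_miss_below[of K a], where \<rho>=\<mu> and x=a]
    unfolding miss_below_prob tree_misses_def .
  then show ?thesis unfolding Esc_def measure_def by (simp add: enn2real_mult)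
qed

lemma offspring_tail_sum:
  assumes "integrable (measure_pmf \<mu>) real" "measure_pmf.expectation \<mu> real = 1"
  shows "(\<Sum>i. emeasure (measure_pmf \<mu>) {i<..}) = 1"
proof -
  have "(\<Sum>i. emeasure (measure_pmf \<mu>) {i<..}) = (\<integral>\<^sup>+m. (\<Sum>i. indicator {i<..} m) \<partial>\<mu>)"
    by (subst nn_integral_suminf) auto
  also have "\<dots> = (\<integral>\<^sup>+m. ennreal (real m) \<partial>\<mu>)"
  proof (rule nn_integral_cong)
    fix m :: nat
    have "(\<Sum>i. indicator {i<..} m :: ennreal) = (\<Sum>i<m. indicator {i<..} m)" by (rule suminf_finite) auto
    then show "(\<Sum>i. indicator {i<..} m :: ennreal) = ennreal (real m)" by (simp add: ennreal_of_nat_eq_real_of_nat)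
  qed
  also have "\<dots> = 1" using assms by (subst nn_integral_eq_integral) auto
  finally show ?thesis .
qed

text \<open>The mean of the adjoint law is at most the second moment of \<open>\<mu>\<close>.\<close>

lemma adjoint_mean_finite:
  assumes "integrable (measure_pmf \<mu>) (\<lambda>i. (real i)\<^sup>2)"
  shows "(\<Sum>i. emeasure (measure_pmf \<mu>) {i<..} * of_nat i) < \<infinity>"
proof -
  have "(\<Sum>i. emeasure (measure_pmf \<mu>) {i<..} * of_nat i) = (\<integral>\<^sup>+m. (\<Sum>i. indicator {i<..} m * of_nat i) \<partial>\<mu>)"
    by (subst nn_integral_suminf) (auto simp: nn_integral_multc)
  also have "\<dots> \<le> (\<integral>\<^sup>+m. ennreal ((real m)\<^sup>2) \<partial>\<mu>)"
  proof (rule nn_integral_mono)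
    fix m :: nat
    have "(\<Sum>i. indicator {i<..} m * of_nat i :: ennreal) = (\<Sum>i<m. indicator {i<..} m * of_nat i)" by (rule suminf_finite) auto
    also have "\<dots> \<le> (\<Sum>i<m. of_nat m)" by (intro sum_mono) (auto simp: indicator_def)
    also have "\<dots> = ennreal ((real m)\<^sup>2)" by (simp add: ennreal_of_nat_eq_real_of_nat power2_eq_square ennreal_mult)
    finally show "(\<Sum>i. indicator {i<..} m * of_nat i :: ennreal) \<le> ennreal ((real m)\<^sup>2)" .
  qed
  also have "\<dots> < \<infinity>" using assms by (simp add: nn_integral_eq_integral)
  finally show ?thesis .
qed

lemma dyadic_bound:
  fixes t :: real assumes "t \<ge> 0"
  shows "ennreal (t ^ p) \<le> 1 + (\<Sum>k. ennreal (2 ^ (Suc k * p)) * indicator {s. s > 2 ^ k} t)"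
proof (cases "t \<le> 1")
  case True
  then have "ennreal (t ^ p) \<le> 1" using assms by (simp add: power_le_one)
  then show ?thesis by (rule order_trans) simp
next
  case False
  \<comment> \<open>The dyadic shell of \<open>t\<close>; only its term of the sum is used.\<close>
  define j where "j = (LEAST n. t \<le> 2 ^ n)"
  have ex: "\<exists>n. t \<le> 2 ^ n" using real_arch_pow[of 2 t] by (auto intro: less_imp_le)
  have j: "t \<le> 2 ^ j" unfolding j_def using ex by (rule LeastI_ex)
  have single: "f n \<le> suminf f" for f :: "nat \<Rightarrow> ennreal" and n
    using sum_le_suminf[of f "{n}"] by simp
  obtain k where k: "j = Suc k" using False j by (cases j) auto
  have gt: "t > 2 ^ k" using not_less_Least[of k "\<lambda>n. t \<le> 2 ^ n"] k unfolding j_def by auto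
  have "ennreal (t ^ p) \<le> ennreal (2 ^ (Suc k * p)) * indicator {s. s > 2 ^ k} t"
    using power_mono[OF j assms, of p] gt by (simp add: k power_mult del: power_Suc mult_Suc)
  also have "\<dots> \<le> (\<Sum>k. ennreal (2 ^ (Suc k * p)) * indicator {s. s > 2 ^ k} t)"
    by (rule single)
  finally show ?thesis by (rule order_trans) simp
qed

text \<open>Each dyadic shell contributes at most \<open>2 ^ (k * p)\<close> times the tail \<open>2 ^ (- k * d)\<close>, and \<open>p < d\<close>.\<close>

lemma moments_from_tail:
  fixes \<theta> :: "(int ^ 'n) pmf"
  assumes C: "\<forall>r\<ge>1::real. measure_pmf.prob \<theta> {x. norm (rvec x) > r} < C * r powr (- real CARD('n))"
    and C0: "C > 0" and p: "p \<le> CARD('n) - 1"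
  shows "integrable (measure_pmf \<theta>) (\<lambda>x. norm (rvec x) ^ p)"
proof (rule integrableI_bounded)
  have p': "p + 1 \<le> CARD('n)" using p zero_less_card_finite[where 'a='n] by linarith
  have "(\<integral>\<^sup>+x. ennreal (norm (norm (rvec x) ^ p)) \<partial>\<theta>) \<le> (\<integral>\<^sup>+x. 1 + (\<Sum>k. ennreal (2 ^ (Suc k * p)) * indicator {x. norm (rvec x) > 2 ^ k} x) \<partial>\<theta>)"
  proof (rule nn_integral_mono)
    fix x :: "int ^ 'n"
    have "indicator {s. s > 2 ^ k} (norm (rvec x)) = (indicator {x. norm (rvec x) > 2 ^ k} x :: ennreal)" for k :: nat
      by (simp add: indicator_def)
    then show "ennreal (norm (norm (rvec x) ^ p)) \<le> 1 + (\<Sum>k. ennreal (2 ^ (Suc k * p)) * indicator {x. norm (rvec x) > 2 ^ k} x)"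
      using dyadic_bound[of "norm (rvec x)" p] by simp
  qed
  also have "\<dots> = 1 + (\<Sum>k. ennreal (2 ^ (Suc k * p)) * emeasure (measure_pmf \<theta>) {x. norm (rvec x) > 2 ^ k})"
    by (subst nn_integral_add, simp, simp, subst nn_integral_suminf) (auto simp: nn_integral_cmult)
  also have "\<dots> \<le> 1 + (\<Sum>k. ennreal (C * 2 ^ p * (1 / 2) ^ k))"
  proof (intro add_mono suminf_le order_refl)
    fix k :: nat
    have "measure_pmf.prob \<theta> {x. norm (rvec x) > 2 ^ k} \<le> C * (2 ^ k) powr (- real CARD('n))"
      using C[rule_format, of "2 ^ k"] by simp
    also have "(2 ^ k :: real) powr (- real CARD('n)) = 1 / 2 ^ (k * CARD('n))"
      by (simp add: powr_minus powr_realpow power_mult divide_inverse)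
    finally have "2 ^ (Suc k * p) * measure_pmf.prob \<theta> {x. norm (rvec x) > 2 ^ k} \<le> 2 ^ (Suc k * p) * (C * (1 / 2 ^ (k * CARD('n))))"
      by (intro mult_left_mono) auto
    also have "\<dots> \<le> 2 ^ (Suc k * p) * (C * (1 / 2 ^ (k * (p + 1))))"
      using C0 p' by (intro mult_left_mono divide_left_mono power_increasing) auto
    also have "\<dots> = C * 2 ^ p * (1 / 2) ^ k"
      by (simp add: power_add algebra_simps power_one_over)
    finally show "ennreal (2 ^ (Suc k * p)) * emeasure (measure_pmf \<theta>) {x. norm (rvec x) > 2 ^ k} \<le> ennreal (C * 2 ^ p * (1 / 2) ^ k)"
      by (simp add: measure_pmf.emeasure_eq_measure ennreal_mult[symmetric] ennreal_leI)
  qed auto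
  also have "\<dots> < \<infinity>"
  proof -
    have "summable (\<lambda>k. C * 2 ^ p * (1 / 2 :: real) ^ k)" by (intro summable_mult summable_geometric) simp
    then have "(\<Sum>k. ennreal (C * 2 ^ p * (1 / 2) ^ k)) = ennreal (\<Sum>k. C * 2 ^ p * (1 / 2) ^ k)"
      using C0 by (intro suminf_ennreal2) auto
    then show ?thesis by simp
  qed
  finally show "(\<integral>\<^sup>+x. ennreal (norm (norm (rvec x) ^ p)) \<partial>\<theta>) < \<infinity>" .
qed simp

lemma square_add_finite:
  fixes f g :: "'a \<Rightarrow> ennreal"
  assumes "(\<integral>\<^sup>+x. (f x)\<^sup>2 \<partial>count_space UNIV) < \<infinity>" "(\<integral>\<^sup>+x. (g x)\<^sup>2 \<partial>count_space UNIV) < \<infinity>"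
  shows "(\<integral>\<^sup>+x. (f x + g x)\<^sup>2 \<partial>count_space UNIV) < \<infinity>"
proof -
  have "(a + b)\<^sup>2 \<le> 4 * (a\<^sup>2 + b\<^sup>2)" for a b :: ennreal
  proof -
    have "(a + b)\<^sup>2 \<le> (2 * max a b)\<^sup>2"
      by (intro power_mono) (auto simp: mult_2 intro: add_mono)
    also have "\<dots> = 4 * (max a b)\<^sup>2" by (simp add: power_mult_distrib)
    also have "\<dots> \<le> 4 * (a\<^sup>2 + b\<^sup>2)" by (intro mult_left_mono) (auto simp: max_def)
    finally show ?thesis .
  qed
  then have "(\<integral>\<^sup>+x. (f x + g x)\<^sup>2 \<partial>count_space UNIV) \<le> (\<integral>\<^sup>+x. 4 * ((f x)\<^sup>2 + (g x)\<^sup>2) \<partial>count_space UNIV)"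
    by (intro nn_integral_mono) simp
  also have "\<dots> = 4 * ((\<integral>\<^sup>+x. (f x)\<^sup>2 \<partial>count_space UNIV) + (\<integral>\<^sup>+x. (g x)\<^sup>2 \<partial>count_space UNIV))"
    by (simp add: nn_integral_cmult nn_integral_add)
  also have "\<dots> < \<infinity>" using assms by (simp add: ennreal_mult_less_top)
  finally show ?thesis .
qed

lemma square_sum_finite:
  fixes f :: "'b \<Rightarrow> 'a \<Rightarrow> ennreal"
  assumes "finite K" "\<And>b. b \<in> K \<Longrightarrow> (\<integral>\<^sup>+x. (f b x)\<^sup>2 \<partial>count_space UNIV) < \<infinity>"
  shows "(\<integral>\<^sup>+x. (\<Sum>b\<in>K. f b x)\<^sup>2 \<partial>count_space UNIV) < \<infinity>"
  using assms
proof (induction K rule: finite_induct)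
  case (insert b F)
  then show ?case using square_add_finite[of "f b" "\<lambda>x. \<Sum>b\<in>F. f b x"] by simp
qed simp

section \<open>The three limits\<close>

lemma (in centred_walk) green_const_eq: "green_limit / sqrt (real CARD('n)) ^ (CARD('n) - 2) = green_const \<theta>"
proof -
  let ?d = "real CARD('n)"
  have d: "?d > 0" and d2: "real (CARD('n) - 2) = ?d - 2" using dim by (auto simp: of_nat_diff)
  have pos: "s powr (t / 2) = sqrt s ^ n" if "s > 0" "real n = t" for s t :: real and n
  proof -
    have "s powr (t / 2) = (s powr (1 / 2)) powr t" by (simp add: powr_powr)
    also have "\<dots> = sqrt s powr real n" using that by (simp add: powr_half_sqrt)
    also have "\<dots> = sqrt s ^ n" using powr_realpow[of "sqrt s" n] that(1) by simp
    finally show ?thesis .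
  qed
  \<comment> \<open>The determinant of the frame carries the covariance into the constant.\<close>
  have det: "\<bar>det frame\<bar> = 1 / sqrt (det Q)"
  proof -
    have "sqrt ((det frame)\<^sup>2 * det Q) = 1" by (simp add: det_frame)
    then have "\<bar>det frame\<bar> * sqrt (det Q) = 1" by (simp add: real_sqrt_mult)
    then show ?thesis by (metis mult_eq_0_iff nonzero_eq_divide_eq zero_neq_one)
  qed
  have G: "Gamma (?d / 2 - 1) = Gamma ((?d - 2) / 2)" by (simp add: diff_divide_distrib)
  show ?thesis
    unfolding green_limit_def kappa_def green_const_def Let_def det G
      pos[OF d d2] pos[OF pi_gt_zero refl, of "CARD('n)"]
    by (simp add: field_simps)
qed

locale critical_snake = centred_walk \<theta>
  for \<theta> :: "(int ^ 'n) pmf" +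
  fixes \<mu> :: "nat pmf" and K :: "(int ^ 'n) set"
  assumes mu_mean: "integrable (measure_pmf \<mu>) real" "measure_pmf.expectation \<mu> real = 1"
    and mu_square: "integrable (measure_pmf \<mu>) (\<lambda>i. (real i)\<^sup>2)"
    and K: "finite K" "K \<noteq> {}"
begin

lemmas tail_sum = offspring_tail_sum[OF mu_mean]

abbreviation "bush_miss \<equiv> bush_misses \<mu> \<theta> K"

text \<open>The survival probability along the ancestral line of the first visit; the line must not meet \<open>K\<close> before its end.\<close>

definition "first_miss x = indicator (- K) x * bush_miss x"

text \<open>A child hits \<open>K\<close> with probability at most a finite sum of Green functions, and a bush has finitely many children on average. Points
  of \<open>K\<close>, where the killing is certain, are covered as well because the Green function is at least \<open>1\<close> at the origin.\<close>

lemma killing_square_bound: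
  assumes k: "\<And>x. k x \<le> indicator K x + (1 - bush_miss x)"
  shows "(\<integral>\<^sup>+x. (k x)\<^sup>2 \<partial>count_space UNIV) < \<infinity>"
proof -
  define m where "m = 1 + (\<Sum>i. emeasure (measure_pmf \<mu>) {i<..} * of_nat i)"
  define S where "S x = (\<Sum>b\<in>K. green \<theta> (b - x))" for x
  have m: "m < \<infinity>" using adjoint_mean_finite[OF mu_square] by (simp add: m_def)
  have "k x \<le> m * S x" for x
  proof -
    have "indicator K x \<le> S x"
    proof (cases "x \<in> K")
      case True
      have "1 \<le> green \<theta> (x - x)" using green_first_step[of \<theta> 0] by simp
      also have "\<dots> \<le> S x" unfolding S_def by (rule member_le_sum[OF True]) (use K in auto)
      finally show ?thesis using True by simp
    qed simp
    moreover have "1 - bush_miss x \<le> (m - 1) * S x"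
    proof -
      have "1 \<le> bush_miss x + (m - 1) * step \<theta> (\<lambda>x. snake_prob \<mu> \<theta> (visit K x)) x"
        using bush_misses_plus[OF tail_sum, of \<theta> K x] by (simp add: m_def)
      also have "\<dots> \<le> bush_miss x + (m - 1) * S x"
        unfolding S_def by (intro add_left_mono mult_left_mono child_hit_le[OF tail_sum K(1)]) simp
      finally show ?thesis by (simp add: ennreal_minus_le_iff)
    qed
    ultimately have "k x \<le> S x + (m - 1) * S x" using k[of x] by (meson add_mono order_trans)
    also have "\<dots> = m * S x" by (simp add: m_def distrib_right)
    finally show ?thesis .
  qed
  then have "(\<integral>\<^sup>+x. (k x)\<^sup>2 \<partial>count_space UNIV) \<le> (\<integral>\<^sup>+x. (m * S x)\<^sup>2 \<partial>count_space UNIV)"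
    by (intro nn_integral_mono power_mono) auto
  also have "\<dots> = m\<^sup>2 * (\<integral>\<^sup>+x. (S x)\<^sup>2 \<partial>count_space UNIV)"
    unfolding power_mult_distrib by (rule nn_integral_cmult) simp
  also have "\<dots> < \<infinity>"
  proof -
    have "(\<integral>\<^sup>+x. (S x)\<^sup>2 \<partial>count_space UNIV) < \<infinity>"
      unfolding S_def by (rule square_sum_finite[OF K(1)]) (rule green_shift_square)
    then show ?thesis using m by (simp add: ennreal_mult_less_top power2_eq_square)
  qed
  finally show ?thesis .
qed

lemma plus_one_minus: "(q :: ennreal) \<le> 1 \<Longrightarrow> q + (1 - q) = 1"
  by (rule add_diff_inverse_ennreal)

sublocale last: killed_centred_walk \<theta> bush_miss "\<lambda>x. 1 - bush_miss x"
proof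
  show "bush_miss x + (1 - bush_miss x) = 1" for x
    by (rule plus_one_minus) (rule bush_misses_le_1[OF tail_sum])
  show "(\<integral>\<^sup>+x. (1 - bush_miss x)\<^sup>2 \<partial>count_space UNIV) < \<infinity>" by (rule killing_square_bound) simp
qed

sublocale first: killed_centred_walk \<theta> first_miss "\<lambda>x. 1 - first_miss x"
proof
  have le: "first_miss x \<le> 1" for x
    using bush_misses_le_1[OF tail_sum, of \<theta> K x] by (auto simp: first_miss_def indicator_def)
  show "first_miss x + (1 - first_miss x) = 1" for x using le by (rule plus_one_minus)
  show "(\<integral>\<^sup>+x. (1 - first_miss x)\<^sup>2 \<partial>count_space UNIV) < \<infinity>"
    by (rule killing_square_bound) (auto simp: first_miss_def indicator_def)
qed

abbreviation "P_visit x \<equiv> measure (brw \<mu> \<theta>) (visit K x)"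
abbreviation "P_first a x \<equiv> measure (brw \<mu> \<theta>) (first_event K a x)"
abbreviation "P_last a x \<equiv> measure (brw \<mu> \<theta>) (last_event K a x)"

lemma Es_eq: "Es \<mu> \<theta> K a = enn2real (first.escape a)"
  by (rule Es_eq_escape[OF first.killing_axioms first_miss_def mu_mean(2)])

lemma Esc_eq: "Esc \<mu> \<theta> K a = enn2real (tree_misses \<mu> \<theta> K a) * enn2real (last.escape a)"
  by (rule Esc_eq_escape[OF last.killing_axioms mu_mean(2)])

lemma first_limit:
  assumes "a \<in> K"
  shows "((\<lambda>x. radius x ^ (CARD('n) - 2) * P_first a x) \<longlongrightarrow> green_limit * Es \<mu> \<theta> K a) lattice_at_infinity"
proof -
  have "P_first a x = enn2real (\<Sum>n. first.killed_walk a n x)" for x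
    using first_event_prob[OF tail_sum K(1) green_finite, of a x]
      killed_first_at[OF first.killing_axioms first_miss_def assms]
    by (simp add: measure_def brw_def)
  then show ?thesis using first.killed_green_asymptotics[of a] by (simp add: Es_eq)
qed

lemma last_limit:
  assumes "a \<in> K"
  shows "((\<lambda>x. radius x ^ (CARD('n) - 2) * P_last a x) \<longlongrightarrow> green_limit * Esc \<mu> \<theta> K a) lattice_at_infinity"
proof -
  have "P_last a x = enn2real (tree_misses \<mu> \<theta> K a) * enn2real (\<Sum>n. last.killed_walk a n x)" for x
    using last_event_prob[OF tail_sum K(1) green_finite, of a x]
      killed_last_at[OF last.killing_axioms assms]
    by (simp add: measure_def brw_def enn2real_mult)
  moreover have "((\<lambda>x. enn2real (tree_misses \<mu> \<theta> K a) * (radius x ^ (CARD('n) - 2) * enn2real (\<Sum>n. last.killed_walk a n x)))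
      \<longlongrightarrow> enn2real (tree_misses \<mu> \<theta> K a) * (green_limit * enn2real (last.escape a))) lattice_at_infinity"
    by (intro tendsto_mult_left last.killed_green_asymptotics)
  ultimately show ?thesis by (simp add: Esc_eq mult_ac)
qed

lemma visit_eq_sum_first: "P_visit x = (\<Sum>a\<in>K. P_first a x)"
proof -
  interpret prob_space "brw \<mu> \<theta>" unfolding brw_def by (rule prob_space_snake)
  have "emeasure (brw \<mu> \<theta>) (visit K x) = (\<Sum>a\<in>K. emeasure (brw \<mu> \<theta>) (first_event K a x))"
    using visit_prob[OF tail_sum K(1) green_finite, of x] by (simp add: brw_def)
  then show ?thesis by (simp add: emeasure_eq_measure sum_nonneg)
qed

lemma visit_limit:
  "((\<lambda>x. radius x ^ (CARD('n) - 2) * P_visit x) \<longlongrightarrow> green_limit * BCap \<mu> \<theta> K) lattice_at_infinity"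
  unfolding visit_eq_sum_first BCap_def sum_distrib_left by (intro tendsto_sum first_limit)

text \<open>Outside of \<open>K\<close> the survival probability is positive, so some point of \<open>K\<close> allows an escape.\<close>

lemma BCap_pos: "BCap \<mu> \<theta> K > 0"
proof -
  obtain a where a: "a \<in> K" using K by auto
  have "first_miss x > 0" if "x \<notin> K" for x
    using bush_misses_pos[OF tail_sum, of \<theta> K x] that by (simp add: first_miss_def)
  then obtain b where b: "b \<in> K" "first.escape b > 0" using first.some_escape[OF _ a] by blast
  have "first.escape b < \<top>"
    using first.mass_le_1[of b 0] by (auto simp: first.escape_def intro!: le_less_trans[OF INF_lower[of 0]])
  then have "Es \<mu> \<theta> K b > 0" unfolding Es_eq using b(2) by (simp add: enn2real_positive_iff)
  then show ?thesis unfolding BCap_def by (intro sum_pos2[OF K(1) b(1)]) (auto simp: Es_eq)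
qed

lemma conditional_limit:
  assumes "((\<lambda>x. radius x ^ (CARD('n) - 2) * f x) \<longlongrightarrow> green_limit * e) lattice_at_infinity"
  shows "((\<lambda>x. f x / P_visit x) \<longlongrightarrow> e / BCap \<mu> \<theta> K) lattice_at_infinity"
proof -
  have pos: "green_limit * BCap \<mu> \<theta> K > 0" using green_limit_pos BCap_pos by simp
  have "((\<lambda>x. (radius x ^ (CARD('n) - 2) * f x) / (radius x ^ (CARD('n) - 2) * P_visit x))
      \<longlongrightarrow> (green_limit * e) / (green_limit * BCap \<mu> \<theta> K)) lattice_at_infinity"
    by (intro tendsto_divide assms visit_limit) (use pos in auto)
  moreover have "eventually (\<lambda>x. (radius x ^ (CARD('n) - 2) * f x) / (radius x ^ (CARD('n) - 2) * P_visit x) = f x / P_visit x) lattice_at_infinity"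
    using order_tendstoD(1)[OF visit_limit pos]
  proof eventually_elim
    case (elim x)
    then have "radius x ^ (CARD('n) - 2) \<noteq> 0" by (metis less_irrefl mult_zero_left)
    then show ?case by (rule nonzero_mult_divide_mult_cancel_left)
  qed
  ultimately have "((\<lambda>x. f x / P_visit x) \<longlongrightarrow> (green_limit * e) / (green_limit * BCap \<mu> \<theta> K)) lattice_at_infinity"
    by (rule Lim_transform_eventually)
  then show ?thesis using green_limit_pos by simp
qed

lemma cov_norm_eq: "cov_norm \<theta> x = radius x / sqrt (real CARD('n))"
  by (simp add: cov_norm_def radius_form)

end

theorem theorem1p1:
  fixes \<mu> :: "nat pmf" and \<theta> :: "(int ^ 'n) pmf"
    and K :: "(int ^ 'n) set" and a :: "int ^ 'n"
  assumes dim: "CARD('n) \<ge> 5"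
    and mu_mean: "integrable (measure_pmf \<mu>) real" "measure_pmf.expectation \<mu> real = 1"
    and mu_var: "integrable (measure_pmf \<mu>) (\<lambda>i. (real i)\<^sup>2)" "measure_pmf.variance \<mu> real > 0"
    and theta_mean: "integrable (measure_pmf \<theta>) rvec" "mean_vec \<theta> = 0"
    and theta_group: "\<not> in_strict_subgroup \<theta>"
    and theta_tail: "\<exists>C>0. \<forall>r\<ge>1::real.
      measure_pmf.prob \<theta> {x. norm (rvec x) > r} < C * r powr (- real CARD('n))"
    and K: "finite K" "K \<noteq> {}"
    and a: "a \<in> K"
  shows "((\<lambda>x. cov_norm \<theta> x ^ (CARD('n) - 2) * \<P>(\<omega> in brw \<mu> \<theta>. visits x K \<omega>))
            \<longlongrightarrow> green_const \<theta> * BCap \<mu> \<theta> K) lattice_at_infinity \<and>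
         ((\<lambda>x. \<P>(\<omega> in brw \<mu> \<theta>. snake_pos x \<omega> (first_hit x K \<omega>) = a \<bar> visits x K \<omega>))
            \<longlongrightarrow> Es \<mu> \<theta> K a / BCap \<mu> \<theta> K) lattice_at_infinity \<and>
         ((\<lambda>x. \<P>(\<omega> in brw \<mu> \<theta>. snake_pos x \<omega> (last_hit x K \<omega>) = a \<bar> visits x K \<omega>))
            \<longlongrightarrow> Esc \<mu> \<theta> K a / BCap \<mu> \<theta> K) lattice_at_infinity"
proof -
  interpret critical_snake \<theta> \<mu> K
  proof
    show "integrable (measure_pmf \<theta>) (\<lambda>x. norm (rvec x) ^ p)" if "p \<le> CARD('n) - 1" for p
      using theta_tail moments_from_tail[OF _ _ that] by blast
  qed (fact assms)+
  have prob: "\<P>(\<omega> in brw \<mu> \<theta>. visits x K \<omega>) = P_visit x"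
    and first_prob: "\<P>(\<omega> in brw \<mu> \<theta>. snake_pos x \<omega> (first_hit x K \<omega>) = a \<and> visits x K \<omega>) = P_first a x"
    and last_prob: "\<P>(\<omega> in brw \<mu> \<theta>. snake_pos x \<omega> (last_hit x K \<omega>) = a \<and> visits x K \<omega>) = P_last a x" for x
    by (simp_all add: visit_def first_event_def last_event_def brw_def)
  have "((\<lambda>x. (radius x ^ (CARD('n) - 2) * P_visit x) / sqrt (real CARD('n)) ^ (CARD('n) - 2))
      \<longlongrightarrow> (green_limit * BCap \<mu> \<theta> K) / sqrt (real CARD('n)) ^ (CARD('n) - 2)) lattice_at_infinity"
    by (intro tendsto_divide visit_limit tendsto_const) simp
  then have "((\<lambda>x. cov_norm \<theta> x ^ (CARD('n) - 2) * P_visit x) \<longlongrightarrow> green_const \<theta> * BCap \<mu> \<theta> K) lattice_at_infinity"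
    by (simp add: cov_norm_eq power_divide green_const_eq[symmetric])
  then show ?thesis
    unfolding cond_prob_def prob first_prob last_prob
    using conditional_limit[OF first_limit[OF a]] conditional_limit[OF last_limit[OF a]] by blast
qed

end
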